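(* Let $V$ be a $7$-dimensional complex vector space and let $W\subset\Lambda^2V^\vee$ be a generic $7$-dimensional subspace of skew forms on $V$. Let $X_W\subset G(2,V)$ be the locus of two-dimensional subspaces $T_2\subset V$ with $w|_{T_2}=0$ for all $w\in W$, and let $Y_W\subset\mathbb{P}W$ be the locus of those $\mathbb{C}w$ for which the skew form $w$ has rank less than $6$. Then in the Grothendieck ring $K_0(\mathrm{Var}/\mathbb{C})$ $$\big([X_W]-[Y_W]\big)(L^2-1)(L-1)L^7=0 .$$
   Context: The Grothendieck ring $K_0(\mathrm{Var}/\mathbb{C})$ is the quotient of the group of formal finite integer linear combinations of isomorphism classes of complex algebraic varieties (reduced separated schemes of finite type over $\mathbb{C}$) by the relations $[Z]-[U]-[Z\setminus U]$ for open subvarieties $U\subseteq Z$, with product induced by the Cartesian product. $L=[\mathbb{C}^1]$ is the class of the affine line. $G(2,V)$ is the Grassmannian of two-dimensional subspaces of $V$, and $\mathbb{P}W$ is the projective space of lines $\mathbb{C}w\subset W$. "Generic $W$" means: the assertion holds for all $W$ in some nonempty Zariski open subset of the Grassmannian of $7$-dimensional subspaces of $\Lambda^2V^\vee$. *)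

theory Defs
  imports
    "HOL-Analysis.Analysis"
    "HOL-Library.Poly_Mapping"
    "HOL-Library.Function_Algebras"
begin

section \<open>Spaces with functions\<close>

text \<open>
  Since \<open>\<complex>\<close> is algebraically closed, reduced separated schemes of finite type over \<open>\<complex>\<close> are
  the same thing as algebraic varieties in the sense of Serre: topological spaces with a sheaf of
  \<open>\<complex>\<close>-valued functions that are separated and have a finite open cover by affine algebraic sets.
  Varieties may be reducible or empty.

  A function belonging to \<open>regular X U\<close> is a total function of which only the values on \<open>U\<close> matter,
  and only open \<open>U\<close> matter.
\<close>

datatype 'a fspace =
  FSpace (zariski_top: "'a topology") (regular: "'a set \<Rightarrow> ('a \<Rightarrow> complex) set")

abbreviation points :: "'a fspace \<Rightarrow> 'a set"
  where "points X \<equiv> topspace (zariski_top X)"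

definition morphism :: "'a fspace \<Rightarrow> 'b fspace \<Rightarrow> ('a \<Rightarrow> 'b) \<Rightarrow> bool"
  where "morphism X Y \<phi> \<longleftrightarrow>
    continuous_map (zariski_top X) (zariski_top Y) \<phi> \<and>
    (\<forall>V f. openin (zariski_top Y) V \<and> f \<in> regular Y V \<longrightarrow>
       f \<circ> \<phi> \<in> regular X {x \<in> points X. \<phi> x \<in> V})"

definition isomorphic :: "'a fspace \<Rightarrow> 'b fspace \<Rightarrow> bool"
  where "isomorphic X Y \<longleftrightarrow> (\<exists>\<phi> \<psi>. morphism X Y \<phi> \<and> morphism Y X \<psi> \<and>
    (\<forall>x \<in> points X. \<psi> (\<phi> x) = x) \<and> (\<forall>y \<in> points Y. \<phi> (\<psi> y) = y))"

text \<open>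
  The reduced structure on a locally closed subset \<open>A\<close>: its regular functions are
  locally restrictions of regular functions on open subsets of \<open>X\<close>.
\<close>

definition induced :: "'a fspace \<Rightarrow> 'a set \<Rightarrow> 'a fspace"
  where "induced X A = FSpace (subtopology (zariski_top X) A)
    (\<lambda>U. {h. \<forall>x\<in>U. \<exists>V g. openin (zariski_top X) V \<and> x \<in> V \<and> g \<in> regular X V \<and>
      (\<forall>y \<in> U \<inter> V. h y = g y)})"

text \<open>The \<open>\<complex>\<close>-algebra of functions generated by a set of functions.\<close>

inductive_set algebra_generated :: "('a \<Rightarrow> complex) set \<Rightarrow> ('a \<Rightarrow> complex) set"
  for S :: "('a \<Rightarrow> complex) set"
  where
    generator: "f \<in> S \<Longrightarrow> f \<in> algebra_generated S"
  | const: "(\<lambda>_. c) \<in> algebra_generated S"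
  | add: "f \<in> algebra_generated S \<Longrightarrow> g \<in> algebra_generated S \<Longrightarrow>
      (\<lambda>x. f x + g x) \<in> algebra_generated S"
  | mult: "f \<in> algebra_generated S \<Longrightarrow> g \<in> algebra_generated S \<Longrightarrow>
      (\<lambda>x. f x * g x) \<in> algebra_generated S"

text \<open>
  For a locally closed subset \<open>M\<close> of an affine space with algebra \<open>A\<close> of polynomial functions:
  the Zariski topology on \<open>M\<close>, and functions that are locally quotients of polynomials.
  No smaller neighbourhoods than the sets \<open>g \<noteq> 0\<close> are needed for the latter, because numerator and
  denominator may be multiplied by a further polynomial.
\<close>

definition zariski :: "'a set \<Rightarrow> ('a \<Rightarrow> complex) set \<Rightarrow> 'a fspace"
  where "zariski M A = FSpace
    (topology_generated_by {{x \<in> M. f x \<noteq> 0} | f. f \<in> A})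
    (\<lambda>U. {h. \<forall>x\<in>U. \<exists>f\<in>A. \<exists>g\<in>A. g x \<noteq> 0 \<and> (\<forall>y\<in>U. g y \<noteq> 0 \<longrightarrow> h y = f y / g y)})"

text \<open>
  The product of varieties. For open \<open>U\<close>, \<open>V\<close> the algebra \<open>product_functions X Y U V\<close> consists of
  the functions \<open>(x, y) \<mapsto> \<Sum>\<^sub>i f\<^sub>i x * g\<^sub>i y\<close> with \<open>f\<^sub>i\<close> regular on \<open>U\<close> and \<open>g\<^sub>i\<close> regular on \<open>V\<close>;
  non-vanishing loci of such functions form a basis of the topology of the product, and the regular
  functions are locally quotients of such functions.
\<close>

definition product_functions ::
    "'a fspace \<Rightarrow> 'b fspace \<Rightarrow> 'a set \<Rightarrow> 'b set \<Rightarrow> ('a \<times> 'b \<Rightarrow> complex) set"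
  where "product_functions X Y U V = algebra_generated
    ({\<lambda>p. f (fst p) | f. f \<in> regular X U} \<union> {\<lambda>p. g (snd p) | g. g \<in> regular Y V})"

definition fproduct :: "'a fspace \<Rightarrow> 'b fspace \<Rightarrow> ('a \<times> 'b) fspace"
  where "fproduct X Y = FSpace
    (topology_generated_by {{p \<in> U \<times> V. f p \<noteq> 0} | U V f.
       openin (zariski_top X) U \<and> openin (zariski_top Y) V \<and> f \<in> product_functions X Y U V})
    (\<lambda>W. {h. \<forall>p\<in>W. \<exists>U V. openin (zariski_top X) U \<and> openin (zariski_top Y) V \<and> p \<in> U \<times> V \<and>
       (\<exists>f \<in> product_functions X Y U V. \<exists>g \<in> product_functions X Y U V. g p \<noteq> 0 \<and>
          (\<forall>q \<in> W \<inter> U \<times> V. g q \<noteq> 0 \<longrightarrow> h q = f q / g q))})"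


section \<open>Complex algebraic varieties\<close>

text \<open>\<open>\<complex>\<^sup>n\<close> is realised as the set of sequences supported on \<open>{..<n}\<close>.\<close>

definition affine_points :: "nat \<Rightarrow> (nat \<Rightarrow> complex) set"
  where "affine_points n = {x. \<forall>i\<ge>n. x i = 0}"

definition polynomials :: "nat \<Rightarrow> ((nat \<Rightarrow> complex) \<Rightarrow> complex) set"
  where "polynomials n = algebra_generated {\<lambda>x. x i | i. i < n}"

definition affine_algebraic :: "nat \<Rightarrow> ((nat \<Rightarrow> complex) \<Rightarrow> complex) set \<Rightarrow> (nat \<Rightarrow> complex) fspace"
  where "affine_algebraic n P = zariski {x \<in> affine_points n. \<forall>p\<in>P. p x = 0} (polynomials n)"

abbreviation affine_space :: "nat \<Rightarrow> (nat \<Rightarrow> complex) fspace"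
  where "affine_space n \<equiv> affine_algebraic n {}"

definition is_affine :: "'a fspace \<Rightarrow> bool"
  where "is_affine X \<longleftrightarrow> (\<exists>n P. P \<subseteq> polynomials n \<and> isomorphic X (affine_algebraic n P))"

text \<open>
  The first condition below is the sheaf property (stability under restriction and gluing, and
  irrelevance of values outside \<open>U\<close>). It makes \<open>induced X U\<close> the plain restriction of \<open>X\<close> for
  open \<open>U\<close>.
\<close>

definition is_variety :: "'a fspace \<Rightarrow> bool"
  where "is_variety X \<longleftrightarrow>
    (\<forall>U h. openin (zariski_top X) U \<and>
       (\<forall>x\<in>U. \<exists>V g. openin (zariski_top X) V \<and> x \<in> V \<and> g \<in> regular X V \<and>
          (\<forall>y \<in> U \<inter> V. h y = g y)) \<longrightarrow> h \<in> regular X U) \<and>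
    (\<exists>\<U>. finite \<U> \<and> \<Union>\<U> = points X \<and>
       (\<forall>U\<in>\<U>. openin (zariski_top X) U \<and> is_affine (induced X U))) \<and>
    closedin (zariski_top (fproduct X X)) {(x, x) | x. x \<in> points X}"


section \<open>The Grothendieck ring of varieties\<close>

text \<open>
  Every complex variety has at most continuum many points, hence is isomorphic to one whose points
  are in the type \<open>nat \<Rightarrow> complex\<close>. So isomorphism classes of varieties over this one type are
  isomorphism classes of all varieties, and \<open>iso_class\<close> is meaningful for varieties over any type.
\<close>

lemma morphism_continuous: "morphism X Y \<phi> \<Longrightarrow> continuous_map (zariski_top X) (zariski_top Y) \<phi>"
  by (simp add: morphism_def)

lemma morphism_regular:
  "morphism X Y \<phi> \<Longrightarrow> openin (zariski_top Y) V \<Longrightarrow> f \<in> regular Y V \<Longrightarrow>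
    f \<circ> \<phi> \<in> regular X {x \<in> points X. \<phi> x \<in> V}"
  by (simp add: morphism_def)

lemma morphism_points: "morphism X Y \<phi> \<Longrightarrow> x \<in> points X \<Longrightarrow> \<phi> x \<in> points Y"
  using continuous_map_funspace[OF morphism_continuous] by blast

lemma morphism_compose:
  assumes \<phi>: "morphism X Y \<phi>" and \<psi>: "morphism Y Z \<psi>"
  shows "morphism X Z (\<psi> \<circ> \<phi>)"
  unfolding morphism_def
proof (intro conjI allI impI)
  show "continuous_map (zariski_top X) (zariski_top Z) (\<psi> \<circ> \<phi>)"
    using morphism_continuous[OF \<phi>] morphism_continuous[OF \<psi>] by (rule continuous_map_compose)
next
  fix V f
  assume *: "openin (zariski_top Z) V \<and> f \<in> regular Z V"
  let ?V' = "{y \<in> points Y. \<psi> y \<in> V}"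
  have "openin (zariski_top Y) ?V'"
    using openin_continuous_map_preimage[OF morphism_continuous[OF \<psi>]] * by simp
  moreover have "f \<circ> \<psi> \<in> regular Y ?V'"
    using morphism_regular[OF \<psi>] * by simp
  ultimately have "f \<circ> \<psi> \<circ> \<phi> \<in> regular X {x \<in> points X. \<phi> x \<in> ?V'}"
    by (rule morphism_regular[OF \<phi>])
  moreover have "{x \<in> points X. \<phi> x \<in> ?V'} = {x \<in> points X. (\<psi> \<circ> \<phi>) x \<in> V}"
    using morphism_points[OF \<phi>] by auto
  ultimately show "f \<circ> (\<psi> \<circ> \<phi>) \<in> regular X {x \<in> points X. (\<psi> \<circ> \<phi>) x \<in> V}"
    by (simp only: comp_assoc)
qed

lemma isomorphic_sym: "isomorphic X Y \<Longrightarrow> isomorphic Y X"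
  unfolding isomorphic_def by blast

lemma isomorphic_trans:
  assumes "isomorphic X Y" "isomorphic Y Z"
  shows "isomorphic X Z"
proof -
  obtain \<phi> \<psi> where 1: "morphism X Y \<phi>" "morphism Y X \<psi>"
      "\<forall>x \<in> points X. \<psi> (\<phi> x) = x" "\<forall>y \<in> points Y. \<phi> (\<psi> y) = y"
    using assms(1) unfolding isomorphic_def by blast
  obtain \<phi>' \<psi>' where 2: "morphism Y Z \<phi>'" "morphism Z Y \<psi>'"
      "\<forall>x \<in> points Y. \<psi>' (\<phi>' x) = x" "\<forall>y \<in> points Z. \<phi>' (\<psi>' y) = y"
    using assms(2) unfolding isomorphic_def by blast
  have "\<forall>x \<in> points X. \<phi> x \<in> points Y" "\<forall>z \<in> points Z. \<psi>' z \<in> points Y"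
    using morphism_points[OF 1(1)] morphism_points[OF 2(2)] by blast+
  then have "(\<psi> \<circ> \<psi>') ((\<phi>' \<circ> \<phi>) x) = x" if "x \<in> points X" for x
    using that 1(3) 2(3) by simp
  moreover have "(\<phi>' \<circ> \<phi>) ((\<psi> \<circ> \<psi>') z) = z" if "z \<in> points Z" for z
    using that 1(4) 2(4) \<open>\<forall>z \<in> points Z. \<psi>' z \<in> points Y\<close> by simp
  ultimately show ?thesis
    unfolding isomorphic_def
    using morphism_compose[OF 1(1) 2(1)] morphism_compose[OF 2(2) 1(2)] by blast
qed

lemma morphism_id: "morphism X X id"
  unfolding morphism_def
proof (intro conjI allI impI)
  fix V f
  assume *: "openin (zariski_top X) V \<and> f \<in> regular X V"
  then have "{x \<in> points X. id x \<in> V} = V"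
    using openin_subset by fastforce
  with * show "f \<circ> id \<in> regular X {x \<in> points X. id x \<in> V}"
    by simp
qed simp

lemma isomorphic_refl: "isomorphic X X"
  unfolding isomorphic_def
  by (intro exI[of _ id] conjI ballI morphism_id) simp_all

lemma is_variety_empty: "is_variety (FSpace (discrete_topology {}) (\<lambda>_. UNIV))"
  unfolding is_variety_def by (auto intro: exI[of _ "{}"])

quotient_type var_class = "(nat \<Rightarrow> complex) fspace" /
  partial: "\<lambda>X Y. is_variety X \<and> is_variety Y \<and> isomorphic X Y"
proof (rule part_equivpI)
  show "\<exists>X :: (nat \<Rightarrow> complex) fspace. is_variety X \<and> is_variety X \<and> isomorphic X X"
    using is_variety_empty isomorphic_refl by blast
  show "symp (\<lambda>X Y :: (nat \<Rightarrow> complex) fspace. is_variety X \<and> is_variety Y \<and> isomorphic X Y)"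
    by (rule sympI) (blast intro: isomorphic_sym)
  show "transp (\<lambda>X Y :: (nat \<Rightarrow> complex) fspace. is_variety X \<and> is_variety Y \<and> isomorphic X Y)"
    by (rule transpI) (blast intro: isomorphic_trans)
qed

definition iso_class :: "'a fspace \<Rightarrow> var_class"
  where "iso_class X = abs_var_class (SOME Z. is_variety Z \<and> isomorphic X Z)"

text \<open>
  \<open>var_class \<Rightarrow>\<^sub>0 int\<close> is the free abelian group on the isomorphism classes. The second premise of
  \<open>relation\<close> holds for every open subset \<open>U\<close>, because affine algebraic sets are noetherian;
  stating it spares that argument wherever relations are used. The complement of \<open>U\<close> is again a
  variety, too.
\<close>

inductive_set scissor_relations :: "(var_class \<Rightarrow>\<^sub>0 int) set"
  where
    relation: "is_variety (Z :: (nat \<Rightarrow> complex) fspace) \<Longrightarrow> is_variety (induced Z U) \<Longrightarrow>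
      openin (zariski_top Z) U \<Longrightarrow>
      frag_of (iso_class Z) - frag_of (iso_class (induced Z U)) -
        frag_of (iso_class (induced Z (points Z - U))) \<in> scissor_relations"
  | zero: "0 \<in> scissor_relations"
  | add: "a \<in> scissor_relations \<Longrightarrow> b \<in> scissor_relations \<Longrightarrow> a + b \<in> scissor_relations"
  | uminus: "a \<in> scissor_relations \<Longrightarrow> - a \<in> scissor_relations"

quotient_type K0 = "var_class \<Rightarrow>\<^sub>0 int" / "\<lambda>a b. a - b \<in> scissor_relations"
proof (rule equivpI)
  show "reflp (\<lambda>a b. a - b \<in> scissor_relations)"
    by (auto intro!: reflpI scissor_relations.zero)
  show "symp (\<lambda>a b. a - b \<in> scissor_relations)"
    by (intro sympI) (drule scissor_relations.uminus, simp)
  show "transp (\<lambda>a b. a - b \<in> scissor_relations)"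
  proof (rule transpI)
    fix a b c :: "var_class \<Rightarrow>\<^sub>0 int"
    assume "a - b \<in> scissor_relations" "b - c \<in> scissor_relations"
    then have "(a - b) + (b - c) \<in> scissor_relations"
      by (rule scissor_relations.add)
    then show "a - c \<in> scissor_relations"
      by simp
  qed
qed

definition K0_class :: "'a fspace \<Rightarrow> K0"
  where "K0_class X = abs_K0 (frag_of (iso_class X))"

text \<open>
  The bilinear extension of \<open>[X] \<cdot> [Y] = [X \<times> Y]\<close> to the free abelian group. It is compatible with
  the scissor relations, so that the product on \<open>K0\<close> below does not depend on the
  representatives that \<open>rep_K0\<close> selects.
\<close>

definition free_mult :: "(var_class \<Rightarrow>\<^sub>0 int) \<Rightarrow> (var_class \<Rightarrow>\<^sub>0 int) \<Rightarrow> (var_class \<Rightarrow>\<^sub>0 int)"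
  where "free_mult a b = frag_extend (\<lambda>c. frag_extend
    (\<lambda>d. frag_of (iso_class (fproduct (rep_var_class c) (rep_var_class d)))) b) a"

instantiation K0 :: "{ab_group_add, one, times}"
begin

lift_definition zero_K0 :: K0 is 0 .

lift_definition plus_K0 :: "K0 \<Rightarrow> K0 \<Rightarrow> K0" is "(+)"
proof -
  fix a a' b b' :: "var_class \<Rightarrow>\<^sub>0 int"
  assume "a - a' \<in> scissor_relations" "b - b' \<in> scissor_relations"
  then have "(a - a') + (b - b') \<in> scissor_relations"
    by (rule scissor_relations.add)
  then show "(a + b) - (a' + b') \<in> scissor_relations"
    by (simp add: algebra_simps)
qed

lift_definition uminus_K0 :: "K0 \<Rightarrow> K0" is uminus
proof -
  fix a a' :: "var_class \<Rightarrow>\<^sub>0 int"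
  assume "a - a' \<in> scissor_relations"
  then have "- (a - a') \<in> scissor_relations"
    by (rule scissor_relations.uminus)
  then show "- a - - a' \<in> scissor_relations"
    by simp
qed

definition minus_K0 :: "K0 \<Rightarrow> K0 \<Rightarrow> K0"
  where "a - b = a + - b" for a b :: K0

definition one_K0 :: K0
  where "1 = K0_class (affine_space 0)"

definition times_K0 :: "K0 \<Rightarrow> K0 \<Rightarrow> K0"
  where "a * b = abs_K0 (free_mult (rep_K0 a) (rep_K0 b))"

instance
proof
  show "a + b + c = a + (b + c)" for a b c :: K0
    by transfer (simp add: scissor_relations.zero add.assoc)
  show "a + b = b + a" for a b :: K0
    by transfer (simp add: scissor_relations.zero add.commute)
  show "0 + a = a" for a :: K0
    by transfer (simp add: scissor_relations.zero)
  show "- a + a = 0" for a :: K0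
    by transfer (simp add: scissor_relations.zero)
qed (simp add: minus_K0_def)

end

instance K0 :: power ..

definition L :: K0
  where "L = K0_class (affine_space 1)"


section \<open>Grassmannians and skew forms\<close>

text \<open>
  The Grassmannian of \<open>k\<close>-dimensional subspaces of a finite-dimensional subspace \<open>E\<close> is the
  quotient by \<open>GL\<^sub>k\<close> of the quasi-affine variety of linearly independent \<open>k\<close>-tuples in \<open>E\<close>: open
  sets and regular functions are those whose pullbacks along \<open>t \<mapsto> span t\<close> are open and regular,
  respectively. For \<open>k = 1\<close> this is the projective space of lines in \<open>E\<close>.
\<close>

definition frames :: "(complex \<Rightarrow> 'v::ab_group_add \<Rightarrow> 'v) \<Rightarrow> nat \<Rightarrow> 'v set \<Rightarrow> (nat \<Rightarrow> 'v) set"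
  where "frames smul k E = {t. (\<forall>i<k. t i \<in> E) \<and> (\<forall>i\<ge>k. t i = 0) \<and> inj_on t {..<k} \<and>
    \<not> module.dependent smul (t ` {..<k})}"

definition frame_space ::
    "(complex \<Rightarrow> 'v::ab_group_add \<Rightarrow> 'v) \<Rightarrow> nat \<Rightarrow> 'v set \<Rightarrow> (nat \<Rightarrow> 'v) fspace"
  where "frame_space smul k E = zariski (frames smul k E)
    (algebra_generated {\<lambda>t. \<xi> (t i) | \<xi> i. Vector_Spaces.linear smul (*) \<xi> \<and> i < k})"

definition subspaces :: "(complex \<Rightarrow> 'v::ab_group_add \<Rightarrow> 'v) \<Rightarrow> nat \<Rightarrow> 'v set \<Rightarrow> 'v set set"
  where "subspaces smul k E =
    {T. module.subspace smul T \<and> T \<subseteq> E \<and> vector_space.dim smul T = k}"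

definition grassmannian ::
    "(complex \<Rightarrow> 'v::ab_group_add \<Rightarrow> 'v) \<Rightarrow> nat \<Rightarrow> 'v set \<Rightarrow> 'v set fspace"
  where "grassmannian smul k E =
    (let \<pi> = (\<lambda>t. module.span smul (t ` {..<k}));
         F = frame_space smul k E
     in FSpace
       (topology (\<lambda>\<U>. \<U> \<subseteq> subspaces smul k E \<and> openin (zariski_top F) {t \<in> points F. \<pi> t \<in> \<U>}))
       (\<lambda>\<U>. {h. h \<circ> \<pi> \<in> regular F {t \<in> points F. \<pi> t \<in> \<U>}}))"

abbreviation projective_space ::
    "(complex \<Rightarrow> 'v::ab_group_add \<Rightarrow> 'v) \<Rightarrow> 'v set \<Rightarrow> 'v set fspace"
  where "projective_space smul E \<equiv> grassmannian smul 1 E"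

definition skew_forms ::
    "(complex \<Rightarrow> 'v::ab_group_add \<Rightarrow> 'v) \<Rightarrow> ('v \<Rightarrow> 'v \<Rightarrow> complex) set"
  where "skew_forms smul = {w.
    (\<forall>x. Vector_Spaces.linear smul (*) (\<lambda>y. w x y)) \<and>
    (\<forall>y. Vector_Spaces.linear smul (*) (\<lambda>x. w x y)) \<and> (\<forall>x. w x x = 0)}"

definition form_scale :: "complex \<Rightarrow> ('v \<Rightarrow> 'v \<Rightarrow> complex) \<Rightarrow> 'v \<Rightarrow> 'v \<Rightarrow> complex"
  where "form_scale c w = (\<lambda>x y. c * w x y)"

text \<open>The rank of a form is the rank of the corresponding map \<open>x \<mapsto> w x\<close> from \<open>V\<close> to its dual.\<close>

definition form_rank :: "('v \<Rightarrow> 'v \<Rightarrow> complex) \<Rightarrow> nat"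
  where "form_rank w = vector_space.dim (\<lambda>c \<xi>. \<lambda>y. c * \<xi> y) (range w)"

definition isotropic_locus ::
    "(complex \<Rightarrow> 'v::ab_group_add \<Rightarrow> 'v) \<Rightarrow> ('v \<Rightarrow> 'v \<Rightarrow> complex) set \<Rightarrow> 'v set fspace"
  where "isotropic_locus smul W = (let G = grassmannian smul 2 UNIV in
    induced G {T \<in> points G. \<forall>w\<in>W. \<forall>x\<in>T. \<forall>y\<in>T. w x y = 0})"

definition pfaffian_locus :: "('v \<Rightarrow> 'v \<Rightarrow> complex) set \<Rightarrow> ('v \<Rightarrow> 'v \<Rightarrow> complex) set fspace"
  where "pfaffian_locus W = (let P = projective_space form_scale W in
    induced P {l \<in> points P. \<exists>w. w \<noteq> 0 \<and> l = module.span form_scale {w} \<and> form_rank w < 6})"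

end

theory Submission
  imports Defs
begin

text \<open>
  Compute in two ways the class of the variety of all \<open>((u, v), \<complex>w)\<close> with \<open>u, v \<in> V\<close>,
  \<open>\<complex>w \<in> PW\<close> and \<open>w u v = 0\<close>. For a fixed pair \<open>(u, v)\<close> the condition on \<open>w\<close> defines a hyperplane
  of \<open>PW\<close>, unless all of \<open>W\<close> vanishes on \<open>(u, v)\<close>; apart from dependent pairs, the latter happens
  for the bases of the members of \<open>X\<^sub>W\<close>, which contribute \<open>[X\<^sub>W] (L\<^sup>2 - 1) (L\<^sup>2 - L) L\<^sup>6\<close>.
  For fixed \<open>w\<close> and \<open>u\<close> the condition on \<open>v\<close> is a linear equation, which is trivial if and only if
  \<open>u\<close> is in the kernel of \<open>w\<close>. The kernel has dimension \<open>1\<close>, but \<open>3\<close> if \<open>\<complex>w \<in> Y\<^sub>W\<close>, because a generic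
  \<open>W\<close> contains no forms of rank \<open>2\<close>; the excess is \<open>[Y\<^sub>W] (L\<^sup>3 - L) (L\<^sup>7 - L\<^sup>6)\<close>. Comparison gives
  the claim, since all other contributions depend on \<open>L\<close> only.

  All fibrations are made trivial by stratifications: \<open>PW\<close> by the first nonzero coordinate, the
  Grassmannian by the first nonzero Pluecker coordinate, and linear systems by the pivots of
  an elimination.

  Genericity: forms of rank at most \<open>2\<close> satisfy \<open>w \<and> w = 0\<close>. There are none but \<open>0\<close> in \<open>W\<close> if the
  \<open>28\<close> products \<open>w\<^sub>i \<and> w\<^sub>j\<close> of basis elements are linearly independent. This is an open condition,
  and \<open>w\<^sub>i = e\<^sub>i\<^sub>+\<^sub>1 \<and> e\<^sub>i\<^sub>-\<^sub>1 + e\<^sub>i\<^sub>+\<^sub>2 \<and> e\<^sub>i\<^sub>-\<^sub>2\<close> with indices modulo \<open>7\<close> satisfies it.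
\<close>

section \<open>Spaces with functions\<close>

text \<open>The factor in the conclusion is what both excess terms have in common:
  \<open>(L^2 - 1) * (L^2 - L) * L^6\<close> and \<open>(L^3 - L) * (L^7 - L^6)\<close> are both
  \<open>(L^2 - 1) * (L - 1) * L^7\<close>. A class is meaningful only for a piece known to be a
  variety; this knowledge travels with every class through \<open>subvariety\<close>. Local
  triviality is never invoked abstractly: each piece comes with explicit inverse maps whose
  denominators do not vanish on it. The counting therefore takes place in products of affine spaces,
  and Grassmannian and \<open>PW\<close> are matched with its strata through charts only at the end.
  Dimensions predict genericity: \<open>PW\<close> has dimension 6, and the forms of rank 2 make up
  a \<open>G(2,7)\<close> of dimension 10 in a \<open>P^20\<close>. Independence of the products in
  the 35-dimensional space of 4-forms is stronger, but costs only one determinant and one integral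
  example. In the cyclic example all terms of a form have the same index sum modulo 7; its products
  therefore fall into 7 blocks of size 4, permuted by the cyclic shift.\<close>

definition sheaf_condition :: "'a fspace \<Rightarrow> bool"
  where "sheaf_condition X \<longleftrightarrow> (\<forall>U h. openin (zariski_top X) U \<and>
    (\<forall>x\<in>U. \<exists>V g. openin (zariski_top X) V \<and> x \<in> V \<and> g \<in> regular X V \<and>
      (\<forall>y \<in> U \<inter> V. h y = g y)) \<longrightarrow> h \<in> regular X U)"

definition function_algebra :: "('a \<Rightarrow> complex) set \<Rightarrow> bool"
  where "function_algebra A \<longleftrightarrow> (\<forall>c. (\<lambda>_. c) \<in> A) \<and>
    (\<forall>f\<in>A. \<forall>g\<in>A. (\<lambda>x. f x + g x) \<in> A \<and> (\<lambda>x. f x * g x) \<in> A)"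

text \<open>Wider than varieties: it is preserved by passing to arbitrary subsets, to products and
  to the quotients that define Grassmannians, so constructions may precede the proof that they yield
  varieties. The last clause is locality: a regular function is invertible among regular functions
  wherever it does not vanish.\<close>

definition fun_space :: "'a fspace \<Rightarrow> bool"
  where "fun_space X \<longleftrightarrow> sheaf_condition X \<and> (\<forall>U. openin (zariski_top X) U \<longrightarrow>
    function_algebra (regular X U) \<and>
    (\<forall>f\<in>regular X U. openin (zariski_top X) {x\<in>U. f x \<noteq> 0} \<and>
       (\<lambda>x. inverse (f x)) \<in> regular X {x\<in>U. f x \<noteq> 0}))"

definition gfun :: "'a fspace \<Rightarrow> ('a \<Rightarrow> complex) set"
  where "gfun X = regular X (points X)"

lemma function_algebraI:
  assumes "\<And>c. (\<lambda>_. c) \<in> A" "\<And>f g. f \<in> A \<Longrightarrow> g \<in> A \<Longrightarrow> (\<lambda>x. f x + g x) \<in> A"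
    "\<And>f g. f \<in> A \<Longrightarrow> g \<in> A \<Longrightarrow> (\<lambda>x. f x * g x) \<in> A"
  shows "function_algebra A"
  using assms unfolding function_algebra_def by blast

lemma function_algebraD:
  assumes "function_algebra A"
  shows "(\<lambda>_. c) \<in> A" "f \<in> A \<Longrightarrow> g \<in> A \<Longrightarrow> (\<lambda>x. f x + g x) \<in> A"
    "f \<in> A \<Longrightarrow> g \<in> A \<Longrightarrow> (\<lambda>x. f x * g x) \<in> A"
  using assms unfolding function_algebra_def by blast+

lemma function_algebra_generated: "function_algebra (algebra_generated S)"
  unfolding function_algebra_def by (simp add: algebra_generated.intros)

lemma fun_space_sheaf:
  assumes "fun_space X" "openin (zariski_top X) U"
    "\<And>x. x \<in> U \<Longrightarrow> \<exists>V g. openin (zariski_top X) V \<and> x \<in> V \<and> g \<in> regular X V \<and>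
      (\<forall>y \<in> U \<inter> V. h y = g y)"
  shows "h \<in> regular X U"
  using assms unfolding fun_space_def sheaf_condition_def by blast

lemma fun_space_algebra:
  "fun_space X \<Longrightarrow> openin (zariski_top X) U \<Longrightarrow> function_algebra (regular X U)"
  unfolding fun_space_def by blast

lemma fun_space_nonzero_open:
  "fun_space X \<Longrightarrow> openin (zariski_top X) U \<Longrightarrow> f \<in> regular X U \<Longrightarrow>
    openin (zariski_top X) {x\<in>U. f x \<noteq> 0}"
  unfolding fun_space_def by blast

lemma fun_space_inverse:
  "fun_space X \<Longrightarrow> openin (zariski_top X) U \<Longrightarrow> f \<in> regular X U \<Longrightarrow>
    (\<lambda>x. inverse (f x)) \<in> regular X {x\<in>U. f x \<noteq> 0}"
  unfolding fun_space_def by blast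

lemma regular_cong:
  assumes "fun_space X" "openin (zariski_top X) U" "f \<in> regular X U" "\<And>x. x \<in> U \<Longrightarrow> g x = f x"
  shows "g \<in> regular X U"
  using assms by (intro fun_space_sheaf[of X U g]) auto

lemma regular_restrict:
  assumes "fun_space X" "openin (zariski_top X) U" "openin (zariski_top X) V" "V \<subseteq> U"
    "f \<in> regular X U"
  shows "f \<in> regular X V"
  using assms by (intro fun_space_sheaf[of X V f]) auto

section \<open>Zariski topologies and local quotients of polynomials\<close>

lemma openin_topology_generated_by_basis:
  assumes "\<And>A B x. A \<in> S \<Longrightarrow> B \<in> S \<Longrightarrow> x \<in> A \<inter> B \<Longrightarrow> \<exists>C\<in>S. x \<in> C \<and> C \<subseteq> A \<inter> B"
  shows "openin (topology_generated_by S) U \<longleftrightarrow> (\<forall>x\<in>U. \<exists>B\<in>S. x \<in> B \<and> B \<subseteq> U)"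
proof
  assume "openin (topology_generated_by S) U"
  then have "generate_topology_on S U"
    by (simp add: openin_topology_generated_by_iff)
  then show "\<forall>x\<in>U. \<exists>B\<in>S. x \<in> B \<and> B \<subseteq> U"
  proof induction
    case (Int a b)
    show ?case
    proof
      fix x assume "x \<in> a \<inter> b"
      then obtain A B where "A \<in> S" "x \<in> A" "A \<subseteq> a" "B \<in> S" "x \<in> B" "B \<subseteq> b"
        using Int.IH by (metis IntD1 IntD2)
      then show "\<exists>B\<in>S. x \<in> B \<and> B \<subseteq> a \<inter> b"
        using assms[of A B x] by (meson IntI Int_mono subset_trans)
    qed
  next
    case (UN K)
    then show ?case by (meson Union_iff Union_upper subset_trans)
  qed auto
next
  assume "\<forall>x\<in>U. \<exists>B\<in>S. x \<in> B \<and> B \<subseteq> U"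
  then show "openin (topology_generated_by S) U"
    by (subst openin_subopen) (meson topology_generated_by_Basis)
qed

lemma openin_zariski:
  assumes "function_algebra A"
  shows "openin (zariski_top (zariski M A)) U \<longleftrightarrow>
    U \<subseteq> M \<and> (\<forall>x\<in>U. \<exists>f\<in>A. f x \<noteq> 0 \<and> (\<forall>y\<in>M. f y \<noteq> 0 \<longrightarrow> y \<in> U))"
proof -
  have "openin (zariski_top (zariski M A)) U \<longleftrightarrow>
    (\<forall>x\<in>U. \<exists>B\<in>{{x \<in> M. f x \<noteq> 0} |f. f \<in> A}. x \<in> B \<and> B \<subseteq> U)"
    unfolding zariski_def fspace.sel
  proof (rule openin_topology_generated_by_basis)
    fix C D x
    assume "C \<in> {{x \<in> M. f x \<noteq> 0} |f. f \<in> A}" "D \<in> {{x \<in> M. f x \<noteq> 0} |f. f \<in> A}" and x: "x \<in> C \<inter> D"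
    then obtain f g where fg: "f \<in> A" "g \<in> A" "C = {x \<in> M. f x \<noteq> 0}" "D = {x \<in> M. g x \<noteq> 0}"
      by blast
    then have "(\<lambda>x. f x * g x) \<in> A"
      using assms function_algebraD by blast
    then show "\<exists>E\<in>{{x \<in> M. f x \<noteq> 0} |f. f \<in> A}. x \<in> E \<and> E \<subseteq> C \<inter> D"
      using fg x by (intro bexI[of _ "{x \<in> M. f x * g x \<noteq> 0}"])
        (auto intro!: exI[of _ "\<lambda>x. f x * g x"])
  qed
  also have "\<dots> \<longleftrightarrow> U \<subseteq> M \<and> (\<forall>x\<in>U. \<exists>f\<in>A. f x \<noteq> 0 \<and> (\<forall>y\<in>M. f y \<noteq> 0 \<longrightarrow> y \<in> U))"
    (is "?l \<longleftrightarrow> ?r")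
  proof
    assume l: ?l
    show ?r
    proof (intro conjI ballI subsetI)
      fix x assume "x \<in> U"
      with l obtain f where f: "f \<in> A" "x \<in> M" "f x \<noteq> 0" "{x \<in> M. f x \<noteq> 0} \<subseteq> U"
        by blast
      show "x \<in> M" by fact
      show "\<exists>f\<in>A. f x \<noteq> 0 \<and> (\<forall>y\<in>M. f y \<noteq> 0 \<longrightarrow> y \<in> U)"
        using f by (intro bexI[of _ f]) auto
    qed
  next
    assume r: ?r
    show ?l
    proof
      fix x assume x: "x \<in> U"
      with r obtain f where f: "f \<in> A" "f x \<noteq> 0" "\<forall>y\<in>M. f y \<noteq> 0 \<longrightarrow> y \<in> U"
        by meson
      then show "\<exists>B\<in>{{x \<in> M. f x \<noteq> 0} |f. f \<in> A}. x \<in> B \<and> B \<subseteq> U"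
        using x r by (intro bexI[of _ "{x \<in> M. f x \<noteq> 0}"]) auto
    qed
  qed
  finally show ?thesis .
qed

lemma regular_zariski:
  "h \<in> regular (zariski M A) U \<longleftrightarrow>
    (\<forall>x\<in>U. \<exists>f\<in>A. \<exists>g\<in>A. g x \<noteq> 0 \<and> (\<forall>y\<in>U. g y \<noteq> 0 \<longrightarrow> h y = f y / g y))"
  by (simp add: zariski_def)

lemma points_zariski: "function_algebra A \<Longrightarrow> points (zariski M A) = M"
proof -
  assume A: "function_algebra A"
  have "openin (zariski_top (zariski M A)) M"
    using function_algebraD(1)[OF A, of 1] unfolding openin_zariski[OF A]
    by (intro conjI ballI bexI[of _ "\<lambda>_. 1"]) auto
  moreover have "points (zariski M A) \<subseteq> M"
    using openin_topspace[of "zariski_top (zariski M A)"] unfolding openin_zariski[OF A] by simp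
  ultimately show ?thesis
    using openin_subset by blast
qed

lemma algebra_regular_zariski:
  "function_algebra A \<Longrightarrow> f \<in> A \<Longrightarrow> f \<in> regular (zariski M A) U"
proof -
  assume A: "function_algebra A" and f: "f \<in> A"
  have "(\<lambda>_. 1) \<in> A" using function_algebraD(1)[OF A] .
  then show ?thesis unfolding regular_zariski using f
    by (intro ballI bexI[of _ f] bexI[of _ "\<lambda>_. 1"]) simp_all
qed

lemma fun_space_zariski:
  assumes A: "function_algebra A"
  shows "fun_space (zariski M A)"
  unfolding fun_space_def
proof (intro conjI allI impI)
  let ?X = "zariski M A"
  show "sheaf_condition ?X"
    unfolding sheaf_condition_def
  proof (intro allI impI)
    fix U h
    assume *: "openin (zariski_top ?X) U \<and>
      (\<forall>x\<in>U. \<exists>V g. openin (zariski_top ?X) V \<and> x \<in> V \<and> g \<in> regular ?X V \<and> (\<forall>y\<in>U \<inter> V. h y = g y))"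
    then have UM: "U \<subseteq> M" unfolding openin_zariski[OF A] by blast
    show "h \<in> regular ?X U"
      unfolding regular_zariski
    proof
      fix x assume "x \<in> U"
      with * obtain V g where V: "openin (zariski_top ?X) V" "x \<in> V" "g \<in> regular ?X V"
        "\<forall>y\<in>U \<inter> V. h y = g y" by blast
      obtain r where r: "r \<in> A" "r x \<noteq> 0" "\<forall>y\<in>M. r y \<noteq> 0 \<longrightarrow> y \<in> V"
        using V(1,2) unfolding openin_zariski[OF A] by blast
      obtain p q where pq: "p \<in> A" "q \<in> A" "q x \<noteq> 0" "\<forall>y\<in>V. q y \<noteq> 0 \<longrightarrow> g y = p y / q y"
        using V(2,3) unfolding regular_zariski by blast
      \<comment> \<open>The polynomial \<open>r\<close> vanishes on \<open>M\<close> outside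
        \<open>V\<close>. Multiplying both parts of the fraction by it discards the points where
        \<open>p / q\<close> need not represent \<open>g\<close>.\<close>
      have "(\<lambda>x. p x * r x) \<in> A" "(\<lambda>x. q x * r x) \<in> A"
        using pq r function_algebraD[OF A] by blast+
      moreover have "\<forall>y\<in>U. q y * r y \<noteq> 0 \<longrightarrow> h y = (p y * r y) / (q y * r y)"
        using V(4) r(3) pq(4) UM by auto
      ultimately show "\<exists>f\<in>A. \<exists>g\<in>A. g x \<noteq> 0 \<and> (\<forall>y\<in>U. g y \<noteq> 0 \<longrightarrow> h y = f y / g y)"
        using pq(3) r(2) by (intro bexI[of _ "\<lambda>x. p x * r x"] bexI[of _ "\<lambda>x. q x * r x"]) auto
    qed
  qed
next
  fix U assume U: "openin (zariski_top (zariski M A)) U"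
  show "function_algebra (regular (zariski M A) U)"
  proof (rule function_algebraI)
    fix c
    show "(\<lambda>_. c) \<in> regular (zariski M A) U"
      by (rule algebra_regular_zariski[OF A function_algebraD(1)[OF A]])
  next
    fix f g
    assume f: "f \<in> regular (zariski M A) U" and g: "g \<in> regular (zariski M A) U"
    show "(\<lambda>x. f x + g x) \<in> regular (zariski M A) U" unfolding regular_zariski
    proof
      fix x assume "x \<in> U"
      then obtain p q where pq: "p \<in> A" "q \<in> A" "q x \<noteq> 0" "\<forall>y\<in>U. q y \<noteq> 0 \<longrightarrow> f y = p y / q y"
        using f unfolding regular_zariski by blast
      obtain r s where rs: "r \<in> A" "s \<in> A" "s x \<noteq> 0" "\<forall>y\<in>U. s y \<noteq> 0 \<longrightarrow> g y = r y / s y"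
        using g \<open>x \<in> U\<close> unfolding regular_zariski by blast
      note p = pq rs
      have "(\<lambda>x. p x * s x + r x * q x) \<in> A" "(\<lambda>x. q x * s x) \<in> A"
        using p function_algebraD[OF A] by simp_all
      then show "\<exists>f'\<in>A. \<exists>g'\<in>A. g' x \<noteq> 0 \<and> (\<forall>y\<in>U. g' y \<noteq> 0 \<longrightarrow> f y + g y = f' y / g' y)"
        using p by (intro bexI[of _ "\<lambda>x. p x * s x + r x * q x"] bexI[of _ "\<lambda>x. q x * s x"])
          (auto simp: field_simps)
    qed
    show "(\<lambda>x. f x * g x) \<in> regular (zariski M A) U" unfolding regular_zariski
    proof
      fix x assume "x \<in> U"
      then obtain p q where pq: "p \<in> A" "q \<in> A" "q x \<noteq> 0" "\<forall>y\<in>U. q y \<noteq> 0 \<longrightarrow> f y = p y / q y"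
        using f unfolding regular_zariski by blast
      obtain r s where rs: "r \<in> A" "s \<in> A" "s x \<noteq> 0" "\<forall>y\<in>U. s y \<noteq> 0 \<longrightarrow> g y = r y / s y"
        using g \<open>x \<in> U\<close> unfolding regular_zariski by blast
      note p = pq rs
      have "(\<lambda>x. p x * r x) \<in> A" "(\<lambda>x. q x * s x) \<in> A"
        using p function_algebraD[OF A] by simp_all
      then show "\<exists>f'\<in>A. \<exists>g'\<in>A. g' x \<noteq> 0 \<and> (\<forall>y\<in>U. g' y \<noteq> 0 \<longrightarrow> f y * g y = f' y / g' y)"
        using p by (intro bexI[of _ "\<lambda>x. p x * r x"] bexI[of _ "\<lambda>x. q x * s x"])
          (auto simp: field_simps)
    qed
  qed
  show "\<forall>f\<in>regular (zariski M A) U. openin (zariski_top (zariski M A)) {x \<in> U. f x \<noteq> 0} \<and>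
    (\<lambda>x. inverse (f x)) \<in> regular (zariski M A) {x \<in> U. f x \<noteq> 0}"
  proof (intro ballI conjI)
    fix f assume f: "f \<in> regular (zariski M A) U"
    show "openin (zariski_top (zariski M A)) {x \<in> U. f x \<noteq> 0}"
      unfolding openin_zariski[OF A]
    proof (intro conjI ballI)
      show "{x \<in> U. f x \<noteq> 0} \<subseteq> M" using U unfolding openin_zariski[OF A] by blast
      fix x assume x: "x \<in> {x \<in> U. f x \<noteq> 0}"
      then obtain p q where pq: "p \<in> A" "q \<in> A" "q x \<noteq> 0" "\<forall>y\<in>U. q y \<noteq> 0 \<longrightarrow> f y = p y / q y"
        using f unfolding regular_zariski by blast
      obtain r where r: "r \<in> A" "r x \<noteq> 0" "\<forall>y\<in>M. r y \<noteq> 0 \<longrightarrow> y \<in> U"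
        using U x unfolding openin_zariski[OF A] by blast
      \<comment> \<open>Each factor has one duty: \<open>q\<close> makes the fraction meaningful,
        \<open>p\<close> makes it nonzero, and \<open>r\<close> confines the set to
        \<open>U\<close>.\<close>
      have "(\<lambda>x. p x * q x * r x) \<in> A"
        using pq r function_algebraD[OF A] by simp
      then show "\<exists>g\<in>A. g x \<noteq> 0 \<and> (\<forall>y\<in>M. g y \<noteq> 0 \<longrightarrow> y \<in> {x \<in> U. f x \<noteq> 0})"
        using pq r x by (intro bexI[of _ "\<lambda>x. p x * q x * r x"]) auto
    qed
    show "(\<lambda>x. inverse (f x)) \<in> regular (zariski M A) {x \<in> U. f x \<noteq> 0}"
      unfolding regular_zariski
    proof
      fix x assume x: "x \<in> {x \<in> U. f x \<noteq> 0}"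
      then obtain p q where pq: "p \<in> A" "q \<in> A" "q x \<noteq> 0" "\<forall>y\<in>U. q y \<noteq> 0 \<longrightarrow> f y = p y / q y"
        using f unfolding regular_zariski by blast
      have "(\<lambda>x. p x * q x) \<in> A" "(\<lambda>x. q x * q x) \<in> A"
        using pq function_algebraD[OF A] by simp_all
      then show "\<exists>p\<in>A. \<exists>q\<in>A. q x \<noteq> 0 \<and> (\<forall>y\<in>{x \<in> U. f x \<noteq> 0}. q y \<noteq> 0 \<longrightarrow> inverse (f y) = p y / q y)"
        using pq x by (intro bexI[of _ "\<lambda>x. q x * q x"] bexI[of _ "\<lambda>x. p x * q x"]) auto
    qed
  qed
qed

section \<open>Induced structures on subsets\<close>

lemma points_induced [simp]: "points (induced X A) = points X \<inter> A"
  by (simp add: induced_def)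

lemma openin_induced: "openin (zariski_top (induced X A)) U \<longleftrightarrow>
    (\<exists>V. openin (zariski_top X) V \<and> U = V \<inter> A)"
  by (simp add: induced_def openin_subtopology)

lemma regular_induced: "h \<in> regular (induced X A) U \<longleftrightarrow> (\<forall>x\<in>U. \<exists>V g. openin (zariski_top X) V \<and>
    x \<in> V \<and> g \<in> regular X V \<and> (\<forall>y \<in> U \<inter> V. h y = g y))"
  by (simp add: induced_def)

lemma regular_inducedI: "openin (zariski_top X) V \<Longrightarrow> g \<in> regular X V \<Longrightarrow> U \<subseteq> V \<Longrightarrow>
    g \<in> regular (induced X A) U"
  unfolding regular_induced by blast

text \<open>Regular functions on a subset extend to the ambient space only locally, so every
  operation is carried out on local extensions and glued.\<close>

lemma fun_space_induced:
  assumes X: "fun_space X"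
  shows "fun_space (induced X A)"
  unfolding fun_space_def
proof (intro conjI allI impI)
  show "sheaf_condition (induced X A)"
    unfolding sheaf_condition_def
  proof (intro allI impI)
    fix U h
    assume *: "openin (zariski_top (induced X A)) U \<and>
      (\<forall>x\<in>U. \<exists>V g. openin (zariski_top (induced X A)) V \<and> x \<in> V \<and> g \<in> regular (induced X A) V \<and>
         (\<forall>y\<in>U \<inter> V. h y = g y))"
    show "h \<in> regular (induced X A) U"
      unfolding regular_induced
    proof
      fix x assume x: "x \<in> U"
      with * obtain V g where V: "openin (zariski_top (induced X A)) V" "x \<in> V"
        "g \<in> regular (induced X A) V" "\<forall>y\<in>U \<inter> V. h y = g y" by blast
      obtain V' where V': "openin (zariski_top X) V'" "V = V' \<inter> A"
        using V(1) unfolding openin_induced by blast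
      obtain V'' g' where V'': "openin (zariski_top X) V''" "x \<in> V''" "g' \<in> regular X V''"
          "\<forall>y\<in>V \<inter> V''. g y = g' y"
        using V(2,3) unfolding regular_induced by blast
      have "U \<subseteq> A" using * unfolding openin_induced by blast
      have "openin (zariski_top X) (V' \<inter> V'')" using V' V'' by blast
      moreover have "g' \<in> regular X (V' \<inter> V'')"
        using regular_restrict[OF X V''(1) calculation] V''(3) by blast
      moreover have "\<forall>y\<in>U \<inter> (V' \<inter> V''). h y = g' y"
        using V V' V'' \<open>U \<subseteq> A\<close> by auto
      ultimately show "\<exists>V g. openin (zariski_top X) V \<and> x \<in> V \<and> g \<in> regular X V \<and>
          (\<forall>y\<in>U \<inter> V. h y = g y)"
        using V(2) V'(2) V''(2) by blast
    qed
  qed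
next
  fix U assume U: "openin (zariski_top (induced X A)) U"
  show "function_algebra (regular (induced X A) U)"
  proof (rule function_algebraI)
    fix c
    show "(\<lambda>_. c) \<in> regular (induced X A) U"
      using U function_algebraD(1)[OF fun_space_algebra[OF X]]
      unfolding openin_induced by (metis inf_le1 regular_inducedI)
  next
    fix f g
    assume f: "f \<in> regular (induced X A) U" and g: "g \<in> regular (induced X A) U"
    \<comment> \<open>The extensions of \<open>f\<close> and of \<open>g\<close> near
      \<open>x\<close> live on different open sets; the intersection serves both.\<close>
    have *: "\<exists>V f' g'. openin (zariski_top X) V \<and> x \<in> V \<and> f' \<in> regular X V \<and> g' \<in> regular X V \<and>
       (\<forall>y \<in> U \<inter> V. f y = f' y \<and> g y = g' y)" if x: "x \<in> U" for x
    proof -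
      obtain V f' where V: "openin (zariski_top X) V" "x \<in> V" "f' \<in> regular X V"
         "\<forall>y \<in> U \<inter> V. f y = f' y" using f x unfolding regular_induced by blast
      obtain V' g' where V': "openin (zariski_top X) V'" "x \<in> V'" "g' \<in> regular X V'"
         "\<forall>y \<in> U \<inter> V'. g y = g' y" using g x unfolding regular_induced by blast
      have o: "openin (zariski_top X) (V \<inter> V')" using V V' by blast
      have "f' \<in> regular X (V \<inter> V')" "g' \<in> regular X (V \<inter> V')"
        using regular_restrict[OF X _ o] V V' by blast+
      then show ?thesis using o V V' by (intro exI[of _ "V \<inter> V'"] exI[of _ f'] exI[of _ g']) blast
    qed
    show "(\<lambda>x. f x + g x) \<in> regular (induced X A) U"
      unfolding regular_induced
    proof
      fix x assume "x \<in> U"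
      then obtain V f' g' where V: "openin (zariski_top X) V" "x \<in> V" "f' \<in> regular X V"
        "g' \<in> regular X V" "\<forall>y \<in> U \<inter> V. f y = f' y \<and> g y = g' y" using * by meson
      have "(\<lambda>x. f' x + g' x) \<in> regular X V"
        using function_algebraD(2)[OF fun_space_algebra[OF X V(1)]] V by blast
      then show "\<exists>V h. openin (zariski_top X) V \<and> x \<in> V \<and> h \<in> regular X V \<and>
          (\<forall>y\<in>U \<inter> V. f y + g y = h y)"
        using V by (intro exI[of _ V] exI[of _ "\<lambda>x. f' x + g' x"]) auto
    qed
    show "(\<lambda>x. f x * g x) \<in> regular (induced X A) U"
      unfolding regular_induced
    proof
      fix x assume "x \<in> U"
      then obtain V f' g' where V: "openin (zariski_top X) V" "x \<in> V" "f' \<in> regular X V"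
        "g' \<in> regular X V" "\<forall>y \<in> U \<inter> V. f y = f' y \<and> g y = g' y" using * by meson
      have "(\<lambda>x. f' x * g' x) \<in> regular X V"
        using function_algebraD(3)[OF fun_space_algebra[OF X V(1)]] V by blast
      then show "\<exists>V h. openin (zariski_top X) V \<and> x \<in> V \<and> h \<in> regular X V \<and>
          (\<forall>y\<in>U \<inter> V. f y * g y = h y)"
        using V by (intro exI[of _ V] exI[of _ "\<lambda>x. f' x * g' x"]) auto
    qed
  qed
  show "\<forall>f\<in>regular (induced X A) U. openin (zariski_top (induced X A)) {x \<in> U. f x \<noteq> 0} \<and>
    (\<lambda>x. inverse (f x)) \<in> regular (induced X A) {x \<in> U. f x \<noteq> 0}"
  proof (intro ballI conjI)
    fix f assume f: "f \<in> regular (induced X A) U"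
    obtain U' where U': "openin (zariski_top X) U'" "U = U' \<inter> A"
      using U unfolding openin_induced by blast
    show "openin (zariski_top (induced X A)) {x \<in> U. f x \<noteq> 0}"
    proof (subst openin_subopen, intro ballI)
      fix x assume x: "x \<in> {x \<in> U. f x \<noteq> 0}"
      then obtain V g where V: "openin (zariski_top X) V" "x \<in> V" "g \<in> regular X V"
         "\<forall>y \<in> U \<inter> V. f y = g y" using f unfolding regular_induced by blast
      have "openin (zariski_top X) {x \<in> V. g x \<noteq> 0}"
        using fun_space_nonzero_open[OF X V(1,3)] .
      then have "openin (zariski_top (induced X A)) (({x \<in> V. g x \<noteq> 0} \<inter> U') \<inter> A)"
        unfolding openin_induced using U'(1) by blast
      then show "\<exists>T. openin (zariski_top (induced X A)) T \<and> x \<in> T \<and> T \<subseteq> {x \<in> U. f x \<noteq> 0}"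
        using x V U'(2) by (intro exI[of _ "({x \<in> V. g x \<noteq> 0} \<inter> U') \<inter> A"]) auto
    qed
    show "(\<lambda>x. inverse (f x)) \<in> regular (induced X A) {x \<in> U. f x \<noteq> 0}"
      unfolding regular_induced
    proof
      fix x assume x: "x \<in> {x \<in> U. f x \<noteq> 0}"
      then obtain V g where V: "openin (zariski_top X) V" "x \<in> V" "g \<in> regular X V"
         "\<forall>y \<in> U \<inter> V. f y = g y" using f unfolding regular_induced by blast
      show "\<exists>V g. openin (zariski_top X) V \<and> x \<in> V \<and> g \<in> regular X V \<and>
          (\<forall>y\<in>{x \<in> U. f x \<noteq> 0} \<inter> V. inverse (f y) = g y)"
        using V x fun_space_nonzero_open[OF X V(1,3)] fun_space_inverse[OF X V(1,3)]
        by (intro exI[of _ "{x \<in> V. g x \<noteq> 0}"] exI[of _ "\<lambda>x. inverse (g x)"]) auto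
    qed
  qed
qed

section \<open>Products\<close>

lemma algebra_generated_mono:
  assumes "S \<subseteq> T" and f: "f \<in> algebra_generated S"
  shows "f \<in> algebra_generated T"
  using f by induction (use assms(1) in \<open>auto intro: algebra_generated.intros\<close>)

lemma product_functions_algebra: "function_algebra (product_functions X Y U V)"
  unfolding product_functions_def by (rule function_algebra_generated)

lemma product_functions_fst:
  "f \<in> regular X U \<Longrightarrow> (\<lambda>p. f (fst p)) \<in> product_functions X Y U V"
  unfolding product_functions_def by (rule algebra_generated.generator) blast

lemma product_functions_snd:
  "f \<in> regular Y V \<Longrightarrow> (\<lambda>p. f (snd p)) \<in> product_functions X Y U V"
  unfolding product_functions_def by (rule algebra_generated.generator) blast

lemma product_functions_restrict:
  assumes X: "fun_space X" and Y: "fun_space Y"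
    and U: "openin (zariski_top X) U" "openin (zariski_top X) U'" "U' \<subseteq> U"
    and V: "openin (zariski_top Y) V" "openin (zariski_top Y) V'" "V' \<subseteq> V"
    and f: "f \<in> product_functions X Y U V"
  shows "f \<in> product_functions X Y U' V'"
proof -
  have "{\<lambda>p. f (fst p) | f. f \<in> regular X U} \<union> {\<lambda>p. g (snd p) | g. g \<in> regular Y V} \<subseteq>
    {\<lambda>p. f (fst p) | f. f \<in> regular X U'} \<union> {\<lambda>p. g (snd p) | g. g \<in> regular Y V'}"
    using regular_restrict[OF X U] regular_restrict[OF Y V] by fast
  then show ?thesis
    using f unfolding product_functions_def by (rule algebra_generated_mono)
qed

text \<open>The generating sets form a basis and not just a subbasis: on the intersection of two
  rectangles both functions restrict, and their product describes the intersection of the two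
  sets.\<close>

lemma openin_fproduct:
  assumes X: "fun_space X" and Y: "fun_space Y"
  shows "openin (zariski_top (fproduct X Y)) W \<longleftrightarrow> (\<forall>p\<in>W. \<exists>U V f. openin (zariski_top X) U \<and>
    openin (zariski_top Y) V \<and> f \<in> product_functions X Y U V \<and> p \<in> U \<times> V \<and> f p \<noteq> 0 \<and>
    {q \<in> U \<times> V. f q \<noteq> 0} \<subseteq> W)"
proof -
  let ?S = "{{p \<in> U \<times> V. f p \<noteq> 0} | U V f.
       openin (zariski_top X) U \<and> openin (zariski_top Y) V \<and> f \<in> product_functions X Y U V}"
  have "openin (zariski_top (fproduct X Y)) W \<longleftrightarrow> (\<forall>p\<in>W. \<exists>B\<in>?S. p \<in> B \<and> B \<subseteq> W)"
    unfolding fproduct_def fspace.sel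
  proof (rule openin_topology_generated_by_basis)
    fix C D p
    assume C: "C \<in> ?S" and D: "D \<in> ?S" and p: "p \<in> C \<inter> D"
    from C obtain U V f where 1: "openin (zariski_top X) U" "openin (zariski_top Y) V"
      "f \<in> product_functions X Y U V" "C = {p \<in> U \<times> V. f p \<noteq> 0}" by blast
    from D obtain U' V' f' where 2: "openin (zariski_top X) U'" "openin (zariski_top Y) V'"
      "f' \<in> product_functions X Y U' V'" "D = {p \<in> U' \<times> V'. f' p \<noteq> 0}" by blast
    have o: "openin (zariski_top X) (U \<inter> U')" "openin (zariski_top Y) (V \<inter> V')" using 1 2 by blast+
    have "f \<in> product_functions X Y (U \<inter> U') (V \<inter> V')"
      by (rule product_functions_restrict[OF X Y _ _ _ _ _ _ 1(3)]) (use 1 2 o in auto)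
    moreover have "f' \<in> product_functions X Y (U \<inter> U') (V \<inter> V')"
      by (rule product_functions_restrict[OF X Y _ _ _ _ _ _ 2(3)]) (use 1 2 o in auto)
    ultimately have "(\<lambda>p. f p * f' p) \<in> product_functions X Y (U \<inter> U') (V \<inter> V')"
      by (rule function_algebraD(3)[OF product_functions_algebra])
    then have "{p \<in> (U \<inter> U') \<times> (V \<inter> V'). f p * f' p \<noteq> 0} \<in> ?S"
      using o by (intro CollectI exI[of _ "U \<inter> U'"] exI[of _ "V \<inter> V'"] exI[of _ "\<lambda>p. f p * f' p"]) simp
    then show "\<exists>E\<in>?S. p \<in> E \<and> E \<subseteq> C \<inter> D"
      by (rule rev_bexI) (use p 1(4) 2(4) in auto)
  qed
  also have "\<dots> \<longleftrightarrow> (\<forall>p\<in>W. \<exists>U V f. openin (zariski_top X) U \<and>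
    openin (zariski_top Y) V \<and> f \<in> product_functions X Y U V \<and> p \<in> U \<times> V \<and> f p \<noteq> 0 \<and>
    {q \<in> U \<times> V. f q \<noteq> 0} \<subseteq> W)" (is "?l \<longleftrightarrow> ?r")
  proof
    assume l: ?l
    show ?r
    proof
      fix p assume "p \<in> W"
      with l have "\<exists>B\<in>?S. p \<in> B \<and> B \<subseteq> W" by (rule bspec)
      then obtain B where B: "B \<in> ?S" "p \<in> B" "B \<subseteq> W" by (elim bexE conjE)
      from B(1) obtain U V f where 1: "openin (zariski_top X) U" "openin (zariski_top Y) V"
        "f \<in> product_functions X Y U V" "B = {p \<in> U \<times> V. f p \<noteq> 0}" by blast
      show "\<exists>U V f. openin (zariski_top X) U \<and>
          openin (zariski_top Y) V \<and> f \<in> product_functions X Y U V \<and> p \<in> U \<times> V \<and> f p \<noteq> 0 \<and>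
          {q \<in> U \<times> V. f q \<noteq> 0} \<subseteq> W"
        by (rule exI[of _ U], rule exI[of _ V], rule exI[of _ f]) (use B 1 in auto)
    qed
  next
    assume r: ?r
    show ?l
    proof
      fix p assume "p \<in> W"
      note bspec[OF r this]
      then obtain U V f where 1: "openin (zariski_top X) U" "openin (zariski_top Y) V"
        "f \<in> product_functions X Y U V" "p \<in> U \<times> V" "f p \<noteq> 0" "{q \<in> U \<times> V. f q \<noteq> 0} \<subseteq> W"
        by (elim exE conjE)
      then have "{q \<in> U \<times> V. f q \<noteq> 0} \<in> ?S"
        by (intro CollectI exI[of _ U] exI[of _ V] exI[of _ f]) simp
      then show "\<exists>B\<in>?S. p \<in> B \<and> B \<subseteq> W"
        by (rule rev_bexI) (use 1 in auto)
    qed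
  qed
  finally show ?thesis .
qed

lemma openin_fproductE:
  assumes "fun_space X" "fun_space Y" "openin (zariski_top (fproduct X Y)) W" "p \<in> W"
  obtains U V f where "openin (zariski_top X) U" "openin (zariski_top Y) V"
    "f \<in> product_functions X Y U V" "p \<in> U \<times> V" "f p \<noteq> 0" "{q \<in> U \<times> V. f q \<noteq> 0} \<subseteq> W"
proof -
  note bspec[OF assms(3)[unfolded openin_fproduct[OF assms(1,2)]] assms(4)]
  then show thesis using that by (elim exE conjE)
qed

lemma points_fproduct [simp]: "points (fproduct X Y) = points X \<times> points Y"
proof -
  let ?S = "{{p \<in> U \<times> V. f p \<noteq> 0} | U V f.
       openin (zariski_top X) U \<and> openin (zariski_top Y) V \<and> f \<in> product_functions X Y U V}"
  have "points (fproduct X Y) = \<Union>?S"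
    by (simp add: fproduct_def)
  also have "\<Union>?S = points X \<times> points Y"
  proof
    show "\<Union>?S \<subseteq> points X \<times> points Y"
    proof
      fix p assume "p \<in> \<Union>?S"
      then obtain B where "B \<in> ?S" "p \<in> B" by (rule UnionE)
      then obtain U V f where "openin (zariski_top X) U" "openin (zariski_top Y) V"
        "f \<in> product_functions X Y U V" "B = {p \<in> U \<times> V. f p \<noteq> 0}"
        by blast
      with \<open>p \<in> B\<close> openin_subset[of "zariski_top X" U] openin_subset[of "zariski_top Y" V]
      show "p \<in> points X \<times> points Y" by auto
    qed
    have "(\<lambda>_. 1) \<in> product_functions X Y (points X) (points Y)"
      by (rule function_algebraD(1)[OF product_functions_algebra])
    then have "{p \<in> points X \<times> points Y. (\<lambda>_. 1) p \<noteq> (0::complex)} \<in> ?S"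
      by (intro CollectI exI[of _ "points X"] exI[of _ "points Y"] exI[of _ "\<lambda>_. 1"]) simp
    then show "points X \<times> points Y \<subseteq> \<Union>?S" by auto
  qed
  finally show ?thesis .
qed

lemma regular_fproductI:
  assumes "\<And>p. p \<in> W \<Longrightarrow> \<exists>U V f g. openin (zariski_top X) U \<and> openin (zariski_top Y) V \<and>
    p \<in> U \<times> V \<and> f \<in> product_functions X Y U V \<and> g \<in> product_functions X Y U V \<and> g p \<noteq> 0 \<and>
    (\<forall>q \<in> W \<inter> U \<times> V. g q \<noteq> 0 \<longrightarrow> h q = f q / g q)"
  shows "h \<in> regular (fproduct X Y) W"
  unfolding fproduct_def fspace.sel
proof (intro CollectI ballI)
  fix p assume "p \<in> W"
  from assms[OF this] obtain U V f g where *: "openin (zariski_top X) U" "openin (zariski_top Y) V"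
    "p \<in> U \<times> V" "f \<in> product_functions X Y U V" "g \<in> product_functions X Y U V" "g p \<noteq> 0"
    "\<forall>q \<in> W \<inter> U \<times> V. g q \<noteq> 0 \<longrightarrow> h q = f q / g q"
    by (elim exE conjE) (rule that)
  show "\<exists>U V. openin (zariski_top X) U \<and> openin (zariski_top Y) V \<and> p \<in> U \<times> V \<and>
      (\<exists>f\<in>product_functions X Y U V. \<exists>g\<in>product_functions X Y U V. g p \<noteq> 0 \<and>
        (\<forall>q\<in>W \<inter> U \<times> V. g q \<noteq> 0 \<longrightarrow> h q = f q / g q))"
    by (intro exI[of _ U] exI[of _ V] conjI bexI[of _ f] bexI[of _ g]) (fact *)+
qed

lemma regular_fproductE:
  assumes "h \<in> regular (fproduct X Y) W" "p \<in> W"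
  obtains U V f g where "openin (zariski_top X) U" "openin (zariski_top Y) V"
    "p \<in> U \<times> V" "f \<in> product_functions X Y U V" "g \<in> product_functions X Y U V" "g p \<noteq> 0"
    "\<forall>q \<in> W \<inter> U \<times> V. g q \<noteq> 0 \<longrightarrow> h q = f q / g q"
proof -
  have "\<forall>p\<in>W. \<exists>U V. openin (zariski_top X) U \<and> openin (zariski_top Y) V \<and> p \<in> U \<times> V \<and>
      (\<exists>f\<in>product_functions X Y U V. \<exists>g\<in>product_functions X Y U V. g p \<noteq> 0 \<and>
        (\<forall>q\<in>W \<inter> U \<times> V. g q \<noteq> 0 \<longrightarrow> h q = f q / g q))"
    using assms(1) unfolding fproduct_def fspace.sel mem_Collect_eq .
  from bspec[OF this assms(2)] obtain U V f g where "openin (zariski_top X) U" "openin (zariski_top Y) V"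
    "p \<in> U \<times> V" "f \<in> product_functions X Y U V" "g \<in> product_functions X Y U V" "g p \<noteq> 0"
    "\<forall>q\<in>W \<inter> U \<times> V. g q \<noteq> 0 \<longrightarrow> h q = f q / g q"
    by (elim exE conjE bexE)
  then show thesis using that by blast
qed

text \<open>Brings two local fractions onto a common rectangle, as sums and products of regular
  functions require.\<close>

lemma regular_fproductE2:
  assumes X: "fun_space X" and Y: "fun_space Y"
    and h: "h \<in> regular (fproduct X Y) W" "h' \<in> regular (fproduct X Y) W" "p \<in> W"
  obtains U V f g f' g' where "openin (zariski_top X) U" "openin (zariski_top Y) V"
    "p \<in> U \<times> V" "f \<in> product_functions X Y U V" "g \<in> product_functions X Y U V" "g p \<noteq> 0"
    "\<forall>q \<in> W \<inter> U \<times> V. g q \<noteq> 0 \<longrightarrow> h q = f q / g q"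
    "f' \<in> product_functions X Y U V" "g' \<in> product_functions X Y U V" "g' p \<noteq> 0"
    "\<forall>q \<in> W \<inter> U \<times> V. g' q \<noteq> 0 \<longrightarrow> h' q = f' q / g' q"
proof -
  obtain U V f g where 1: "openin (zariski_top X) U" "openin (zariski_top Y) V"
    "p \<in> U \<times> V" "f \<in> product_functions X Y U V" "g \<in> product_functions X Y U V" "g p \<noteq> 0"
    "\<forall>q \<in> W \<inter> U \<times> V. g q \<noteq> 0 \<longrightarrow> h q = f q / g q"
    by (rule regular_fproductE[OF h(1,3)])
  obtain U' V' f' g' where 2: "openin (zariski_top X) U'" "openin (zariski_top Y) V'"
    "p \<in> U' \<times> V'" "f' \<in> product_functions X Y U' V'" "g' \<in> product_functions X Y U' V'" "g' p \<noteq> 0"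
    "\<forall>q \<in> W \<inter> U' \<times> V'. g' q \<noteq> 0 \<longrightarrow> h' q = f' q / g' q"
    by (rule regular_fproductE[OF h(2,3)])
  have o: "openin (zariski_top X) (U \<inter> U')" "openin (zariski_top Y) (V \<inter> V')"
    using 1 2 by blast+
  note r1 = product_functions_restrict[OF X Y 1(1) o(1) _ 1(2) o(2)]
  note r2 = product_functions_restrict[OF X Y 2(1) o(1) _ 2(2) o(2)]
  show thesis
    by (rule that[OF o _ r1[OF _ _ 1(4)] r1[OF _ _ 1(5)] 1(6) _ r2[OF _ _ 2(4)] r2[OF _ _ 2(5)] 2(6)])
      (use 1(3,7) 2(3,7) in auto)
qed

lemma fun_space_fproduct:
  assumes X: "fun_space X" and Y: "fun_space Y"
  shows "fun_space (fproduct X Y)"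
  unfolding fun_space_def
proof (intro conjI allI impI)
  let ?P = "fproduct X Y"
  show "sheaf_condition ?P"
    unfolding sheaf_condition_def
  proof (intro allI impI)
    fix W h
    assume *: "openin (zariski_top ?P) W \<and>
      (\<forall>x\<in>W. \<exists>V g. openin (zariski_top ?P) V \<and> x \<in> V \<and> g \<in> regular ?P V \<and> (\<forall>y\<in>W \<inter> V. h y = g y))"
    show "h \<in> regular ?P W"
    proof (rule regular_fproductI)
      fix p assume p: "p \<in> W"
      with * obtain W' k where W': "openin (zariski_top ?P) W'" "p \<in> W'" "k \<in> regular ?P W'"
        "\<forall>y\<in>W \<inter> W'. h y = k y" by blast
      obtain U V f g where 1: "openin (zariski_top X) U" "openin (zariski_top Y) V"
        "p \<in> U \<times> V" "f \<in> product_functions X Y U V" "g \<in> product_functions X Y U V" "g p \<noteq> 0"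
        "\<forall>q \<in> W' \<inter> U \<times> V. g q \<noteq> 0 \<longrightarrow> k q = f q / g q"
        by (rule regular_fproductE[OF W'(3,2)])
      obtain U' V' r where 2: "openin (zariski_top X) U'" "openin (zariski_top Y) V'"
        "r \<in> product_functions X Y U' V'" "p \<in> U' \<times> V'" "r p \<noteq> 0" "{q \<in> U' \<times> V'. r q \<noteq> 0} \<subseteq> W'"
        by (rule openin_fproductE[OF X Y W'(1,2)])
      have o: "openin (zariski_top X) (U \<inter> U')" "openin (zariski_top Y) (V \<inter> V')"
        using 1 2 by blast+
      have f: "f \<in> product_functions X Y (U \<inter> U') (V \<inter> V')"
        by (rule product_functions_restrict[OF X Y _ o(1) _ _ o(2) _ 1(4)]) (use 1 2 in auto)
      have g: "g \<in> product_functions X Y (U \<inter> U') (V \<inter> V')"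
        by (rule product_functions_restrict[OF X Y _ o(1) _ _ o(2) _ 1(5)]) (use 1 2 in auto)
      have r: "r \<in> product_functions X Y (U \<inter> U') (V \<inter> V')"
        by (rule product_functions_restrict[OF X Y _ o(1) _ _ o(2) _ 2(3)]) (use 1 2 in auto)
      have fr: "(\<lambda>q. f q * r q) \<in> product_functions X Y (U \<inter> U') (V \<inter> V')"
        "(\<lambda>q. g q * r q) \<in> product_functions X Y (U \<inter> U') (V \<inter> V')"
        by (intro function_algebraD(2,3)[OF product_functions_algebra]; fact)+
      show "\<exists>U V f g. openin (zariski_top X) U \<and> openin (zariski_top Y) V \<and>
          p \<in> U \<times> V \<and> f \<in> product_functions X Y U V \<and> g \<in> product_functions X Y U V \<and> g p \<noteq> 0 \<and>
          (\<forall>q \<in> W \<inter> U \<times> V. g q \<noteq> 0 \<longrightarrow> h q = f q / g q)"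
        by (rule exI[of _ "U \<inter> U'"], rule exI[of _ "V \<inter> V'"], rule exI[of _ "\<lambda>q. f q * r q"],
            rule exI[of _ "\<lambda>q. g q * r q"]) (use o fr 1 2 W'(4) in auto)
    qed
  qed
next
  fix W assume W: "openin (zariski_top (fproduct X Y)) W"
  show "function_algebra (regular (fproduct X Y) W)"
  proof (rule function_algebraI)
    fix c
    show "(\<lambda>_. c) \<in> regular (fproduct X Y) W"
    proof (rule regular_fproductI)
      fix p assume "p \<in> W"
      then have p: "p \<in> points X \<times> points Y" using W openin_subset points_fproduct by blast
      show "\<exists>U V f g. openin (zariski_top X) U \<and> openin (zariski_top Y) V \<and>
          p \<in> U \<times> V \<and> f \<in> product_functions X Y U V \<and> g \<in> product_functions X Y U V \<and> g p \<noteq> 0 \<and>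
          (\<forall>q \<in> W \<inter> U \<times> V. g q \<noteq> 0 \<longrightarrow> c = f q / g q)"
        by (rule exI[of _ "points X"], rule exI[of _ "points Y"], rule exI[of _ "\<lambda>q. c"],
            rule exI[of _ "\<lambda>q. 1"])
          (use p function_algebraD(1)[OF product_functions_algebra] in auto)
    qed
  next
    fix h h' assume h: "h \<in> regular (fproduct X Y) W" "h' \<in> regular (fproduct X Y) W"
    show "(\<lambda>p. h p + h' p) \<in> regular (fproduct X Y) W"
    proof (rule regular_fproductI)
      fix p assume "p \<in> W"
      obtain U V f g f' g' where 1: "openin (zariski_top X) U" "openin (zariski_top Y) V"
        "p \<in> U \<times> V" "f \<in> product_functions X Y U V" "g \<in> product_functions X Y U V" "g p \<noteq> 0"
        "\<forall>q \<in> W \<inter> U \<times> V. g q \<noteq> 0 \<longrightarrow> h q = f q / g q"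
        "f' \<in> product_functions X Y U V" "g' \<in> product_functions X Y U V" "g' p \<noteq> 0"
        "\<forall>q \<in> W \<inter> U \<times> V. g' q \<noteq> 0 \<longrightarrow> h' q = f' q / g' q"
        by (rule regular_fproductE2[OF X Y h \<open>p \<in> W\<close>])
      have 2: "(\<lambda>q. f q * g' q + f' q * g q) \<in> product_functions X Y U V"
        "(\<lambda>q. g q * g' q) \<in> product_functions X Y U V"
        by (intro function_algebraD(2,3)[OF product_functions_algebra]; fact)+
      show "\<exists>U V f g. openin (zariski_top X) U \<and> openin (zariski_top Y) V \<and>
          p \<in> U \<times> V \<and> f \<in> product_functions X Y U V \<and> g \<in> product_functions X Y U V \<and> g p \<noteq> 0 \<and>
          (\<forall>q \<in> W \<inter> U \<times> V. g q \<noteq> 0 \<longrightarrow> h q + h' q = f q / g q)"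
        by (rule exI[of _ U], rule exI[of _ V], rule exI[of _ "\<lambda>q. f q * g' q + f' q * g q"],
            rule exI[of _ "\<lambda>q. g q * g' q"]) (use 1 2 in \<open>auto simp: field_simps\<close>)
    qed
    show "(\<lambda>p. h p * h' p) \<in> regular (fproduct X Y) W"
    proof (rule regular_fproductI)
      fix p assume "p \<in> W"
      obtain U V f g f' g' where 1: "openin (zariski_top X) U" "openin (zariski_top Y) V"
        "p \<in> U \<times> V" "f \<in> product_functions X Y U V" "g \<in> product_functions X Y U V" "g p \<noteq> 0"
        "\<forall>q \<in> W \<inter> U \<times> V. g q \<noteq> 0 \<longrightarrow> h q = f q / g q"
        "f' \<in> product_functions X Y U V" "g' \<in> product_functions X Y U V" "g' p \<noteq> 0"
        "\<forall>q \<in> W \<inter> U \<times> V. g' q \<noteq> 0 \<longrightarrow> h' q = f' q / g' q"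
        by (rule regular_fproductE2[OF X Y h \<open>p \<in> W\<close>])
      have 2: "(\<lambda>q. f q * f' q) \<in> product_functions X Y U V"
        "(\<lambda>q. g q * g' q) \<in> product_functions X Y U V"
        by (intro function_algebraD(2,3)[OF product_functions_algebra]; fact)+
      show "\<exists>U V f g. openin (zariski_top X) U \<and> openin (zariski_top Y) V \<and>
          p \<in> U \<times> V \<and> f \<in> product_functions X Y U V \<and> g \<in> product_functions X Y U V \<and> g p \<noteq> 0 \<and>
          (\<forall>q \<in> W \<inter> U \<times> V. g q \<noteq> 0 \<longrightarrow> h q * h' q = f q / g q)"
        by (rule exI[of _ U], rule exI[of _ V], rule exI[of _ "\<lambda>q. f q * f' q"],
            rule exI[of _ "\<lambda>q. g q * g' q"]) (use 1 2 in \<open>auto simp: field_simps\<close>)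
    qed
  qed
  show "\<forall>h\<in>regular (fproduct X Y) W. openin (zariski_top (fproduct X Y)) {x \<in> W. h x \<noteq> 0} \<and>
    (\<lambda>x. inverse (h x)) \<in> regular (fproduct X Y) {x \<in> W. h x \<noteq> 0}"
  proof (intro ballI conjI)
    fix h assume h: "h \<in> regular (fproduct X Y) W"
    show "openin (zariski_top (fproduct X Y)) {x \<in> W. h x \<noteq> 0}"
      unfolding openin_fproduct[OF X Y]
    proof
      fix p assume p: "p \<in> {x \<in> W. h x \<noteq> 0}"
      then have pW: "p \<in> W" by simp
      obtain U V f g where 1: "openin (zariski_top X) U" "openin (zariski_top Y) V"
        "p \<in> U \<times> V" "f \<in> product_functions X Y U V" "g \<in> product_functions X Y U V" "g p \<noteq> 0"
        "\<forall>q \<in> W \<inter> U \<times> V. g q \<noteq> 0 \<longrightarrow> h q = f q / g q"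
        by (rule regular_fproductE[OF h pW])
      obtain U' V' r where 2: "openin (zariski_top X) U'" "openin (zariski_top Y) V'"
        "r \<in> product_functions X Y U' V'" "p \<in> U' \<times> V'" "r p \<noteq> 0" "{q \<in> U' \<times> V'. r q \<noteq> 0} \<subseteq> W"
        by (rule openin_fproductE[OF X Y W pW])
      have o: "openin (zariski_top X) (U \<inter> U')" "openin (zariski_top Y) (V \<inter> V')"
        using 1 2 by blast+
      have f: "f \<in> product_functions X Y (U \<inter> U') (V \<inter> V')"
        by (rule product_functions_restrict[OF X Y _ o(1) _ _ o(2) _ 1(4)]) (use 1 2 in auto)
      have g: "g \<in> product_functions X Y (U \<inter> U') (V \<inter> V')"
        by (rule product_functions_restrict[OF X Y _ o(1) _ _ o(2) _ 1(5)]) (use 1 2 in auto)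
      have r: "r \<in> product_functions X Y (U \<inter> U') (V \<inter> V')"
        by (rule product_functions_restrict[OF X Y _ o(1) _ _ o(2) _ 2(3)]) (use 1 2 in auto)
      have fgr: "(\<lambda>q. f q * g q * r q) \<in> product_functions X Y (U \<inter> U') (V \<inter> V')"
        by (intro function_algebraD(2,3)[OF product_functions_algebra]; fact)+
      show "\<exists>U V f. openin (zariski_top X) U \<and>
        openin (zariski_top Y) V \<and> f \<in> product_functions X Y U V \<and> p \<in> U \<times> V \<and> f p \<noteq> 0 \<and>
        {q \<in> U \<times> V. f q \<noteq> 0} \<subseteq> {x \<in> W. h x \<noteq> 0}"
        by (rule exI[of _ "U \<inter> U'"], rule exI[of _ "V \<inter> V'"],
            rule exI[of _ "\<lambda>q. f q * g q * r q"]) (use o fgr 1 2 p in auto)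
    qed
    show "(\<lambda>x. inverse (h x)) \<in> regular (fproduct X Y) {x \<in> W. h x \<noteq> 0}"
    proof (rule regular_fproductI)
      fix p assume p: "p \<in> {x \<in> W. h x \<noteq> 0}"
      then have pW: "p \<in> W" by simp
      obtain U V f g where 1: "openin (zariski_top X) U" "openin (zariski_top Y) V"
        "p \<in> U \<times> V" "f \<in> product_functions X Y U V" "g \<in> product_functions X Y U V" "g p \<noteq> 0"
        "\<forall>q \<in> W \<inter> U \<times> V. g q \<noteq> 0 \<longrightarrow> h q = f q / g q"
        by (rule regular_fproductE[OF h pW])
      have 2: "(\<lambda>q. g q * g q) \<in> product_functions X Y U V"
        "(\<lambda>q. f q * g q) \<in> product_functions X Y U V"
        by (intro function_algebraD(2,3)[OF product_functions_algebra]; fact)+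
      show "\<exists>U V f g. openin (zariski_top X) U \<and> openin (zariski_top Y) V \<and>
          p \<in> U \<times> V \<and> f \<in> product_functions X Y U V \<and> g \<in> product_functions X Y U V \<and> g p \<noteq> 0 \<and>
          (\<forall>q \<in> {x \<in> W. h x \<noteq> 0} \<inter> U \<times> V. g q \<noteq> 0 \<longrightarrow> inverse (h q) = f q / g q)"
        by (rule exI[of _ U], rule exI[of _ V], rule exI[of _ "\<lambda>q. g q * g q"],
            rule exI[of _ "\<lambda>q. f q * g q"]) (use 1 2 p in auto)
    qed
  qed
qed

section \<open>Morphisms and global regular functions\<close>

lemma zariski_top_induced: "zariski_top (induced X A) = subtopology (zariski_top X) A"
  by (simp add: induced_def)

lemma morphism_preimage_open:
  "morphism X Y \<phi> \<Longrightarrow> openin (zariski_top Y) V \<Longrightarrow> openin (zariski_top X) {x \<in> points X. \<phi> x \<in> V}"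
  by (rule openin_continuous_map_preimage[OF morphism_continuous])

text \<open>The values off \<open>points X\<close> are irrelevant because in a
  \<open>fun_space\<close> a regular function may be altered outside its open set.\<close>

lemma morphism_cong:
  assumes X: "fun_space X" and \<phi>: "morphism X Y \<phi>" and eq: "\<And>x. x \<in> points X \<Longrightarrow> \<psi> x = \<phi> x"
  shows "morphism X Y \<psi>"
  unfolding morphism_def
proof (intro conjI allI impI)
  show "continuous_map (zariski_top X) (zariski_top Y) \<psi>"
    using continuous_map_eq[OF morphism_continuous[OF \<phi>]] eq by metis
  fix V f assume V: "openin (zariski_top Y) V \<and> f \<in> regular Y V"
  have *: "{x \<in> points X. \<psi> x \<in> V} = {x \<in> points X. \<phi> x \<in> V}" using eq by auto
  show "f \<circ> \<psi> \<in> regular X {x \<in> points X. \<psi> x \<in> V}"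
    unfolding *
    by (rule regular_cong[OF X morphism_preimage_open[OF \<phi>] morphism_regular[OF \<phi>, of V f]])
      (use V eq in auto)
qed

lemma morphism_comp: "morphism X Y \<phi> \<Longrightarrow> morphism Y Z \<psi> \<Longrightarrow> morphism X Z (\<lambda>x. \<psi> (\<phi> x))"
  using morphism_compose[of X Y \<phi> Z \<psi>] by (simp add: comp_def)

lemma morphism_induced: "morphism (induced X A) X (\<lambda>x. x)"
  unfolding morphism_def
proof (intro conjI allI impI)
  show "continuous_map (zariski_top (induced X A)) (zariski_top X) (\<lambda>x. x)"
    unfolding zariski_top_induced by (rule continuous_map_from_subtopology) simp
  fix V f assume V: "openin (zariski_top X) V \<and> f \<in> regular X V"
  have "f \<in> regular (induced X A) {x \<in> points (induced X A). x \<in> V}"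
    by (rule regular_inducedI[of X V]) (use V in auto)
  then show "f \<circ> (\<lambda>x. x) \<in> regular (induced X A) {x \<in> points (induced X A). x \<in> V}"
    by (simp add: comp_def)
qed

lemma morphism_restrict: "morphism X Y \<phi> \<Longrightarrow> morphism (induced X A) Y \<phi>"
  using morphism_comp[OF morphism_induced] .

text \<open>Universal property of the induced structure. A function on the subset extends to
  \<open>Y\<close> only locally; the pullbacks of the local extensions are glued by the sheaf
  condition on \<open>Z\<close>.\<close>

lemma morphism_into_induced:
  assumes Z: "fun_space Z" and \<phi>: "morphism Z Y \<phi>" and A: "\<And>z. z \<in> points Z \<Longrightarrow> \<phi> z \<in> A"
  shows "morphism Z (induced Y A) \<phi>"
  unfolding morphism_def
proof (intro conjI allI impI)
  show c: "continuous_map (zariski_top Z) (zariski_top (induced Y A)) \<phi>"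
    unfolding zariski_top_induced continuous_map_in_subtopology
    using morphism_continuous[OF \<phi>] A by auto
  fix V f assume V: "openin (zariski_top (induced Y A)) V \<and> f \<in> regular (induced Y A) V"
  show "f \<circ> \<phi> \<in> regular Z {z \<in> points Z. \<phi> z \<in> V}"
  proof (rule fun_space_sheaf[OF Z])
    show "openin (zariski_top Z) {z \<in> points Z. \<phi> z \<in> V}"
      using openin_continuous_map_preimage[OF c] V by blast
    fix z assume z: "z \<in> {z \<in> points Z. \<phi> z \<in> V}"
    have "\<forall>y\<in>V. \<exists>N g. openin (zariski_top Y) N \<and> y \<in> N \<and> g \<in> regular Y N \<and> (\<forall>x\<in>V \<inter> N. f x = g x)"
      using V unfolding regular_induced by blast
    from bspec[OF this, of "\<phi> z"] z
    obtain N g where N: "openin (zariski_top Y) N" "\<phi> z \<in> N" "g \<in> regular Y N"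
      "\<forall>x\<in>V \<inter> N. f x = g x" by auto
    show "\<exists>W h. openin (zariski_top Z) W \<and> z \<in> W \<and> h \<in> regular Z W \<and>
        (\<forall>y\<in>{z \<in> points Z. \<phi> z \<in> V} \<inter> W. (f \<circ> \<phi>) y = h y)"
      by (rule exI[of _ "{z \<in> points Z. \<phi> z \<in> N}"], rule exI[of _ "g \<circ> \<phi>"])
        (use N z morphism_preimage_open[OF \<phi> N(1)] morphism_regular[OF \<phi> N(1,3)] in auto)
  qed
qed

lemma gfun_const: "fun_space X \<Longrightarrow> (\<lambda>_. c) \<in> gfun X"
  unfolding gfun_def by (rule function_algebraD(1)[OF fun_space_algebra[OF _ openin_topspace]])

lemma gfun_add: "fun_space X \<Longrightarrow> f \<in> gfun X \<Longrightarrow> g \<in> gfun X \<Longrightarrow> (\<lambda>x. f x + g x) \<in> gfun X"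
  unfolding gfun_def by (rule function_algebraD(2)[OF fun_space_algebra[OF _ openin_topspace]])

lemma gfun_mult: "fun_space X \<Longrightarrow> f \<in> gfun X \<Longrightarrow> g \<in> gfun X \<Longrightarrow> (\<lambda>x. f x * g x) \<in> gfun X"
  unfolding gfun_def by (rule function_algebraD(3)[OF fun_space_algebra[OF _ openin_topspace]])

lemma gfun_uminus: "fun_space X \<Longrightarrow> f \<in> gfun X \<Longrightarrow> (\<lambda>x. - f x) \<in> gfun X"
  using gfun_mult[OF _ gfun_const[of X "- 1"], of f] by simp

lemma gfun_diff: "fun_space X \<Longrightarrow> f \<in> gfun X \<Longrightarrow> g \<in> gfun X \<Longrightarrow> (\<lambda>x. f x - g x) \<in> gfun X"
  using gfun_add[OF _ _ gfun_uminus[of X g], of f] by simp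

lemma gfun_sum:
  assumes "fun_space X" "\<And>i. i \<in> I \<Longrightarrow> f i \<in> gfun X"
  shows "(\<lambda>x. \<Sum>i\<in>I. f i x) \<in> gfun X"
  using assms(2)
proof (induction I rule: infinite_finite_induct)
  case (insert i I)
  then have "(\<lambda>x. f i x + (\<Sum>i\<in>I. f i x)) \<in> gfun X"
    by (intro gfun_add[OF assms(1)]) auto
  then show ?case using insert by simp
qed (simp_all add: gfun_const[OF assms(1)])

lemma gfun_prod:
  assumes "fun_space X" "\<And>i. i \<in> I \<Longrightarrow> f i \<in> gfun X"
  shows "(\<lambda>x. \<Prod>i\<in>I. f i x) \<in> gfun X"
  using assms(2)
proof (induction I rule: infinite_finite_induct)
  case (insert i I)
  then have "(\<lambda>x. f i x * (\<Prod>i\<in>I. f i x)) \<in> gfun X"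
    by (intro gfun_mult[OF assms(1)]) auto
  then show ?case using insert by simp
qed (simp_all add: gfun_const[OF assms(1)])

lemma gfun_inverse:
  assumes "fun_space X" "f \<in> gfun X" "\<And>x. x \<in> points X \<Longrightarrow> f x \<noteq> 0"
  shows "(\<lambda>x. inverse (f x)) \<in> gfun X"
proof -
  have "{x \<in> points X. f x \<noteq> 0} = points X" using assms(3) by auto
  then show ?thesis using fun_space_inverse[OF assms(1) openin_topspace assms(2)[unfolded gfun_def]]
    by (simp add: gfun_def)
qed

lemma gfun_divide:
  assumes "fun_space X" "f \<in> gfun X" "g \<in> gfun X" "\<And>x. x \<in> points X \<Longrightarrow> g x \<noteq> 0"
  shows "(\<lambda>x. f x / g x) \<in> gfun X"
  unfolding divide_inverse by (intro gfun_mult gfun_inverse assms)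

lemma gfun_cong:
  "fun_space X \<Longrightarrow> f \<in> gfun X \<Longrightarrow> (\<And>x. x \<in> points X \<Longrightarrow> g x = f x) \<Longrightarrow> g \<in> gfun X"
  unfolding gfun_def by (rule regular_cong[OF _ openin_topspace])

lemma gfun_pullback:
  assumes "morphism X Y \<phi>" "f \<in> gfun Y"
  shows "(\<lambda>x. f (\<phi> x)) \<in> gfun X"
proof -
  have "{x \<in> points X. \<phi> x \<in> points Y} = points X"
    using morphism_points[OF assms(1)] by auto
  then show ?thesis
    using morphism_regular[OF assms(1) openin_topspace assms(2)[unfolded gfun_def]]
    by (simp add: comp_def gfun_def)
qed

lemma gfun_induced: "f \<in> gfun X \<Longrightarrow> f \<in> gfun (induced X A)"
  using gfun_pullback[OF morphism_induced] .

lemma gfun_induced_subset: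
  assumes X: "fun_space X" and f: "f \<in> gfun (induced X A)" and "B \<subseteq> A"
  shows "f \<in> gfun (induced X B)"
proof -
  have "morphism (induced X B) (induced X A) (\<lambda>x. x)"
    by (rule morphism_into_induced[OF fun_space_induced[OF X] morphism_induced])
      (use assms(3) in auto)
  from gfun_pullback[OF this f] show ?thesis .
qed

lemma closedin_zero:
  assumes X: "fun_space X" and f: "f \<in> gfun X"
  shows "closedin (zariski_top X) {x \<in> points X. f x = 0}"
proof -
  have "points X - {x \<in> points X. f x = 0} = {x \<in> points X. f x \<noteq> 0}" by auto
  then show ?thesis
    unfolding closedin_def using fun_space_nonzero_open[OF X openin_topspace f[unfolded gfun_def]] by auto
qed

lemma closedin_zeros:
  assumes X: "fun_space X" and F: "F \<subseteq> gfun X"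
  shows "closedin (zariski_top X) {x \<in> points X. \<forall>f\<in>F. f x = 0}"
\<comment> \<open>The intersection of an empty family would be the whole type and not
  \<open>points X\<close>.\<close>
proof (cases "F = {}")
  case False
  have "{x \<in> points X. \<forall>f\<in>F. f x = 0} = (\<Inter>f\<in>F. {x \<in> points X. f x = 0})"
    using False by auto
  then show ?thesis
    using closedin_zero[OF X] F False by (metis (no_types, lifting) closedin_INT subset_eq)
qed auto

section \<open>Universal properties and standard isomorphisms\<close>

lemma morphism_fst: "morphism (fproduct X Y) X fst"
  unfolding morphism_def
proof (intro conjI allI impI)
  have *: "{p \<in> points (fproduct X Y). fst p \<in> V} = V \<times> points Y"
    if "openin (zariski_top X) V" for V
    using openin_subset[OF that] by auto
  have o: "openin (zariski_top (fproduct X Y)) (V \<times> points Y)" if "openin (zariski_top X) V" for V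
  proof -
    have "V \<times> points Y = {p \<in> V \<times> points Y. (\<lambda>_. 1) p \<noteq> (0::complex)}" by auto
    moreover have "openin (zariski_top (fproduct X Y)) \<dots>"
      unfolding fproduct_def fspace.sel
      by (rule topology_generated_by_Basis, intro CollectI exI[of _ V] exI[of _ "points Y"] exI[of _ "\<lambda>_. 1"])
        (simp add: that function_algebraD(1)[OF product_functions_algebra])
    ultimately show ?thesis by simp
  qed
  show "continuous_map (zariski_top (fproduct X Y)) (zariski_top X) fst"
    unfolding continuous_map_def using * o by auto
  fix V f assume V: "openin (zariski_top X) V \<and> f \<in> regular X V"
  then have "{p \<in> points (fproduct X Y). fst p \<in> V} = V \<times> points Y" using * by blast
  moreover have "f \<circ> fst \<in> regular (fproduct X Y) (V \<times> points Y)"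
  proof (rule regular_fproductI)
    fix p assume p: "p \<in> V \<times> points Y"
    show "\<exists>U V' f' g. openin (zariski_top X) U \<and> openin (zariski_top Y) V' \<and>
      p \<in> U \<times> V' \<and> f' \<in> product_functions X Y U V' \<and> g \<in> product_functions X Y U V' \<and> g p \<noteq> 0 \<and>
      (\<forall>q\<in>V \<times> points Y \<inter> U \<times> V'. g q \<noteq> 0 \<longrightarrow> (f \<circ> fst) q = f' q / g q)"
      by (rule exI[of _ V], rule exI[of _ "points Y"], rule exI[of _ "\<lambda>p. f (fst p)"],
          rule exI[of _ "\<lambda>_. 1"])
        (use p V product_functions_fst[of f X V] function_algebraD(1)[OF product_functions_algebra]
          in auto)
  qed
  ultimately show "f \<circ> fst \<in> regular (fproduct X Y) {p \<in> points (fproduct X Y). fst p \<in> V}"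
    by simp
qed

lemma morphism_snd: "morphism (fproduct X Y) Y snd"
  unfolding morphism_def
proof (intro conjI allI impI)
  have *: "{p \<in> points (fproduct X Y). snd p \<in> V} = points X \<times> V"
    if "openin (zariski_top Y) V" for V
    using openin_subset[OF that] by auto
  have o: "openin (zariski_top (fproduct X Y)) (points X \<times> V)" if "openin (zariski_top Y) V" for V
  proof -
    have "points X \<times> V = {p \<in> points X \<times> V. (\<lambda>_. 1) p \<noteq> (0::complex)}" by auto
    moreover have "openin (zariski_top (fproduct X Y)) \<dots>"
      unfolding fproduct_def fspace.sel
      by (rule topology_generated_by_Basis, intro CollectI exI[of _ "points X"] exI[of _ V] exI[of _ "\<lambda>_. 1"])
        (simp add: that function_algebraD(1)[OF product_functions_algebra])
    ultimately show ?thesis by simp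
  qed
  show "continuous_map (zariski_top (fproduct X Y)) (zariski_top Y) snd"
    unfolding continuous_map_def using * o by auto
  fix V f assume V: "openin (zariski_top Y) V \<and> f \<in> regular Y V"
  then have "{p \<in> points (fproduct X Y). snd p \<in> V} = points X \<times> V" using * by blast
  moreover have "f \<circ> snd \<in> regular (fproduct X Y) (points X \<times> V)"
  proof (rule regular_fproductI)
    fix p assume p: "p \<in> points X \<times> V"
    show "\<exists>U V' f' g. openin (zariski_top X) U \<and> openin (zariski_top Y) V' \<and>
      p \<in> U \<times> V' \<and> f' \<in> product_functions X Y U V' \<and> g \<in> product_functions X Y U V' \<and> g p \<noteq> 0 \<and>
      (\<forall>q\<in>points X \<times> V \<inter> U \<times> V'. g q \<noteq> 0 \<longrightarrow> (f \<circ> snd) q = f' q / g q)"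
      by (rule exI[of _ "points X"], rule exI[of _ V], rule exI[of _ "\<lambda>p. f (snd p)"],
          rule exI[of _ "\<lambda>_. 1"])
        (use p V product_functions_snd[of f Y V] function_algebraD(1)[OF product_functions_algebra]
          in auto)
  qed
  ultimately show "f \<circ> snd \<in> regular (fproduct X Y) {p \<in> points (fproduct X Y). snd p \<in> V}"
    by simp
qed

lemma product_functions_pullback:
  assumes Z: "fun_space Z" and \<alpha>: "morphism Z X \<alpha>" and \<beta>: "morphism Z Y \<beta>"
    and U: "openin (zariski_top X) U" and V: "openin (zariski_top Y) V"
    and f: "f \<in> product_functions X Y U V"
  shows "(\<lambda>z. f (\<alpha> z, \<beta> z)) \<in> regular Z ({z \<in> points Z. \<alpha> z \<in> U} \<inter> {z \<in> points Z. \<beta> z \<in> V})"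
proof -
  let ?W = "{z \<in> points Z. \<alpha> z \<in> U} \<inter> {z \<in> points Z. \<beta> z \<in> V}"
  have o: "openin (zariski_top Z) ?W"
    using morphism_preimage_open[OF \<alpha> U] morphism_preimage_open[OF \<beta> V] by blast
  show ?thesis
    using f unfolding product_functions_def
  proof induction
    case (generator f)
    then consider g where "g \<in> regular X U" "f = (\<lambda>p. g (fst p))"
      | g where "g \<in> regular Y V" "f = (\<lambda>p. g (snd p))" by blast
    then show ?case
    proof cases
      case 1
      have "g \<circ> \<alpha> \<in> regular Z ?W"
        by (rule regular_restrict[OF Z morphism_preimage_open[OF \<alpha> U] o _
            morphism_regular[OF \<alpha> U 1(1)]]) auto
      then show ?thesis using 1 by (simp add: comp_def)
    next
      case 2
      have "g \<circ> \<beta> \<in> regular Z ?W"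
        by (rule regular_restrict[OF Z morphism_preimage_open[OF \<beta> V] o _
            morphism_regular[OF \<beta> V 2(1)]]) auto
      then show ?thesis using 2 by (simp add: comp_def)
    qed
  next
    case (const c)
    show ?case by (rule function_algebraD(1)[OF fun_space_algebra[OF Z o]])
  next
    case (add f g)
    then show ?case by (intro function_algebraD(2)[OF fun_space_algebra[OF Z o]])
  next
    case (mult f g)
    then show ?case by (intro function_algebraD(3)[OF fun_space_algebra[OF Z o]])
  qed
qed

text \<open>Universal property of the product: basic open sets and local fractions are both made of
  \<open>product_functions\<close>, whose pullbacks are regular.\<close>

lemma morphism_pair:
  assumes X: "fun_space X" and Y: "fun_space Y" and Z: "fun_space Z"
    and \<alpha>: "morphism Z X \<alpha>" and \<beta>: "morphism Z Y \<beta>"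
  shows "morphism Z (fproduct X Y) (\<lambda>z. (\<alpha> z, \<beta> z))"
proof -
  let ?W = "\<lambda>U V. {z \<in> points Z. \<alpha> z \<in> U} \<inter> {z \<in> points Z. \<beta> z \<in> V}"
  have oW: "openin (zariski_top Z) (?W U V)"
    if "openin (zariski_top X) U" "openin (zariski_top Y) V" for U V
    using morphism_preimage_open[OF \<alpha> that(1)] morphism_preimage_open[OF \<beta> that(2)] by blast
  have c: "openin (zariski_top Z) {z \<in> points Z. (\<alpha> z, \<beta> z) \<in> W}"
    if W: "openin (zariski_top (fproduct X Y)) W" for W
  proof (subst openin_subopen, intro ballI)
    fix z assume z: "z \<in> {z \<in> points Z. (\<alpha> z, \<beta> z) \<in> W}"
    then have zW: "(\<alpha> z, \<beta> z) \<in> W" by simp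
    obtain U V f where 1: "openin (zariski_top X) U" "openin (zariski_top Y) V"
      "f \<in> product_functions X Y U V" "(\<alpha> z, \<beta> z) \<in> U \<times> V" "f (\<alpha> z, \<beta> z) \<noteq> 0"
      "{q \<in> U \<times> V. f q \<noteq> 0} \<subseteq> W"
      by (rule openin_fproductE[OF X Y W zW])
    have "openin (zariski_top Z) {z \<in> ?W U V. f (\<alpha> z, \<beta> z) \<noteq> 0}"
      by (rule fun_space_nonzero_open[OF Z oW[OF 1(1,2)]
          product_functions_pullback[OF Z \<alpha> \<beta> 1(1,2,3)]])
    then show "\<exists>T. openin (zariski_top Z) T \<and> z \<in> T \<and> T \<subseteq> {z \<in> points Z. (\<alpha> z, \<beta> z) \<in> W}"
      by (rule_tac exI) (use 1 z in auto)
  qed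
  show ?thesis
    unfolding morphism_def
  proof (intro conjI allI impI)
    show "continuous_map (zariski_top Z) (zariski_top (fproduct X Y)) (\<lambda>z. (\<alpha> z, \<beta> z))"
      unfolding continuous_map_def
      using c morphism_points[OF \<alpha>] morphism_points[OF \<beta>] by auto
    fix W h assume W: "openin (zariski_top (fproduct X Y)) W \<and> h \<in> regular (fproduct X Y) W"
    show "h \<circ> (\<lambda>z. (\<alpha> z, \<beta> z)) \<in> regular Z {z \<in> points Z. (\<alpha> z, \<beta> z) \<in> W}"
    proof (rule fun_space_sheaf[OF Z])
      show "openin (zariski_top Z) {z \<in> points Z. (\<alpha> z, \<beta> z) \<in> W}" using c W by blast
      fix z assume z: "z \<in> {z \<in> points Z. (\<alpha> z, \<beta> z) \<in> W}"
      then have zW: "(\<alpha> z, \<beta> z) \<in> W" by simp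
      obtain U V f g where 1: "openin (zariski_top X) U" "openin (zariski_top Y) V"
        "(\<alpha> z, \<beta> z) \<in> U \<times> V" "f \<in> product_functions X Y U V" "g \<in> product_functions X Y U V"
        "g (\<alpha> z, \<beta> z) \<noteq> 0" "\<forall>q \<in> W \<inter> U \<times> V. g q \<noteq> 0 \<longrightarrow> h q = f q / g q"
        by (rule regular_fproductE[OF conjunct2[OF W] zW])
      let ?T = "{z \<in> ?W U V. g (\<alpha> z, \<beta> z) \<noteq> 0}"
      have oT: "openin (zariski_top Z) ?T"
        by (rule fun_space_nonzero_open[OF Z oW[OF 1(1,2)]
            product_functions_pullback[OF Z \<alpha> \<beta> 1(1,2,5)]])
      have "(\<lambda>z. inverse (g (\<alpha> z, \<beta> z))) \<in> regular Z ?T"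
        by (rule fun_space_inverse[OF Z oW[OF 1(1,2)]
            product_functions_pullback[OF Z \<alpha> \<beta> 1(1,2,5)]])
      moreover have "(\<lambda>z. f (\<alpha> z, \<beta> z)) \<in> regular Z ?T"
        by (rule regular_restrict[OF Z oW[OF 1(1,2)] oT _
            product_functions_pullback[OF Z \<alpha> \<beta> 1(1,2,4)]]) auto
      ultimately have "(\<lambda>z. f (\<alpha> z, \<beta> z) * inverse (g (\<alpha> z, \<beta> z))) \<in> regular Z ?T"
        by (intro function_algebraD(3)[OF fun_space_algebra[OF Z oT]])
      then show "\<exists>V k. openin (zariski_top Z) V \<and> z \<in> V \<and> k \<in> regular Z V \<and>
          (\<forall>y\<in>{z \<in> points Z. (\<alpha> z, \<beta> z) \<in> W} \<inter> V. (h \<circ> (\<lambda>z. (\<alpha> z, \<beta> z))) y = k y)"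
        by (intro exI[of _ ?T] exI[of _ "\<lambda>z. f (\<alpha> z, \<beta> z) * inverse (g (\<alpha> z, \<beta> z))"])
          (use oT 1 z in \<open>auto simp: divide_inverse\<close>)
    qed
  qed
qed

text \<open>Pullback commutes with sums, products and quotients, so continuity and regularity need
  testing only on generators of the algebra. Maps into affine spaces and frame spaces are verified
  in this way, coordinate by coordinate.\<close>

lemma morphism_zariski:
  assumes Z: "fun_space Z" and M: "\<And>z. z \<in> points Z \<Longrightarrow> \<phi> z \<in> M"
    and S: "\<And>s. s \<in> S \<Longrightarrow> (\<lambda>z. s (\<phi> z)) \<in> gfun Z"
  shows "morphism Z (zariski M (algebra_generated S)) \<phi>"
proof -
  let ?A = "algebra_generated S"
  note A = function_algebra_generated[of S]
  have f: "(\<lambda>z. f (\<phi> z)) \<in> gfun Z" if "f \<in> ?A" for f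
    using that by induction (auto intro: S gfun_const[OF Z] gfun_add[OF Z] gfun_mult[OF Z])
  have o: "openin (zariski_top Z) {z \<in> points Z. f (\<phi> z) \<noteq> 0}" if "f \<in> ?A" for f
    using fun_space_nonzero_open[OF Z openin_topspace f[OF that, unfolded gfun_def]] .
  have c: "openin (zariski_top Z) {z \<in> points Z. \<phi> z \<in> U}"
    if U: "openin (zariski_top (zariski M ?A)) U" for U
  proof (subst openin_subopen, intro ballI)
    fix z assume z: "z \<in> {z \<in> points Z. \<phi> z \<in> U}"
    then obtain g where g: "g \<in> ?A" "g (\<phi> z) \<noteq> 0" "\<forall>y\<in>M. g y \<noteq> 0 \<longrightarrow> y \<in> U"
      using U unfolding openin_zariski[OF A] by blast
    show "\<exists>T. openin (zariski_top Z) T \<and> z \<in> T \<and> T \<subseteq> {z \<in> points Z. \<phi> z \<in> U}"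
      by (rule exI[of _ "{z \<in> points Z. g (\<phi> z) \<noteq> 0}"]) (use g z o[OF g(1)] M in auto)
  qed
  show ?thesis
    unfolding morphism_def
  proof (intro conjI allI impI)
    show "continuous_map (zariski_top Z) (zariski_top (zariski M ?A)) \<phi>"
      unfolding continuous_map_def points_zariski[OF A] using c M by auto
    fix U h assume U: "openin (zariski_top (zariski M ?A)) U \<and> h \<in> regular (zariski M ?A) U"
    show "h \<circ> \<phi> \<in> regular Z {z \<in> points Z. \<phi> z \<in> U}"
    proof (rule fun_space_sheaf[OF Z])
      show oU: "openin (zariski_top Z) {z \<in> points Z. \<phi> z \<in> U}" using c U by blast
      fix z assume z: "z \<in> {z \<in> points Z. \<phi> z \<in> U}"
      then obtain p q where pq: "p \<in> ?A" "q \<in> ?A" "q (\<phi> z) \<noteq> 0"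
          "\<forall>y\<in>U. q y \<noteq> 0 \<longrightarrow> h y = p y / q y"
        using U unfolding regular_zariski by blast
      let ?T = "{z \<in> points Z. q (\<phi> z) \<noteq> 0}"
      have "(\<lambda>z. inverse (q (\<phi> z))) \<in> regular Z ?T"
        by (rule fun_space_inverse[OF Z openin_topspace f[OF pq(2), unfolded gfun_def]])
      moreover have "(\<lambda>z. p (\<phi> z)) \<in> regular Z ?T"
        by (rule regular_restrict[OF Z openin_topspace o[OF pq(2)] _ f[OF pq(1), unfolded gfun_def]]) auto
      ultimately have "(\<lambda>z. p (\<phi> z) * inverse (q (\<phi> z))) \<in> regular Z ?T"
        by (intro function_algebraD(3)[OF fun_space_algebra[OF Z o[OF pq(2)]]])
      then show "\<exists>V k. openin (zariski_top Z) V \<and> z \<in> V \<and> k \<in> regular Z V \<and>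
          (\<forall>y\<in>{z \<in> points Z. \<phi> z \<in> U} \<inter> V. (h \<circ> \<phi>) y = k y)"
        by (intro exI[of _ ?T] exI[of _ "\<lambda>z. p (\<phi> z) * inverse (q (\<phi> z))"])
          (use o[OF pq(2)] pq z in \<open>auto simp: divide_inverse\<close>)
    qed
  qed
qed

lemma isomorphicI:
  assumes "morphism X Y \<phi>" "morphism Y X \<psi>"
    "\<And>x. x \<in> points X \<Longrightarrow> \<psi> (\<phi> x) = x" "\<And>y. y \<in> points Y \<Longrightarrow> \<phi> (\<psi> y) = y"
  shows "isomorphic X Y"
  unfolding isomorphic_def using assms by blast

text \<open>Both maps are required to be morphisms on the subsets only, so they may carry
  denominators that vanish elsewhere.\<close>

lemma isomorphic_induced:
  assumes X: "fun_space X" and Y: "fun_space Y"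
    and \<phi>: "morphism (induced X S) Y \<phi>" and \<psi>: "morphism (induced Y T) X \<psi>"
    and ST: "\<And>x. x \<in> points X \<Longrightarrow> x \<in> S \<Longrightarrow> \<phi> x \<in> T \<and> \<psi> (\<phi> x) = x"
      "\<And>y. y \<in> points Y \<Longrightarrow> y \<in> T \<Longrightarrow> \<psi> y \<in> S \<and> \<phi> (\<psi> y) = y"
  shows "isomorphic (induced X S) (induced Y T)"
proof (rule isomorphicI)
  show "morphism (induced X S) (induced Y T) \<phi>"
    by (rule morphism_into_induced[OF fun_space_induced[OF X] \<phi>]) (use ST in auto)
  show "morphism (induced Y T) (induced X S) \<psi>"
    by (rule morphism_into_induced[OF fun_space_induced[OF Y] \<psi>]) (use ST in auto)
qed (use ST in auto)

lemma isomorphic_induced_induced: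
  assumes X: "fun_space X"
  shows "isomorphic (induced (induced X A) B) (induced X (A \<inter> B))"
proof (rule isomorphicI)
  note f = fun_space_induced[OF X] fun_space_induced[OF fun_space_induced[OF X]]
  show "morphism (induced (induced X A) B) (induced X (A \<inter> B)) (\<lambda>x. x)"
    by (rule morphism_into_induced[OF f(2) morphism_comp[OF morphism_induced morphism_induced]])
      auto
  show "morphism (induced X (A \<inter> B)) (induced (induced X A) B) (\<lambda>x. x)"
    by (intro morphism_into_induced f(1) morphism_induced) auto
qed auto

lemma isomorphic_induced_points: "fun_space X \<Longrightarrow> isomorphic (induced X (points X)) X"
  by (rule isomorphicI[OF morphism_induced
        morphism_into_induced[OF _ morphism_id[unfolded id_def]]]) auto

lemma isomorphic_induced_zariski:
  assumes "M' \<subseteq> M"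
  shows "isomorphic (induced (zariski M (algebra_generated S)) M') (zariski M' (algebra_generated S))"
proof -
  note A = function_algebra_generated[of S]
  note p = points_zariski[OF A] and fs = fun_space_zariski[OF A]
  have g: "s \<in> gfun (zariski N (algebra_generated S))" if "s \<in> S" for s N
    unfolding gfun_def by (rule algebra_regular_zariski[OF A algebra_generated.generator[OF that]])
  show ?thesis
  proof (rule isomorphicI)
    show "morphism (induced (zariski M (algebra_generated S)) M') (zariski M' (algebra_generated S)) (\<lambda>x. x)"
      by (rule morphism_zariski[OF fun_space_induced[OF fs]]) (auto intro: gfun_induced g)
    show "morphism (zariski M' (algebra_generated S)) (induced (zariski M (algebra_generated S)) M') (\<lambda>x. x)"
      by (intro morphism_into_induced fs morphism_zariski) (use assms in \<open>auto simp: p intro: g\<close>)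
  qed auto
qed

lemma morphism_map_prod:
  assumes "fun_space X" "fun_space Y" "fun_space X'" "fun_space Y'"
    "morphism X X' \<phi>" "morphism Y Y' \<psi>"
  shows "morphism (fproduct X Y) (fproduct X' Y') (\<lambda>p. (\<phi> (fst p), \<psi> (snd p)))"
  by (intro morphism_pair fun_space_fproduct assms morphism_comp[OF morphism_fst]
      morphism_comp[OF morphism_snd])

lemma isomorphic_fproduct:
  assumes fs: "fun_space X" "fun_space Y" "fun_space X'" "fun_space Y'"
    and iso: "isomorphic X X'" "isomorphic Y Y'"
  shows "isomorphic (fproduct X Y) (fproduct X' Y')"
proof -
  obtain \<phi> \<psi> where 1: "morphism X X' \<phi>" "morphism X' X \<psi>"
      "\<forall>x \<in> points X. \<psi> (\<phi> x) = x" "\<forall>y \<in> points X'. \<phi> (\<psi> y) = y"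
    using iso(1) unfolding isomorphic_def by blast
  obtain \<phi>' \<psi>' where 2: "morphism Y Y' \<phi>'" "morphism Y' Y \<psi>'"
      "\<forall>x \<in> points Y. \<psi>' (\<phi>' x) = x" "\<forall>y \<in> points Y'. \<phi>' (\<psi>' y) = y"
    using iso(2) unfolding isomorphic_def by blast
  show ?thesis
    by (rule isomorphicI[OF morphism_map_prod[OF fs 1(1) 2(1)]
          morphism_map_prod[OF fs(3,4,1,2) 1(2) 2(2)]]) (use 1 2 in auto)
qed

lemma isomorphic_fproduct_induced:
  assumes X: "fun_space X" and Y: "fun_space Y"
  shows "isomorphic (fproduct (induced X S) (induced Y T)) (induced (fproduct X Y) (S \<times> T))"
proof (rule isomorphicI)
  note f = fun_space_induced[OF X] fun_space_induced[OF Y] fun_space_induced[OF fun_space_fproduct[OF X Y]]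
  show "morphism (fproduct (induced X S) (induced Y T)) (induced (fproduct X Y) (S \<times> T)) (\<lambda>p. (fst p, snd p))"
    by (intro morphism_into_induced morphism_map_prod fun_space_fproduct f X Y morphism_induced) auto
  show "morphism (induced (fproduct X Y) (S \<times> T)) (fproduct (induced X S) (induced Y T)) (\<lambda>p. (fst p, snd p))"
    by (intro morphism_pair f morphism_into_induced morphism_restrict[OF morphism_fst]
        morphism_restrict[OF morphism_snd]) auto
qed auto

lemma isomorphic_fproduct_commute:
  assumes X: "fun_space X" and Y: "fun_space Y"
  shows "isomorphic (fproduct X Y) (fproduct Y X)"
  by (rule isomorphicI[of _ _ "\<lambda>p. (snd p, fst p)" "\<lambda>p. (snd p, fst p)"])
    (auto intro!: morphism_pair morphism_fst morphism_snd X Y fun_space_fproduct)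

lemma isomorphic_fproduct_assoc:
  assumes X: "fun_space X" and Y: "fun_space Y" and Z: "fun_space Z"
  shows "isomorphic (fproduct (fproduct X Y) Z) (fproduct X (fproduct Y Z))"
proof (rule isomorphicI)
  note f = X Y Z fun_space_fproduct[OF X Y] fun_space_fproduct[OF Y Z]
    fun_space_fproduct[OF fun_space_fproduct[OF X Y] Z]
    fun_space_fproduct[OF X fun_space_fproduct[OF Y Z]]
  show "morphism (fproduct (fproduct X Y) Z) (fproduct X (fproduct Y Z))
      (\<lambda>p. (fst (fst p), (snd (fst p), snd p)))"
    by (intro morphism_pair f morphism_comp[OF morphism_fst morphism_fst]
        morphism_comp[OF morphism_fst morphism_snd] morphism_snd)
  show "morphism (fproduct X (fproduct Y Z)) (fproduct (fproduct X Y) Z)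
      (\<lambda>p. ((fst p, fst (snd p)), snd (snd p)))"
    by (intro morphism_pair f morphism_comp[OF morphism_snd morphism_fst]
        morphism_comp[OF morphism_snd morphism_snd] morphism_fst)
qed auto

section \<open>Affine varieties\<close>

lemma affine_algebraic_eq:
  "affine_algebraic n P = zariski {x \<in> affine_points n. \<forall>p\<in>P. p x = 0} (algebra_generated {\<lambda>x. x i | i. i < n})"
  by (simp add: affine_algebraic_def polynomials_def)

lemma points_affine [simp]: "points (affine_algebraic n P) = {x \<in> affine_points n. \<forall>p\<in>P. p x = 0}"
  unfolding affine_algebraic_eq by (rule points_zariski[OF function_algebra_generated])

lemma fun_space_affine: "fun_space (affine_algebraic n P)"
  unfolding affine_algebraic_eq by (rule fun_space_zariski[OF function_algebra_generated])

text \<open>Coordinates with index at least \<open>n\<close> vanish on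
  \<open>affine_points n\<close>; with no bound on \<open>i\<close>, coordinate arguments may run
  over all indices.\<close>

lemma gfun_coord: "(\<lambda>x. x i) \<in> gfun (affine_algebraic n P)"
proof (cases "i < n")
  case True
  then have "(\<lambda>x. x i) \<in> algebra_generated {\<lambda>x. x i | i. i < n}"
    by (intro algebra_generated.generator) blast
  then show ?thesis
    unfolding gfun_def affine_algebraic_eq
    by (rule algebra_regular_zariski[OF function_algebra_generated])
next
  case False
  show ?thesis
    by (rule gfun_cong[OF fun_space_affine gfun_const[OF fun_space_affine, of 0]])
      (use False in \<open>auto simp: affine_points_def\<close>)
qed

lemma gfun_coord_pullback: "morphism Z (affine_algebraic n P) \<phi> \<Longrightarrow> (\<lambda>z. \<phi> z i) \<in> gfun Z"
  using gfun_pullback[OF _ gfun_coord] .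

lemma morphism_affine:
  assumes "fun_space Z" "\<And>z. z \<in> points Z \<Longrightarrow> \<phi> z \<in> affine_points n"
    "\<And>z p. z \<in> points Z \<Longrightarrow> p \<in> P \<Longrightarrow> p (\<phi> z) = 0" "\<And>i. i < n \<Longrightarrow> (\<lambda>z. \<phi> z i) \<in> gfun Z"
  shows "morphism Z (affine_algebraic n P) \<phi>"
  unfolding affine_algebraic_eq
  by (rule morphism_zariski[OF assms(1)]) (use assms(2-4) in auto)

lemma is_affine_isomorphic: "isomorphic X Y \<Longrightarrow> is_affine X \<Longrightarrow> is_affine Y"
  unfolding is_affine_def using isomorphic_trans[OF isomorphic_sym] by blast

text \<open>A closed set is the zero set of the polynomials vanishing on it. Adjoining these to the
  equations of an affine model presents the subset as an affine algebraic set.\<close>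

lemma is_affine_closed:
  assumes X: "fun_space X" and aff: "is_affine X" and C: "closedin (zariski_top X) C"
  shows "is_affine (induced X C)"
proof -
  obtain n P where P: "P \<subseteq> polynomials n" and iso: "isomorphic X (affine_algebraic n P)"
    using aff unfolding is_affine_def by blast
  let ?Y = "affine_algebraic n P"
  obtain \<phi> \<psi> where 1: "morphism X ?Y \<phi>" "morphism ?Y X \<psi>"
      "\<forall>x \<in> points X. \<psi> (\<phi> x) = x" "\<forall>y \<in> points ?Y. \<phi> (\<psi> y) = y"
    using iso unfolding isomorphic_def by blast
  let ?D = "{y \<in> points ?Y. \<psi> y \<in> C}"
  have D: "closedin (zariski_top ?Y) ?D"
    by (rule closedin_continuous_map_preimage[OF morphism_continuous[OF 1(2)] C])
  define P' where "P' = {f \<in> polynomials n. \<forall>x\<in>?D. f x = 0}"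
  let ?M = "{x \<in> affine_points n. \<forall>p\<in>P \<union> P'. p x = 0}"
  have "?D \<subseteq> ?M" unfolding P'_def by auto
  \<comment> \<open>For a point outside the closed set, the definition of the topology supplies a
    polynomial that vanishes on the set but not at the point.\<close>
  moreover have "?M \<subseteq> ?D"
  proof
    fix x assume x: "x \<in> ?M"
    show "x \<in> ?D"
    proof (rule ccontr)
      assume nx: "x \<notin> ?D"
      have "openin (zariski_top ?Y) (points ?Y - ?D)" using D unfolding closedin_def by blast
      then have a: "\<forall>x \<in> points ?Y - ?D. \<exists>f\<in>polynomials n. f x \<noteq> 0 \<and> (\<forall>y\<in>points ?Y. f y \<noteq> 0 \<longrightarrow> y \<in> points ?Y - ?D)"
        unfolding points_affine unfolding affine_algebraic_eq polynomials_def
          openin_zariski[OF function_algebra_generated] by (rule conjunct2)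
      have b: "x \<in> points ?Y - ?D" using x nx by auto
      from bspec[OF a b] obtain f where f: "f \<in> polynomials n" "f x \<noteq> 0"
          "\<forall>y\<in>points ?Y. f y \<noteq> 0 \<longrightarrow> y \<in> points ?Y - ?D"
        by (elim bexE conjE) (rule that)
      then have "f \<in> P'" unfolding P'_def by auto
      then show False using x f(2) by blast
    qed
  qed
  ultimately have DM: "?D = ?M" by (rule subset_antisym)
  have "isomorphic (induced X C) (induced ?Y ?M)"
    unfolding DM[symmetric]
    by (rule isomorphic_induced[OF X fun_space_affine morphism_restrict[OF 1(1)]
          morphism_restrict[OF 1(2)]])
      (use 1 morphism_points[OF 1(1)] in auto)
  moreover have "isomorphic (induced ?Y ?M) (affine_algebraic n (P \<union> P'))"
    unfolding affine_algebraic_eq by (rule isomorphic_induced_zariski) auto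
  ultimately have "isomorphic (induced X C) (affine_algebraic n (P \<union> P'))"
    by (rule isomorphic_trans)
  moreover have "P \<union> P' \<subseteq> polynomials n" using P unfolding P'_def by blast
  ultimately show ?thesis unfolding is_affine_def by blast
qed

lemma polynomials_substitute:
  assumes f: "f \<in> polynomials n" and s: "\<And>i. i < n \<Longrightarrow> (\<lambda>x. \<phi> x i) \<in> polynomials m"
  shows "(\<lambda>x. f (\<phi> x)) \<in> polynomials m"
  using f unfolding polynomials_def[of n]
  by induction (auto intro: s[unfolded polynomials_def] algebra_generated.intros simp: polynomials_def)

lemma polynomials_coord: "i < n \<Longrightarrow> (\<lambda>x. x i) \<in> polynomials n"
  unfolding polynomials_def by (intro algebra_generated.generator) blast

lemma is_affine_fproduct:
  assumes X: "fun_space X" "is_affine X" and Y: "fun_space Y" "is_affine Y"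
  shows "is_affine (fproduct X Y)"
proof -
  obtain m P where P: "P \<subseteq> polynomials m" "isomorphic X (affine_algebraic m P)"
    using X(2) unfolding is_affine_def by blast
  obtain n Q where Q: "Q \<subseteq> polynomials n" "isomorphic Y (affine_algebraic n Q)"
    using Y(2) unfolding is_affine_def by blast
  \<comment> \<open>The coordinates of \<open>X\<close> occupy the places below \<open>m\<close>,
    those of \<open>Y\<close> are shifted by \<open>m\<close>; \<open>?l\<close> and
    \<open>?r\<close> recover the two halves.\<close>
  let ?l = "\<lambda>(z::nat \<Rightarrow> complex) i. if i < m then z i else 0" and ?r = "\<lambda>(z::nat \<Rightarrow> complex) i. z (i + m)"
  let ?R = "(\<lambda>p z. p (?l z)) ` P \<union> (\<lambda>q z. q (?r z)) ` Q"
  let ?Z = "affine_algebraic (m + n) ?R"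
  have R: "?R \<subseteq> polynomials (m + n)"
  proof -
    have "(\<lambda>z. p (?l z)) \<in> polynomials (m + n)" if "p \<in> P" for p
      by (rule polynomials_substitute) (use that P(1) polynomials_coord in auto)
    moreover have "(\<lambda>z. q (?r z)) \<in> polynomials (m + n)" if "q \<in> Q" for q
      by (rule polynomials_substitute) (use that Q(1) polynomials_coord in auto)
    ultimately show ?thesis by auto
  qed
  let ?A = "affine_algebraic m P" and ?B = "affine_algebraic n Q"
  let ?c = "\<lambda>p i. if i < m then fst p i else snd p (i - m)"
  note fs = fun_space_affine[of m P] fun_space_affine[of n Q]
  have AB: "fun_space (fproduct ?A ?B)" by (intro fun_space_fproduct fs)
  have inv: "?l (?c p) = fst p" "?r (?c p) = snd p" if "p \<in> points (fproduct ?A ?B)" for p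
    using that by (auto simp: affine_points_def fun_eq_iff)
  have "isomorphic (fproduct ?A ?B) ?Z"
  proof (rule isomorphicI)
    show "morphism (fproduct ?A ?B) ?Z ?c"
    proof (rule morphism_affine[OF AB])
      fix z assume z: "z \<in> points (fproduct ?A ?B)"
      then show "?c z \<in> affine_points (m + n)"
        by (auto simp: affine_points_def)
      fix p assume "p \<in> ?R"
      then show "p (?c z) = 0"
        using inv[OF z] z by auto
    next
      fix i show "(\<lambda>z. ?c z i) \<in> gfun (fproduct ?A ?B)"
        by (cases "i < m") (auto intro: gfun_coord_pullback[OF morphism_fst] gfun_coord_pullback[OF morphism_snd])
    qed
    show "morphism ?Z (fproduct ?A ?B) (\<lambda>z. (?l z, ?r z))"
    proof (intro morphism_pair fs fun_space_affine morphism_affine)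
      fix i
      show "(\<lambda>z. if i < m then z i else 0) \<in> gfun ?Z"
        by (cases "i < m") (auto intro: gfun_coord gfun_const fun_space_affine)
      show "(\<lambda>z. z (i + m)) \<in> gfun ?Z" by (rule gfun_coord)
    qed (auto simp: affine_points_def)
  qed (use inv in \<open>auto simp: affine_points_def fun_eq_iff\<close>)
  then have "is_affine (fproduct ?A ?B)"
    using R unfolding is_affine_def by blast
  then show ?thesis
    using isomorphic_fproduct[OF X(1) Y(1) fs P(2) Q(2)] is_affine_isomorphic isomorphic_sym by blast
qed

section \<open>From affine covers to varieties, and constructions that preserve varieties\<close>

lemma sheaf_conditionD:
  assumes "sheaf_condition X" "openin (zariski_top X) U"
    "\<forall>x\<in>U. \<exists>V g. openin (zariski_top X) V \<and> x \<in> V \<and> g \<in> regular X V \<and> (\<forall>y \<in> U \<inter> V. h y = g y)"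
  shows "h \<in> regular X U"
  using assms(1)[unfolded sheaf_condition_def, rule_format, OF conjI[OF assms(2,3)]] .

lemma sheaf_glue:
  assumes "sheaf_condition X" "openin (zariski_top X) U"
    "\<And>x. x \<in> U \<Longrightarrow> \<exists>N. openin (zariski_top X) N \<and> x \<in> N \<and> h \<in> regular X N"
  shows "h \<in> regular X U"
proof -
  have "\<forall>x\<in>U. \<exists>V g. openin (zariski_top X) V \<and> x \<in> V \<and> g \<in> regular X V \<and> (\<forall>y \<in> U \<inter> V. h y = g y)"
  proof
    fix x assume "x \<in> U"
    obtain N where "openin (zariski_top X) N" "x \<in> N" "h \<in> regular X N"
      using assms(3)[OF \<open>x \<in> U\<close>] by blast
    then show "\<exists>V g. openin (zariski_top X) V \<and> x \<in> V \<and> g \<in> regular X V \<and> (\<forall>y \<in> U \<inter> V. h y = g y)"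
      by (intro exI[of _ N] exI[of _ h]) simp
  qed
  then show ?thesis by (rule sheaf_conditionD[OF assms(1,2)])
qed

text \<open>The chart is an isomorphism of \<open>induced X N\<close>. As \<open>N\<close> is open,
  openness and, by the sheaf condition, regularity there are openness and regularity in
  \<open>X\<close> itself.\<close>

lemma fun_space_chart:
  assumes sh: "sheaf_condition X" and N: "openin (zariski_top X) N"
    and iso: "isomorphic (induced X N) Y"
  obtains \<phi> \<psi> where "\<forall>z\<in>N. \<psi> (\<phi> z) = z"
    "\<forall>U f. openin (zariski_top X) U \<and> f \<in> regular X U \<longrightarrow>
      openin (zariski_top Y) {y \<in> points Y. \<psi> y \<in> U \<inter> N} \<and>
      (\<lambda>y. f (\<psi> y)) \<in> regular Y {y \<in> points Y. \<psi> y \<in> U \<inter> N}"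
    "\<forall>U k. openin (zariski_top Y) U \<and> k \<in> regular Y U \<longrightarrow>
      openin (zariski_top X) {z \<in> N. \<phi> z \<in> U} \<and> (\<lambda>z. k (\<phi> z)) \<in> regular X {z \<in> N. \<phi> z \<in> U}"
    "\<forall>z\<in>N. \<phi> z \<in> points Y"
proof -
  obtain \<phi> \<psi> where 1: "morphism (induced X N) Y \<phi>" "morphism Y (induced X N) \<psi>"
      "\<forall>x \<in> points (induced X N). \<psi> (\<phi> x) = x" "\<forall>y \<in> points Y. \<phi> (\<psi> y) = y"
    using iso unfolding isomorphic_def by blast
  have NX: "N \<subseteq> points X" using N by (rule openin_subset)
  have a: "openin (zariski_top Y) {y \<in> points Y. \<psi> y \<in> U \<inter> N} \<and>
      (\<lambda>y. f (\<psi> y)) \<in> regular Y {y \<in> points Y. \<psi> y \<in> U \<inter> N}"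
    if U: "openin (zariski_top X) U \<and> f \<in> regular X U" for U f
  proof -
    have o: "openin (zariski_top (induced X N)) (U \<inter> N)"
      unfolding openin_induced using U by blast
    have "f \<in> regular (induced X N) (U \<inter> N)"
      by (rule regular_inducedI[of X U]) (use U in auto)
    from morphism_regular[OF 1(2) o this] morphism_preimage_open[OF 1(2) o]
    show ?thesis by (simp add: comp_def)
  qed
  have b: "openin (zariski_top X) {z \<in> N. \<phi> z \<in> U} \<and> (\<lambda>z. k (\<phi> z)) \<in> regular X {z \<in> N. \<phi> z \<in> U}"
    if U: "openin (zariski_top Y) U \<and> k \<in> regular Y U" for U k
  proof
    have eq: "{z \<in> points (induced X N). \<phi> z \<in> U} = {z \<in> N. \<phi> z \<in> U}"
      using NX by auto
    have "openin (zariski_top (induced X N)) {z \<in> N. \<phi> z \<in> U}"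
      using morphism_preimage_open[OF 1(1) conjunct1[OF U]] unfolding eq .
    then obtain V where "openin (zariski_top X) V" "{z \<in> N. \<phi> z \<in> U} = V \<inter> N"
      unfolding openin_induced by blast
    then show o: "openin (zariski_top X) {z \<in> N. \<phi> z \<in> U}" using N by (simp add: openin_Int)
    have "k \<circ> \<phi> \<in> regular (induced X N) {z \<in> N. \<phi> z \<in> U}"
      using morphism_regular[OF 1(1) conjunct1[OF U] conjunct2[OF U]] unfolding eq .
    then have r: "(\<lambda>z. k (\<phi> z)) \<in> regular (induced X N) {z \<in> N. \<phi> z \<in> U}"
      by (simp add: comp_def)
    show "(\<lambda>z. k (\<phi> z)) \<in> regular X {z \<in> N. \<phi> z \<in> U}"
      by (rule sheaf_conditionD[OF sh o r[unfolded regular_induced]])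
  qed
  show thesis
    by (rule that[of \<psi> \<phi>]) (use 1 a b NX morphism_points[OF 1(1)] in auto)
qed

text \<open>\<open>is_variety\<close> postulates the sheaf condition and affine charts, but neither
  algebra operations nor inverses. Both are local and hence inherited from the charts.\<close>

lemma fun_space_local:
  fixes X :: "'a fspace" and Y :: "'a \<Rightarrow> 'b fspace"
  assumes sh: "sheaf_condition X"
    and ch: "\<And>x. x \<in> points X \<Longrightarrow> \<exists>N. openin (zariski_top X) N \<and> x \<in> N \<and> fun_space (Y x) \<and>
      isomorphic (induced X N) (Y x)"
  shows "fun_space X"
proof -
  have algebra: "\<exists>N. openin (zariski_top X) N \<and> x \<in> N \<and> (\<lambda>_. c) \<in> regular X N \<and>
      (\<lambda>x. f x + g x) \<in> regular X N \<and> (\<lambda>x. f x * g x) \<in> regular X N"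
    if U: "openin (zariski_top X) U" and f: "f \<in> regular X U" and g: "g \<in> regular X U" and x: "x \<in> U"
    for U f g x c
  proof -
    have "x \<in> points X" using U x openin_subset by blast
    from ch[OF this] obtain N where N: "openin (zariski_top X) N" "x \<in> N" "fun_space (Y x)"
      "isomorphic (induced X N) (Y x)" by blast
    obtain \<phi> \<psi> where 1: "\<forall>z\<in>N. \<psi> (\<phi> z) = z"
      "\<forall>U f. openin (zariski_top X) U \<and> f \<in> regular X U \<longrightarrow>
        openin (zariski_top (Y x)) {y \<in> points (Y x). \<psi> y \<in> U \<inter> N} \<and>
        (\<lambda>y. f (\<psi> y)) \<in> regular (Y x) {y \<in> points (Y x). \<psi> y \<in> U \<inter> N}"
      "\<forall>U k. openin (zariski_top (Y x)) U \<and> k \<in> regular (Y x) U \<longrightarrow>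
        openin (zariski_top X) {z \<in> N. \<phi> z \<in> U} \<and> (\<lambda>z. k (\<phi> z)) \<in> regular X {z \<in> N. \<phi> z \<in> U}"
      "\<forall>z\<in>N. \<phi> z \<in> points (Y x)"
      by (rule fun_space_chart[OF sh N(1,4)])
    let ?M = "{y \<in> points (Y x). \<psi> y \<in> U \<inter> N}"
    have M: "openin (zariski_top (Y x)) ?M" using 1(2) U f by blast
    note alg = function_algebraD[OF fun_space_algebra[OF N(3) M]]
    have UN: "{z \<in> N. \<phi> z \<in> ?M} = U \<inter> N" using 1(1,4) by auto
    have o: "openin (zariski_top X) (U \<inter> N)" using U N(1) by blast
    have fg: "(\<lambda>y. f (\<psi> y)) \<in> regular (Y x) ?M" "(\<lambda>y. g (\<psi> y)) \<in> regular (Y x) ?M"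
      using 1(2) U f g by blast+
    have pull: "(\<lambda>z. k (\<phi> z)) \<in> regular X (U \<inter> N)" if "k \<in> regular (Y x) ?M" for k
      using 1(3)[rule_format, of ?M k] M that unfolding UN by blast
    have cong: "h' \<in> regular X (U \<inter> N)" if "h \<in> regular X (U \<inter> N)" "\<forall>z\<in>U \<inter> N. h' z = h z" for h h'
      by (rule sheaf_conditionD[OF sh o], intro ballI exI[of _ "U \<inter> N"] exI[of _ h]) (use o that in auto)
    have "(\<lambda>z. c) \<in> regular X (U \<inter> N)" using pull[OF alg(1)] .
    moreover have "(\<lambda>z. f z + g z) \<in> regular X (U \<inter> N)"
      by (rule cong[OF pull[OF alg(2)[OF fg]]]) (use 1(1) in auto)
    moreover have "(\<lambda>z. f z * g z) \<in> regular X (U \<inter> N)"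
      by (rule cong[OF pull[OF alg(3)[OF fg]]]) (use 1(1) in auto)
    ultimately show ?thesis using o x N(2) by blast
  qed
  have inv: "\<exists>N. openin (zariski_top X) N \<and> x \<in> N \<and> N \<subseteq> {x\<in>U. f x \<noteq> 0} \<and>
      (\<lambda>x. inverse (f x)) \<in> regular X N"
    if U: "openin (zariski_top X) U" and f: "f \<in> regular X U" and x: "x \<in> {x\<in>U. f x \<noteq> 0}" for U f x
  proof -
    have "x \<in> points X" using U x openin_subset by blast
    from ch[OF this] obtain N where N: "openin (zariski_top X) N" "x \<in> N" "fun_space (Y x)"
      "isomorphic (induced X N) (Y x)" by blast
    obtain \<phi> \<psi> where 1: "\<forall>z\<in>N. \<psi> (\<phi> z) = z"
      "\<forall>U f. openin (zariski_top X) U \<and> f \<in> regular X U \<longrightarrow>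
        openin (zariski_top (Y x)) {y \<in> points (Y x). \<psi> y \<in> U \<inter> N} \<and>
        (\<lambda>y. f (\<psi> y)) \<in> regular (Y x) {y \<in> points (Y x). \<psi> y \<in> U \<inter> N}"
      "\<forall>U k. openin (zariski_top (Y x)) U \<and> k \<in> regular (Y x) U \<longrightarrow>
        openin (zariski_top X) {z \<in> N. \<phi> z \<in> U} \<and> (\<lambda>z. k (\<phi> z)) \<in> regular X {z \<in> N. \<phi> z \<in> U}"
      "\<forall>z\<in>N. \<phi> z \<in> points (Y x)"
      by (rule fun_space_chart[OF sh N(1,4)])
    let ?M = "{y \<in> points (Y x). \<psi> y \<in> U \<inter> N}"
    have M: "openin (zariski_top (Y x)) ?M" using 1(2) U f by blast
    have fM: "(\<lambda>y. f (\<psi> y)) \<in> regular (Y x) ?M" using 1(2) U f by blast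
    let ?M' = "{y \<in> ?M. f (\<psi> y) \<noteq> 0}"
    let ?N = "{z \<in> N. \<phi> z \<in> ?M'}"
    have N': "?N = {z \<in> U \<inter> N. f z \<noteq> 0}" using 1(1,4) by auto
    have "openin (zariski_top (Y x)) ?M'" "(\<lambda>y. inverse (f (\<psi> y))) \<in> regular (Y x) ?M'"
      by (rule fun_space_nonzero_open[OF N(3) M fM], rule fun_space_inverse[OF N(3) M fM])
    then have o: "openin (zariski_top X) ?N" and r: "(\<lambda>z. inverse (f (\<psi> (\<phi> z)))) \<in> regular X ?N"
      using 1(3)[rule_format, of ?M' "\<lambda>y. inverse (f (\<psi> y))"] by blast+
    have "\<forall>z\<in>?N. inverse (f z) = inverse (f (\<psi> (\<phi> z)))" using 1(1) by auto
    then have "(\<lambda>z. inverse (f z)) \<in> regular X ?N"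
      by (intro sheaf_conditionD[OF sh o] ballI exI[of _ ?N] exI[of _ "\<lambda>z. inverse (f (\<psi> (\<phi> z)))"])
        (use o r in auto)
    then show ?thesis using o x N(2) unfolding N' by (intro exI[of _ "{z \<in> U \<inter> N. f z \<noteq> 0}"]) auto
  qed
  have const: "\<exists>N. openin (zariski_top X) N \<and> x \<in> N \<and> (\<lambda>_. c) \<in> regular X N"
    if "x \<in> points X" for x c
  proof -
    have e: "f \<in> regular X {}" for f using sheaf_glue[OF sh openin_empty] by blast
    from ch[OF that] obtain N where N: "openin (zariski_top X) N" "x \<in> N" "fun_space (Y x)"
      "isomorphic (induced X N) (Y x)" by blast
    obtain \<phi> \<psi> where 1: "\<forall>z\<in>N. \<psi> (\<phi> z) = z"
      "\<forall>U f. openin (zariski_top X) U \<and> f \<in> regular X U \<longrightarrow>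
        openin (zariski_top (Y x)) {y \<in> points (Y x). \<psi> y \<in> U \<inter> N} \<and>
        (\<lambda>y. f (\<psi> y)) \<in> regular (Y x) {y \<in> points (Y x). \<psi> y \<in> U \<inter> N}"
      "\<forall>U k. openin (zariski_top (Y x)) U \<and> k \<in> regular (Y x) U \<longrightarrow>
        openin (zariski_top X) {z \<in> N. \<phi> z \<in> U} \<and> (\<lambda>z. k (\<phi> z)) \<in> regular X {z \<in> N. \<phi> z \<in> U}"
      "\<forall>z\<in>N. \<phi> z \<in> points (Y x)"
      by (rule fun_space_chart[OF sh N(1,4)])
    have "{z \<in> N. \<phi> z \<in> points (Y x)} = N" using 1(4) by auto
    then have "(\<lambda>_. c) \<in> regular X N"
      using 1(3)[rule_format, of "points (Y x)" "\<lambda>_. c"]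
        function_algebraD(1)[OF fun_space_algebra[OF N(3) openin_topspace], of c] by simp
    then show ?thesis using N by blast
  qed
  show ?thesis
    unfolding fun_space_def
  proof (intro conjI allI impI ballI)
    fix U assume U: "openin (zariski_top X) U"
    show "function_algebra (regular X U)"
    proof (rule function_algebraI)
      fix c
      show "(\<lambda>_. c) \<in> regular X U"
        by (rule sheaf_glue[OF sh U]) (use const U openin_subset in blast)
    next
      fix f g assume f: "f \<in> regular X U" and g: "g \<in> regular X U"
      show "(\<lambda>x. f x + g x) \<in> regular X U"
        by (rule sheaf_glue[OF sh U]) (use algebra[OF U f g] in blast)
      show "(\<lambda>x. f x * g x) \<in> regular X U"
        by (rule sheaf_glue[OF sh U]) (use algebra[OF U f g] in blast)
    qed
    fix f assume f: "f \<in> regular X U"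
    show o: "openin (zariski_top X) {x \<in> U. f x \<noteq> 0}"
      by (subst openin_subopen) (use inv[OF U f] in blast)
    show "(\<lambda>x. inverse (f x)) \<in> regular X {x \<in> U. f x \<noteq> 0}"
      by (rule sheaf_glue[OF sh o]) (use inv[OF U f] in blast)
  qed (rule sh)
qed

lemma is_varietyE:
  assumes "is_variety X"
  obtains \<U> where "finite \<U>" "\<Union>\<U> = points X" "\<forall>U\<in>\<U>. openin (zariski_top X) U"
    "\<forall>U\<in>\<U>. is_affine (induced X U)"
proof -
  from assms have "\<exists>\<U>. finite \<U> \<and> \<Union>\<U> = points X \<and> (\<forall>U\<in>\<U>. openin (zariski_top X) U \<and> is_affine (induced X U))"
    unfolding is_variety_def by (elim conjE)
  then show thesis by (elim exE conjE) (rule that, assumption+, blast+)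
qed

lemma is_variety_sheaf: "is_variety X \<Longrightarrow> sheaf_condition X"
  unfolding is_variety_def sheaf_condition_def by (elim conjE)

lemma is_variety_fun_space:
  assumes "is_variety X"
  shows "fun_space X"
proof -
  obtain \<U> where \<U>: "finite \<U>" "\<Union>\<U> = points X" "\<forall>U\<in>\<U>. openin (zariski_top X) U"
    "\<forall>U\<in>\<U>. is_affine (induced X U)"
    by (rule is_varietyE[OF assms])
  \<comment> \<open>\<open>fun_space_local\<close> expects the chart as a function of the point, so
    a model is selected at each point.\<close>
  define Y :: "'a \<Rightarrow> (nat \<Rightarrow> complex) fspace" where "Y x = (SOME Y. \<exists>N. openin (zariski_top X) N \<and>
      x \<in> N \<and> fun_space Y \<and> isomorphic (induced X N) Y)" for x
  show ?thesis
  proof (rule fun_space_local[OF is_variety_sheaf[OF assms]])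
    fix x assume "x \<in> points X"
    then obtain U where U: "U \<in> \<U>" "x \<in> U" using \<U>(2) by blast
    then have "is_affine (induced X U)" using \<U>(4) by blast
    then obtain n P where "isomorphic (induced X U) (affine_algebraic n P)"
      unfolding is_affine_def by (elim exE conjE) (rule that)
    then show "\<exists>N. openin (zariski_top X) N \<and> x \<in> N \<and> fun_space (Y x) \<and> isomorphic (induced X N) (Y x)"
      unfolding Y_def
      by (intro someI_ex[of "\<lambda>Y. \<exists>N. openin (zariski_top X) N \<and> x \<in> N \<and> fun_space Y \<and> isomorphic (induced X N) Y"]
          exI[of _ "affine_algebraic n P"] exI[of _ U] conjI fun_space_affine)
        (use U \<U>(3) in auto)
  qed
qed

lemma is_varietyI:
  assumes "fun_space X" "finite \<U>" "\<Union>\<U> = points X"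
    "\<And>U. U \<in> \<U> \<Longrightarrow> openin (zariski_top X) U" "\<And>U. U \<in> \<U> \<Longrightarrow> is_affine (induced X U)"
    "closedin (zariski_top (fproduct X X)) {(x, x) | x. x \<in> points X}"
  shows "is_variety X"
proof -
  have "sheaf_condition X" using assms(1) unfolding fun_space_def by (rule conjunct1)
  moreover have "\<exists>\<U>. finite \<U> \<and> \<Union>\<U> = points X \<and> (\<forall>U\<in>\<U>. openin (zariski_top X) U \<and> is_affine (induced X U))"
    using assms(2-5) by (intro exI[of _ \<U>]) simp
  ultimately show ?thesis
    unfolding is_variety_def sheaf_condition_def using assms(6) by (intro conjI)
qed

lemma is_variety_diagonal:
  "is_variety X \<Longrightarrow> closedin (zariski_top (fproduct X X)) {(x, x) | x. x \<in> points X}"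
  unfolding is_variety_def by (elim conjE)

text \<open>The preimage of the diagonal under an injective morphism, applied to both factors, is
  the diagonal. Separatedness thus passes to subspaces and to isomorphic copies.\<close>

lemma diagonal_closed_pullback:
  assumes X: "fun_space X" and Z: "fun_space Z" and \<iota>: "morphism Z X \<iota>" "inj_on \<iota> (points Z)"
    and d: "closedin (zariski_top (fproduct X X)) {(x, x) | x. x \<in> points X}"
  shows "closedin (zariski_top (fproduct Z Z)) {(x, x) | x. x \<in> points Z}"
proof -
  have "closedin (zariski_top (fproduct Z Z))
      {p \<in> points (fproduct Z Z). (\<iota> (fst p), \<iota> (snd p)) \<in> {(x, x) | x. x \<in> points X}}"
    by (rule closedin_continuous_map_preimage[OF morphism_continuous[OF
          morphism_map_prod[OF Z Z X X \<iota>(1) \<iota>(1)]] d])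
  moreover have "{p \<in> points (fproduct Z Z). (\<iota> (fst p), \<iota> (snd p)) \<in> {(x, x) | x. x \<in> points X}} =
      {(x, x) | x. x \<in> points Z}"
    using morphism_points[OF \<iota>(1)] \<iota>(2) by (auto simp: inj_on_def)
  ultimately show ?thesis by simp
qed

text \<open>The affine cover is intersected with \<open>C\<close>. Each intersection is closed in an
  affine chart, and restricting to chart and subset in either order gives the same space.\<close>

lemma is_variety_closed:
  assumes X: "is_variety X" and C: "closedin (zariski_top X) C"
  shows "is_variety (induced X C)"
proof -
  note fs = is_variety_fun_space[OF X]
  obtain \<U> where \<U>: "finite \<U>" "\<Union>\<U> = points X" "\<forall>U\<in>\<U>. openin (zariski_top X) U"
    "\<forall>U\<in>\<U>. is_affine (induced X U)"
    by (rule is_varietyE[OF X])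
  show ?thesis
  proof (rule is_varietyI[OF fun_space_induced[OF fs]])
    show "finite ((\<lambda>U. U \<inter> C) ` \<U>)" using \<U>(1) by simp
    show "\<Union>((\<lambda>U. U \<inter> C) ` \<U>) = points (induced X C)" using \<U>(2) by auto
    show "openin (zariski_top (induced X C)) U" if "U \<in> (\<lambda>U. U \<inter> C) ` \<U>" for U
      using that \<U>(3) unfolding openin_induced by blast
    show "is_affine (induced (induced X C) V)" if V: "V \<in> (\<lambda>U. U \<inter> C) ` \<U>" for V
    proof -
      obtain U where U: "U \<in> \<U>" "V = U \<inter> C" using V by blast
      have "closedin (zariski_top (induced X U)) V"
        unfolding zariski_top_induced U(2) Int_commute[of U C]
        by (intro closedin_subtopology_Int_closed[of _ C U, unfolded Int_commute[of U C]] C)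
      from is_affine_closed[OF fun_space_induced[OF fs] \<U>(4)[rule_format, OF U(1)] this]
      have "is_affine (induced (induced X U) V)" .
      moreover have "isomorphic (induced (induced X U) V) (induced X (U \<inter> V))"
        by (rule isomorphic_induced_induced[OF fs])
      moreover have "U \<inter> V = C \<inter> V" using U by auto
      moreover have "isomorphic (induced (induced X C) V) (induced X (C \<inter> V))"
        by (rule isomorphic_induced_induced[OF fs])
      ultimately show ?thesis
        using is_affine_isomorphic isomorphic_sym by metis
    qed
    show "closedin (zariski_top (fproduct (induced X C) (induced X C)))
        {(x, x) | x. x \<in> points (induced X C)}"
      by (rule diagonal_closed_pullback[OF fs fun_space_induced[OF fs] morphism_induced _
            is_variety_diagonal[OF X]]) (auto simp: inj_on_def)
  qed
qed

lemma is_variety_isomorphic: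
  assumes iso: "isomorphic X Y" and X: "is_variety X" and Y: "fun_space Y"
  shows "is_variety Y"
proof -
  note fs = is_variety_fun_space[OF X]
  obtain \<U> where \<U>: "finite \<U>" "\<Union>\<U> = points X" "\<forall>U\<in>\<U>. openin (zariski_top X) U"
    "\<forall>U\<in>\<U>. is_affine (induced X U)"
    by (rule is_varietyE[OF X])
  obtain \<phi> \<psi> where 1: "morphism X Y \<phi>" "morphism Y X \<psi>"
      "\<forall>x \<in> points X. \<psi> (\<phi> x) = x" "\<forall>y \<in> points Y. \<phi> (\<psi> y) = y"
    using iso unfolding isomorphic_def by blast
  let ?f = "\<lambda>U. {y \<in> points Y. \<psi> y \<in> U}"
  show ?thesis
  proof (rule is_varietyI[OF Y])
    show "finite (?f ` \<U>)" using \<U>(1) by simp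
    show "\<Union>(?f ` \<U>) = points Y" using \<U>(2) morphism_points[OF 1(2)] by auto
    show "openin (zariski_top Y) U" if "U \<in> ?f ` \<U>" for U
      using that \<U>(3) morphism_preimage_open[OF 1(2)] by blast
    show "is_affine (induced Y V)" if V: "V \<in> ?f ` \<U>" for V
    proof -
      obtain U where U: "U \<in> \<U>" "V = ?f U" using V by blast
      have "isomorphic (induced X U) (induced Y V)"
        by (rule isomorphic_induced[OF fs Y morphism_restrict[OF 1(1)] morphism_restrict[OF 1(2)]])
          (use 1 U morphism_points[OF 1(1)] in auto)
      then show ?thesis using \<U>(4) U(1) is_affine_isomorphic by blast
    qed
    show "closedin (zariski_top (fproduct Y Y)) {(x, x) | x. x \<in> points Y}"
      by (rule diagonal_closed_pullback[OF fs Y 1(2) _ is_variety_diagonal[OF X]])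
        (rule inj_on_inverseI[of _ \<phi>], use 1(4) in blast)
  qed
qed

lemma is_variety_fproduct:
  assumes X: "is_variety X" and Y: "is_variety Y"
  shows "is_variety (fproduct X Y)"
proof -
  note fX = is_variety_fun_space[OF X] and fY = is_variety_fun_space[OF Y]
  note fXY = fun_space_fproduct[OF fX fY]
  obtain \<U> where \<U>: "finite \<U>" "\<Union>\<U> = points X" "\<forall>U\<in>\<U>. openin (zariski_top X) U"
    "\<forall>U\<in>\<U>. is_affine (induced X U)"
    by (rule is_varietyE[OF X])
  obtain \<V> where \<V>: "finite \<V>" "\<Union>\<V> = points Y" "\<forall>U\<in>\<V>. openin (zariski_top Y) U"
    "\<forall>U\<in>\<V>. is_affine (induced Y U)"
    by (rule is_varietyE[OF Y])
  let ?P = "fproduct X Y"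
  show ?thesis
  proof (rule is_varietyI[OF fXY])
    show "finite ((\<lambda>(U, V). U \<times> V) ` (\<U> \<times> \<V>))" using \<U>(1) \<V>(1) by simp
    show "\<Union>((\<lambda>(U, V). U \<times> V) ` (\<U> \<times> \<V>)) = points ?P"
      unfolding points_fproduct \<U>(2)[symmetric] \<V>(2)[symmetric] by auto
    fix W assume "W \<in> (\<lambda>(U, V). U \<times> V) ` (\<U> \<times> \<V>)"
    then obtain p where p: "W = (\<lambda>(U, V). U \<times> V) p" "p \<in> \<U> \<times> \<V>" by (rule imageE)
    define U V where "U = fst p" and "V = snd p"
    have W: "W = U \<times> V" and U: "U \<in> \<U>" and V: "V \<in> \<V>"
      using p by (auto simp: U_def V_def case_prod_beta)
    have oU: "openin (zariski_top X) U" and oV: "openin (zariski_top Y) V"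
      using U V \<U>(3) \<V>(3) by blast+
    have "W = {p \<in> points ?P. fst p \<in> U} \<inter> {p \<in> points ?P. snd p \<in> V}"
      using openin_subset[OF oU] openin_subset[OF oV] W by auto
    then show "openin (zariski_top ?P) W"
      by (simp only: openin_Int[OF morphism_preimage_open[OF morphism_fst oU]
            morphism_preimage_open[OF morphism_snd oV]])
    have "is_affine (fproduct (induced X U) (induced Y V))"
      using is_affine_fproduct[OF fun_space_induced[OF fX] _ fun_space_induced[OF fY]] U V \<U>(4) \<V>(4)
      by blast
    then show "is_affine (induced ?P W)"
      unfolding W using isomorphic_fproduct_induced[OF fX fY] is_affine_isomorphic by blast
  next
    \<comment> \<open>A pair of points of the product is diagonal if and only if both of its
      projections are.\<close>
    have "closedin (zariski_top (fproduct ?P ?P))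
      ({p \<in> points (fproduct ?P ?P). (fst (fst p), fst (snd p)) \<in> {(x, x) | x. x \<in> points X}} \<inter>
       {p \<in> points (fproduct ?P ?P). (snd (fst p), snd (snd p)) \<in> {(x, x) | x. x \<in> points Y}})"
      by (intro closedin_Int closedin_continuous_map_preimage[OF morphism_continuous[OF
            morphism_map_prod[OF fXY fXY fX fX morphism_fst morphism_fst]] is_variety_diagonal[OF X]]
          closedin_continuous_map_preimage[OF morphism_continuous[OF
            morphism_map_prod[OF fXY fXY fY fY morphism_snd morphism_snd]] is_variety_diagonal[OF Y]])
    also have "({p \<in> points (fproduct ?P ?P). (fst (fst p), fst (snd p)) \<in> {(x, x) | x. x \<in> points X}} \<inter>
       {p \<in> points (fproduct ?P ?P). (snd (fst p), snd (snd p)) \<in> {(x, x) | x. x \<in> points Y}}) =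
       {(x, x) | x. x \<in> points ?P}" by auto
    finally show "closedin (zariski_top (fproduct ?P ?P)) {(x, x) | x. x \<in> points ?P}" .
  qed
qed

lemma is_variety_affine: "is_variety (affine_space n)"
proof (rule is_varietyI[OF fun_space_affine, of "{points (affine_space n)}"])
  let ?A = "affine_space n"
  note fs = fun_space_affine[of n "{}"]
  show "is_affine (induced ?A U)" if "U \<in> {points ?A}" for U
    using isomorphic_induced_points[OF fs] that unfolding is_affine_def by blast
  show "openin (zariski_top ?A) U" if "U \<in> {points ?A}" for U
    using that openin_topspace by (metis singletonD)
  have "closedin (zariski_top (fproduct ?A ?A))
      {p \<in> points (fproduct ?A ?A). \<forall>f\<in>range (\<lambda>i p. fst p i - snd p i). f p = 0}"
    by (rule closedin_zeros[OF fun_space_fproduct[OF fs fs]])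
      (auto intro!: gfun_diff fun_space_fproduct fs gfun_coord_pullback[OF morphism_fst]
        gfun_coord_pullback[OF morphism_snd])
  also have "{p \<in> points (fproduct ?A ?A). \<forall>f\<in>range (\<lambda>i p. fst p i - snd p i). f p = 0} =
      {(x, x) | x. x \<in> points ?A}"
    by (auto simp: fun_eq_iff)
  finally show "closedin (zariski_top (fproduct ?A ?A)) {(x, x) | x. x \<in> points ?A}" .
qed auto

text \<open>Rabinowitsch's device: the open set is isomorphic to the closed subset
  \<open>f x * t = 1\<close> of the product with the affine line. Nonvanishing loci are thus
  varieties without any noetherian argument.\<close>

lemma is_variety_nonzero:
  assumes X: "is_variety X" and f: "f \<in> gfun X"
  shows "is_variety (induced X {x \<in> points X. f x \<noteq> 0})"
proof -
  let ?A = "affine_space 1" and ?U = "{x \<in> points X. f x \<noteq> 0}"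
  let ?P = "fproduct X ?A"
  note fX = is_variety_fun_space[OF X] and fA = fun_space_affine[of 1 "{}"]
  note fP = fun_space_fproduct[OF fX fA]
  let ?C = "{p \<in> points ?P. \<forall>g\<in>{\<lambda>p. f (fst p) * snd p 0 - 1}. g p = 0}"
  have "(\<lambda>p. f (fst p) * snd p 0 - 1) \<in> gfun ?P"
    by (intro gfun_diff gfun_mult gfun_const fP gfun_pullback[OF morphism_fst f]
        gfun_coord_pullback[OF morphism_snd])
  then have C: "closedin (zariski_top ?P) ?C"
    by (intro closedin_zeros fP) auto
  have V: "is_variety (induced ?P ?C)"
    by (rule is_variety_closed[OF is_variety_fproduct[OF X is_variety_affine] C])
  have fU: "fun_space (induced X ?U)" by (rule fun_space_induced[OF fX])
  have "isomorphic (induced ?P ?C) (induced X ?U)"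
  proof (rule isomorphic_induced[OF fP fX morphism_restrict[OF morphism_fst]])
    have inv: "(\<lambda>x. inverse (f x)) \<in> gfun (induced X ?U)"
      by (rule gfun_inverse[OF fU gfun_induced[OF f]]) auto
    show "morphism (induced X ?U) ?P (\<lambda>x. (x, \<lambda>i. if i = 0 then inverse (f x) else 0))"
    proof (intro morphism_pair fX fA fU morphism_induced morphism_affine)
      fix i :: nat
      show "(\<lambda>x. if i = 0 then inverse (f x) else 0) \<in> gfun (induced X ?U)"
        using inv by (cases "i = 0") (auto intro: gfun_const[OF fU])
    qed (auto simp: affine_points_def)
    show "fst x \<in> ?U \<and> (fst x, \<lambda>i. if i = 0 then inverse (f (fst x)) else 0) = x"
      if "x \<in> points ?P" "x \<in> ?C" for x
      using that by (cases x) (auto simp: affine_points_def fun_eq_iff Suc_le_eq intro: inverse_unique)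
  qed (auto simp: affine_points_def)
  from is_variety_isomorphic[OF this V fU] show ?thesis .
qed

section \<open>The Grothendieck ring\<close>

text \<open>Topology and functions are carried along the injection. That the result is again a
  \<open>fun_space\<close> is read off from a single chart, the whole space.\<close>

lemma fun_space_transport:
  fixes X :: "'a fspace" and j :: "'a \<Rightarrow> 'b"
  assumes X: "fun_space X" and j: "inj_on j (points X)"
  shows "\<exists>Z :: 'b fspace. fun_space Z \<and> isomorphic X Z"
proof -
  define k where "k = inv_into (points X) j"
  have kj: "k (j x) = x" if "x \<in> points X" for x
    using j that unfolding k_def by simp
  define Z where "Z = FSpace (pullback_topology (j ` points X) k (zariski_top X))
    (\<lambda>W. {h. h \<circ> j \<in> regular X {x \<in> points X. j x \<in> W}})"
  have ptsZ: "points Z = j ` points X"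
    unfolding Z_def fspace.sel topspace_pullback_topology using kj by auto
  have openZ: "openin (zariski_top Z) W \<longleftrightarrow> (\<exists>U. openin (zariski_top X) U \<and> W = k -` U \<inter> j ` points X)" for W
    unfolding Z_def fspace.sel openin_pullback_topology ..
  have regZ: "h \<in> regular Z W \<longleftrightarrow> h \<circ> j \<in> regular X {x \<in> points X. j x \<in> W}" for h W
    unfolding Z_def by simp
  have pre: "openin (zariski_top X) {x \<in> points X. j x \<in> W}" if W: "openin (zariski_top Z) W" for W
  proof -
    obtain U where U: "openin (zariski_top X) U" "W = k -` U \<inter> j ` points X"
      using W unfolding openZ by blast
    have "{x \<in> points X. j x \<in> W} = U" using U openin_subset[OF U(1)] kj by (auto dest: inj_onD[OF j])
    then show ?thesis using U(1) by simp
  qed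
  have mj: "morphism X Z j"
    unfolding morphism_def continuous_map_def
  proof (intro conjI allI impI)
    show "j \<in> points X \<rightarrow> points Z" using ptsZ by auto
    fix V f assume "openin (zariski_top Z) V \<and> f \<in> regular Z V"
    then show "f \<circ> j \<in> regular X {x \<in> points X. j x \<in> V}" using regZ by blast
  qed (rule pre)
  have mk: "morphism Z X k"
    unfolding morphism_def continuous_map_def
  proof (intro conjI allI impI)
    show "k \<in> points Z \<rightarrow> points X" using ptsZ kj by auto
    fix V assume V: "openin (zariski_top X) V"
    have eq: "{z \<in> points Z. k z \<in> V} = k -` V \<inter> j ` points X" unfolding ptsZ by auto
    show "openin (zariski_top Z) {z \<in> points Z. k z \<in> V}"
      unfolding openZ eq using V by blast
  next
    fix V f assume V: "openin (zariski_top X) V \<and> f \<in> regular X V"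
    have "{x \<in> points X. j x \<in> {z \<in> points Z. k z \<in> V}} = V"
      unfolding ptsZ using kj openin_subset[OF conjunct1[OF V]] by (auto dest: inj_onD[OF j])
    moreover have "f \<circ> k \<circ> j \<in> regular X V"
      by (rule regular_cong[OF X conjunct1[OF V] conjunct2[OF V]])
        (use kj openin_subset[OF conjunct1[OF V]] in auto)
    ultimately show "f \<circ> k \<in> regular Z {z \<in> points Z. k z \<in> V}" unfolding regZ by simp
  qed
  have sheaf: "sheaf_condition Z"
    unfolding sheaf_condition_def
  proof (intro allI impI)
    fix W h
    assume *: "openin (zariski_top Z) W \<and>
      (\<forall>x\<in>W. \<exists>V g. openin (zariski_top Z) V \<and> x \<in> V \<and> g \<in> regular Z V \<and> (\<forall>y\<in>W \<inter> V. h y = g y))"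
    show "h \<in> regular Z W"
      unfolding regZ
    proof (rule fun_space_sheaf[OF X pre[OF conjunct1[OF *]]])
      fix x assume x: "x \<in> {x \<in> points X. j x \<in> W}"
      then have "j x \<in> W" by simp
      from bspec[OF conjunct2[OF *] this] obtain V g where V: "openin (zariski_top Z) V" "j x \<in> V"
        "g \<in> regular Z V" "\<forall>y\<in>W \<inter> V. h y = g y" by (elim exE conjE) (rule that)
      show "\<exists>V g. openin (zariski_top X) V \<and> x \<in> V \<and> g \<in> regular X V \<and>
          (\<forall>y\<in>{x \<in> points X. j x \<in> W} \<inter> V. (h \<circ> j) y = g y)"
        by (rule exI[of _ "{x \<in> points X. j x \<in> V}"], rule exI[of _ "g \<circ> j"])
          (use x V pre[OF V(1)] V(3)[unfolded regZ] in auto)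
    qed
  qed
  have "fun_space Z"
  proof (rule fun_space_local[OF sheaf])
    fix z assume z: "z \<in> points Z"
    have "isomorphic (induced Z (points Z)) X"
      by (rule isomorphicI[OF morphism_restrict[OF mk] morphism_into_induced[OF X mj]])
        (use kj ptsZ in auto)
    then show "\<exists>N. openin (zariski_top Z) N \<and> z \<in> N \<and> fun_space X \<and> isomorphic (induced Z N) X"
      using z X by (intro exI[of _ "points Z"]) simp
  qed
  moreover have "isomorphic X Z"
    by (rule isomorphicI[OF mj mk]) (use kj ptsZ in auto)
  ultimately show ?thesis by blast
qed

text \<open>Finitely many affine charts embed the points into \<open>nat => complex\<close>: place
  \<open>0\<close> holds the number of the first chart containing the point, the later places hold
  its coordinates in this chart.\<close>

lemma variety_model:
  fixes X :: "'a fspace"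
  assumes X: "is_variety X"
  shows "\<exists>Z :: (nat \<Rightarrow> complex) fspace. is_variety Z \<and> isomorphic X Z"
proof -
  obtain \<U> where \<U>: "finite \<U>" "\<Union>\<U> = points X" "\<forall>U\<in>\<U>. openin (zariski_top X) U"
    "\<forall>U\<in>\<U>. is_affine (induced X U)"
    by (rule is_varietyE[OF X])
  have "\<exists>\<phi> :: 'a \<Rightarrow> nat \<Rightarrow> complex. inj_on \<phi> U" if U: "U \<in> \<U>" for U
  proof -
    obtain n P where "isomorphic (induced X U) (affine_algebraic n P)"
      using \<U>(4)[rule_format, OF U] unfolding is_affine_def by (elim exE conjE) (rule that)
    then obtain \<phi> :: "'a \<Rightarrow> nat \<Rightarrow> complex" and \<psi> where "\<forall>x\<in>points (induced X U). \<psi> (\<phi> x) = x"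
      unfolding isomorphic_def by blast
    moreover have "points (induced X U) = U" using U \<U>(2) by auto
    ultimately have "inj_on \<phi> U" by (intro inj_on_inverseI[of U \<psi> \<phi>]) auto
    then show ?thesis by blast
  qed
  then obtain \<phi> :: "'a set \<Rightarrow> 'a \<Rightarrow> nat \<Rightarrow> complex" where \<phi>: "\<And>U. U \<in> \<U> \<Longrightarrow> inj_on (\<phi> U) U"
    by metis
  obtain Us where Us: "set Us = \<U>" using finite_list[OF \<U>(1)] by (elim exE) (rule that)
  define k where "k x = (LEAST m. m < length Us \<and> x \<in> Us ! m)" for x
  have k: "k x < length Us \<and> x \<in> Us ! k x" if x: "x \<in> points X" for x
  proof -
    have "x \<in> \<Union>(set Us)" using x \<U>(2) Us by simp
    then obtain U where U: "U \<in> set Us" "x \<in> U" by (elim UnionE) (rule that)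
    from U(1) obtain m where "m < length Us" "Us ! m = U" unfolding in_set_conv_nth by (elim exE conjE) (rule that)
    with U(2) have "\<exists>m. m < length Us \<and> x \<in> Us ! m" by (intro exI[of _ m]) simp
    then show ?thesis unfolding k_def by (rule LeastI_ex)
  qed
  define j where "j x m = (case m of 0 \<Rightarrow> of_nat (k x) | Suc m \<Rightarrow> \<phi> (Us ! k x) x m)" for x m
  have "inj_on j (points X)"
  proof (rule inj_onI)
    fix x y assume xy: "x \<in> points X" "y \<in> points X" "j x = j y"
    then have "j x 0 = j y 0" "\<And>m. j x (Suc m) = j y (Suc m)" by simp_all
    then have eq: "k x = k y" "\<phi> (Us ! k x) x = \<phi> (Us ! k x) y"
      unfolding j_def by (simp_all add: fun_eq_iff)
    have "Us ! k x \<in> \<U>" using k[OF xy(1)] unfolding Us[symmetric] by simp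
    from inj_onD[OF \<phi>[OF this] eq(2)] show "x = y" using k[OF xy(1)] k[OF xy(2)] eq(1) by simp
  qed
  from fun_space_transport[OF is_variety_fun_space[OF X] this]
  show ?thesis using is_variety_isomorphic[OF _ X] by blast
qed

lemma rep_var_class_variety: "is_variety (rep_var_class c)"
  using Quotient3_rep_reflp[OF Quotient3_var_class] by blast

lemma abs_var_class_eq:
  "is_variety X \<Longrightarrow> is_variety Y \<Longrightarrow> isomorphic X Y \<Longrightarrow> abs_var_class X = abs_var_class Y"
  using Quotient3_rel_abs[OF Quotient3_var_class] by blast

text \<open>Isomorphic spaces, even over different point types, satisfy the same predicate under
  \<open>SOME\<close>, so the same model is selected.\<close>

lemma iso_class_cong:
  fixes X :: "'a fspace" and Y :: "'b fspace"
  assumes "isomorphic X Y"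
  shows "iso_class X = iso_class Y"
proof -
  have "(\<lambda>Z :: (nat \<Rightarrow> complex) fspace. is_variety Z \<and> isomorphic X Z) = (\<lambda>Z. is_variety Z \<and> isomorphic Y Z)"
    by (intro ext iffI; elim conjE; intro conjI; (assumption |
          erule isomorphic_trans[OF assms] isomorphic_trans[OF isomorphic_sym[OF assms]]))
  then show ?thesis unfolding iso_class_def by simp
qed

lemma iso_class_model:
  fixes Z :: "(nat \<Rightarrow> complex) fspace"
  assumes "is_variety Z" "isomorphic X Z"
  shows "iso_class X = abs_var_class Z"
proof -
  let ?S = "SOME Z :: (nat \<Rightarrow> complex) fspace. is_variety Z \<and> isomorphic X Z"
  have S: "is_variety ?S \<and> isomorphic X ?S"
    by (rule someI[of "\<lambda>Z. is_variety Z \<and> isomorphic X Z" Z]) (use assms in blast)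
  show ?thesis
    unfolding iso_class_def
    by (rule abs_var_class_eq[OF conjunct1[OF S] assms(1)
          isomorphic_trans[OF isomorphic_sym[OF conjunct2[OF S]] assms(2)]])
qed

lemma iso_class_rep: "iso_class (rep_var_class c) = c"
  using iso_class_model[OF rep_var_class_variety isomorphic_refl]
    Quotient3_abs_rep[OF Quotient3_var_class] by metis

lemma isomorphic_rep_iso_class:
  assumes "is_variety X"
  shows "isomorphic X (rep_var_class (iso_class X))"
proof -
  obtain Z :: "(nat \<Rightarrow> complex) fspace" where Z: "is_variety Z" "isomorphic X Z"
    using variety_model[OF assms] by blast
  have "abs_var_class Z = abs_var_class (rep_var_class (abs_var_class Z))"
    using Quotient3_abs_rep[OF Quotient3_var_class] by metis
  then have "isomorphic Z (rep_var_class (abs_var_class Z))"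
    using Quotient3_rel[OF Quotient3_var_class, of Z "rep_var_class (abs_var_class Z)"]
      Z(1) rep_var_class_variety isomorphic_refl[of Z]
      isomorphic_refl[of "rep_var_class (abs_var_class Z)"] by blast
  then show ?thesis using iso_class_model[OF Z] isomorphic_trans[OF Z(2)] by simp
qed

text \<open>The generating relations live over the point type \<open>nat => complex\<close>. A model
  of \<open>X\<close> carries the open set and its complement there, so the relation becomes
  available over every point type.\<close>

lemma scissor_relation_variety:
  assumes X: "is_variety X" and U: "openin (zariski_top X) U" and V: "is_variety (induced X U)"
  shows "frag_of (iso_class X) - frag_of (iso_class (induced X U)) -
    frag_of (iso_class (induced X (points X - U))) \<in> scissor_relations"
proof -
  obtain Z :: "(nat \<Rightarrow> complex) fspace" where Z: "is_variety Z" "isomorphic X Z"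
    using variety_model[OF X] by blast
  obtain \<phi> \<psi> where 1: "morphism X Z \<phi>" "morphism Z X \<psi>"
      "\<forall>x \<in> points X. \<psi> (\<phi> x) = x" "\<forall>y \<in> points Z. \<phi> (\<psi> y) = y"
    using Z(2) unfolding isomorphic_def by blast
  note fs = is_variety_fun_space[OF X] is_variety_fun_space[OF Z(1)]
  let ?U = "{z \<in> points Z. \<psi> z \<in> U}"
  have i: "isomorphic (induced X U) (induced Z ?U)"
    by (rule isomorphic_induced[OF fs morphism_restrict[OF 1(1)] morphism_restrict[OF 1(2)]])
      (use 1 morphism_points[OF 1(1)] in auto)
  have i': "isomorphic (induced X (points X - U)) (induced Z (points Z - ?U))"
    by (rule isomorphic_induced[OF fs morphism_restrict[OF 1(1)] morphism_restrict[OF 1(2)]])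
      (use 1 morphism_points[OF 1(1)] morphism_points[OF 1(2)] in auto)
  have "frag_of (iso_class Z) - frag_of (iso_class (induced Z ?U)) -
      frag_of (iso_class (induced Z (points Z - ?U))) \<in> scissor_relations"
    by (rule scissor_relations.relation[OF Z(1)
          is_variety_isomorphic[OF i V fun_space_induced[OF fs(2)]] morphism_preimage_open[OF 1(2) U]])
  then show ?thesis
    using iso_class_cong[OF Z(2)] iso_class_cong[OF i] iso_class_cong[OF i'] by simp
qed

section \<open>The product on the Grothendieck ring\<close>

lemma frag_extend_add_right:
  "frag_extend (\<lambda>c. f c + g c) a = frag_extend f a + frag_extend g a"
  unfolding frag_extend_def by (simp add: frag_cmul_distrib2 sum.distrib)

lemma frag_extend_diff_right:
  "frag_extend (\<lambda>c. f c - g c) a = frag_extend f a - frag_extend g a"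
  using frag_extend_add_right[of "\<lambda>c. f c - g c" g a] by (simp add: algebra_simps)

lemma free_mult_of [simp]: "free_mult (frag_of c) (frag_of d) =
    frag_of (iso_class (fproduct (rep_var_class c) (rep_var_class d)))"
  by (simp add: free_mult_def)

lemma free_mult_diff_left: "free_mult (a - a') b = free_mult a b - free_mult a' b"
  by (simp add: free_mult_def frag_extend_diff)

lemma free_mult_diff_right: "free_mult a (b - b') = free_mult a b - free_mult a b'"
  by (simp add: free_mult_def frag_extend_diff frag_extend_diff_right)

lemma free_mult_zero [simp]: "free_mult 0 b = 0" "free_mult a 0 = 0"
  using free_mult_diff_left[of 0 0 b] free_mult_diff_right[of a 0 0] by simp_all

lemma free_mult_add_left: "free_mult (a + a') b = free_mult a b + free_mult a' b"
  using free_mult_diff_left[of "a + a'" a' b] by (simp add: algebra_simps)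

lemma free_mult_minus_left: "free_mult (- a) b = - free_mult a b"
  using free_mult_diff_left[of 0 a b] by simp

text \<open>Identities additive in an argument reduce to basis elements; differences suffice to
  reach everything else.\<close>

lemma frag_induct [case_names zero of diff]:
  assumes "P 0" "\<And>x. P (frag_of x)" "\<And>a b. P a \<Longrightarrow> P b \<Longrightarrow> P (a - b)"
  shows "P c"
  by (rule frag_induction[of c UNIV]) (use assms in auto)

lemma isomorphic_fproduct_rep:
  assumes "is_variety X" "is_variety Y"
  shows "isomorphic (fproduct (rep_var_class (iso_class X)) (rep_var_class (iso_class Y)))
    (fproduct X Y)"
  by (intro isomorphic_fproduct is_variety_fun_space rep_var_class_variety assms
      isomorphic_sym[OF isomorphic_rep_iso_class])

lemma free_mult_commute: "free_mult a b = free_mult b a"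
proof (induction a rule: frag_induct)
  case (of c)
  show ?case
  proof (induction b rule: frag_induct)
    case (of d)
    show ?case
      unfolding free_mult_of
      by (intro arg_cong[where f = frag_of] iso_class_cong isomorphic_fproduct_commute
          is_variety_fun_space rep_var_class_variety)
  qed (simp_all add: free_mult_diff_left free_mult_diff_right)
qed (simp_all add: free_mult_diff_left free_mult_diff_right)

lemma free_mult_assoc: "free_mult (free_mult a b) c = free_mult a (free_mult b c)"
proof (induction a rule: frag_induct)
  case (of x)
  show ?case
  proof (induction b rule: frag_induct)
    case (of y)
    show ?case
    proof (induction c rule: frag_induct)
      case (of z)
      let ?X = "rep_var_class x" and ?Y = "rep_var_class y" and ?Z = "rep_var_class z"
      note v = rep_var_class_variety[of x] rep_var_class_variety[of y] rep_var_class_variety[of z]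
      note f = v[THEN is_variety_fun_space]
      note vp = is_variety_fproduct[OF v(1,2)] is_variety_fproduct[OF v(2,3)]
      have 1: "isomorphic (fproduct (rep_var_class (iso_class (fproduct ?X ?Y))) ?Z) (fproduct (fproduct ?X ?Y) ?Z)"
        by (intro isomorphic_fproduct is_variety_fun_space rep_var_class_variety vp v isomorphic_refl
            isomorphic_sym[OF isomorphic_rep_iso_class])
      have 2: "isomorphic (fproduct (fproduct ?X ?Y) ?Z) (fproduct ?X (fproduct ?Y ?Z))"
        by (intro isomorphic_fproduct_assoc f)
      have 3: "isomorphic (fproduct ?X (fproduct ?Y ?Z)) (fproduct ?X (rep_var_class (iso_class (fproduct ?Y ?Z))))"
        by (intro isomorphic_fproduct is_variety_fun_space rep_var_class_variety vp v isomorphic_refl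
            isomorphic_rep_iso_class)
      from iso_class_cong[OF isomorphic_trans[OF isomorphic_trans[OF 1 2] 3]]
      show ?case by simp
    qed (simp_all add: free_mult_diff_left free_mult_diff_right)
  qed (simp_all add: free_mult_diff_left free_mult_diff_right)
qed (simp_all add: free_mult_diff_left free_mult_diff_right)

lemma scissor_relations_diff:
  "a \<in> scissor_relations \<Longrightarrow> b \<in> scissor_relations \<Longrightarrow> a - b \<in> scissor_relations"
  using scissor_relations.add[OF _ scissor_relations.uminus[of b], of a] by simp

text \<open>The complement of \<open>U x D\<close> in \<open>Z x D\<close> is
  \<open>(Z - U) x D\<close>, so multiplication by a variety \<open>D\<close> sends the relation for
  \<open>U\<close> in \<open>Z\<close> to a relation of the same kind. Additivity extends this to
  all elements.\<close>

lemma free_mult_scissor: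
  assumes "r \<in> scissor_relations"
  shows "free_mult r b \<in> scissor_relations"
  using assms
proof induction
  case (relation Z U)
  show ?case
  proof (induction b rule: frag_induct)
    case (of d)
    let ?D = "rep_var_class d"
    let ?P = "fproduct Z ?D" and ?C = "points Z - U"
    note v = relation(1) rep_var_class_variety[of d]
    note f = v[THEN is_variety_fun_space]
    have "openin (zariski_top ?P) {p \<in> points ?P. fst p \<in> U}"
      by (rule morphism_preimage_open[OF morphism_fst relation(3)])
    moreover have UZ: "U \<subseteq> points Z" using relation(3) by (rule openin_subset)
    ultimately have o: "openin (zariski_top ?P) (U \<times> points ?D)"
      by (auto elim!: back_subst[of "openin (zariski_top ?P)"])
    have C: "is_variety (induced Z ?C)"
      by (rule is_variety_closed[OF relation(1)]) (use relation(3) in blast)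
    have ip: "isomorphic (fproduct (induced Z S) ?D) (induced ?P (S \<times> points ?D))" for S
    proof -
      have "isomorphic (fproduct (induced Z S) ?D) (fproduct (induced Z S) (induced ?D (points ?D)))"
        by (intro isomorphic_fproduct fun_space_induced f isomorphic_refl
            isomorphic_sym[OF isomorphic_induced_points])
      then show ?thesis
        using isomorphic_fproduct_induced[OF f] by (rule isomorphic_trans)
    qed
    have e: "iso_class (fproduct (rep_var_class (iso_class S)) ?D) = iso_class (fproduct S ?D)"
      if "is_variety S" for S :: "(nat \<Rightarrow> complex) fspace"
      by (intro iso_class_cong isomorphic_fproduct is_variety_fun_space rep_var_class_variety that
          isomorphic_refl isomorphic_sym[OF isomorphic_rep_iso_class])
    have c: "points ?P - U \<times> points ?D = ?C \<times> points ?D" by auto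
    have "is_variety (induced ?P (U \<times> points ?D))"
      by (rule is_variety_isomorphic[OF ip is_variety_fproduct[OF relation(2) v(2)]])
        (intro fun_space_induced fun_space_fproduct f)
    from scissor_relation_variety[OF is_variety_fproduct[OF v] o this]
    show ?case
      unfolding c iso_class_cong[OF ip, symmetric]
      by (simp add: free_mult_diff_left e[OF relation(1)] e[OF relation(2)] e[OF C])
  qed (simp_all add: free_mult_diff_right scissor_relations.zero scissor_relations_diff)
qed (simp_all add: free_mult_add_left free_mult_minus_left scissor_relations.intros)

text \<open>For representatives \<open>r\<close>, \<open>s\<close> of the classes of
  \<open>a\<close>, \<open>b\<close>, the products differ by \<open>(r - a) s + a (s - b)\<close>.
  Both terms are relations, the second by commutativity, so the choices made by
  \<open>rep_K0\<close> do not matter.\<close>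

lemma times_K0_abs: "abs_K0 a * abs_K0 b = abs_K0 (free_mult a b)"
proof -
  have "rep_K0 (abs_K0 c) - c \<in> scissor_relations" for c
    using Quotient3_rep_abs[OF Quotient3_K0, of c] scissor_relations.zero by simp
  then have "free_mult (rep_K0 (abs_K0 a) - a) (rep_K0 (abs_K0 b)) \<in> scissor_relations"
      "free_mult (rep_K0 (abs_K0 b) - b) a \<in> scissor_relations"
    using free_mult_scissor by blast+
  then have "free_mult (rep_K0 (abs_K0 a) - a) (rep_K0 (abs_K0 b)) +
      free_mult a (rep_K0 (abs_K0 b) - b) \<in> scissor_relations"
    using scissor_relations.add free_mult_commute by metis
  then have "free_mult (rep_K0 (abs_K0 a)) (rep_K0 (abs_K0 b)) - free_mult a b \<in> scissor_relations"
    by (simp add: free_mult_diff_left free_mult_diff_right)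
  then show ?thesis unfolding times_K0_def K0.abs_eq_iff .
qed

lemma K0_class_cong: "isomorphic X Y \<Longrightarrow> K0_class X = K0_class Y"
  unfolding K0_class_def by (simp add: iso_class_cong)

lemma K0_class_fproduct:
  assumes "is_variety X" "is_variety Y"
  shows "K0_class (fproduct X Y) = K0_class X * K0_class Y"
  unfolding K0_class_def times_K0_abs free_mult_of
  using iso_class_cong[OF isomorphic_fproduct_rep[OF assms]] by simp

lemma isomorphic_point_fproduct:
  assumes X: "fun_space X"
  shows "isomorphic (fproduct (affine_space 0) X) X"
proof (rule isomorphicI[OF morphism_snd])
  show "morphism X (fproduct (affine_space 0) X) (\<lambda>x. (\<lambda>_. 0, x))"
    by (intro morphism_pair morphism_affine fun_space_affine X morphism_id[unfolded id_def])
      (auto simp: affine_points_def)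
qed (auto simp: affine_points_def)

instance K0 :: "{comm_ring, comm_monoid_mult}"
proof
  fix a b c :: K0
  define a' b' c' where "a' = rep_K0 a" "b' = rep_K0 b" "c' = rep_K0 c"
  then have abc: "a = abs_K0 a'" "b = abs_K0 b'" "c = abs_K0 c'"
    by (simp_all add: Quotient3_abs_rep[OF Quotient3_K0])
  show "a * b * c = a * (b * c)"
    unfolding abc times_K0_abs free_mult_assoc ..
  show "a * b = b * a"
    unfolding abc times_K0_abs free_mult_commute[of a'] ..
  show "(a + b) * c = a * c + b * c"
    unfolding abc times_K0_abs plus_K0.abs_eq free_mult_add_left ..
  have "free_mult (frag_of (iso_class (affine_space 0))) a' = a'"
  proof (induction a' rule: frag_induct)
    case (of x)
    have "isomorphic (fproduct (rep_var_class (iso_class (affine_space 0))) (rep_var_class x))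
        (fproduct (affine_space 0) (rep_var_class x))"
      by (intro isomorphic_fproduct is_variety_fun_space rep_var_class_variety is_variety_affine
          isomorphic_refl isomorphic_sym[OF isomorphic_rep_iso_class])
    also note isomorphic_point_fproduct[OF is_variety_fun_space[OF rep_var_class_variety[of x]]]
    finally (isomorphic_trans) show ?case by (simp add: iso_class_cong iso_class_rep)
  qed (simp_all add: free_mult_diff_right)
  then show "1 * a = a"
    unfolding one_K0_def K0_class_def abc times_K0_abs by simp
qed

lemma K0_class_scissor:
  assumes X: "is_variety X" and U: "openin (zariski_top X) U" and V: "is_variety (induced X U)"
  shows "K0_class X = K0_class (induced X U) + K0_class (induced X (points X - U))"
proof -
  have "frag_of (iso_class X) - (frag_of (iso_class (induced X U)) +
      frag_of (iso_class (induced X (points X - U)))) \<in> scissor_relations"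
    using scissor_relation_variety[OF assms] by (simp add: algebra_simps)
  then show ?thesis unfolding K0_class_def plus_K0.abs_eq K0.abs_eq_iff .
qed

section \<open>Stratifications\<close>

text \<open>Local closedness is not demanded separately: the induced structure itself has to be a
  variety. \<open>K0_class\<close> is defined for every space but is under control only for
  varieties, hence this predicate accompanies each class computation.\<close>

definition subvariety :: "'a fspace \<Rightarrow> 'a set \<Rightarrow> bool"
  where "subvariety X S \<longleftrightarrow> fun_space X \<and> S \<subseteq> points X \<and> is_variety (induced X S)"

definition sclass :: "'a fspace \<Rightarrow> 'a set \<Rightarrow> K0"
  where "sclass X S = K0_class (induced X S)"

lemma subvarietyD:
  assumes "subvariety X S"
  shows "fun_space X" "S \<subseteq> points X" "is_variety (induced X S)"
  using assms unfolding subvariety_def by simp_all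

lemma points_induced_subvariety: "subvariety X S \<Longrightarrow> points (induced X S) = S"
  unfolding subvariety_def by auto

text \<open>Variety status and class are transferred together, so a stratum given by a
  parametrisation needs no separate description by equations.\<close>

lemma subvariety_isoI:
  assumes S: "subvariety X S" and Y: "fun_space Y" "T \<subseteq> points Y"
    and \<phi>: "morphism (induced X S) Y \<phi>" and \<psi>: "morphism (induced Y T) X \<psi>"
    and "\<And>x. x \<in> S \<Longrightarrow> \<phi> x \<in> T \<and> \<psi> (\<phi> x) = x" "\<And>y. y \<in> T \<Longrightarrow> \<psi> y \<in> S \<and> \<phi> (\<psi> y) = y"
  shows "subvariety Y T" "sclass Y T = sclass X S"
proof -
  have i: "isomorphic (induced X S) (induced Y T)"
    by (rule isomorphic_induced[OF subvarietyD(1)[OF S] Y(1) \<phi> \<psi>]) (use assms(6,7) in auto)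
  show "sclass Y T = sclass X S" unfolding sclass_def by (rule K0_class_cong[OF i, symmetric])
  show "subvariety Y T"
    unfolding subvariety_def
    using is_variety_isomorphic[OF i subvarietyD(3)[OF S] fun_space_induced[OF Y(1)]] Y by simp
qed

lemma subvariety_points:
  assumes "is_variety X"
  shows "subvariety X (points X)" "sclass X (points X) = K0_class X"
proof -
  note f = is_variety_fun_space[OF assms]
  note i = isomorphic_induced_points[OF f]
  show "subvariety X (points X)"
    unfolding subvariety_def
    using is_variety_isomorphic[OF isomorphic_sym[OF i] assms fun_space_induced[OF f]] f by simp
  show "sclass X (points X) = K0_class X"
    unfolding sclass_def by (rule K0_class_cong[OF i])
qed

text \<open>Restriction in stages: cuts are made inside \<open>induced X S\<close>, while the pieces
  are wanted as subsets of \<open>X\<close>.\<close>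

lemma is_variety_induced_induced:
  assumes X: "fun_space X" and V: "is_variety (induced (induced X S) T)" and "T \<subseteq> S"
  shows "is_variety (induced X T)" "K0_class (induced (induced X S) T) = sclass X T"
proof -
  have i: "isomorphic (induced (induced X S) T) (induced X T)"
    using isomorphic_induced_induced[OF X, of S T] assms(3) by (simp add: Int_absorb1)
  show "is_variety (induced X T)"
    by (rule is_variety_isomorphic[OF i V fun_space_induced[OF X]])
  show "K0_class (induced (induced X S) T) = sclass X T"
    unfolding sclass_def by (rule K0_class_cong[OF i])
qed

lemma subvariety_zeros:
  assumes S: "subvariety X S" and F: "F \<subseteq> gfun (induced X S)"
  shows "subvariety X {x \<in> S. \<forall>f\<in>F. f x = 0}"
proof -
  note f = subvarietyD(1)[OF S]
  have "closedin (zariski_top (induced X S)) {x \<in> S. \<forall>f\<in>F. f x = 0}"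
    using closedin_zeros[OF fun_space_induced[OF f] F] unfolding points_induced_subvariety[OF S] .
  then have "is_variety (induced (induced X S) {x \<in> S. \<forall>f\<in>F. f x = 0})"
    by (rule is_variety_closed[OF subvarietyD(3)[OF S]])
  from is_variety_induced_induced(1)[OF f this] show ?thesis
    unfolding subvariety_def using S unfolding subvariety_def by auto
qed

text \<open>In the counts the scissor relation is used only in this form: the zeros of one function
  are closed, and its nonvanishing locus is a variety by \<open>is_variety_nonzero\<close>.\<close>

lemma subvariety_cut:
  assumes S: "subvariety X S" and f: "f \<in> gfun (induced X S)"
  shows "subvariety X {x \<in> S. f x = 0}" "subvariety X {x \<in> S. f x \<noteq> 0}"
    "sclass X S = sclass X {x \<in> S. f x \<noteq> 0} + sclass X {x \<in> S. f x = 0}"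
proof -
  note fs = subvarietyD(1)[OF S] and pS = points_induced_subvariety[OF S]
  have eq: "{x \<in> S. \<forall>g\<in>{f}. g x = 0} = {x \<in> S. f x = 0}" by auto
  show Z: "subvariety X {x \<in> S. f x = 0}"
    using subvariety_zeros[OF S, of "{f}"] f unfolding eq by simp
  have U: "is_variety (induced (induced X S) {x \<in> S. f x \<noteq> 0})"
    using is_variety_nonzero[OF subvarietyD(3)[OF S] f] unfolding pS .
  note U1 = is_variety_induced_induced[OF fs U]
  show "subvariety X {x \<in> S. f x \<noteq> 0}"
    unfolding subvariety_def using U1(1) S unfolding subvariety_def by auto
  have "openin (zariski_top (induced X S)) {x \<in> S. f x \<noteq> 0}"
    using fun_space_nonzero_open[OF fun_space_induced[OF fs] openin_topspace f[unfolded gfun_def]]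
    unfolding pS .
  from K0_class_scissor[OF subvarietyD(3)[OF S] this U]
  have "sclass X S = K0_class (induced (induced X S) {x \<in> S. f x \<noteq> 0}) +
      K0_class (induced (induced X S) (S - {x \<in> S. f x \<noteq> 0}))"
    unfolding pS sclass_def .
  moreover have "S - {x \<in> S. f x \<noteq> 0} = {x \<in> S. f x = 0}" by auto
  moreover have "K0_class (induced (induced X S) {x \<in> S. f x \<noteq> 0}) = sclass X {x \<in> S. f x \<noteq> 0}"
    by (rule U1(2)) auto
  moreover have "K0_class (induced (induced X S) {x \<in> S. f x = 0}) = sclass X {x \<in> S. f x = 0}"
    unfolding sclass_def
    using K0_class_cong[OF isomorphic_induced_induced[OF fs, of S "{x \<in> S. f x = 0}"]]
    by (simp add: Int_absorb1)
  ultimately show "sclass X S = sclass X {x \<in> S. f x \<noteq> 0} + sclass X {x \<in> S. f x = 0}"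
    by simp
qed

lemma subvariety_empty:
  assumes X: "fun_space X"
  shows "subvariety X {}" "sclass X {} = 0"
proof -
  note f = fun_space_induced[OF X, of "{}"]
  have "{(x, x) |x. x \<in> points (induced X {})} = {}" by auto
  then have "is_variety (induced X {})"
    by (intro is_varietyI[OF f, of "{}"]) auto
  then show *: "subvariety X {}" unfolding subvariety_def using X by simp
  \<comment> \<open>Cutting the empty set along a function gives \<open>c = c + c\<close> for its
    class \<open>c\<close>.\<close>
  have "(\<lambda>_. 0) \<in> gfun (induced X {})" by (rule gfun_const[OF f])
  from subvariety_cut(3)[OF * this] show "sclass X {} = 0" by simp
qed

lemma subvariety_times:
  assumes S: "subvariety X S" and T: "subvariety Y T"
  shows "subvariety (fproduct X Y) (S \<times> T)" "sclass (fproduct X Y) (S \<times> T) = sclass X S * sclass Y T"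
proof -
  note f = subvarietyD(1)[OF S] subvarietyD(1)[OF T]
  note i = isomorphic_fproduct_induced[OF f, of S T]
  note v = subvarietyD(3)[OF S] subvarietyD(3)[OF T]
  show "subvariety (fproduct X Y) (S \<times> T)"
    unfolding subvariety_def
    using is_variety_isomorphic[OF i is_variety_fproduct[OF v]] fun_space_induced fun_space_fproduct[OF f]
      subvarietyD(2)[OF S] subvarietyD(2)[OF T] by auto
  show "sclass (fproduct X Y) (S \<times> T) = sclass X S * sclass Y T"
    unfolding sclass_def using K0_class_cong[OF i] K0_class_fproduct[OF v] by simp
qed

lemma gfun_mono: "subvariety X S \<Longrightarrow> f \<in> gfun (induced X S) \<Longrightarrow> T \<subseteq> S \<Longrightarrow> f \<in> gfun (induced X T)"
  by (rule gfun_induced_subset[OF subvarietyD(1)])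

section \<open>Fibrations over stratified bases\<close>

text \<open>Each function cuts only the common zero locus of its predecessors, so one application of
  \<open>subvariety_cut\<close> per function suffices.\<close>

lemma stratify_sum:
  fixes f :: "nat \<Rightarrow> 'a \<Rightarrow> complex"
  assumes S: "subvariety X S" and f: "\<forall>k<n. f k \<in> gfun (induced X S)"
  shows "subvariety X {x \<in> S. \<forall>i<n. f i x = 0}"
    "\<And>k. k < n \<Longrightarrow> subvariety X {x \<in> S. f k x \<noteq> 0 \<and> (\<forall>i<k. f i x = 0)}"
    "sclass X S = (\<Sum>k<n. sclass X {x \<in> S. f k x \<noteq> 0 \<and> (\<forall>i<k. f i x = 0)}) +
      sclass X {x \<in> S. \<forall>i<n. f i x = 0}"
proof -
  have "subvariety X {x \<in> S. \<forall>i<n. f i x = 0} \<and>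
    (\<forall>k<n. subvariety X {x \<in> S. f k x \<noteq> 0 \<and> (\<forall>i<k. f i x = 0)}) \<and>
    sclass X S = (\<Sum>k<n. sclass X {x \<in> S. f k x \<noteq> 0 \<and> (\<forall>i<k. f i x = 0)}) +
      sclass X {x \<in> S. \<forall>i<n. f i x = 0}"
    using f
  proof (induction n)
    case 0
    then show ?case using S by simp
  next
    case (Suc n)
    then have IH: "subvariety X {x \<in> S. \<forall>i<n. f i x = 0}"
      "\<forall>k<n. subvariety X {x \<in> S. f k x \<noteq> 0 \<and> (\<forall>i<k. f i x = 0)}"
      "sclass X S = (\<Sum>k<n. sclass X {x \<in> S. f k x \<noteq> 0 \<and> (\<forall>i<k. f i x = 0)}) +
        sclass X {x \<in> S. \<forall>i<n. f i x = 0}" by auto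
    have "f n \<in> gfun (induced X {x \<in> S. \<forall>i<n. f i x = 0})"
      by (rule gfun_mono[OF S Suc.prems[rule_format]]) auto
    note c = subvariety_cut[OF IH(1) this]
    have e: "{x \<in> {x \<in> S. \<forall>i<n. f i x = 0}. f n x = 0} = {x \<in> S. \<forall>i<Suc n. f i x = 0}"
      "{x \<in> {x \<in> S. \<forall>i<n. f i x = 0}. f n x \<noteq> 0} = {x \<in> S. f n x \<noteq> 0 \<and> (\<forall>i<n. f i x = 0)}"
      by (auto simp: less_Suc_eq)
    show ?case using c IH unfolding e by (auto simp: less_Suc_eq)
  qed
  then show "subvariety X {x \<in> S. \<forall>i<n. f i x = 0}"
    "\<And>k. k < n \<Longrightarrow> subvariety X {x \<in> S. f k x \<noteq> 0 \<and> (\<forall>i<k. f i x = 0)}"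
    "sclass X S = (\<Sum>k<n. sclass X {x \<in> S. f k x \<noteq> 0 \<and> (\<forall>i<k. f i x = 0)}) +
      sclass X {x \<in> S. \<forall>i<n. f i x = 0}" by blast+
qed

text \<open>Here \<open>c\<close> is the class of the fibre wherever some \<open>f k\<close> is
  nonzero. The product formula \<open>piece\<close> is asked for all subvarieties of the locus
  \<open>f k \<noteq> 0\<close>, since the strata are smaller than that locus. Nothing is assumed
  over the common zeros, whose preimage is left as a remainder.\<close>

lemma stratify_fibration:
  fixes f :: "nat \<Rightarrow> 'a \<Rightarrow> complex"
  assumes S: "subvariety X S" and E: "subvariety Y E"
    and p: "morphism (induced Y E) X p" "\<And>y. y \<in> E \<Longrightarrow> p y \<in> S"
    and f: "\<forall>k<n. f k \<in> gfun (induced X S)"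
    and piece: "\<And>T k. k < n \<Longrightarrow> subvariety X T \<Longrightarrow> T \<subseteq> S \<Longrightarrow> (\<And>x. x \<in> T \<Longrightarrow> f k x \<noteq> 0) \<Longrightarrow>
      sclass Y {y \<in> E. p y \<in> T} = c * sclass X T"
  shows "sclass Y E = c * (sclass X S - sclass X {x \<in> S. \<forall>i<n. f i x = 0}) +
      sclass Y {y \<in> E. p y \<in> {x \<in> S. \<forall>i<n. f i x = 0}}"
    "subvariety Y {y \<in> E. p y \<in> {x \<in> S. \<forall>i<n. f i x = 0}}"
proof -
  have pS: "morphism (induced Y E) (induced X S) p"
    by (rule morphism_into_induced[OF fun_space_induced[OF subvarietyD(1)[OF E]] p(1)])
      (use p(2) in auto)
  have fp: "\<forall>k<n. (\<lambda>y. f k (p y)) \<in> gfun (induced Y E)"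
    by (intro allI impI gfun_pullback[OF pS] f[rule_format])
  have e: "{y \<in> E. p y \<in> {x \<in> S. P x}} = {y \<in> E. P (p y)}" for P
    using p(2) by auto
  note 1 = stratify_sum[of X S n f, OF S f] and 2 = stratify_sum[of Y E n "\<lambda>k y. f k (p y)", OF E fp]
  have "sclass Y {y \<in> E. f k (p y) \<noteq> 0 \<and> (\<forall>i<k. f i (p y) = 0)} =
      c * sclass X {x \<in> S. f k x \<noteq> 0 \<and> (\<forall>i<k. f i x = 0)}" if k: "k < n" for k
  proof -
    let ?T = "{x \<in> S. f k x \<noteq> 0 \<and> (\<forall>i<k. f i x = 0)}"
    have "sclass Y {y \<in> E. p y \<in> ?T} = c * sclass X ?T"
      by (rule piece[OF k 1(2)[OF k]]) auto
    moreover have "{y \<in> E. p y \<in> ?T} = {y \<in> E. f k (p y) \<noteq> 0 \<and> (\<forall>i<k. f i (p y) = 0)}"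
      by (rule e)
    ultimately show ?thesis by simp
  qed
  then have "sclass Y E = (\<Sum>k<n. c * sclass X {x \<in> S. f k x \<noteq> 0 \<and> (\<forall>i<k. f i x = 0)}) +
      sclass Y {y \<in> E. \<forall>i<n. f i (p y) = 0}"
    using 2(3) by simp
  also have "(\<Sum>k<n. c * sclass X {x \<in> S. f k x \<noteq> 0 \<and> (\<forall>i<k. f i x = 0)}) =
      c * (sclass X S - sclass X {x \<in> S. \<forall>i<n. f i x = 0})"
    using 1(3) by (simp add: sum_distrib_left)
  finally show "sclass Y E = c * (sclass X S - sclass X {x \<in> S. \<forall>i<n. f i x = 0}) +
      sclass Y {y \<in> E. p y \<in> {x \<in> S. \<forall>i<n. f i x = 0}}"
    unfolding e[of "\<lambda>x. \<forall>i<n. f i x = 0"] .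
  show "subvariety Y {y \<in> E. p y \<in> {x \<in> S. \<forall>i<n. f i x = 0}}"
    unfolding e[of "\<lambda>x. \<forall>i<n. f i x = 0"] using 2(1) .
qed

section \<open>Coordinate subspaces and linear elimination\<close>

text \<open>Indexed by a set of places and not by a dimension, so that pivots can be deleted
  anywhere without renumbering.\<close>

definition coord :: "nat set \<Rightarrow> (nat \<Rightarrow> complex) set"
  where "coord J = {v. \<forall>i. i \<notin> J \<longrightarrow> v i = 0}"

lemma coord_subset: "J \<subseteq> {..<n} \<Longrightarrow> coord J \<subseteq> affine_points n"
  unfolding coord_def affine_points_def by auto

lemma coord_lessThan: "coord {..<n} = points (affine_space n)"
  unfolding coord_def by (auto simp: affine_points_def)

lemma morphism_affine_space:
  assumes "fun_space Z" "\<And>z. z \<in> points Z \<Longrightarrow> \<phi> z \<in> affine_points n"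
    "\<And>i. i < n \<Longrightarrow> (\<lambda>z. \<phi> z i) \<in> gfun Z"
  shows "morphism Z (affine_space n) \<phi>"
  by (rule morphism_affine) (use assms in auto)

lemma gfun_if: "(P \<Longrightarrow> f \<in> gfun X) \<Longrightarrow> (\<not> P \<Longrightarrow> g \<in> gfun X) \<Longrightarrow> (\<lambda>x. if P then f x else g x) \<in> gfun X"
  by (cases P) auto

lemma gfun_coord_induced: "(\<lambda>v. v i) \<in> gfun (induced (affine_space n) S)"
  by (rule gfun_induced[OF gfun_coord])

text \<open>One affine line is split off for each place in \<open>J\<close>: coordinate
  \<open>q\<close> moves to a separate factor.\<close>

lemma coord_class:
  assumes "J \<subseteq> {..<n}"
  shows "subvariety (affine_space n) (coord J)" "sclass (affine_space n) (coord J) = L ^ card J"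
proof -
  let ?A = "affine_space n" and ?B = "affine_space 1" and ?C = "affine_space 0"
  have "finite J" using assms finite_subset by blast
  then have "subvariety ?A (coord J) \<and> sclass ?A (coord J) = L ^ card J"
    using assms
  proof (induction J)
    case empty
    note pt = subvariety_points[OF is_variety_affine[of 0]]
    have m: "morphism (induced ?C (points ?C)) ?A (\<lambda>x. x)" "morphism (induced ?A (coord {})) ?C (\<lambda>x. x)"
      by (intro morphism_affine_space fun_space_induced fun_space_affine gfun_coord_induced;
          auto simp: affine_points_def coord_def)+
    note * = subvariety_isoI[OF pt(1) fun_space_affine _ m]
    have "subvariety ?A (coord {})" "sclass ?A (coord {}) = sclass ?C (points ?C)"
      by (rule *; auto simp: affine_points_def coord_def)+
    then show ?case using pt(2) by (simp add: one_K0_def)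
  next
    case (insert q J)
    then have IH: "subvariety ?A (coord J)" "sclass ?A (coord J) = L ^ card J"
      and q: "q < n" "q \<notin> J" "J \<subseteq> {..<n}" by auto
    have qn: "i \<noteq> q \<and> i \<notin> J" if "n \<le> i" for i using q that by auto
    note A1 = subvariety_points[OF is_variety_affine[of 1]]
    note P = subvariety_times[OF A1(1) IH(1)]
    let ?P = "fproduct ?B ?A" and ?S = "points ?B \<times> coord J"
    have f: "fun_space ?P" by (intro fun_space_fproduct fun_space_affine)
    have "subvariety ?A (coord (insert q J)) \<and> sclass ?A (coord (insert q J)) = sclass ?P ?S"
    proof (rule conjI)
      let ?\<phi> = "\<lambda>(p :: (nat \<Rightarrow> complex) \<times> (nat \<Rightarrow> complex)) i. if i = q then fst p 0 else snd p i"
      let ?\<psi> = "\<lambda>v :: nat \<Rightarrow> complex. (\<lambda>i. if i = (0::nat) then v q else 0, \<lambda>i. if i = q then 0 else v i)"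
      have \<phi>: "morphism (induced ?P ?S) ?A ?\<phi>"
      proof (rule morphism_affine_space[OF fun_space_induced[OF f]])
        show "?\<phi> p \<in> affine_points n" if "p \<in> points (induced ?P ?S)" for p
          using that q by (auto simp: affine_points_def coord_def)
        show "(\<lambda>p. ?\<phi> p i) \<in> gfun (induced ?P ?S)" for i
          by (intro gfun_if gfun_induced gfun_coord_pullback[OF morphism_fst]
              gfun_coord_pullback[OF morphism_snd])
      qed
      have \<psi>: "morphism (induced ?A (coord (insert q J))) ?P ?\<psi>"
        by (intro morphism_pair fun_space_affine fun_space_induced morphism_affine_space gfun_if
            gfun_coord_induced gfun_const) (auto simp: affine_points_def)
      note * = subvariety_isoI[OF P(1) fun_space_affine _ \<phi> \<psi>]
      show "subvariety ?A (coord (insert q J))"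
        by (rule *) (use q qn in \<open>auto simp: coord_def affine_points_def fun_eq_iff\<close>)
      show "sclass ?A (coord (insert q J)) = sclass ?P ?S"
        by (rule *) (use q qn in \<open>auto simp: coord_def affine_points_def fun_eq_iff\<close>)
    qed
    then show ?case
      using P(2) A1(2) IH(2) insert.hyps by (simp add: L_def)
  qed
  then show "subvariety ?A (coord J)" "sclass ?A (coord J) = L ^ card J" by auto
qed

lemma times_coord_class:
  assumes "subvariety X S" "J \<subseteq> {..<n}"
  shows "subvariety (fproduct X (affine_space n)) (S \<times> coord J)"
    "sclass (fproduct X (affine_space n)) (S \<times> coord J) = sclass X S * L ^ card J"
  using subvariety_times[OF assms(1) coord_class(1)[OF assms(2)]] coord_class(2)[OF assms(2)] by auto

lemma gfun_fst:
  assumes "fun_space X" "fun_space Y" "a \<in> gfun (induced X S)" "\<And>p. p \<in> T \<Longrightarrow> fst p \<in> S"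
  shows "(\<lambda>p. a (fst p)) \<in> gfun (induced (fproduct X Y) T)"
  by (rule gfun_pullback[OF morphism_into_induced[OF fun_space_induced[OF fun_space_fproduct]
          morphism_restrict[OF morphism_fst]] assms(3)]) (use assms in auto)

lemma gfun_snd_coord: "(\<lambda>p. snd p i) \<in> gfun (induced (fproduct X (affine_space n)) T)"
  by (intro gfun_induced gfun_coord_pullback[OF morphism_snd])

text \<open>Elimination of the variables numbered by \<open>D\<close>: \<open>E\<close> is the graph
  over \<open>E'\<close> of the functions \<open>g i\<close>. The set \<open>E'\<close> carries
  zeros in these places, so that both sets lie in the same ambient product; the projection writes
  the zeros and its inverse restores the values.\<close>

lemma graph_iso:
  fixes X :: "'a fspace"
  defines "P n \<equiv> fproduct X (affine_space n)"
  assumes X: "fun_space X" and E': "subvariety (P n) E'" and E: "E \<subseteq> points X \<times> affine_points n"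
    and D: "D \<subseteq> {..<n}" and g: "\<And>i. i \<in> D \<Longrightarrow> g i \<in> gfun (induced (P n) E')"
    and 1: "\<And>x v. (x, v) \<in> E \<Longrightarrow> (x, \<lambda>i. if i \<in> D then 0 else v i) \<in> E' \<and>
      (\<forall>i\<in>D. v i = g i (x, \<lambda>i. if i \<in> D then 0 else v i))"
    and 2: "\<And>x v. (x, v) \<in> E' \<Longrightarrow> (x, \<lambda>i. if i \<in> D then g i (x, v) else v i) \<in> E \<and> (\<forall>i\<in>D. v i = 0)"
  shows "subvariety (P n) E" "sclass (P n) E = sclass (P n) E'"
proof -
  note fA = fun_space_affine[of n "{}"]
  have fP: "fun_space (P n)" unfolding P_def by (intro fun_space_fproduct X fA)
  have E'p: "E' \<subseteq> points X \<times> affine_points n" using subvarietyD(2)[OF E'] unfolding P_def by simp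
  let ?\<phi> = "\<lambda>p. (fst p, \<lambda>i. if i \<in> D then g i p else snd p i)"
  let ?\<psi> = "\<lambda>p. (fst p, \<lambda>i. if i \<in> D then 0 else snd p i)"
  have \<phi>: "morphism (induced (P n) E') (P n) ?\<phi>"
    unfolding P_def
  proof (intro morphism_pair X fA fun_space_induced fun_space_fproduct
      morphism_restrict[OF morphism_fst] morphism_affine_space gfun_if gfun_snd_coord)
    show "g i \<in> gfun (induced (fproduct X (affine_space n)) E')" if "i \<in> D" for i
      using g[OF that] unfolding P_def .
  qed (use E'p D in \<open>auto simp: affine_points_def\<close>)
  have \<psi>: "morphism (induced (P n) E) (P n) ?\<psi>"
    unfolding P_def
    by (intro morphism_pair X fA fun_space_induced fun_space_fproduct
      morphism_restrict[OF morphism_fst] morphism_affine_space gfun_if gfun_snd_coord gfun_const)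
     (use E in \<open>auto simp: affine_points_def\<close>)
  have a: "?\<phi> p \<in> E \<and> ?\<psi> (?\<phi> p) = p" if "p \<in> E'" for p
    using 2[of "fst p" "snd p", unfolded prod.collapse, OF that] by (auto simp: fun_eq_iff prod_eq_iff)
  have b: "?\<psi> p \<in> E' \<and> ?\<phi> (?\<psi> p) = p" if "p \<in> E" for p
    using 1[of "fst p" "snd p", unfolded prod.collapse, OF that] by (auto simp: fun_eq_iff prod_eq_iff)
  have Ep: "E \<subseteq> points (P n)" unfolding P_def using E by simp
  show "subvariety (P n) E"
    by (rule subvariety_isoI(1)[OF E' fP Ep \<phi> \<psi>]) (use a b in blast)+
  show "sclass (P n) E = sclass (P n) E'"
    by (rule subvariety_isoI(2)[OF E' fP Ep \<phi> \<psi>]) (use a b in blast)+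
qed

text \<open>The coefficient \<open>a q\<close> is a pivot on all of \<open>S\<close>: the equation
  determines \<open>v q\<close>, and the other coordinates remain free. The constant term
  \<open>b\<close> allows for cells of \<open>PW\<close>, where one homogeneous coordinate is fixed
  to \<open>1\<close>.\<close>

lemma linear_equation_class:
  assumes S: "subvariety X S" and J: "J \<subseteq> {..<n}" "q \<in> J"
    and b: "b \<in> gfun (induced X S)" and a: "\<And>j. j \<in> J \<Longrightarrow> a j \<in> gfun (induced X S)"
    and aq: "\<And>x. x \<in> S \<Longrightarrow> a q x \<noteq> 0"
  defines "E \<equiv> {(x, v). x \<in> S \<and> v \<in> coord J \<and> b x + (\<Sum>j\<in>J. a j x * v j) = 0}"
  shows "subvariety (fproduct X (affine_space n)) E"
    "sclass (fproduct X (affine_space n)) E = sclass X S * L ^ (card J - 1)"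
proof -
  let ?J = "J - {q}" and ?P = "fproduct X (affine_space n)"
  have J': "?J \<subseteq> {..<n}" using J by auto
  have fin: "finite J" using J finite_subset by blast
  note X = subvarietyD(1)[OF S] and fA = fun_space_affine[of n "{}"]
  note T = times_coord_class[OF S J']
  let ?g = "\<lambda>(i::nat) p. - (b (fst p) + (\<Sum>j\<in>?J. a j (fst p) * snd p j)) / a q (fst p)"
  have g: "?g i \<in> gfun (induced ?P (S \<times> coord ?J))" for i
    by (intro gfun_divide gfun_uminus gfun_add gfun_sum gfun_mult gfun_snd_coord
        gfun_fst[OF X fA b] gfun_fst[OF X fA a] fun_space_induced fun_space_fproduct X fA)
      (use aq J(2) in auto)
  have sum: "(\<Sum>j\<in>J. h j) = h q + (\<Sum>j\<in>?J. h j)" for h :: "nat \<Rightarrow> complex"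
    by (rule sum.remove[OF fin J(2)])
  have iff: "v q = ?g q (x, \<lambda>i. if i \<in> {q} then 0 else v i) \<longleftrightarrow> b x + (\<Sum>j\<in>J. a j x * v j) = 0"
    if "x \<in> S" for x v
  proof -
    have "(\<Sum>j\<in>?J. a j x * (if j \<in> {q} then 0 else v j)) = (\<Sum>j\<in>?J. a j x * v j)"
      by (intro sum.cong) auto
    then show ?thesis
      using aq[OF that] unfolding sum by (simp add: field_simps add_eq_0_iff)
  qed
  have E1: "(x, \<lambda>i. if i \<in> {q} then 0 else v i) \<in> S \<times> coord ?J \<and>
      (\<forall>i\<in>{q}. v i = ?g i (x, \<lambda>i. if i \<in> {q} then 0 else v i))" if "(x, v) \<in> E" for x v
    using that iff[of x v] unfolding E_def coord_def by auto
  have E2: "(x, \<lambda>i. if i \<in> {q} then ?g i (x, v) else v i) \<in> E \<and> (\<forall>i\<in>{q}. v i = 0)"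
    if xv: "(x, v) \<in> S \<times> coord ?J" for x v
  proof -
    let ?v = "\<lambda>i. if i \<in> {q} then ?g i (x, v) else v i"
    have x: "x \<in> S" and v: "v q = 0" using xv by (auto simp: coord_def)
    have "(\<lambda>i. if i \<in> {q} then 0 else ?v i) = v" using v by auto
    then have "b x + (\<Sum>j\<in>J. a j x * ?v j) = 0" using iff[OF x, of ?v] by simp
    then show ?thesis using xv J(2) unfolding E_def coord_def by auto
  qed
  have Ep: "E \<subseteq> points X \<times> affine_points n"
    using subvarietyD(2)[OF S] coord_subset[OF J(1)] unfolding E_def by auto
  have D: "{q} \<subseteq> {..<n}" using J by auto
  note * = graph_iso[OF X T(1) Ep D g E1 E2]
  show "subvariety ?P E" by (rule *(1))
  show "sclass ?P E = sclass X S * L ^ (card J - 1)"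
    using *(2) T(2) J(2) fin by simp
qed

section \<open>Kernels of skew matrices by Schur complements\<close>

text \<open>
  Up to the factor \<open>w p q\<close>, this is \<open>w\<close> restricted to the orthogonal complement of the span of the
  basis vectors \<open>p\<close> and \<open>q\<close>. Without the denominator it is a polynomial everywhere.
\<close>

definition schur :: "(nat \<Rightarrow> nat \<Rightarrow> 'a::comm_ring) \<Rightarrow> nat \<Rightarrow> nat \<Rightarrow> nat \<Rightarrow> nat \<Rightarrow> 'a"
  where "schur w p q i j = w p q * w i j - w p i * w q j + w p j * w q i"

definition alternating :: "(nat \<Rightarrow> nat \<Rightarrow> complex) \<Rightarrow> bool"
  where "alternating w \<longleftrightarrow> (\<forall>i. w i i = 0) \<and> (\<forall>i j. w i j = - w j i)"

lemma alternating_schur: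
  assumes "alternating w"
  shows "alternating (schur w p q)"
proof -
  have w: "w i i = 0" "w i j = - w j i" for i j
    using assms unfolding alternating_def by blast+
  show ?thesis
    unfolding alternating_def schur_def
  proof (intro conjI allI)
    fix i j
    show "w p q * w i i - w p i * w q i + w p i * w q i = 0" by (simp add: w(1))
    show "w p q * w i j - w p i * w q j + w p j * w q i =
        - (w p q * w j i - w p j * w q i + w p i * w q j)"
      by (subst w(2)[of i j]) (simp add: algebra_simps)
  qed
qed

text \<open>Rows \<open>p\<close> and \<open>q\<close> express \<open>v q\<close> and
  \<open>v p\<close> through the other coordinates. Substituted into any other row, they leave a row
  of the Schur complement.\<close>

lemma kernel_schur:
  assumes w: "alternating w" and J: "finite J" "p \<in> J" "q \<in> J" and pq: "w p q \<noteq> 0"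
  defines "J' \<equiv> J - {p, q}"
  shows "(\<forall>i\<in>J. (\<Sum>j\<in>J. w i j * v j) = 0) \<longleftrightarrow>
    v p = (\<Sum>j\<in>J'. w q j * v j) / w p q \<and> v q = - (\<Sum>j\<in>J'. w p j * v j) / w p q \<and>
    (\<forall>i\<in>J'. (\<Sum>j\<in>J'. schur w p q i j * v j) = 0)"
proof -
  have ne: "p \<noteq> q" using pq w unfolding alternating_def by metis
  have sk: "w i i = 0" "w q p = - w p q" "w i p = - w p i" "w i q = - w q i" for i
    using w unfolding alternating_def by blast+
  have sum: "(\<Sum>j\<in>J. h j) = h p + h q + (\<Sum>j\<in>J'. h j)" for h :: "nat \<Rightarrow> complex"
  proof -
    have "(\<Sum>j\<in>J. h j) = h p + (\<Sum>j\<in>J - {p}. h j)" by (rule sum.remove[OF J(1,2)])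
    also have "(\<Sum>j\<in>J - {p}. h j) = h q + (\<Sum>j\<in>J - {p} - {q}. h j)"
      by (rule sum.remove) (use J ne in auto)
    also have "J - {p} - {q} = J'" unfolding J'_def by auto
    finally show ?thesis by (simp add: add.assoc)
  qed
  have ep: "(\<Sum>j\<in>J. w p j * v j) = 0 \<longleftrightarrow> v q = - (\<Sum>j\<in>J'. w p j * v j) / w p q"
    using sum[of "\<lambda>j. w p j * v j"] sk(1)[of p] pq
    by (simp add: field_simps add_eq_0_iff) (rule equation_minus_iff)
  have eq: "(\<Sum>j\<in>J. w q j * v j) = 0 \<longleftrightarrow> v p = (\<Sum>j\<in>J'. w q j * v j) / w p q"
    using sum[of "\<lambda>j. w q j * v j"] sk(1)[of q] sk(2) pq
    by (simp add: field_simps) (metis add_cancel_left_right)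
  have ei: "(\<Sum>j\<in>J. w i j * v j) = 0 \<longleftrightarrow> (\<Sum>j\<in>J'. schur w p q i j * v j) = 0"
    if vq: "v q = - (\<Sum>j\<in>J'. w p j * v j) / w p q" and vp: "v p = (\<Sum>j\<in>J'. w q j * v j) / w p q" for i
  proof -
    have s: "(\<Sum>j\<in>J. w i j * v j) = (\<Sum>j\<in>J'. w i j * v j) - w p i * v p - w q i * v q"
      using sum[of "\<lambda>j. w i j * v j"] sk(3)[of i] sk(4)[of i] by simp
    \<comment> \<open>Multiplication by the pivot clears the denominators of \<open>v p\<close> and
      \<open>v q\<close>.\<close>
    have "w p q * (\<Sum>j\<in>J. w i j * v j) =
        w p q * (\<Sum>j\<in>J'. w i j * v j) - w p i * (w p q * v p) - w q i * (w p q * v q)"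
      unfolding s by (simp add: algebra_simps)
    also have "\<dots> = w p q * (\<Sum>j\<in>J'. w i j * v j) - w p i * (\<Sum>j\<in>J'. w q j * v j) + w q i * (\<Sum>j\<in>J'. w p j * v j)"
      using vp vq pq by simp
    also have "\<dots> = (\<Sum>j\<in>J'. schur w p q i j * v j)"
      unfolding schur_def by (simp add: sum_distrib_left sum_subtractf sum.distrib algebra_simps)
    finally show ?thesis using pq by (metis mult_eq_0_iff)
  qed
  have "(\<forall>i\<in>J. (\<Sum>j\<in>J. w i j * v j) = 0) \<longleftrightarrow> (\<Sum>j\<in>J. w p j * v j) = 0 \<and> (\<Sum>j\<in>J. w q j * v j) = 0 \<and>
    (\<forall>i\<in>J'. (\<Sum>j\<in>J. w i j * v j) = 0)"
    using J unfolding J'_def by auto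
  then show ?thesis using ep eq ei by auto
qed

definition skew_kernel :: "'a set \<Rightarrow> nat set \<Rightarrow> (nat \<Rightarrow> nat \<Rightarrow> 'a \<Rightarrow> complex) \<Rightarrow> ('a \<times> (nat \<Rightarrow> complex)) set"
  where "skew_kernel S J w = {(x, v). x \<in> S \<and> v \<in> coord J \<and> (\<forall>i\<in>J. (\<Sum>j\<in>J. w i j x * v j) = 0)}"

text \<open>Instance of \<open>graph_iso\<close> with two eliminated variables: an elimination step
  shrinks the skew system by two indices and leaves the class of the kernel unchanged.\<close>

lemma skew_kernel_schur:
  fixes X :: "'a fspace"
  defines "P n \<equiv> fproduct X (affine_space n)"
  assumes S: "subvariety X S" and J: "J \<subseteq> {..<n}" "p \<in> J" "q \<in> J"
    and w: "\<And>i j. w i j \<in> gfun (induced X S)" and alt: "\<And>x. x \<in> S \<Longrightarrow> alternating (\<lambda>i j. w i j x)"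
    and pq: "\<And>x. x \<in> S \<Longrightarrow> w p q x \<noteq> 0"
    and sub: "subvariety (P n) (skew_kernel S (J - {p, q}) (\<lambda>i j x. schur (\<lambda>i j. w i j x) p q i j))"
  shows "subvariety (P n) (skew_kernel S J w)"
    "sclass (P n) (skew_kernel S J w) =
      sclass (P n) (skew_kernel S (J - {p, q}) (\<lambda>i j x. schur (\<lambda>i j. w i j x) p q i j))"
proof -
  let ?J = "J - {p, q}"
  let ?E' = "skew_kernel S ?J (\<lambda>i j x. schur (\<lambda>i j. w i j x) p q i j)" and ?E = "skew_kernel S J w"
  have fin: "finite J" using J finite_subset by blast
  note X = subvarietyD(1)[OF S] and fA = fun_space_affine[of n "{}"]
  let ?g = "\<lambda>i t. (if i = p then (\<Sum>j\<in>?J. w q j (fst t) * snd t j) / w p q (fst t)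
    else - (\<Sum>j\<in>?J. w p j (fst t) * snd t j) / w p q (fst t))"
  have E'S: "fst t \<in> S" if "t \<in> ?E'" for t using that unfolding skew_kernel_def by auto
  have g: "?g i \<in> gfun (induced (fproduct X (affine_space n)) ?E')" for i
    by (intro gfun_if gfun_divide gfun_uminus gfun_sum gfun_mult gfun_snd_coord
        gfun_fst[OF X fA w] fun_space_induced fun_space_fproduct X fA E'S)
      (use pq E'S in auto)
  have cong: "(\<Sum>j\<in>?J. h j * (if j \<in> {p, q} then 0 else v j)) = (\<Sum>j\<in>?J. h j * v j)"
    for h and v :: "nat \<Rightarrow> complex"
    by (intro sum.cong) auto
  have ne: "p \<noteq> q" if "x \<in> S" for x
    using pq[OF that] alt[OF that] unfolding alternating_def by metis
  have iff: "(\<forall>i\<in>J. (\<Sum>j\<in>J. w i j x * v j) = 0) \<longleftrightarrow>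
      v p = ?g p (x, \<lambda>i. if i \<in> {p, q} then 0 else v i) \<and>
      v q = ?g q (x, \<lambda>i. if i \<in> {p, q} then 0 else v i) \<and>
      (\<forall>i\<in>?J. (\<Sum>j\<in>?J. schur (\<lambda>i j. w i j x) p q i j * (if j \<in> {p, q} then 0 else v j)) = 0)"
    if x: "x \<in> S" for x v
    unfolding cong fst_conv snd_conv using kernel_schur[OF alt[OF x] fin J(2,3) pq[OF x], of v] ne[OF x]
    by simp
  have E1: "(x, \<lambda>i. if i \<in> {p, q} then 0 else v i) \<in> ?E' \<and>
      (\<forall>i\<in>{p, q}. v i = ?g i (x, \<lambda>i. if i \<in> {p, q} then 0 else v i))" if "(x, v) \<in> ?E" for x v
  proof -
    have x: "x \<in> S" and v: "v \<in> coord J" and k: "\<forall>i\<in>J. (\<Sum>j\<in>J. w i j x * v j) = 0"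
      using that unfolding skew_kernel_def by auto
    note k' = k[unfolded iff[OF x]]
    have "(\<lambda>i. if i \<in> {p, q} then 0 else v i) \<in> coord ?J" using v unfolding coord_def by auto
    then show ?thesis using k' x unfolding skew_kernel_def by blast
  qed
  have E2: "(x, \<lambda>i. if i \<in> {p, q} then ?g i (x, v) else v i) \<in> ?E \<and> (\<forall>i\<in>{p, q}. v i = 0)"
    if xv: "(x, v) \<in> ?E'" for x v
  proof -
    let ?v = "\<lambda>i. if i \<in> {p, q} then ?g i (x, v) else v i"
    have x: "x \<in> S" and v: "v \<in> coord ?J"
      and k: "\<forall>i\<in>?J. (\<Sum>j\<in>?J. schur (\<lambda>i j. w i j x) p q i j * v j) = 0"
      using xv unfolding skew_kernel_def by auto
    have r: "(\<lambda>i. if i \<in> {p, q} then 0 else ?v i) = v" using v unfolding coord_def by auto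
    have c: "(\<Sum>j\<in>?J. h j * (if j \<in> {p, q} then 0 else ?v j)) = (\<Sum>j\<in>?J. h j * v j)" for h
      using r by (metis (no_types, lifting))
    have "\<forall>i\<in>J. (\<Sum>j\<in>J. w i j x * ?v j) = 0"
      unfolding iff[OF x] r c using k by auto
    moreover have "?v \<in> coord J" using v J unfolding coord_def by auto
    ultimately show ?thesis using x v unfolding skew_kernel_def coord_def by blast
  qed
  have Ep: "?E \<subseteq> points X \<times> affine_points n"
    using subvarietyD(2)[OF S] coord_subset[OF J(1)] unfolding skew_kernel_def by auto
  have D: "{p, q} \<subseteq> {..<n}" using J by auto
  note * = graph_iso[OF X sub[unfolded P_def] Ep D g E1 E2]
  show "subvariety (P n) ?E" unfolding P_def by (rule *(1))
  show "sclass (P n) ?E = sclass (P n) ?E'" unfolding P_def by (rule *(2))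
qed

lemma skew_kernel_zero:
  assumes "\<And>x i j. x \<in> S \<Longrightarrow> i \<in> J \<Longrightarrow> j \<in> J \<Longrightarrow> w i j x = 0"
  shows "skew_kernel S J w = S \<times> coord J"
  unfolding skew_kernel_def using assms by auto

text \<open>Any enumeration of \<open>I\<close> will do, because the resulting formula refers to the
  common zero locus and not to the individual strata.\<close>

lemma stratify_fibration_finite:
  fixes f :: "'i \<Rightarrow> 'a \<Rightarrow> complex"
  assumes S: "subvariety X S" and E: "subvariety Y E"
    and p: "morphism (induced Y E) X p" "\<And>y. y \<in> E \<Longrightarrow> p y \<in> S"
    and I: "finite I" and f: "\<forall>k\<in>I. f k \<in> gfun (induced X S)"
    and piece: "\<And>T k. k \<in> I \<Longrightarrow> subvariety X T \<Longrightarrow> T \<subseteq> S \<Longrightarrow> (\<And>x. x \<in> T \<Longrightarrow> f k x \<noteq> 0) \<Longrightarrow>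
      sclass Y {y \<in> E. p y \<in> T} = c * sclass X T"
  shows "sclass Y E = c * (sclass X S - sclass X {x \<in> S. \<forall>i\<in>I. f i x = 0}) +
      sclass Y {y \<in> E. p y \<in> {x \<in> S. \<forall>i\<in>I. f i x = 0}}"
    "subvariety Y {y \<in> E. p y \<in> {x \<in> S. \<forall>i\<in>I. f i x = 0}}"
proof -
  obtain xs where xs: "set xs = I" using finite_list[OF I] by (elim exE) (rule that)
  have m: "xs ! k \<in> I" if "k < length xs" for k using that xs nth_mem by blast
  have eq: "(\<forall>i<length xs. f (xs ! i) x = 0) \<longleftrightarrow> (\<forall>i\<in>I. f i x = 0)" for x
    unfolding xs[symmetric] by (simp add: all_set_conv_all_nth)
  have f': "\<forall>k<length xs. (\<lambda>k. f (xs ! k)) k \<in> gfun (induced X S)" using f m by blast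
  have piece': "sclass Y {y \<in> E. p y \<in> T} = c * sclass X T"
    if "k < length xs" "subvariety X T" "T \<subseteq> S" "\<And>x. x \<in> T \<Longrightarrow> (\<lambda>k. f (xs ! k)) k x \<noteq> 0" for T k
    by (rule piece[OF m[OF that(1)] that(2,3)]) (use that(4) in simp)
  note * = stratify_fibration[OF S E p f' piece']
  show "sclass Y E = c * (sclass X S - sclass X {x \<in> S. \<forall>i\<in>I. f i x = 0}) +
      sclass Y {y \<in> E. p y \<in> {x \<in> S. \<forall>i\<in>I. f i x = 0}}"
    using *(1) unfolding eq .
  show "subvariety Y {y \<in> E. p y \<in> {x \<in> S. \<forall>i\<in>I. f i x = 0}}"
    using *(2) unfolding eq .
qed

lemma gfun_schur:
  assumes "fun_space Z" "\<And>i j. w i j \<in> gfun Z"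
  shows "(\<lambda>x. schur (\<lambda>i j. w i j x) p q i j) \<in> gfun Z"
  unfolding schur_def by (intro gfun_add gfun_diff gfun_mult assms)

text \<open>Places \<open>p\<close> and \<open>q\<close> lie in the radical of the complement. A
  nonzero entry of it has both indices outside \<open>{p, q}\<close>, so later pivots may be
  searched among all indices.\<close>

lemma schur_zero:
  assumes "alternating w"
  shows "schur w p q p j = 0" "schur w p q q j = 0" "schur w p q i p = 0" "schur w p q i q = 0"
proof -
  have w: "w i i = 0" "w i j = - w j i" for i j
    using assms unfolding alternating_def by blast+
  show "schur w p q p j = 0" "schur w p q q j = 0" "schur w p q i p = 0" "schur w p q i q = 0"
    by (simp_all add: schur_def w(1) w(2)[of q p] w(2)[of i p] w(2)[of i q])
qed

text \<open>Cut out by its linear equations, whatever the rank, so variety status is available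
  before any stratification.\<close>

lemma subvariety_skew_kernel:
  assumes S: "subvariety X S" and J: "J \<subseteq> {..<n}" and w: "\<And>i j. w i j \<in> gfun (induced X S)"
  shows "subvariety (fproduct X (affine_space n)) (skew_kernel S J w)"
proof -
  let ?F = "(\<lambda>i t. \<Sum>j\<in>J. w i j (fst t) * snd t j) ` J"
  note X = subvarietyD(1)[OF S] and fA = fun_space_affine[of n "{}"]
  have "?F \<subseteq> gfun (induced (fproduct X (affine_space n)) (S \<times> coord J))"
    by (intro image_subsetI gfun_sum gfun_mult gfun_snd_coord gfun_fst[OF X fA w] fun_space_induced
        fun_space_fproduct X fA) auto
  from subvariety_zeros[OF times_coord_class(1)[OF S J] this]
  have "subvariety (fproduct X (affine_space n)) {t \<in> S \<times> coord J. \<forall>f\<in>?F. f t = 0}" .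
  also have "{t \<in> S \<times> coord J. \<forall>f\<in>?F. f t = 0} = skew_kernel S J w"
    unfolding skew_kernel_def by auto
  finally show ?thesis .
qed

lemma skew_kernel_restrict: "T \<subseteq> S \<Longrightarrow> {t \<in> skew_kernel S J w. fst t \<in> T} = skew_kernel T J w"
  unfolding skew_kernel_def by auto

text \<open>Two eliminations in a row, the part common to the cases of rank 4 and rank 6.\<close>

lemma skew_kernel_schur2:
  fixes X :: "'a fspace"
  assumes T: "subvariety X T" and J: "J \<subseteq> {..<n}"
    and w: "\<And>i j. w i j \<in> gfun (induced X T)" and alt: "\<And>x. x \<in> T \<Longrightarrow> alternating (\<lambda>i j. w i j x)"
    and pq: "p \<in> J" "q \<in> J" "\<And>x. x \<in> T \<Longrightarrow> w p q x \<noteq> 0"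
    and rs: "r \<in> J - {p, q}" "s \<in> J - {p, q}" "\<And>x. x \<in> T \<Longrightarrow> schur (\<lambda>i j. w i j x) p q r s \<noteq> 0"
  shows "sclass (fproduct X (affine_space n)) (skew_kernel T J w) =
    sclass (fproduct X (affine_space n)) (skew_kernel T (J - {p, q} - {r, s})
      (\<lambda>i j x. schur (schur (\<lambda>i j. w i j x) p q) r s i j))"
proof -
  let ?w1 = "\<lambda>i j x. schur (\<lambda>i j. w i j x) p q i j"
  note fT = fun_space_induced[OF subvarietyD(1)[OF T], of T]
  have w1: "?w1 i j \<in> gfun (induced X T)" for i j by (rule gfun_schur[OF fT w])
  have w2: "(\<lambda>x. schur (\<lambda>i j. ?w1 i j x) r s i j) \<in> gfun (induced X T)" for i j
    by (rule gfun_schur[OF fT w1])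
  have J': "J - {p, q} \<subseteq> {..<n}" "J - {p, q} - {r, s} \<subseteq> {..<n}" using J by auto
  note a = skew_kernel_schur(2)[OF T J pq(1,2) w alt pq(3) subvariety_skew_kernel[OF T J'(1) w1]]
  note b = skew_kernel_schur(2)[OF T J'(1) rs(1,2) w1 alternating_schur[OF alt] rs(3)
      subvariety_skew_kernel[OF T J'(2) w2]]
  show ?thesis using a b by simp
qed

section \<open>The incidence variety of a net of skew forms\<close>

locale skew_net =
  fixes w :: "nat \<Rightarrow> nat \<Rightarrow> nat \<Rightarrow> complex"
  assumes w_alternating: "alternating (w k)"
begin

text \<open>
  A point \<open>a\<close> of \<open>cell i\<close> below stands for the line through the form with matrix \<open>\<lambda>j l. W i j l a\<close>,
  that is, with homogeneous coordinates \<open>(0, \<dots>, 0, 1, a (i + 1), \<dots>, a 6)\<close>.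
\<close>

definition W :: "nat \<Rightarrow> nat \<Rightarrow> nat \<Rightarrow> (nat \<Rightarrow> complex) \<Rightarrow> complex"
  where "W i j l a = w i j l + (\<Sum>k\<in>{i<..<7}. a k * w k j l)"

definition pairing :: "nat \<Rightarrow> (nat \<Rightarrow> complex) \<Rightarrow> (nat \<Rightarrow> complex) \<Rightarrow> complex"
  where "pairing k u v = (\<Sum>j<7. \<Sum>l<7. w k j l * u j * v l)"

text \<open>Product of the pivots of an elimination along the index pairs \<open>(p, q)\<close>,
  \<open>(r, s)\<close>, \<open>(t, u)\<close>. Cleared denominators contribute extra factors, so it
  is not literally a minor; but some choice of indices gives a nonzero value exactly when the matrix
  has rank 6.\<close>

definition rank6_minor :: "nat \<Rightarrow> nat \<times> nat \<times> nat \<times> nat \<times> nat \<times> nat \<Rightarrow> (nat \<Rightarrow> complex) \<Rightarrow> complex"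
  where "rank6_minor i = (\<lambda>(p, q, r, s, t, u) a. W i p q a * schur (\<lambda>j l. W i j l a) p q r s *
    schur (schur (\<lambda>j l. W i j l a) p q) r s t u)"

definition rank4_minor :: "nat \<Rightarrow> nat \<times> nat \<times> nat \<times> nat \<Rightarrow> (nat \<Rightarrow> complex) \<Rightarrow> complex"
  where "rank4_minor i = (\<lambda>(p, q, r, s) a. W i p q a * schur (\<lambda>j l. W i j l a) p q r s)"

abbreviation cell :: "nat \<Rightarrow> (nat \<Rightarrow> complex) set"
  where "cell i \<equiv> coord {i<..<7}"

text \<open>The part of the Pfaffian locus in \<open>cell i\<close>, written as failure of every
  three-step elimination.\<close>

definition degenerate :: "nat \<Rightarrow> (nat \<Rightarrow> complex) set"
  where "degenerate i = {a \<in> cell i. \<forall>m \<in> {..<7} \<times> {..<7} \<times> {..<7} \<times> {..<7} \<times> {..<7} \<times> {..<7}.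
    rank6_minor i m a = 0}"

abbreviation A7 :: "(nat \<Rightarrow> complex) fspace"
  where "A7 \<equiv> affine_space 7"

section \<open>The bundle of kernels over the cells of \<open>PW\<close>\<close>

lemma cell_class: "i < 7 \<Longrightarrow> subvariety A7 (cell i)" "i < 7 \<Longrightarrow> sclass A7 (cell i) = L ^ (6 - i)"
proof -
  have s: "{i<..<7} \<subseteq> {..<7::nat}" by auto
  show "subvariety A7 (cell i)" by (rule coord_class(1)[OF s])
  show "sclass A7 (cell i) = L ^ (6 - i)" using coord_class(2)[OF s] by simp
qed

lemma W_alternating: "alternating (\<lambda>j l. W i j l a)"
proof -
  have "w k j j = 0" "w k j l = - w k l j" for k j l
    using w_alternating[of k] unfolding alternating_def by blast+
  note a = this
  show ?thesis
    unfolding alternating_def W_def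
    by (intro conjI allI, simp add: a(1)) (subst (1 2) a(2), simp add: sum_negf)
qed

lemma W_gfun: "W i j l \<in> gfun (induced A7 T)"
proof -
  have "(\<lambda>a. w i j l + (\<Sum>k\<in>{i<..<7}. a k * w k j l)) \<in> gfun (induced A7 T)"
    by (intro gfun_add gfun_const gfun_sum gfun_mult gfun_coord_induced fun_space_induced fun_space_affine)
  then show ?thesis by (simp add: W_def[abs_def])
qed

lemmas schur_gfun = gfun_schur[OF fun_space_induced[OF fun_space_affine] W_gfun]
lemmas schur2_gfun = gfun_schur[OF fun_space_induced[OF fun_space_affine] schur_gfun]

lemma rank6_minor_gfun: "rank6_minor i m \<in> gfun (induced A7 T)"
proof -
  obtain p q r s t u where m: "m = (p, q, r, s, t, u)" by (cases m)
  show ?thesis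
    unfolding rank6_minor_def m prod.case
    by (intro gfun_mult W_gfun schur_gfun schur2_gfun fun_space_induced fun_space_affine)
qed

lemma rank4_minor_gfun: "rank4_minor i m \<in> gfun (induced A7 T)"
proof -
  obtain p q r s where m: "m = (p, q, r, s)" by (cases m)
  show ?thesis
    unfolding rank4_minor_def m prod.case
    by (intro gfun_mult W_gfun schur_gfun fun_space_induced fun_space_affine)
qed

text \<open>Three eliminations leave a single index, where an alternating matrix is zero: one free
  coordinate. Distinctness of the six pivot indices is deduced at a point of \<open>T\<close>, so
  the empty \<open>T\<close> is treated apart.\<close>

lemma kernel_rank6:
  assumes T: "subvariety A7 T" and m: "p < 7" "q < 7" "r < 7" "s < 7" "t < 7" "u < 7"
    and ne: "\<And>a. a \<in> T \<Longrightarrow> rank6_minor i (p, q, r, s, t, u) a \<noteq> 0"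
  shows "sclass (fproduct A7 A7) (skew_kernel T {..<7} (W i)) = L * sclass A7 T"
proof (cases "T = {}")
  case True
  have "fun_space (fproduct A7 A7)" by (intro fun_space_fproduct fun_space_affine)
  then show ?thesis
    using subvariety_empty(2)[of "fproduct A7 A7"] subvariety_empty(2)[OF fun_space_affine[of 7 "{}"]]
    unfolding True skew_kernel_def by simp
next
  case False
  then obtain a where a: "a \<in> T" by blast
  let ?S1 = "\<lambda>a. schur (\<lambda>j l. W i j l a) p q" and ?S2 = "\<lambda>a. schur (schur (\<lambda>j l. W i j l a) p q) r s"
  let ?S3 = "\<lambda>a. schur (schur (schur (\<lambda>j l. W i j l a) p q) r s) t u"
  have ne': "W i p q a \<noteq> 0" "?S1 a r s \<noteq> 0" "?S2 a t u \<noteq> 0" if "a \<in> T" for a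
    using ne[OF that] unfolding rank6_minor_def by auto
  note alt = W_alternating alternating_schur[OF W_alternating]
    alternating_schur[OF alternating_schur[OF W_alternating]]
    alternating_schur[OF alternating_schur[OF alternating_schur[OF W_alternating]]]
  have ap: "?S1 a p j = 0" "?S1 a q j = 0" "?S1 a j p = 0" "?S1 a j q = 0" for j
    by (rule schur_zero[OF alt(1)])+
  \<comment> \<open>The zero rows and columns \<open>p\<close> and \<open>q\<close> survive the
    second elimination, which forces \<open>t\<close> and \<open>u\<close> to avoid them as
    well.\<close>
  have ar: "?S2 a p j = 0" "?S2 a q j = 0" "?S2 a j p = 0" "?S2 a j q = 0"
    for j
    unfolding schur_def[of "?S1 a"] by (simp_all add: ap)
  have ar': "?S2 a r j = 0" "?S2 a s j = 0" "?S2 a j r = 0" "?S2 a j s = 0" for j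
    by (rule schur_zero[OF alt(2)])+
  have rs: "r \<in> {..<7} - {p, q}" "s \<in> {..<7} - {p, q}" using ne'(2)[OF a] ap m by auto
  have tu: "t \<in> {..<7} - {p, q} - {r, s}" "u \<in> {..<7} - {p, q} - {r, s}"
    using ne'(3)[OF a] ar ar' m by auto
  let ?J = "{..<7} - {p, q} - {r, s} - {t, u}"
  have pq: "p \<noteq> q" using ne'(1)[OF a] alt(1) unfolding alternating_def by metis
  have rs': "r \<noteq> s" using ne'(2)[OF a] alt(2) unfolding alternating_def by metis
  have tu': "t \<noteq> u" using ne'(3)[OF a] alt(3) unfolding alternating_def by metis
  have card: "card ?J = 1"
    using pq rs rs' tu tu' m by (simp add: card_Diff_subset)
  then obtain z where z: "?J = {z}" using card_1_singletonE by blast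
  have "sclass (fproduct A7 A7) (skew_kernel T {..<7} (W i)) =
      sclass (fproduct A7 A7) (skew_kernel T ({..<7} - {p, q} - {r, s}) (\<lambda>j l a. ?S2 a j l))"
    by (rule skew_kernel_schur2[OF T _ W_gfun alt(1)]) (use m rs ne' in auto)
  also have "\<dots> = sclass (fproduct A7 A7) (skew_kernel T ?J (\<lambda>j l a. ?S3 a j l))"
    by (rule skew_kernel_schur(2)[OF T _ tu schur2_gfun alt(3) ne'(3) subvariety_skew_kernel[OF T _
          gfun_schur[OF fun_space_induced[OF fun_space_affine] schur2_gfun]]]) auto
  also have "skew_kernel T ?J (\<lambda>j l a. ?S3 a j l) = T \<times> coord ?J"
    by (rule skew_kernel_zero) (use alt(4) z in \<open>auto simp: alternating_def\<close>)
  also have "sclass (fproduct A7 A7) (T \<times> coord ?J) = sclass A7 T * L ^ card ?J"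
    by (rule times_coord_class(2)[OF T]) auto
  finally show ?thesis unfolding card by (simp add: mult.commute)
qed

text \<open>On \<open>degenerate i\<close> every candidate for a third pivot vanishes. After two
  eliminations no equation is left, and three of the seven coordinates stay free.\<close>

lemma kernel_rank4:
  assumes T: "subvariety A7 T" "T \<subseteq> degenerate i" and m: "p < 7" "q < 7" "r < 7" "s < 7"
    and ne: "\<And>a. a \<in> T \<Longrightarrow> rank4_minor i (p, q, r, s) a \<noteq> 0"
  shows "sclass (fproduct A7 A7) (skew_kernel T {..<7} (W i)) = L ^ 3 * sclass A7 T"
proof (cases "T = {}")
  case True
  have "fun_space (fproduct A7 A7)" by (intro fun_space_fproduct fun_space_affine)
  then show ?thesis
    using subvariety_empty(2)[of "fproduct A7 A7"] subvariety_empty(2)[OF fun_space_affine[of 7 "{}"]]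
    unfolding True skew_kernel_def by simp
next
  case False
  then obtain a where a: "a \<in> T" by blast
  let ?S1 = "\<lambda>a. schur (\<lambda>j l. W i j l a) p q" and ?S2 = "\<lambda>a. schur (schur (\<lambda>j l. W i j l a) p q) r s"
  have ne': "W i p q a \<noteq> 0" "?S1 a r s \<noteq> 0" if "a \<in> T" for a
    using ne[OF that] unfolding rank4_minor_def by auto
  have S2: "?S2 a t u = 0" if "a \<in> T" "t < 7" "u < 7" for a t u
  proof -
    have "(p, q, r, s, t, u) \<in> {..<7} \<times> {..<7} \<times> {..<7} \<times> {..<7} \<times> {..<7} \<times> {..<7}"
      using m that by auto
    then have "rank6_minor i (p, q, r, s, t, u) a = 0"
      using T(2) that(1) unfolding degenerate_def by blast
    then show ?thesis using ne'[OF that(1)] unfolding rank6_minor_def by auto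
  qed
  note alt = W_alternating alternating_schur[OF W_alternating]
  have ap: "?S1 a p j = 0" "?S1 a q j = 0" "?S1 a j p = 0" "?S1 a j q = 0" for j
    by (rule schur_zero[OF alt(1)])+
  have rs: "r \<in> {..<7} - {p, q}" "s \<in> {..<7} - {p, q}" using ne'(2)[OF a] ap m by auto
  let ?J = "{..<7} - {p, q} - {r, s}"
  have pq: "p \<noteq> q" using ne'(1)[OF a] alt(1) unfolding alternating_def by metis
  have rs': "r \<noteq> s" using ne'(2)[OF a] alt(2) unfolding alternating_def by metis
  have card: "card ?J = 3"
    using pq rs rs' m by (simp add: card_Diff_subset)
  have "sclass (fproduct A7 A7) (skew_kernel T {..<7} (W i)) =
      sclass (fproduct A7 A7) (skew_kernel T ?J (\<lambda>j l a. ?S2 a j l))"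
    by (rule skew_kernel_schur2[OF T(1) _ W_gfun alt(1)]) (use m rs ne' in auto)
  also have "skew_kernel T ?J (\<lambda>j l a. ?S2 a j l) = T \<times> coord ?J"
    by (rule skew_kernel_zero) (use S2 in auto)
  also have "sclass (fproduct A7 A7) (T \<times> coord ?J) = sclass A7 T * L ^ card ?J"
    by (rule times_coord_class(2)[OF T(1)]) auto
  finally show ?thesis unfolding card by (simp add: mult.commute)
qed

lemma degenerate_subvariety:
  assumes i: "i < 7"
  shows "subvariety A7 (degenerate i)"
proof -
  let ?F = "rank6_minor i ` ({..<7} \<times> {..<7} \<times> {..<7} \<times> {..<7} \<times> {..<7} \<times> {..<7})"
  have "?F \<subseteq> gfun (induced A7 (cell i))" by (intro image_subsetI rank6_minor_gfun)
  from subvariety_zeros[OF cell_class(1)[OF i] this] show ?thesis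
    unfolding degenerate_def by (simp only: ball_simps)
qed

text \<open>The cell is split by rank: the fibre is a line off \<open>degenerate i\<close> and
  three-dimensional on it, hence the correction term.\<close>

lemma kernel_class:
  assumes i: "i < 7" and gen: "\<And>a. a \<in> cell i \<Longrightarrow>
    \<exists>m \<in> {..<7} \<times> {..<7} \<times> {..<7} \<times> {..<7}. rank4_minor i m a \<noteq> 0"
  shows "subvariety (fproduct A7 A7) (skew_kernel (cell i) {..<7} (W i))"
    "sclass (fproduct A7 A7) (skew_kernel (cell i) {..<7} (W i)) =
      L * sclass A7 (cell i) + (L ^ 3 - L) * sclass A7 (degenerate i)"
proof -
  let ?K = "\<lambda>S. skew_kernel S {..<7} (W i)" and ?P = "fproduct A7 A7"
  note c = cell_class(1)[OF i] and d = degenerate_subvariety[OF i]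
  show K: "subvariety ?P (?K (cell i))"
    by (rule subvariety_skew_kernel[OF c _ W_gfun]) auto
  have Kd: "subvariety ?P (?K (degenerate i))"
    by (rule subvariety_skew_kernel[OF d _ W_gfun]) auto
  have inS: "fst t \<in> S" if "t \<in> ?K S" for t S using that unfolding skew_kernel_def by auto
  have dc: "degenerate i \<subseteq> cell i" unfolding degenerate_def by auto
  let ?I = "{..<7::nat} \<times> {..<7::nat} \<times> {..<7::nat} \<times> {..<7::nat}"
  have "sclass ?P (?K (cell i)) = L * (sclass A7 (cell i) - sclass A7 (degenerate i)) +
      sclass ?P {t \<in> ?K (cell i). fst t \<in> degenerate i}"
    unfolding degenerate_def
  proof (rule stratify_fibration_finite(1)[OF c K morphism_restrict[OF morphism_fst]])
    fix T and k :: "nat \<times> nat \<times> nat \<times> nat \<times> nat \<times> nat"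
    assume k: "k \<in> {..<7} \<times> {..<7} \<times> {..<7} \<times> {..<7} \<times> {..<7} \<times> {..<7}"
      and T: "subvariety A7 T" "T \<subseteq> cell i" "\<And>x. x \<in> T \<Longrightarrow> rank6_minor i k x \<noteq> 0"
    obtain p q r s t u where k': "k = (p, q, r, s, t, u)" by (cases k)
    have "sclass ?P (?K T) = L * sclass A7 T"
      by (rule kernel_rank6[OF T(1) _ _ _ _ _ _ T(3)[unfolded k']]) (use k k' in auto)
    then show "sclass ?P {y \<in> ?K (cell i). fst y \<in> T} = L * sclass A7 T"
      unfolding skew_kernel_restrict[OF T(2)] .
  qed (use inS rank6_minor_gfun in auto)
  also have "{t \<in> ?K (cell i). fst t \<in> degenerate i} = ?K (degenerate i)"
    by (rule skew_kernel_restrict[OF dc])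
  also have "sclass ?P (?K (degenerate i)) =
      L ^ 3 * (sclass A7 (degenerate i) - sclass A7 {a \<in> degenerate i. \<forall>m\<in>?I. rank4_minor i m a = 0}) +
      sclass ?P {t \<in> ?K (degenerate i). fst t \<in> {a \<in> degenerate i. \<forall>m\<in>?I. rank4_minor i m a = 0}}"
  proof (rule stratify_fibration_finite(1)[OF d Kd morphism_restrict[OF morphism_fst]])
    fix T and k :: "nat \<times> nat \<times> nat \<times> nat"
    assume k: "k \<in> ?I"
      and T: "subvariety A7 T" "T \<subseteq> degenerate i" "\<And>x. x \<in> T \<Longrightarrow> rank4_minor i k x \<noteq> 0"
    obtain p q r s where k': "k = (p, q, r, s)" by (cases k)
    have "sclass ?P (?K T) = L ^ 3 * sclass A7 T"
      by (rule kernel_rank4[OF T(1,2) _ _ _ _ T(3)[unfolded k']]) (use k k' in auto)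
    then show "sclass ?P {y \<in> ?K (degenerate i). fst y \<in> T} = L ^ 3 * sclass A7 T"
      unfolding skew_kernel_restrict[OF T(2)] .
  qed (use inS rank4_minor_gfun in auto)
  \<comment> \<open>Genericity enters here: points of rank 2 would form a remainder with larger
    kernels.\<close>
  also have "{a \<in> degenerate i. \<forall>m\<in>?I. rank4_minor i m a = 0} = {}"
    using gen dc by blast
  finally show "sclass ?P (?K (cell i)) =
      L * sclass A7 (cell i) + (L ^ 3 - L) * sclass A7 (degenerate i)"
    using subvariety_empty(2)[OF fun_space_affine[of 7 "{}"]]
      subvariety_empty(2)[OF fun_space_fproduct[OF fun_space_affine[of 7 "{}"] fun_space_affine[of 7 "{}"]]]
    by (simp add: algebra_simps)
qed

end

section \<open>The incidence variety over pairs of vectors\<close>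

lemma gfun_fst_coord: "(\<lambda>p. fst p i) \<in> gfun (induced (fproduct (affine_space n) Y) T)"
  by (intro gfun_induced gfun_coord_pullback[OF morphism_fst])

lemma sclass_empty: "fun_space X \<Longrightarrow> S = {} \<Longrightarrow> sclass X S = 0"
  using subvariety_empty(2) by blast

lemma fun_space_A2: "fun_space (fproduct (affine_space m) (affine_space n))"
  by (intro fun_space_fproduct fun_space_affine)

lemma fun_space_A3: "fun_space (fproduct (fproduct (affine_space m) (affine_space n)) (affine_space k))"
  by (intro fun_space_fproduct fun_space_affine)

context skew_net
begin

abbreviation V7 :: "(nat \<Rightarrow> complex) set"
  where "V7 \<equiv> coord {..<7}"

abbreviation A77 :: "((nat \<Rightarrow> complex) \<times> (nat \<Rightarrow> complex)) fspace"
  where "A77 \<equiv> fproduct A7 A7"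

abbreviation A777 :: "(((nat \<Rightarrow> complex) \<times> (nat \<Rightarrow> complex)) \<times> (nat \<Rightarrow> complex)) fspace"
  where "A777 \<equiv> fproduct A77 A7"

lemma V7_class: "subvariety A7 V7" "sclass A7 V7 = L ^ 7"
  using coord_class[of "{..<7}" 7] by simp_all

lemma V7_eq: "V7 = affine_points 7"
  unfolding coord_lessThan by simp

text \<open>The part of the incidence variety over \<open>cell i\<close>, with the point of
  \<open>PW\<close> as last factor. Homogeneous coordinate \<open>i\<close> equals \<open>1\<close>
  there, which explains the term \<open>pairing i\<close> without a variable.\<close>

definition incidence :: "nat \<Rightarrow> (((nat \<Rightarrow> complex) \<times> (nat \<Rightarrow> complex)) \<times> (nat \<Rightarrow> complex)) set"
  where "incidence i = {(p, a). p \<in> V7 \<times> V7 \<and> a \<in> cell i \<and>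
    pairing i (fst p) (snd p) + (\<Sum>k\<in>{i<..<7}. pairing k (fst p) (snd p) * a k) = 0}"

text \<open>The order \<open>6 - k\<close> is that of the stratification by the last nonzero \<open>pairing k u v\<close>.\<close>

definition isotropic :: "((nat \<Rightarrow> complex) \<times> (nat \<Rightarrow> complex)) set"
  where "isotropic = {p \<in> V7 \<times> V7. \<forall>k<7. pairing (6 - k) (fst p) (snd p) = 0}"

lemma pairing_gfun: "(\<lambda>p. pairing k (fst p) (snd p)) \<in> gfun (induced A77 T)"
  unfolding pairing_def
  by (intro gfun_sum gfun_mult gfun_const gfun_fst_coord gfun_snd_coord fun_space_induced fun_space_A2)

lemma pairing_gfun3: "(\<lambda>t. pairing k (fst (fst t)) (snd (fst t))) \<in> gfun (induced A777 T)"
  by (rule gfun_induced[OF gfun_pullback[OF morphism_fst gfun_cong[OF fun_space_A2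
          gfun_pullback[OF _ pairing_gfun[where T = UNIV]]]]])
    (auto intro!: morphism_into_induced fun_space_A2 morphism_id[unfolded id_def])

lemma cell_subset: "{i<..<7} \<subseteq> {..<7::nat}" by auto

lemma subvariety_incidence:
  assumes i: "i < 7"
  shows "subvariety A777 (incidence i)"
proof -
  have V2: "subvariety A77 (V7 \<times> V7)" by (rule subvariety_times(1)[OF V7_class(1) V7_class(1)])
  have "(\<lambda>t. pairing i (fst (fst t)) (snd (fst t)) +
      (\<Sum>k\<in>{i<..<7}. pairing k (fst (fst t)) (snd (fst t)) * snd t k))
      \<in> gfun (induced A777 ((V7 \<times> V7) \<times> cell i))"
    by (intro gfun_add gfun_sum gfun_mult pairing_gfun3 gfun_snd_coord fun_space_induced fun_space_A3)
  from subvariety_cut(1)[OF times_coord_class(1)[OF V2 cell_subset] this]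
  show ?thesis
    by (rule back_subst[of "subvariety A777"]) (auto simp: incidence_def)
qed

text \<open>The equation is affine linear in the \<open>6 - i\<close> coordinates of the cell and
  has pivot \<open>pairing m\<close>, so one coordinate is lost.\<close>

lemma incidence_pivot:
  assumes T: "subvariety A77 T" "T \<subseteq> V7 \<times> V7" and m: "i < m" "m < 7"
    and ne: "\<And>p. p \<in> T \<Longrightarrow> pairing m (fst p) (snd p) \<noteq> 0"
  shows "sclass A777 {t \<in> incidence i. fst t \<in> T} = L ^ (5 - i) * sclass A77 T"
proof -
  let ?a = "\<lambda>k p. pairing k (fst p) (snd p)"
  have "sclass A777 {(p, a). p \<in> T \<and> a \<in> cell i \<and> ?a i p + (\<Sum>k\<in>{i<..<7}. ?a k p * a k) = 0} =
      sclass A77 T * L ^ (card {i<..<7} - 1)"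
    by (rule linear_equation_class(2)[where q = m and a = ?a and b = "?a i"])
      (use T(1) m ne pairing_gfun cell_subset in auto)
  moreover have "{(p, a). p \<in> T \<and> a \<in> cell i \<and> ?a i p + (\<Sum>k\<in>{i<..<7}. ?a k p * a k) = 0} =
      {t \<in> incidence i. fst t \<in> T}"
    unfolding incidence_def using T(2) by auto
  ultimately show ?thesis by (simp add: mult.commute)
qed

lemma incidence_zero:
  assumes T: "subvariety A77 T" "T \<subseteq> V7 \<times> V7"
    and z: "\<And>p k. p \<in> T \<Longrightarrow> i \<le> k \<Longrightarrow> k < 7 \<Longrightarrow> pairing k (fst p) (snd p) = 0" and i: "i < 7"
  shows "sclass A777 {t \<in> incidence i. fst t \<in> T} = L ^ (6 - i) * sclass A77 T"
proof -
  have "{t \<in> incidence i. fst t \<in> T} = T \<times> cell i"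
    unfolding incidence_def using T(2) z i by (auto intro!: sum.neutral)
  then show ?thesis
    using times_coord_class(2)[OF T(1) cell_subset, of i] by (simp add: mult.commute)
qed

text \<open>Class of the fibre in \<open>cell i\<close> over a pair whose last nonzero pairing has
  index \<open>m\<close>: a hyperplane of the cell for \<open>i < m\<close>; nothing for
  \<open>i = m\<close>, where the equation reduces to \<open>pairing m u v = 0\<close>; the whole
  cell for \<open>i > m\<close>.\<close>

definition coeff :: "nat \<Rightarrow> nat \<Rightarrow> K0"
  where "coeff i m = (if i < m then L ^ (5 - i) else if i = m then 0 else L ^ (6 - i))"

text \<open>A hyperplane of \<open>P^6\<close> is a \<open>P^5\<close>, wherever it lies: the
  exponents \<open>5, ..., 6 - m\<close> come from the cells below \<open>m\<close>, and
  \<open>5 - m, ..., 0\<close> from those above.\<close>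

lemma sum_coeff:
  assumes "m < 7"
  shows "(\<Sum>i<7. coeff i m) = (\<Sum>e<6. L ^ e)"
proof -
  have "m = 0 \<or> m = 1 \<or> m = 2 \<or> m = 3 \<or> m = 4 \<or> m = 5 \<or> m = 6" using assms by arith
  then show ?thesis
    by (elim disjE) (simp_all add: coeff_def lessThan_nat_numeral lessThan_Suc add_ac)
qed

lemma subvariety_V77: "subvariety A77 (V7 \<times> V7)" "sclass A77 (V7 \<times> V7) = L ^ 7 * L ^ 7"
  using subvariety_times[OF V7_class(1) V7_class(1)] V7_class(2) by simp_all

text \<open>The fibre over a pair is a \<open>P^5\<close>, except over isotropic pairs, where it is
  all of \<open>P^6\<close>. The excess is one cell of class \<open>L ^ 6\<close>.\<close>

lemma isotropic_class:
  shows "subvariety A77 isotropic"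
    "(\<Sum>i<7. sclass A777 (incidence i)) =
      (\<Sum>e<6. L ^ e) * (L ^ 7 * L ^ 7) + L ^ 6 * sclass A77 isotropic"
proof -
  let ?f = "\<lambda>k p. pairing (6 - k) (fst p) (snd p)"
  let ?T = "\<lambda>k. {p \<in> V7 \<times> V7. ?f k p \<noteq> 0 \<and> (\<forall>j<k. ?f j p = 0)}"
  have f: "\<forall>k<7. ?f k \<in> gfun (induced A77 (V7 \<times> V7))" using pairing_gfun by blast
  note s = stratify_sum[OF subvariety_V77(1) f]
  show D: "subvariety A77 isotropic" using s(1) unfolding isotropic_def .
  have inc: "sclass A777 (incidence i) =
      (\<Sum>k<7. coeff i (6 - k) * sclass A77 (?T k)) + L ^ (6 - i) * sclass A77 isotropic"
    if i: "i < 7" for i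
  proof -
    let ?g = "\<lambda>k t. pairing (6 - k) (fst (fst t)) (snd (fst t))"
    have g: "\<forall>k<7. ?g k \<in> gfun (induced A777 (incidence i))" using pairing_gfun3 by blast
    have e: "{t \<in> incidence i. P (fst t)} = {t \<in> incidence i. fst t \<in> {p \<in> V7 \<times> V7. P p}}" for P
      unfolding incidence_def by auto
    have "sclass A777 {t \<in> incidence i. ?g k t \<noteq> 0 \<and> (\<forall>j<k. ?g j t = 0)} =
        coeff i (6 - k) * sclass A77 (?T k)" if k: "k < 7" for k
    proof -
      \<comment> \<open>Stratum \<open>k\<close> constrains the indices \<open>6 - j\<close> with
        \<open>j < k\<close>; these are exactly the \<open>m\<close> with
        \<open>6 - k < m < 7\<close>.\<close>
      have z: "pairing m (fst p) (snd p) = 0" if "p \<in> ?T k" "6 - k < m" "m < 7" for p m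
      proof -
        have "6 - m < k" "6 - (6 - m) = m" using that k by auto
        then show ?thesis using that(1) by (metis (mono_tags, lifting) mem_Collect_eq)
      qed
      consider "i < 6 - k" | "i = 6 - k" | "6 - k < i" by arith
      then have "sclass A777 {t \<in> incidence i. fst t \<in> ?T k} = coeff i (6 - k) * sclass A77 (?T k)"
      proof cases
        case 1
        have "sclass A777 {t \<in> incidence i. fst t \<in> ?T k} = L ^ (5 - i) * sclass A77 (?T k)"
          by (rule incidence_pivot[OF s(2)[OF k] _ 1]) auto
        then show ?thesis using 1 by (simp add: coeff_def)
      next
        case 2
        have "{t \<in> incidence i. fst t \<in> ?T k} = {}"
        proof -
          have ne: "pairing i (fst p) (snd p) + (\<Sum>k\<in>{i<..<7}. pairing k (fst p) (snd p) * a k) \<noteq> 0"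
            if p: "p \<in> ?T k" for p a
          proof -
            have "(\<Sum>k\<in>{i<..<7}. pairing k (fst p) (snd p) * a k) = 0"
              by (intro sum.neutral) (use z[OF p] 2 in auto)
            then show ?thesis using p 2 by auto
          qed
          have n: "t \<notin> incidence i" if "fst t \<in> ?T k" for t
            using ne[OF that, of "snd t"] unfolding incidence_def by (simp add: case_prod_beta)
          have g: "{t \<in> B. fst t \<in> C} = {}" if "\<And>t. fst t \<in> C \<Longrightarrow> t \<notin> B"
            for B :: "(((nat \<Rightarrow> complex) \<times> (nat \<Rightarrow> complex)) \<times> (nat \<Rightarrow> complex)) set" and C
            using that by blast
          show ?thesis by (rule g[OF n])
        qed
        then have 0: "sclass A777 {t \<in> incidence i. fst t \<in> ?T k} = 0"
          by (rule sclass_empty[OF fun_space_A3])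
        show ?thesis unfolding 0 using 2 by (simp add: coeff_def)
      next
        case 3
        have "sclass A777 {t \<in> incidence i. fst t \<in> ?T k} = L ^ (6 - i) * sclass A77 (?T k)"
          by (rule incidence_zero[OF s(2)[OF k] _ z i]) (use 3 in auto)
        then show ?thesis using 3 by (simp add: coeff_def)
      qed
      then show ?thesis
        using e[of "\<lambda>p. ?f k p \<noteq> 0 \<and> (\<forall>j<k. ?f j p = 0)"] by simp
    qed
    moreover have "sclass A777 {t \<in> incidence i. \<forall>k<7. ?g k t = 0} = L ^ (6 - i) * sclass A77 isotropic"
    proof -
      have z: "pairing k (fst p) (snd p) = 0" if "p \<in> isotropic" "k < 7" for p k
      proof -
        have "6 - k < 7" "6 - (6 - k) = k" using that by auto
        then show ?thesis using that(1) unfolding isotropic_def by (metis (mono_tags, lifting) mem_Collect_eq)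
      qed
      have "sclass A777 {t \<in> incidence i. fst t \<in> isotropic} = L ^ (6 - i) * sclass A77 isotropic"
        by (rule incidence_zero[OF D _ z i]) (auto simp: isotropic_def)
      then show ?thesis
        using e[of "\<lambda>p. \<forall>k<7. ?f k p = 0"] unfolding isotropic_def by simp
    qed
    ultimately show ?thesis using stratify_sum(3)[OF subvariety_incidence[OF i] g] by simp
  qed
  have "(\<Sum>i<7. sclass A777 (incidence i)) =
      (\<Sum>i<7. \<Sum>k<7. coeff i (6 - k) * sclass A77 (?T k)) + (\<Sum>i<7. L ^ (6 - i) * sclass A77 isotropic)"
    by (simp add: inc sum.distrib)
  also have "(\<Sum>i<7. \<Sum>k<7. coeff i (6 - k) * sclass A77 (?T k)) =
      (\<Sum>k<7. (\<Sum>i<7. coeff i (6 - k)) * sclass A77 (?T k))"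
    by (subst sum.swap) (simp add: sum_distrib_right)
  also have "\<dots> = (\<Sum>k<7. (\<Sum>e<6. L ^ e) * sclass A77 (?T k))"
    by (intro sum.cong refl) (simp add: sum_coeff)
  also have "\<dots> = (\<Sum>e<6. L ^ e) * (\<Sum>k<7. sclass A77 (?T k))"
    by (simp add: sum_distrib_left)
  also have "(\<Sum>k<7. sclass A77 (?T k)) = L ^ 7 * L ^ 7 - sclass A77 isotropic"
    using s(3) subvariety_V77(2) unfolding isotropic_def by simp
  \<comment> \<open>The cells of \<open>P^6\<close> have exponents \<open>6, ..., 0\<close>;
    separating the largest leaves the class of \<open>P^5\<close>, which absorbs the subtracted term
    above.\<close>
  also have "(\<Sum>i<7. L ^ (6 - i) * sclass A77 isotropic) =
      (\<Sum>e<6. L ^ e) * sclass A77 isotropic + L ^ 6 * sclass A77 isotropic"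
    by (simp add: lessThan_nat_numeral lessThan_Suc algebra_simps)
  finally show "(\<Sum>i<7. sclass A777 (incidence i)) =
      (\<Sum>e<6. L ^ e) * (L ^ 7 * L ^ 7) + L ^ 6 * sclass A77 isotropic"
    by (simp add: algebra_simps)
qed

section \<open>The incidence variety over pairs of a vector and a form\<close>

text \<open>Coordinate \<open>l\<close> of the functional \<open>v \<mapsto> w u v\<close>, where
  \<open>p\<close> is the pair of \<open>u\<close> and the cell coordinates of \<open>w\<close>. All
  of them vanish if and only if \<open>u\<close> is in the kernel of \<open>w\<close>.\<close>

definition contraction :: "nat \<Rightarrow> nat \<Rightarrow> (nat \<Rightarrow> complex) \<times> (nat \<Rightarrow> complex) \<Rightarrow> complex"
  where "contraction i l p = (\<Sum>j<7. W i j l (snd p) * fst p j)"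

lemma contraction_gfun: "contraction i l \<in> gfun (induced A77 T)"
proof -
  have "(\<lambda>p. \<Sum>j<7. (w i j l + (\<Sum>k\<in>{i<..<7}. snd p k * w k j l)) * fst p j) \<in> gfun (induced A77 T)"
    by (intro gfun_sum gfun_mult gfun_add gfun_const gfun_fst_coord gfun_snd_coord fun_space_induced fun_space_A2)
  then show ?thesis by (simp add: contraction_def[abs_def] W_def)
qed

lemma contraction_pairing:
  "(\<Sum>l<7. contraction i l (u, a) * v l) = pairing i u v + (\<Sum>k\<in>{i<..<7}. pairing k u v * a k)"
proof -
  have "(\<Sum>l<7. contraction i l (u, a) * v l) =
      (\<Sum>l<7. \<Sum>j<7. w i j l * u j * v l) + (\<Sum>l<7. \<Sum>j<7. \<Sum>k\<in>{i<..<7}. w k j l * u j * v l * a k)"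
    unfolding contraction_def W_def
    by (simp add: sum_distrib_right sum_distrib_left sum.distrib algebra_simps)
  also have "(\<Sum>l<7. \<Sum>j<7. w i j l * u j * v l) = pairing i u v"
    unfolding pairing_def by (rule sum.swap)
  also have "(\<Sum>l<7. \<Sum>j<7. \<Sum>k\<in>{i<..<7}. w k j l * u j * v l * a k) =
      (\<Sum>k\<in>{i<..<7}. \<Sum>l<7. \<Sum>j<7. w k j l * u j * v l * a k)"
  proof -
    have "(\<Sum>l<7. \<Sum>j<7. \<Sum>k\<in>{i<..<7}. w k j l * u j * v l * a k) =
        (\<Sum>l<7. \<Sum>k\<in>{i<..<7}. \<Sum>j<7. w k j l * u j * v l * a k)"
      by (intro sum.cong refl sum.swap)
    also have "\<dots> = (\<Sum>k\<in>{i<..<7}. \<Sum>l<7. \<Sum>j<7. w k j l * u j * v l * a k)"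
      by (rule sum.swap)
    finally show ?thesis .
  qed
  also have "\<dots> = (\<Sum>k\<in>{i<..<7}. pairing k u v * a k)"
    unfolding pairing_def sum_distrib_right by (rule sum.cong[OF refl], rule sum.swap)
  finally show ?thesis .
qed

text \<open>With \<open>v\<close> as fibre coordinate the equation is linear with coefficients
  \<open>contraction\<close>. Its solution space has class \<open>L ^ 6\<close> off the bundle of
  kernels and \<open>L ^ 7\<close> on it, so the class of that bundle enters with weight
  \<open>L ^ 7 - L ^ 6\<close>.\<close>

lemma incidence_class:
  assumes i: "i < 7" and gen: "\<And>a. a \<in> cell i \<Longrightarrow>
    \<exists>m \<in> {..<7} \<times> {..<7} \<times> {..<7} \<times> {..<7}. rank4_minor i m a \<noteq> 0"
  shows "sclass A777 (incidence i) = L ^ 6 * (L ^ 7 * L ^ (6 - i)) +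
    (L ^ 7 - L ^ 6) * (L * L ^ (6 - i) + (L ^ 3 - L) * sclass A7 (degenerate i))"
proof -
  let ?S = "V7 \<times> cell i"
  have S: "subvariety A77 ?S" "sclass A77 ?S = L ^ 7 * L ^ (6 - i)"
    using subvariety_times[OF V7_class(1) cell_class(1)[OF i]] V7_class(2) cell_class(2)[OF i] by simp_all
  let ?E = "{(p, v). p \<in> ?S \<and> v \<in> V7 \<and> (\<Sum>l<7. contraction i l p * v l) = 0}"
  \<comment> \<open>The factors are only permuted, to make \<open>v\<close> the last one. The
    permutation is its own inverse.\<close>
  have m: "morphism (induced A777 (incidence i)) A777 (\<lambda>t. ((fst (fst t), snd t), snd (fst t)))"
    "morphism (induced A777 ?E) A777 (\<lambda>t. ((fst (fst t), snd t), snd (fst t)))"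
    by (intro morphism_restrict morphism_pair fun_space_A2 fun_space_A3 fun_space_affine
        morphism_comp[OF morphism_fst morphism_fst] morphism_comp[OF morphism_fst morphism_snd] morphism_snd)+
  have "?E \<subseteq> points A777" using coord_subset[of "{..<7}" 7] coord_subset[OF cell_subset[of i]] by auto
  note iso = subvariety_isoI[OF subvariety_incidence[OF i] fun_space_A3 this m]
  have E: "subvariety A777 ?E" "sclass A777 ?E = sclass A777 (incidence i)"
    by (rule iso; auto simp: incidence_def contraction_pairing)+
  let ?Z = "{p \<in> ?S. \<forall>l\<in>{..<7}. contraction i l p = 0}"
  have "sclass A777 ?E = L ^ 6 * (sclass A77 ?S - sclass A77 ?Z) + sclass A777 {t \<in> ?E. fst t \<in> ?Z}"
  proof (rule stratify_fibration_finite(1)[OF S(1) E(1) morphism_restrict[OF morphism_fst]])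
    fix T and l :: nat assume l: "l \<in> {..<7}" and T: "subvariety A77 T" "T \<subseteq> ?S"
      "\<And>p. p \<in> T \<Longrightarrow> contraction i l p \<noteq> 0"
    have "sclass A777 {(p, v). p \<in> T \<and> v \<in> V7 \<and> (\<lambda>_. 0) p + (\<Sum>l<7. contraction i l p * v l) = 0} =
        sclass A77 T * L ^ (card {..<7::nat} - 1)"
      by (rule linear_equation_class(2)[where q = l and a = "contraction i" and b = "\<lambda>_. 0"])
        (use T(1,3) l contraction_gfun gfun_const[OF fun_space_induced[OF fun_space_A2]] in auto)
    moreover have "{(p, v). p \<in> T \<and> v \<in> V7 \<and> (\<lambda>_. 0) p + (\<Sum>l<7. contraction i l p * v l) = 0} =
        {t \<in> ?E. fst t \<in> T}" using T(2) by auto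
    ultimately show "sclass A777 {t \<in> ?E. fst t \<in> T} = L ^ 6 * sclass A77 T"
      by (simp add: mult.commute)
  qed (use contraction_gfun in auto)
  also have "{t \<in> ?E. fst t \<in> ?Z} = ?Z \<times> V7" by auto
  finally have 1: "sclass A777 ?E = L ^ 6 * (sclass A77 ?S - sclass A77 ?Z) + sclass A777 (?Z \<times> V7)" .
  have alt: "W i j l a = - W i l j a" for j l a
    using W_alternating[of i a] unfolding alternating_def by blast
  \<comment> \<open>\<open>contraction\<close> sums over the first index and
    \<open>skew_kernel\<close> over the second; skew symmetry identifies the two systems.\<close>
  have swap: "(\<Sum>j<7. W i j l a * u j) = 0 \<longleftrightarrow> (\<Sum>j<7. W i l j a * u j) = 0" for l a and u :: "nat \<Rightarrow> complex"
  proof -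
    have "(\<Sum>j<7. W i j l a * u j) = - (\<Sum>j<7. W i l j a * u j)"
      by (subst alt) (simp add: sum_negf)
    then show ?thesis by simp
  qed
  note K = kernel_class[OF i gen]
  have m2: "morphism (induced A77 T) A77 (\<lambda>p. (snd p, fst p))" for T
    by (intro morphism_restrict morphism_pair fun_space_A2 fun_space_affine morphism_fst morphism_snd)
  have "?Z \<subseteq> points A77" using coord_subset[of "{..<7}" 7] coord_subset[OF cell_subset[of i]] by auto
  note iso2 = subvariety_isoI[OF K(1) fun_space_A2 this m2 m2]
  have Z: "subvariety A77 ?Z" "sclass A77 ?Z = sclass A77 (skew_kernel (cell i) {..<7} (W i))"
    by (rule iso2; auto simp: skew_kernel_def contraction_def swap)+
  have "sclass A777 (?Z \<times> V7) = sclass A77 ?Z * L ^ 7"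
    using times_coord_class(2)[OF Z(1), of "{..<7}" 7] by simp
  then have "sclass A777 (incidence i) = L ^ 6 * (sclass A77 ?S - sclass A77 ?Z) + sclass A77 ?Z * L ^ 7"
    using 1 E(2) by simp
  moreover have "c * (x - z) + z * d = c * x + (d - c) * z" for c d x z :: K0
    by (simp add: algebra_simps)
  ultimately show ?thesis
    using S(2) Z(2) K(2) cell_class(2)[OF i] by simp
qed

end

section \<open>The class of \<open>GL2\<close>, frames of isotropic planes and dependent
  pairs\<close>

lemma coord_nonzero_class:
  assumes J: "J \<subseteq> {..<n}" "i \<in> J"
  shows "subvariety (affine_space n) {x \<in> coord J. x i \<noteq> 0}"
    "sclass (affine_space n) {x \<in> coord J. x i \<noteq> 0} = L ^ card J - L ^ (card J - 1)"
proof -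
  have J': "J - {i} \<subseteq> {..<n}" using J by auto
  have fin: "finite J" using J finite_subset by blast
  note c = subvariety_cut[OF coord_class(1)[OF J(1)] gfun_coord_induced[of i]]
  show "subvariety (affine_space n) {x \<in> coord J. x i \<noteq> 0}" by (rule c(2))
  have "{x \<in> coord J. x i = 0} = coord (J - {i})" unfolding coord_def using J(2) by auto
  then show "sclass (affine_space n) {x \<in> coord J. x i \<noteq> 0} = L ^ card J - L ^ (card J - 1)"
    using c(3) coord_class(2)[OF J(1)] coord_class(2)[OF J'] J(2) fin by simp
qed

lemma coord_nonzero2_class:
  assumes J: "J \<subseteq> {..<n}" "i \<in> J" "j \<in> J" "i \<noteq> j"
  shows "subvariety (affine_space n) {x \<in> coord J. x i \<noteq> 0 \<and> x j \<noteq> 0}"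
    "sclass (affine_space n) {x \<in> coord J. x i \<noteq> 0 \<and> x j \<noteq> 0} =
      L ^ card J - L ^ (card J - 1) - (L ^ (card J - 1) - L ^ (card J - 2))"
proof -
  have J': "J - {j} \<subseteq> {..<n}" "i \<in> J - {j}" using J by auto
  have fin: "finite J" using J finite_subset by blast
  note a = coord_nonzero_class[OF J(1,2)] and b = coord_nonzero_class[OF J']
  note c = subvariety_cut[OF a(1) gfun_coord_induced[of j]]
  have e: "{x \<in> {x \<in> coord J. x i \<noteq> 0}. x j \<noteq> 0} = {x \<in> coord J. x i \<noteq> 0 \<and> x j \<noteq> 0}" by auto
  show "subvariety (affine_space n) {x \<in> coord J. x i \<noteq> 0 \<and> x j \<noteq> 0}" using c(2) unfolding e .
  have "{x \<in> {x \<in> coord J. x i \<noteq> 0}. x j = 0} = {x \<in> coord (J - {j}). x i \<noteq> 0}"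
    unfolding coord_def using J by auto
  moreover have "card (J - {j}) - 1 = card J - 2" "card (J - {j}) = card J - 1" using J fin by simp_all
  ultimately show "sclass (affine_space n) {x \<in> coord J. x i \<noteq> 0 \<and> x j \<noteq> 0} =
      L ^ card J - L ^ (card J - 1) - (L ^ (card J - 1) - L ^ (card J - 2))"
    using c(3) a(2) b(2) unfolding e by (simp add: algebra_simps)
qed

definition GL2 :: "(nat \<Rightarrow> complex) set"
  where "GL2 = {g \<in> coord {..<4}. g 0 * g 3 - g 1 * g 2 \<noteq> 0}"

text \<open>For \<open>g 0 = 0\<close> the determinant is \<open>- g 1 * g 2\<close> and
  \<open>g 3\<close> is free. For \<open>g 0 \<noteq> 0\<close> the determinant may replace
  \<open>g 3\<close> as a coordinate. The sum of the two parts is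
  \<open>(L^2 - 1) * (L^2 - L)\<close> multiplied out.\<close>

lemma GL2_class:
  "subvariety (affine_space 4) GL2" "sclass (affine_space 4) GL2 = L ^ 4 - L ^ 3 - L ^ 2 + L"
proof -
  let ?A = "affine_space 4" and ?d = "\<lambda>g :: nat \<Rightarrow> complex. g 0 * g 3 - g 1 * g 2"
  note f = fun_space_affine[of 4 "{}"]
  note c = coord_class[of "{..<4}" 4, OF order_refl]
  have d: "?d \<in> gfun (induced ?A T)" for T
    by (intro gfun_diff gfun_mult gfun_coord_induced fun_space_induced f)
  note s = subvariety_cut(2)[OF c(1) d]
  show G: "subvariety ?A GL2" using s unfolding GL2_def .
  let ?G = "{g \<in> GL2. g 0 \<noteq> 0}" and ?T = "{x \<in> coord {..<4}. x 0 \<noteq> 0 \<and> x 3 \<noteq> 0}"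
  note cut = subvariety_cut[OF G gfun_coord_induced[of 0]]
  have 1: "{g \<in> GL2. g 0 = 0} = {x \<in> coord {1, 2, 3}. x 1 \<noteq> 0 \<and> x 2 \<noteq> 0}"
  proof -
    have J: "{1, 2, 3} = {..<4} - {0::nat}" by auto
    have m: "x \<in> coord {1, 2, 3} \<longleftrightarrow> x \<in> coord {..<4} \<and> x 0 = 0" for x
      unfolding J coord_def by auto
    show ?thesis
      by (intro set_eqI, simp only: m GL2_def mem_Collect_eq) auto
  qed
  have 2: "sclass ?A {x \<in> coord {1, 2, 3}. x 1 \<noteq> 0 \<and> x 2 \<noteq> 0} = L ^ 3 - L ^ 2 - (L ^ 2 - L ^ 1)"
    using coord_nonzero2_class(2)[of "{1, 2, 3}" 4 1 2]
    by (simp add: power2_eq_square power3_eq_cube mult.assoc)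
  note t = coord_nonzero2_class[of "{..<4}" 4 0 3]
  have T: "subvariety ?A ?T" "sclass ?A ?T = L ^ 4 - L ^ 3 - (L ^ 3 - L ^ 2)"
    using t by simp_all
  have Gp: "?G \<subseteq> points ?A" unfolding GL2_def using coord_subset[of "{..<4}" 4] by auto
  have G0: "g 0 \<noteq> 0" if "g \<in> points (induced ?A ?T)" for g
    using that by auto
  \<comment> \<open>In the source of this map the entry \<open>x 3\<close> stands for the
    determinant.\<close>
  let ?\<phi> = "\<lambda>x :: nat \<Rightarrow> complex. \<lambda>i :: nat. if i = 3 then (x 3 + x 1 * x 2) / x 0 else x i"
  let ?\<psi> = "\<lambda>g :: nat \<Rightarrow> complex. \<lambda>i :: nat. if i = 3 then ?d g else g i"
  have m1: "morphism (induced ?A ?T) ?A ?\<phi>"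
    by (intro morphism_affine_space fun_space_induced f gfun_if gfun_divide gfun_add gfun_mult gfun_coord_induced)
      (auto simp: affine_points_def)
  have m2: "morphism (induced ?A ?G) ?A ?\<psi>"
    by (intro morphism_affine_space fun_space_induced f gfun_if gfun_diff gfun_mult gfun_coord_induced)
      (auto simp: affine_points_def)
  have "sclass ?A ?G = sclass ?A ?T"
    by (rule subvariety_isoI(2)[OF T(1) f Gp m1 m2])
      (auto simp: GL2_def coord_def fun_eq_iff field_simps)
  then have 3: "sclass ?A ?G = L ^ 4 - L ^ 3 - (L ^ 3 - L ^ 2)"
    using T(2) by simp
  show "sclass ?A GL2 = L ^ 4 - L ^ 3 - L ^ 2 + L"
    unfolding cut(3) 1 2 3 by (simp add: algebra_simps)
qed

context skew_net
begin

definition minor :: "nat \<times> nat \<Rightarrow> (nat \<Rightarrow> complex) \<times> (nat \<Rightarrow> complex) \<Rightarrow> complex"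
  where "minor c p = fst p (fst c) * snd p (snd c) - fst p (snd c) * snd p (fst c)"

lemma minor_gfun: "minor c \<in> gfun (induced A77 T)"
proof -
  have "(\<lambda>p. fst p (fst c) * snd p (snd c) - fst p (snd c) * snd p (fst c)) \<in> gfun (induced A77 T)"
    by (intro gfun_diff gfun_mult gfun_fst_coord gfun_snd_coord fun_space_induced fun_space_A2)
  then show ?thesis by (simp add: minor_def[abs_def])
qed

lemma pairing_skew: "pairing k v u = - pairing k u v" "pairing k u u = 0"
proof -
  have w: "w k j l = - w k l j" for j l
    using w_alternating[of k] unfolding alternating_def by blast
  show 1: "pairing k v u = - pairing k u v" for u v
  proof -
    have "pairing k v u = (\<Sum>l<7. \<Sum>j<7. w k j l * v j * u l)"
      unfolding pairing_def by (rule sum.swap)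
    also have "\<dots> = (\<Sum>l<7. \<Sum>j<7. - (w k l j * u l * v j))"
      by (intro sum.cong refl) (subst w, simp)
    finally show ?thesis unfolding pairing_def by (simp add: sum_negf)
  qed
  show "pairing k u u = 0" using 1[of u u] by simp
qed

lemma pairing_linear:
  "pairing k (\<lambda>i. a * u i + b * v i) x = a * pairing k u x + b * pairing k v x"
  unfolding pairing_def by (simp add: sum_distrib_left sum.distrib algebra_simps)

lemma pairing_linear_right:
  "pairing k x (\<lambda>i. a * u i + b * v i) = a * pairing k x u + b * pairing k x v"
  unfolding pairing_def by (simp add: sum_distrib_left sum.distrib algebra_simps)

text \<open>On a plane every alternating bilinear form is a multiple of the determinant. Together
  with \<open>minor_transform\<close> this makes isotropy and the position of the first nonzero
  minor invariant under change of frame.\<close>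

lemma pairing_transform:
  "pairing k (\<lambda>i. a * u i + b * v i) (\<lambda>i. c * u i + d * v i) = (a * d - b * c) * pairing k u v"
  unfolding pairing_linear pairing_linear_right
  by (simp add: pairing_skew(2) pairing_skew(1)[of k v u] algebra_simps)

lemma minor_transform:
  "minor m (\<lambda>i. a * u i + b * v i, \<lambda>i. c * u i + d * v i) = (a * d - b * c) * minor m (u, v)"
  unfolding minor_def by (simp add: algebra_simps)

lemma coord_linear: "u \<in> coord J \<Longrightarrow> v \<in> coord J \<Longrightarrow> (\<lambda>i. a * u i + b * v i) \<in> coord J"
  unfolding coord_def by simp

lemma isotropic_iff: "p \<in> isotropic \<longleftrightarrow> p \<in> V7 \<times> V7 \<and> (\<forall>k<7. pairing k (fst p) (snd p) = 0)"
proof -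
  have "(\<forall>k<7. P (6 - k)) \<longleftrightarrow> (\<forall>k<7. P k)" for P :: "nat \<Rightarrow> bool"
  proof
    assume *: "\<forall>k<7. P (6 - k)"
    show "\<forall>k<7. P k"
    proof (intro allI impI)
      fix k :: nat assume "k < 7"
      then have "6 - (6 - k) = k" "6 - k < 7" by auto
      then show "P k" using * by metis
    qed
  qed auto
  from this[of "\<lambda>k. pairing k (fst p) (snd p) = 0"] show ?thesis unfolding isotropic_def by simp
qed

lemma isotropic_transform:
  "(u, v) \<in> isotropic \<Longrightarrow> (\<lambda>l. a * u l + b * v l, \<lambda>l. c * u l + d * v l) \<in> isotropic"
  unfolding isotropic_iff fst_conv snd_conv pairing_transform by (simp add: coord_linear)

text \<open>Slices for the action of \<open>GL2\<close>: in stratum \<open>k\<close> the frame of a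
  plane is normalised to the identity in the columns \<open>ms ! k\<close>. The charts of the
  Grassmannian cut the same sets out of \<open>X_W\<close>, which ties the count to the isotropic
  locus.\<close>

definition normal_frames :: "(nat \<times> nat) list \<Rightarrow> nat \<Rightarrow> ((nat \<Rightarrow> complex) \<times> (nat \<Rightarrow> complex)) set"
  where "normal_frames ms k = {p \<in> isotropic. (\<forall>i<k. minor (ms ! i) p = 0) \<and>
    fst p (fst (ms ! k)) = 1 \<and> fst p (snd (ms ! k)) = 0 \<and>
    snd p (fst (ms ! k)) = 0 \<and> snd p (snd (ms ! k)) = 1}"

lemma subvariety_normal_frames: "subvariety A77 (normal_frames ms k)"
proof -
  let ?F = "(\<lambda>i. minor (ms ! i)) ` {..<k} \<union> {\<lambda>p. fst p (fst (ms ! k)) - 1, \<lambda>p. fst p (snd (ms ! k)),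
    \<lambda>p. snd p (fst (ms ! k)), \<lambda>p. snd p (snd (ms ! k)) - 1}"
  have "?F \<subseteq> gfun (induced A77 isotropic)"
    by (auto intro!: minor_gfun gfun_diff gfun_const gfun_fst_coord gfun_snd_coord fun_space_induced fun_space_A2)
  from subvariety_zeros[OF isotropic_class(1) this] show ?thesis
    by (rule back_subst[of "subvariety A77"]) (auto simp: normal_frames_def)
qed

text \<open>A frame in stratum \<open>k\<close> is a unique product of an invertible matrix and a
  normal frame. The matrix is the 2 x 2 block of the frame in the columns \<open>ms ! k\<close>, so
  the parametrisation has a regular inverse.\<close>

lemma frames_class:
  assumes ms: "set ms \<subseteq> {..<7} \<times> {..<7}" "k < length ms"
  shows "sclass A77 {p \<in> isotropic. minor (ms ! k) p \<noteq> 0 \<and> (\<forall>i<k. minor (ms ! i) p = 0)} =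
    sclass A77 (normal_frames ms k) * sclass (affine_space 4) GL2"
proof -
  let ?D = "{p \<in> isotropic. minor (ms ! k) p \<noteq> 0 \<and> (\<forall>i<k. minor (ms ! i) p = 0)}"
  let ?B = "normal_frames ms k" and ?P = "fproduct A77 (affine_space 4)"
  obtain i j where ij: "ms ! k = (i, j)" by (cases "ms ! k")
  have ij7: "i < 7" "j < 7" using ms ij nth_mem by fastforce+
  note S = subvariety_times[OF subvariety_normal_frames[of ms k] GL2_class(1)]
  have fP: "fun_space ?P" by (rule fun_space_A3)
  have Dp: "?D \<subseteq> points A77" unfolding isotropic_def using V7_eq by auto
  let ?\<phi> = "\<lambda>t :: ((nat \<Rightarrow> complex) \<times> (nat \<Rightarrow> complex)) \<times> (nat \<Rightarrow> complex).
    (\<lambda>l. snd t 0 * fst (fst t) l + snd t 1 * snd (fst t) l,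
     \<lambda>l. snd t 2 * fst (fst t) l + snd t 3 * snd (fst t) l)"
  let ?m = "minor (i, j)"
  \<comment> \<open>The inverse of the block, by Cramer's rule, applied to the frame; followed by
    the four entries of the block itself.\<close>
  let ?\<psi> = "\<lambda>p :: (nat \<Rightarrow> complex) \<times> (nat \<Rightarrow> complex).
    ((\<lambda>l. (snd p j / ?m p) * fst p l + (- fst p j / ?m p) * snd p l,
      \<lambda>l. (- snd p i / ?m p) * fst p l + (fst p i / ?m p) * snd p l),
     \<lambda>l :: nat. if l = 0 then fst p i else if l = 1 then fst p j else if l = 2 then snd p i
       else if l = 3 then snd p j else 0)"
  have co: "(\<lambda>t. fst (fst t) l) \<in> gfun (induced ?P T)" "(\<lambda>t. snd (fst t) l) \<in> gfun (induced ?P T)" for l T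
    by (intro gfun_induced gfun_coord_pullback[OF morphism_comp[OF morphism_fst morphism_fst]]
        gfun_coord_pullback[OF morphism_comp[OF morphism_fst morphism_snd]])+
  have m1: "morphism (induced ?P (?B \<times> GL2)) A77 ?\<phi>"
  proof (intro morphism_pair fun_space_affine fun_space_induced fP morphism_affine_space gfun_add gfun_mult
      co gfun_snd_coord)
    fix t assume "t \<in> points (induced ?P (?B \<times> GL2))"
    then have "fst (fst t) \<in> affine_points 7" "snd (fst t) \<in> affine_points 7" by auto
    then show "(\<lambda>l. snd t 0 * fst (fst t) l + snd t 1 * snd (fst t) l) \<in> affine_points 7"
      "(\<lambda>l. snd t 2 * fst (fst t) l + snd t 3 * snd (fst t) l) \<in> affine_points 7"
      by (simp_all add: affine_points_def)
  qed
  have m2: "morphism (induced A77 ?D) ?P ?\<psi>"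
  proof (intro morphism_pair fun_space_affine fun_space_induced fun_space_A2 morphism_affine_space
      gfun_add gfun_mult gfun_divide gfun_uminus gfun_if minor_gfun gfun_fst_coord gfun_snd_coord gfun_const)
    fix p assume p: "p \<in> points (induced A77 ?D)"
    then have "fst p \<in> affine_points 7" "snd p \<in> affine_points 7" by auto
    then show "(\<lambda>l. snd p j / ?m p * fst p l + - fst p j / ?m p * snd p l) \<in> affine_points 7"
      "(\<lambda>l. - snd p i / ?m p * fst p l + fst p i / ?m p * snd p l) \<in> affine_points 7"
      by (simp_all add: affine_points_def)
    show "?m p \<noteq> 0" "?m p \<noteq> 0" "?m p \<noteq> 0" "?m p \<noteq> 0" using p ij by auto
  qed (auto simp: affine_points_def)
  have a: "?\<phi> t \<in> ?D \<and> ?\<psi> (?\<phi> t) = t" if t: "t \<in> ?B \<times> GL2" for t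
  proof -
    obtain u v g where t': "t = ((u, v), g)" by (cases t) auto
    have uv: "(u, v) \<in> isotropic" "\<forall>l<k. minor (ms ! l) (u, v) = 0" "u i = 1" "u j = 0" "v i = 0" "v j = 1"
      and g: "g \<in> coord {..<4}" "g 0 * g 3 - g 1 * g 2 \<noteq> 0"
      using t ij unfolding t' normal_frames_def GL2_def by auto
    let ?U = "\<lambda>l. g 0 * u l + g 1 * v l" and ?V = "\<lambda>l. g 2 * u l + g 3 * v l"
    have m: "?m (?U, ?V) = g 0 * g 3 - g 1 * g 2"
      unfolding minor_def using uv by simp
    have "(?U, ?V) \<in> isotropic"
      by (rule isotropic_transform[OF uv(1)])
    moreover have "\<forall>l<k. minor (ms ! l) (?U, ?V) = 0"
      unfolding minor_transform using uv(2) by simp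
    ultimately have D: "?\<phi> t \<in> ?D" using m g(2) ij unfolding t' by simp
    have g4: "g l = 0" if "l \<ge> 4" for l using g(1) that unfolding coord_def by auto
    have g': "(if l = 0 then g 0 else if l = 1 then g 1 else if l = 2 then g 2 else if l = 3 then g 3 else 0) = g l" for l
    proof -
      consider "l = 0" | "l = 1" | "l = 2" | "l = 3" | "l \<ge> 4" by arith
      then show ?thesis by cases (auto simp: g4)
    qed
    let ?d = "g 0 * g 3 - g 1 * g 2"
    have "(g 3 / ?d) * ?U l + (- g 1 / ?d) * ?V l = u l" "(- g 2 / ?d) * ?U l + (g 0 / ?d) * ?V l = v l" for l
    proof -
      have "(g 3 / ?d) * ?U l + (- g 1 / ?d) * ?V l = (?d * u l) / ?d"
        by (simp add: diff_divide_distrib[symmetric] add_divide_distrib[symmetric] algebra_simps)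
      then show "(g 3 / ?d) * ?U l + (- g 1 / ?d) * ?V l = u l" using g(2) by simp
      have "(- g 2 / ?d) * ?U l + (g 0 / ?d) * ?V l = (?d * v l) / ?d"
        by (simp add: diff_divide_distrib[symmetric] add_divide_distrib[symmetric] algebra_simps)
      then show "(- g 2 / ?d) * ?U l + (g 0 / ?d) * ?V l = v l" using g(2) by simp
    qed
    then have fu: "(\<lambda>l. (g 3 / ?d) * ?U l + (- g 1 / ?d) * ?V l) = u"
      and fv: "(\<lambda>l. (- g 2 / ?d) * ?U l + (g 0 / ?d) * ?V l) = v" by blast+
    have U: "?U i = g 0" "?U j = g 1" "?V i = g 2" "?V j = g 3" using uv(3-6) by simp_all
    have fg: "(\<lambda>l. if l = 0 then g 0 else if l = 1 then g 1 else if l = 2 then g 2 else if l = 3 then g 3 else 0) = g"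
      by (rule ext) (rule g')
    have "?\<psi> (?\<phi> t) = t"
      by (simp only: t' fst_conv snd_conv m U fu fv fg)
    then show ?thesis using D by blast
  qed
  have b: "?\<psi> p \<in> ?B \<times> GL2 \<and> ?\<phi> (?\<psi> p) = p" if p: "p \<in> ?D" for p
  proof -
    obtain u v where p': "p = (u, v)" by (cases p)
    have uv: "(u, v) \<in> isotropic" "\<forall>l<k. minor (ms ! l) (u, v) = 0" and m: "?m (u, v) \<noteq> 0"
      using p ij unfolding p' by auto
    let ?d = "?m (u, v)"
    have d: "?d = u i * v j - u j * v i" unfolding minor_def by simp
    let ?U = "\<lambda>l. (v j / ?d) * u l + (- u j / ?d) * v l" and ?V = "\<lambda>l. (- v i / ?d) * u l + (u i / ?d) * v l"
    have "(?U, ?V) \<in> isotropic"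
      by (rule isotropic_transform[OF uv(1)])
    moreover have "\<forall>l<k. minor (ms ! l) (?U, ?V) = 0"
      unfolding minor_transform using uv(2) by simp
    moreover have "?U i = 1" "?U j = 0" "?V i = 0" "?V j = 1"
    proof -
      have lin: "(x / e) * y + (- z / e) * t = (x * y - z * t) / e" "(- z / e) * t + (x / e) * y = (x * y - z * t) / e"
        for x y z t e :: complex by (simp_all add: diff_divide_distrib)
      have d': "v j * u i - u j * v i = ?d" "u i * v j - v i * u j = ?d" unfolding d by simp_all
      show "?U i = 1" "?U j = 0" "?V i = 0" "?V j = 1" unfolding lin d' using m by simp_all
    qed
    ultimately have B: "(?U, ?V) \<in> ?B" unfolding normal_frames_def using ij by simp
    have G: "snd (?\<psi> p) \<in> GL2"
      using m d unfolding GL2_def coord_def p' by auto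
    have "u i * ?U l + u j * ?V l = u l" "v i * ?U l + v j * ?V l = v l" for l
    proof -
      have "u i * ?U l + u j * ?V l = (?d * u l) / ?d"
        unfolding d by (simp add: diff_divide_distrib[symmetric] add_divide_distrib[symmetric] algebra_simps)
      then show "u i * ?U l + u j * ?V l = u l" using m by simp
      have "v i * ?U l + v j * ?V l = (?d * v l) / ?d"
        unfolding d by (simp add: diff_divide_distrib[symmetric] add_divide_distrib[symmetric] algebra_simps)
      then show "v i * ?U l + v j * ?V l = v l" using m by simp
    qed
    then have "?\<phi> (?\<psi> p) = p" unfolding p' by simp
    then show ?thesis using B G unfolding p' by simp
  qed
  have "sclass A77 ?D = sclass ?P (?B \<times> GL2)"
    by (rule subvariety_isoI(2)[OF S(1) fun_space_A2 Dp m1 m2 a b])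
  then show ?thesis using S(2) by simp
qed

definition dependent_pairs :: "((nat \<Rightarrow> complex) \<times> (nat \<Rightarrow> complex)) set"
  where "dependent_pairs = {p \<in> V7 \<times> V7. \<forall>m \<in> {..<7} \<times> {..<7}. minor m p = 0}"

text \<open>Vanishing minors allow \<open>u\<close> and \<open>v\<close> to be interchanged in every
  product \<open>u j * v l\<close>, so the pairing equals its own negative.\<close>

lemma dependent_isotropic:
  assumes "p \<in> dependent_pairs"
  shows "pairing k (fst p) (snd p) = 0"
proof -
  have m: "fst p j * snd p l = fst p l * snd p j" if "j < 7" "l < 7" for j l
    using assms that unfolding dependent_pairs_def minor_def by auto
  have "pairing k (fst p) (snd p) = (\<Sum>j<7. \<Sum>l<7. w k j l * (fst p j * snd p l))"
    unfolding pairing_def by (simp add: mult.assoc)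
  also have "\<dots> = (\<Sum>j<7. \<Sum>l<7. w k j l * (fst p l * snd p j))"
    by (intro sum.cong refl) (simp add: m)
  also have "\<dots> = pairing k (snd p) (fst p)"
    unfolding pairing_def by (intro sum.cong refl) (simp add: mult_ac)
  finally show ?thesis using pairing_skew(1)[of k "fst p" "snd p"] by simp
qed

text \<open>Over \<open>u \<noteq> 0\<close> the fibre is the line of multiples of \<open>u\<close>;
  over \<open>u = 0\<close> it is the whole space.\<close>

lemma dependent_class:
  "subvariety A77 dependent_pairs" "sclass A77 dependent_pairs = L * (L ^ 7 - 1) + L ^ 7"
proof -
  have "minor ` ({..<7} \<times> {..<7}) \<subseteq> gfun (induced A77 (V7 \<times> V7))"
    by (intro image_subsetI minor_gfun)
  from subvariety_zeros[OF subvariety_V77(1) this]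
  show D: "subvariety A77 dependent_pairs"
    unfolding dependent_pairs_def by (simp only: ball_simps)
  let ?Z = "{u \<in> V7. \<forall>i\<in>{..<7}. u i = 0}"
  have "sclass A77 dependent_pairs = L * (sclass A7 V7 - sclass A7 ?Z) +
      sclass A77 {p \<in> dependent_pairs. fst p \<in> ?Z}"
  proof (rule stratify_fibration_finite(1)[where f = "\<lambda>i u. u i", OF V7_class(1) D morphism_restrict[OF morphism_fst]])
    fix T and i :: nat assume i: "i \<in> {..<7}" and T: "subvariety A7 T" "T \<subseteq> V7" "\<And>u. u \<in> T \<Longrightarrow> u i \<noteq> 0"
    let ?B = "affine_space 1" and ?E = "{p \<in> dependent_pairs. fst p \<in> T}"
    note A1 = subvariety_points[OF is_variety_affine[of 1]]
    note P = subvariety_times[OF T(1) A1(1)]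
    have fP: "fun_space (fproduct A7 ?B)" by (rule fun_space_A2)
    have Ep: "?E \<subseteq> points A77" unfolding dependent_pairs_def using V7_eq by auto
    have m1: "morphism (induced (fproduct A7 ?B) (T \<times> points ?B)) A77 (\<lambda>t. (fst t, \<lambda>l. snd t 0 * fst t l))"
      by (intro morphism_pair fun_space_affine fun_space_induced fP morphism_restrict[OF morphism_fst]
          morphism_affine_space gfun_mult gfun_fst_coord gfun_snd_coord) (auto simp: affine_points_def)
    \<comment> \<open>The scalar factor is read off at the place \<open>i\<close>, where
      \<open>u\<close> does not vanish on \<open>T\<close>.\<close>
    have m2: "morphism (induced A77 ?E) (fproduct A7 ?B) (\<lambda>p. (fst p, \<lambda>l. if l = 0 then snd p i / fst p i else 0))"
      by (intro morphism_pair fun_space_affine fun_space_induced fun_space_A2 morphism_restrict[OF morphism_fst]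
          morphism_affine_space gfun_if gfun_divide gfun_const gfun_fst_coord gfun_snd_coord)
        (use T(3) in \<open>auto simp: affine_points_def\<close>)
    have a: "(fst t, \<lambda>l. snd t 0 * fst t l) \<in> ?E \<and>
        (fst (fst t, \<lambda>l. snd t 0 * fst t l), \<lambda>l. if l = 0 then snd (fst t, \<lambda>l. snd t 0 * fst t l) i / fst (fst t, \<lambda>l. snd t 0 * fst t l) i else 0) = t"
      if t: "t \<in> T \<times> points ?B" for t
    proof -
      have u: "fst t \<in> T" "fst t \<in> V7" using t T(2) by auto
      have z: "snd t l = 0" if "l \<noteq> 0" for l using t that by (auto simp: affine_points_def)
      show ?thesis
        using u T(3)[OF u(1)] z
        by (auto simp: dependent_pairs_def minor_def coord_def prod_eq_iff fun_eq_iff)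
    qed
    have b: "(fst p, \<lambda>l. if l = (0::nat) then snd p i / fst p i else 0) \<in> T \<times> points ?B \<and>
        (fst p, \<lambda>l. (if (0::nat) = 0 then snd p i / fst p i else 0) * fst p l) = p"
      if p: "p \<in> ?E" for p
    proof -
      have "fst p j * snd p l = fst p l * snd p j" if "j < 7" "l < 7" for j l
        using p that unfolding dependent_pairs_def minor_def by auto
      then have "snd p i / fst p i * fst p l = snd p l" if "l < 7" for l
        using that i T(3)[of "fst p"] p by (simp add: field_simps)
      moreover have "fst p l = 0" "snd p l = 0" if "\<not> l < 7" for l
        using p that unfolding dependent_pairs_def coord_def by auto
      ultimately have "snd p i / fst p i * fst p l = snd p l" for l
        by (cases "l < 7") auto
      then show ?thesis using p by (auto simp: affine_points_def prod_eq_iff fun_eq_iff)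
    qed
    have "sclass A77 ?E = sclass (fproduct A7 ?B) (T \<times> points ?B)"
      by (rule subvariety_isoI(2)[OF P(1) fun_space_A2 Ep m1 m2]) (use a b in auto)
    then show "sclass A77 ?E = L * sclass A7 T"
      using P(2) A1(2) by (simp add: L_def mult.commute)
  qed (auto simp: dependent_pairs_def gfun_coord_induced)
  also have "?Z = coord {}" unfolding coord_def by auto
  also have "{p \<in> dependent_pairs. fst p \<in> coord {}} = coord {} \<times> V7"
    unfolding dependent_pairs_def minor_def coord_def by auto
  finally show "sclass A77 dependent_pairs = L * (L ^ 7 - 1) + L ^ 7"
    using V7_class(2) coord_class[of "{}" 7] times_coord_class(2)[of A7 "coord {}" "{..<7}" 7] by simp
qed

text \<open>Dependent pairs are isotropic for every net, so the remainder of the stratification by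
  Pluecker coordinates is a polynomial in \<open>L\<close>.\<close>

lemma isotropic_frames_class:
  assumes ms: "set ms = {(i, j). i < j \<and> j < 7}"
  shows "sclass A77 isotropic =
    (\<Sum>k<length ms. sclass A77 (normal_frames ms k)) * (L ^ 4 - L ^ 3 - L ^ 2 + L) +
    (L * (L ^ 7 - 1) + L ^ 7)"
proof -
  have f: "\<forall>k<length ms. minor (ms ! k) \<in> gfun (induced A77 isotropic)" using minor_gfun by blast
  have "p \<in> isotropic \<and> (\<forall>i<length ms. minor (ms ! i) p = 0) \<longleftrightarrow> p \<in> dependent_pairs" for p
  proof -
    have "(\<forall>i<length ms. minor (ms ! i) p = 0) \<longleftrightarrow> (\<forall>m\<in>set ms. minor m p = 0)"
      by (simp add: all_set_conv_all_nth)
    also have "\<dots> \<longleftrightarrow> (\<forall>m \<in> {..<7} \<times> {..<7}. minor m p = 0)"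
    proof
      assume *: "\<forall>m\<in>set ms. minor m p = 0"
      show "\<forall>m \<in> {..<7} \<times> {..<7}. minor m p = 0"
      proof
        fix m :: "nat \<times> nat" assume m: "m \<in> {..<7} \<times> {..<7}"
        obtain i j where ij: "m = (i, j)" by (cases m)
        consider "i < j" | "i = j" | "j < i" by arith
        then show "minor m p = 0"
        proof cases
          case 1
          then show ?thesis using * m unfolding ms ij by auto
        next
          case 2
          then show ?thesis unfolding ij minor_def by simp
        next
          case 3
          then have "minor (j, i) p = 0" using * m unfolding ms ij by auto
          then show ?thesis unfolding ij minor_def by (simp add: mult.commute)
        qed
      qed
    qed (auto simp: ms)
    finally show ?thesis
      using dependent_isotropic[of p] unfolding isotropic_iff dependent_pairs_def by blast
  qed
  then have e: "{p \<in> isotropic. \<forall>i<length ms. minor (ms ! i) p = 0} = dependent_pairs" by blast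
  have "set ms \<subseteq> {..<7} \<times> {..<7}" unfolding ms by auto
  note fc = frames_class[OF this]
  show ?thesis
    using stratify_sum(3)[OF isotropic_class(1) f] fc
    unfolding e dependent_class(2) GL2_class(2) by (simp add: sum_distrib_right)
qed

section \<open>Comparison of the two counts\<close>

text \<open>Apart from the terms with \<open>?X\<close> and \<open>?Y\<close> both evaluations of
  the incidence class are polynomials in \<open>L\<close>, and these agree. The remaining equation
  is only rearranged, never divided by a power of \<open>L\<close>.\<close>

lemma main_class_identity:
  assumes ms: "set ms = {(i, j). i < j \<and> j < 7}"
    and gen: "\<And>i a. i < 7 \<Longrightarrow> a \<in> cell i \<Longrightarrow>
      \<exists>m \<in> {..<7} \<times> {..<7} \<times> {..<7} \<times> {..<7}. rank4_minor i m a \<noteq> 0"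
  shows "((\<Sum>k<length ms. sclass A77 (normal_frames ms k)) - (\<Sum>i<7. sclass A7 (degenerate i))) *
    (L ^ 2 - 1) * (L - 1) * L ^ 7 = 0"
proof -
  let ?X = "\<Sum>k<length ms. sclass A77 (normal_frames ms k)" and ?Y = "\<Sum>i<7. sclass A7 (degenerate i)"
  let ?P = "\<Sum>e<6. L ^ e" and ?s = "L ^ 6"
  \<comment> \<open>The geometric series. Nothing else about \<open>?P\<close> is needed to match
    the terms that depend on \<open>L\<close> only.\<close>
  have s: "?s = L * ?P - ?P + 1"
    by (simp add: lessThan_nat_numeral lessThan_Suc numeral_eq_Suc algebra_simps)
  have q: "L ^ 7 = L * ?s" by (simp add: numeral_eq_Suc)
  have P6: "(\<Sum>i<7. L ^ (6 - i)) = ?P + ?s"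
    by (simp add: lessThan_nat_numeral lessThan_Suc add_ac)
  have "(\<Sum>i<7. sclass A777 (incidence i)) = (\<Sum>i<7. (?s * L ^ 7 + (L ^ 7 - ?s) * L) * L ^ (6 - i) +
      (L ^ 7 - ?s) * (L ^ 3 - L) * sclass A7 (degenerate i))"
  proof (rule sum.cong[OF refl])
    fix i :: nat assume "i \<in> {..<7}"
    then have i: "i < 7" by simp
    show "sclass A777 (incidence i) = (?s * L ^ 7 + (L ^ 7 - ?s) * L) * L ^ (6 - i) +
      (L ^ 7 - ?s) * (L ^ 3 - L) * sclass A7 (degenerate i)"
    proof -
      have "sclass A777 (incidence i) = ?s * (L ^ 7 * L ^ (6 - i)) +
          (L ^ 7 - ?s) * (L * L ^ (6 - i) + (L ^ 3 - L) * sclass A7 (degenerate i))"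
        by (rule incidence_class[OF i]) (rule gen[OF i])
      then show ?thesis by (simp only: distrib_left distrib_right mult.assoc add.assoc)
    qed
  qed
  also have "\<dots> = (?s * L ^ 7 + (L ^ 7 - ?s) * L) * (?P + ?s) + (L ^ 7 - ?s) * (L ^ 3 - L) * ?Y"
    unfolding sum.distrib sum_distrib_left[symmetric] P6 ..
  finally have A: "?P * (L ^ 7 * L ^ 7) + ?s * (?X * (L ^ 4 - L ^ 3 - L ^ 2 + L) + (L * (L ^ 7 - 1) + L ^ 7)) =
      (?s * L ^ 7 + (L ^ 7 - ?s) * L) * (?P + ?s) + (L ^ 7 - ?s) * (L ^ 3 - L) * ?Y"
    unfolding isotropic_class(2) isotropic_frames_class[OF ms] .
  have B: "?P * (L ^ 7 * L ^ 7) + ?s * (L * (L ^ 7 - 1) + L ^ 7) =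
      (?s * L ^ 7 + (L ^ 7 - ?s) * L) * (?P + ?s)"
  proof -
    \<comment> \<open>With indeterminates in place of \<open>L\<close>, \<open>?P\<close> and
      \<open>?s\<close> the expansion stays small; the linear relation among them suffices.\<close>
    have "p * (l * s * (l * s)) + s * (l * (l * s - 1) + l * s) =
        (s * (l * s) + (l * s - s) * l) * (p + s)" if s: "s = l * p - p + 1" for l p s :: K0
      unfolding s by (simp add: algebra_simps)
    from this[OF s] show ?thesis unfolding q .
  qed
  have "t * x = z" if "p + t * (x + c) = y + z" "p + t * c = y" for x z p t c y :: K0
  proof -
    have "t * x = (p + t * (x + c)) - (p + t * c)" by (simp add: algebra_simps)
    then show ?thesis unfolding that by simp
  qed
  from this[OF A B] have C: "?s * (?X * (L ^ 4 - L ^ 3 - L ^ 2 + L)) = (L ^ 7 - ?s) * (L ^ 3 - L) * ?Y" .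
  \<comment> \<open>The right side is the class of \<open>GL2\<close>. The missing power comes from
    the factor \<open>L ^ 6\<close> of the isotropic pairs.\<close>
  have D: "(L ^ 2 - 1) * (L - 1) * L = L ^ 4 - L ^ 3 - L ^ 2 + L"
    by (simp add: numeral_eq_Suc algebra_simps)
  \<comment> \<open>Excess of the solution space for \<open>v\<close> times excess of the kernel
    over \<open>Y_W\<close>.\<close>
  have E: "(L ^ 7 - ?s) * (L ^ 3 - L) = (L ^ 2 - 1) * (L - 1) * L ^ 7"
  proof -
    have "(l * s - s) * (l * l * l - l) = (l * l - 1) * (l - 1) * (l * s)" for l s :: K0
      by (simp add: algebra_simps)
    from this[of L ?s] show ?thesis unfolding q by (simp add: power3_eq_cube power2_eq_square)
  qed
  have "x * d * e * (l * s) = s * (x * (d * e * l))" for x d e l s :: K0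
    by (simp add: mult_ac)
  from this[of ?X "L ^ 2 - 1" "L - 1" L ?s]
  have F: "?X * (L ^ 2 - 1) * (L - 1) * L ^ 7 = (L ^ 2 - 1) * (L - 1) * L ^ 7 * ?Y"
    unfolding q[symmetric] D C E .
  have "(x - y) * d * e * l = x * d * e * l - d * e * l * y" for x y d e l :: K0
    by (simp add: algebra_simps)
  then show ?thesis using F by simp
qed

end

section \<open>Atlases of Grassmannians\<close>

lemma regular_induced_open:
  assumes X: "fun_space X" and U: "openin (zariski_top X) U" and V: "openin (zariski_top X) V" "V \<subseteq> U"
    and h: "h \<in> regular (induced X U) V"
  shows "h \<in> regular X V"
proof (rule fun_space_sheaf[OF X V(1)])
  fix x assume x: "x \<in> V"
  from bspec[OF h[unfolded regular_induced] x]
  show "\<exists>N g. openin (zariski_top X) N \<and> x \<in> N \<and> g \<in> regular X N \<and> (\<forall>y\<in>V \<inter> N. h y = g y)" .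
qed

lemma openin_induced_open:
  assumes "openin (zariski_top X) U" "openin (zariski_top (induced X U)) V"
  shows "openin (zariski_top X) V"
  using assms unfolding openin_induced by (elim exE conjE) (simp add: openin_Int)

section \<open>Grassmannians as quotients of frame spaces\<close>

locale finite_frames = vector_space smul
  for smul :: "complex \<Rightarrow> 'v::ab_group_add \<Rightarrow> 'v" +
  fixes k :: nat and E :: "'v set"
  assumes k_pos: "k > 0" and E_subspace: "subspace E"
begin

abbreviation F :: "(nat \<Rightarrow> 'v) fspace"
  where "F \<equiv> frame_space smul k E"

abbreviation G :: "'v set fspace"
  where "G \<equiv> grassmannian smul k E"

abbreviation frame_span :: "(nat \<Rightarrow> 'v) \<Rightarrow> 'v set"
  where "frame_span t \<equiv> module.span smul (t ` {..<k})"

lemma points_F [simp]: "points F = frames smul k E"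
  unfolding frame_space_def by (rule points_zariski[OF function_algebra_generated])

lemma fun_space_F: "fun_space F"
  unfolding frame_space_def by (rule fun_space_zariski[OF function_algebra_generated])

lemma frame_coordinate_gfun:
  "Vector_Spaces.linear smul (*) \<xi> \<Longrightarrow> i < k \<Longrightarrow> (\<lambda>t. \<xi> (t i)) \<in> gfun F"
  unfolding gfun_def frame_space_def
  by (rule algebra_regular_zariski[OF function_algebra_generated algebra_generated.generator]) blast

lemma frame_span_subspaces:
  assumes t: "t \<in> frames smul k E"
  shows "frame_span t \<in> subspaces smul k E"
proof -
  have "t ` {..<k} \<subseteq> E" "inj_on t {..<k}" "independent (t ` {..<k})"
    using t unfolding frames_def by auto
  then show ?thesis
    unfolding subspaces_def
    using span_minimal[OF _ E_subspace] dim_span_eq_card_independent[of "t ` {..<k}"]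
    by (simp add: card_image)
qed

lemma frame_exists:
  assumes T: "T \<in> subspaces smul k E"
  shows "\<exists>t \<in> frames smul k E. frame_span t = T"
proof -
  have T': "subspace T" "T \<subseteq> E" "dim T = k" using T unfolding subspaces_def by auto
  obtain B where B: "B \<subseteq> T" "independent B" "T \<subseteq> span B" "card B = k"
    using basis_exists[of T] T'(3) by metis
  \<comment> \<open>A positive \<open>card\<close> excludes an infinite basis, for which
    \<open>card\<close> would be \<open>0\<close>.\<close>
  have "finite B" using B(4) k_pos card_ge_0_finite by metis
  then obtain f where f: "bij_betw f {..<k} B"
    using ex_bij_betw_nat_finite[of B] B(4) by (metis atLeast0LessThan)
  let ?t = "\<lambda>i. if i < k then f i else 0"
  have im: "?t ` {..<k} = B" using f unfolding bij_betw_def by auto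
  have "inj_on ?t {..<k}" using f unfolding bij_betw_def inj_on_def by auto
  moreover have "f i \<in> E" if "i < k" for i
    using f that T'(2) B(1) unfolding bij_betw_def by auto
  ultimately have "?t \<in> frames smul k E"
    using B T' im unfolding frames_def by auto
  moreover have "frame_span ?t = T"
    unfolding im using span_minimal[OF B(1) T'(1)] B(3) by auto
  ultimately show ?thesis by blast
qed

text \<open>The definition passes through \<open>topology\<close>; its open sets become accessible
  once preimages under \<open>frame_span\<close> are shown to form a topology.\<close>

lemma openin_G: "openin (zariski_top G) U \<longleftrightarrow>
  U \<subseteq> subspaces smul k E \<and> openin (zariski_top F) {t \<in> frames smul k E. frame_span t \<in> U}"
proof -
  let ?P = "\<lambda>U. U \<subseteq> subspaces smul k E \<and> openin (zariski_top F) {t \<in> points F. frame_span t \<in> U}"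
  have "istopology ?P"
    unfolding istopology_def
  proof (intro conjI allI impI)
    fix S T assume "?P S" "?P T"
    moreover have "{t \<in> points F. frame_span t \<in> S \<inter> T} =
      {t \<in> points F. frame_span t \<in> S} \<inter> {t \<in> points F. frame_span t \<in> T}" by auto
    ultimately show "S \<inter> T \<subseteq> subspaces smul k E"
      "openin (zariski_top F) {t \<in> points F. frame_span t \<in> S \<inter> T}"
      using openin_Int by auto
  next
    fix \<K> assume *: "\<forall>S\<in>\<K>. ?P S"
    then show "\<Union>\<K> \<subseteq> subspaces smul k E" by blast
    have "openin (zariski_top F) (\<Union>S\<in>\<K>. {t \<in> points F. frame_span t \<in> S})"
      using * by (intro openin_Union) auto
    also have "(\<Union>S\<in>\<K>. {t \<in> points F. frame_span t \<in> S}) = {t \<in> points F. frame_span t \<in> \<Union>\<K>}"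
      by auto
    finally show "openin (zariski_top F) {t \<in> points F. frame_span t \<in> \<Union>\<K>}" .
  qed
  from topology_inverse'[OF this] show ?thesis
    unfolding grassmannian_def Let_def fspace.sel by simp
qed

lemma regular_G: "h \<in> regular G U \<longleftrightarrow>
    (\<lambda>t. h (frame_span t)) \<in> regular F {t \<in> frames smul k E. frame_span t \<in> U}"
  unfolding grassmannian_def Let_def fspace.sel by (simp add: comp_def)

lemma points_G [simp]: "points G = subspaces smul k E"
proof -
  have "{t \<in> frames smul k E. frame_span t \<in> subspaces smul k E} = points F"
    using frame_span_subspaces by auto
  then have "openin (zariski_top G) (subspaces smul k E)"
    unfolding openin_G using openin_topspace[of "zariski_top F"] by (simp only: points_F) simp
  moreover have "points G \<subseteq> subspaces smul k E"
    using openin_topspace[of "zariski_top G"] unfolding openin_G by (rule conjunct1)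
  ultimately show ?thesis using openin_subset by blast
qed

text \<open>Every condition speaks of preimages under \<open>frame_span\<close>, and preimages
  commute with gluing, algebra operations and nonvanishing loci.\<close>

lemma fun_space_G: "fun_space G"
  unfolding fun_space_def
proof (intro conjI allI impI ballI)
  show "sheaf_condition G"
    unfolding sheaf_condition_def
  proof (intro allI impI)
    fix U h
    assume *: "openin (zariski_top G) U \<and>
      (\<forall>x\<in>U. \<exists>V g. openin (zariski_top G) V \<and> x \<in> V \<and> g \<in> regular G V \<and> (\<forall>y\<in>U \<inter> V. h y = g y))"
    show "h \<in> regular G U"
      unfolding regular_G
    proof (rule fun_space_sheaf[OF fun_space_F])
      show "openin (zariski_top F) {t \<in> frames smul k E. frame_span t \<in> U}"
        using conjunct1[OF *] unfolding openin_G by (rule conjunct2)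
      fix t assume t: "t \<in> {t \<in> frames smul k E. frame_span t \<in> U}"
      then have "frame_span t \<in> U" by simp
      from bspec[OF conjunct2[OF *] this] obtain V g where V: "openin (zariski_top G) V"
        "frame_span t \<in> V" "g \<in> regular G V" "\<forall>y\<in>U \<inter> V. h y = g y" by (elim exE conjE) (rule that)
      show "\<exists>V g. openin (zariski_top F) V \<and> t \<in> V \<and> g \<in> regular F V \<and>
          (\<forall>y\<in>{t \<in> frames smul k E. frame_span t \<in> U} \<inter> V. h (frame_span y) = g y)"
        by (rule exI[of _ "{t \<in> frames smul k E. frame_span t \<in> V}"], rule exI[of _ "\<lambda>t. g (frame_span t)"])
          (use t V V(1)[unfolded openin_G] V(3)[unfolded regular_G] in auto)
    qed
  qed
next
  fix U assume U: "openin (zariski_top G) U"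
  have o: "openin (zariski_top F) {t \<in> frames smul k E. frame_span t \<in> U}"
    using U unfolding openin_G by (rule conjunct2)
  note alg = function_algebraD[OF fun_space_algebra[OF fun_space_F o]]
  show "function_algebra (regular G U)"
    by (rule function_algebraI; unfold regular_G) (rule alg; assumption?)+
  fix h assume h: "h \<in> regular G U"
  have e: "{t \<in> frames smul k E. frame_span t \<in> {x \<in> U. h x \<noteq> 0}} =
      {t \<in> {t \<in> frames smul k E. frame_span t \<in> U}. h (frame_span t) \<noteq> 0}" by auto
  have "openin (zariski_top F) {t \<in> frames smul k E. frame_span t \<in> {x \<in> U. h x \<noteq> 0}}"
    unfolding e by (rule fun_space_nonzero_open[OF fun_space_F o h[unfolded regular_G]])
  moreover have "U \<subseteq> subspaces smul k E" using U unfolding openin_G by (rule conjunct1)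
  ultimately show "openin (zariski_top G) {x \<in> U. h x \<noteq> 0}"
    unfolding openin_G by auto
  show "(\<lambda>x. inverse (h x)) \<in> regular G {x \<in> U. h x \<noteq> 0}"
    unfolding regular_G e by (rule fun_space_inverse[OF fun_space_F o h[unfolded regular_G]])
qed

lemma morphism_frame_span: "morphism F G frame_span"
  unfolding morphism_def continuous_map_def
proof (intro conjI allI impI)
  show "frame_span \<in> points F \<rightarrow> points G" using frame_span_subspaces by auto
  show "openin (zariski_top F) {t \<in> points F. frame_span t \<in> U}" if "openin (zariski_top G) U" for U
    using that unfolding openin_G points_F by (rule conjunct2)
  fix U h assume "openin (zariski_top G) U \<and> h \<in> regular G U"
  then show "h \<circ> frame_span \<in> regular F {t \<in> points F. frame_span t \<in> U}"
    unfolding regular_G points_F comp_def by (rule conjunct2)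
qed

text \<open>Universal property of the quotient, over an open set: a map on subspaces is a morphism
  if its composite with \<open>frame_span\<close> is one.\<close>

lemma morphism_from_G:
  assumes U: "openin (zariski_top G) U"
    and \<phi>: "morphism (induced F {t \<in> frames smul k E. frame_span t \<in> U}) Y (\<lambda>t. \<phi> (frame_span t))"
  shows "morphism (induced G U) Y \<phi>"
proof -
  let ?U = "{t \<in> frames smul k E. frame_span t \<in> U}"
  have oU: "openin (zariski_top F) ?U" and US: "U \<subseteq> subspaces smul k E"
    using U unfolding openin_G by auto
  have pU: "points (induced F ?U) = ?U" by auto
  have pGU: "points (induced G U) = U" using US by auto
  have e: "{t \<in> frames smul k E. frame_span t \<in> {x \<in> U. \<phi> x \<in> V}} =
      {t \<in> points (induced F ?U). \<phi> (frame_span t) \<in> V}" for V by auto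
  have o: "openin (zariski_top G) {x \<in> U. \<phi> x \<in> V}" if V: "openin (zariski_top Y) V" for V
    unfolding openin_G e
    using openin_induced_open[OF oU morphism_preimage_open[OF \<phi> V]] US by auto
  show ?thesis
    unfolding morphism_def continuous_map_def pGU
  proof (intro conjI allI impI)
    show "\<phi> \<in> U \<rightarrow> points Y"
    proof
      fix x assume x: "x \<in> U"
      then obtain t where t: "t \<in> frames smul k E" "frame_span t = x" using frame_exists US by blast
      then show "\<phi> x \<in> points Y" using morphism_points[OF \<phi>, of t] x by auto
    qed
    show "openin (zariski_top (induced G U)) {x \<in> U. \<phi> x \<in> V}" if "openin (zariski_top Y) V" for V
      unfolding openin_induced using o[OF that] by (intro exI[of _ "{x \<in> U. \<phi> x \<in> V}"]) auto
    fix V f assume V: "openin (zariski_top Y) V \<and> f \<in> regular Y V"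
    have "f \<circ> (\<lambda>t. \<phi> (frame_span t)) \<in> regular (induced F ?U) {t \<in> points (induced F ?U). \<phi> (frame_span t) \<in> V}"
      by (rule morphism_regular[OF \<phi> conjunct1[OF V] conjunct2[OF V]])
    from regular_induced_open[OF fun_space_F oU openin_induced_open[OF oU morphism_preimage_open[OF \<phi> conjunct1[OF V]]] _ this]
    have "f \<circ> \<phi> \<in> regular G {x \<in> U. \<phi> x \<in> V}"
      unfolding regular_G e by (simp add: comp_def subset_iff)
    then show "f \<circ> \<phi> \<in> regular (induced G U) {x \<in> U. \<phi> x \<in> V}"
      by (rule regular_inducedI[OF o[OF conjunct1[OF V]]]) simp
  qed
qed

end

section \<open>Atlases by normal forms, separatedness and classes of closed subsets\<close>

text \<open>Gluing data shared by projective spaces and Grassmannians of planes. Chart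
  \<open>m\<close> consists of the spans of frames with \<open>\<mu> m \<noteq> 0\<close>;
  \<open>\<sigma> m\<close> computes the normal form in a closed subset \<open>C m\<close> of an
  affine variety, and \<open>\<rho>\<close> turns a normal form back into a frame. The functions in
  \<open>H m m'\<close> test equality of spans across two charts and provide separatedness.\<close>

locale grassmann_atlas = finite_frames smul k E
  for smul :: "complex \<Rightarrow> 'v::ab_group_add \<Rightarrow> 'v" and k :: nat and E :: "'v set" +
  fixes Y :: "'b fspace" and N :: nat and \<mu> :: "nat \<Rightarrow> (nat \<Rightarrow> 'v) \<Rightarrow> complex"
    and \<sigma> :: "nat \<Rightarrow> (nat \<Rightarrow> 'v) \<Rightarrow> 'b" and \<rho> :: "'b \<Rightarrow> nat \<Rightarrow> 'v"
    and C :: "nat \<Rightarrow> 'b set" and H :: "nat \<Rightarrow> nat \<Rightarrow> ('b \<times> 'b \<Rightarrow> complex) set"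
  assumes Y: "is_variety Y" "is_affine Y"
    and C: "m < N \<Longrightarrow> closedin (zariski_top Y) (C m)"
    and \<mu>: "m < N \<Longrightarrow> \<mu> m \<in> gfun F"
    and \<mu>_span: "m < N \<Longrightarrow> t \<in> frames smul k E \<Longrightarrow> t' \<in> frames smul k E \<Longrightarrow>
      frame_span t = frame_span t' \<Longrightarrow> \<mu> m t \<noteq> 0 \<Longrightarrow> \<mu> m t' \<noteq> 0 \<and> \<sigma> m t = \<sigma> m t'"
    and \<sigma>: "m < N \<Longrightarrow> morphism (induced F {t \<in> frames smul k E. \<mu> m t \<noteq> 0}) Y (\<sigma> m)"
    and \<sigma>_C: "m < N \<Longrightarrow> t \<in> frames smul k E \<Longrightarrow> \<mu> m t \<noteq> 0 \<Longrightarrow> \<sigma> m t \<in> C m"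
    and \<rho>: "m < N \<Longrightarrow> morphism (induced Y (C m)) F \<rho>"
    and \<mu>_\<rho>: "m < N \<Longrightarrow> x \<in> C m \<Longrightarrow> \<mu> m (\<rho> x) \<noteq> 0"
    and \<sigma>_\<rho>: "m < N \<Longrightarrow> x \<in> C m \<Longrightarrow> \<sigma> m (\<rho> x) = x"
    and span_\<rho>\<sigma>: "m < N \<Longrightarrow> t \<in> frames smul k E \<Longrightarrow> \<mu> m t \<noteq> 0 \<Longrightarrow> frame_span (\<rho> (\<sigma> m t)) = frame_span t"
    and cover: "t \<in> frames smul k E \<Longrightarrow> \<exists>m<N. \<mu> m t \<noteq> 0"
    and H: "m < N \<Longrightarrow> m' < N \<Longrightarrow> h \<in> H m m' \<Longrightarrow> h \<in> gfun (induced (fproduct Y Y) (C m \<times> C m'))"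
    and H_span: "m < N \<Longrightarrow> m' < N \<Longrightarrow> x \<in> C m \<Longrightarrow> y \<in> C m' \<Longrightarrow>
      frame_span (\<rho> x) = frame_span (\<rho> y) \<longleftrightarrow> (\<forall>h\<in>H m m'. h (x, y) = 0)"
begin

lemma fun_space_Y: "fun_space Y"
  by (rule is_variety_fun_space[OF Y(1)])

lemma C_points: "m < N \<Longrightarrow> C m \<subseteq> points Y"
  using C closedin_subset by blast

lemma \<rho>_frames: "m < N \<Longrightarrow> x \<in> C m \<Longrightarrow> \<rho> x \<in> frames smul k E"
  using morphism_points[OF \<rho>, of m x] C_points by auto

definition chart :: "nat \<Rightarrow> 'v set set"
  where "chart m = frame_span ` {t \<in> frames smul k E. \<mu> m t \<noteq> 0}"

lemma chart_iff: "m < N \<Longrightarrow> t \<in> frames smul k E \<Longrightarrow> frame_span t \<in> chart m \<longleftrightarrow> \<mu> m t \<noteq> 0"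
  unfolding chart_def using \<mu>_span by blast

lemma chart_pullback:
  "m < N \<Longrightarrow> {t \<in> frames smul k E. frame_span t \<in> chart m} = {t \<in> frames smul k E. \<mu> m t \<noteq> 0}"
  using chart_iff by auto

lemma openin_chart: "m < N \<Longrightarrow> openin (zariski_top G) (chart m)"
  unfolding openin_G chart_pullback
  using fun_space_nonzero_open[OF fun_space_F openin_topspace \<mu>[unfolded gfun_def], of m]
    frame_span_subspaces unfolding chart_def by auto

text \<open>Any frame of the subspace may be chosen: by \<open>\<mu>_span\<close>, the value of
  \<open>\<sigma> m\<close> depends on the span only.\<close>

definition chart_map :: "nat \<Rightarrow> 'v set \<Rightarrow> 'b"
  where "chart_map m x = \<sigma> m (SOME t. t \<in> frames smul k E \<and> frame_span t = x)"

lemma chart_map: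
  assumes "m < N" "t \<in> frames smul k E" "\<mu> m t \<noteq> 0"
  shows "chart_map m (frame_span t) = \<sigma> m t"
proof -
  let ?t = "SOME t'. t' \<in> frames smul k E \<and> frame_span t' = frame_span t"
  have "?t \<in> frames smul k E \<and> frame_span ?t = frame_span t"
    by (rule someI[of _ t]) (use assms(2) in simp)
  then show ?thesis
    unfolding chart_map_def using \<mu>_span[OF assms(1,2) _ _ assms(3), of ?t] by simp
qed

lemma morphism_chart_map:
  assumes m: "m < N"
  shows "morphism (induced G (chart m)) Y (chart_map m)"
proof (rule morphism_from_G[OF openin_chart[OF m]])
  show "morphism (induced F {t \<in> frames smul k E. frame_span t \<in> chart m}) Y (\<lambda>t. chart_map m (frame_span t))"
    unfolding chart_pullback[OF m]
    by (rule morphism_cong[OF fun_space_induced[OF fun_space_F] \<sigma>[OF m]]) (use chart_map[OF m] in auto)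
qed

lemma morphism_span_\<rho>: "m < N \<Longrightarrow> morphism (induced Y (C m)) G (\<lambda>x. frame_span (\<rho> x))"
  by (rule morphism_comp[OF \<rho> morphism_frame_span])

lemma chart_map_C:
  assumes m: "m < N" and x: "x \<in> chart m"
  shows "chart_map m x \<in> C m" "frame_span (\<rho> (chart_map m x)) = x"
proof -
  obtain t where t: "t \<in> frames smul k E" "\<mu> m t \<noteq> 0" "x = frame_span t"
    using x unfolding chart_def by blast
  then show "chart_map m x \<in> C m" "frame_span (\<rho> (chart_map m x)) = x"
    using chart_map[OF m t(1,2)] \<sigma>_C[OF m t(1,2)] span_\<rho>\<sigma>[OF m t(1,2)] by simp_all
qed

lemma span_\<rho>_chart:
  assumes m: "m < N" and x: "x \<in> C m"
  shows "frame_span (\<rho> x) \<in> chart m" "chart_map m (frame_span (\<rho> x)) = x"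
  using chart_iff[OF m \<rho>_frames[OF m x]] \<mu>_\<rho>[OF m x] chart_map[OF m \<rho>_frames[OF m x] \<mu>_\<rho>[OF m x]]
    \<sigma>_\<rho>[OF m x] by simp_all

lemma chart_subset: "chart m \<subseteq> subspaces smul k E"
  unfolding chart_def using frame_span_subspaces by auto

lemma isomorphic_chart:
  assumes m: "m < N" and S: "S \<subseteq> chart m"
  shows "isomorphic (induced G S) (induced Y {x \<in> C m. frame_span (\<rho> x) \<in> S})"
proof (rule isomorphic_induced[OF fun_space_G fun_space_Y])
  show "morphism (induced G S) Y (chart_map m)"
  proof -
    have "morphism (induced G S) (induced G (chart m)) (\<lambda>x. x)"
      by (rule morphism_into_induced[OF fun_space_induced[OF fun_space_G] morphism_induced]) (use S in auto)
    from morphism_comp[OF this morphism_chart_map[OF m]] show ?thesis .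
  qed
  show "morphism (induced Y {x \<in> C m. frame_span (\<rho> x) \<in> S}) G (\<lambda>x. frame_span (\<rho> x))"
  proof -
    have "morphism (induced Y {x \<in> C m. frame_span (\<rho> x) \<in> S}) (induced Y (C m)) (\<lambda>x. x)"
      by (rule morphism_into_induced[OF fun_space_induced[OF fun_space_Y] morphism_induced]) auto
    from morphism_comp[OF this morphism_span_\<rho>[OF m]] show ?thesis .
  qed
qed (use chart_map_C[OF m] span_\<rho>_chart[OF m] S in auto)

text \<open>Two different subspaces lie in charts \<open>m\<close> and \<open>m'\<close>, and some
  function of \<open>H m m'\<close> is nonzero at their normal forms. Its nonvanishing locus is an
  open neighbourhood without diagonal points.\<close>

lemma diagonal_closed: "closedin (zariski_top (fproduct G G)) {(x, x) |x. x \<in> points G}"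
proof -
  have "openin (zariski_top (fproduct G G)) (points (fproduct G G) - {(x, x) |x. x \<in> points G})"
  proof (subst openin_subopen, intro ballI)
    fix p assume p: "p \<in> points (fproduct G G) - {(x, x) |x. x \<in> points G}"
    obtain x y where xy: "p = (x, y)" by (cases p)
    have ne: "x \<noteq> y" "x \<in> subspaces smul k E" "y \<in> subspaces smul k E" using p unfolding xy by auto
    have "\<exists>m<N. x \<in> chart m" if "x \<in> subspaces smul k E" for x
      using frame_exists[OF that] cover chart_iff by metis
    then obtain m m' where m: "m < N" "x \<in> chart m" "m' < N" "y \<in> chart m'" using ne by blast
    let ?U = "chart m \<times> chart m'" and ?P = "fproduct G G"
    let ?Q = "induced (fproduct Y Y) (C m \<times> C m')"
    have fP: "fun_space ?P" by (intro fun_space_fproduct fun_space_G)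
    have oU: "openin (zariski_top ?P) ?U"
    proof -
      have "?U = {p \<in> points ?P. fst p \<in> chart m} \<inter> {p \<in> points ?P. snd p \<in> chart m'}"
        using chart_subset by auto
      then show ?thesis
        using openin_Int[OF morphism_preimage_open[OF morphism_fst openin_chart[OF m(1)]]
            morphism_preimage_open[OF morphism_snd openin_chart[OF m(3)]]] by simp
    qed
    let ?\<phi> = "\<lambda>p. (chart_map m (fst p), chart_map m' (snd p))"
    have m\<phi>: "morphism (induced ?P ?U) ?Q ?\<phi>"
    proof (rule morphism_into_induced[OF fun_space_induced[OF fP]])
      have "morphism (induced ?P ?U) (induced G (chart m)) fst" "morphism (induced ?P ?U) (induced G (chart m')) snd"
        by (intro morphism_into_induced fun_space_induced fP morphism_restrict morphism_fst morphism_snd; auto)+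
      then show "morphism (induced ?P ?U) (fproduct Y Y) ?\<phi>"
        by (intro morphism_pair fun_space_Y fun_space_induced fP morphism_comp[OF _ morphism_chart_map[OF m(1)]]
            morphism_comp[OF _ morphism_chart_map[OF m(3)]])
    qed (use chart_map_C(1) m in auto)
    have iff: "a = b \<longleftrightarrow> (\<forall>h\<in>H m m'. h (?\<phi> (a, b)) = 0)" if "a \<in> chart m" "b \<in> chart m'" for a b
      using H_span[OF m(1,3) chart_map_C(1)[OF m(1) that(1)] chart_map_C(1)[OF m(3) that(2)]]
        chart_map_C(2)[OF m(1) that(1)] chart_map_C(2)[OF m(3) that(2)] by simp
    obtain h where h: "h \<in> H m m'" "h (?\<phi> (x, y)) \<noteq> 0" using iff[OF m(2,4)] ne by blast
    let ?O = "{p \<in> points (induced ?P ?U). h (?\<phi> p) \<noteq> 0}"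
    have pU: "points (induced ?P ?U) = ?U" using chart_subset by auto
    have "openin (zariski_top (induced ?P ?U)) ?O"
      by (rule fun_space_nonzero_open[OF fun_space_induced[OF fP] openin_topspace
            gfun_pullback[OF m\<phi> H[OF m(1,3) h(1)], unfolded gfun_def]])
    from openin_induced_open[OF oU this] have "openin (zariski_top ?P) ?O" .
    moreover have "p \<in> ?O" unfolding pU using m h(2) xy by simp
    moreover have "?O \<subseteq> points ?P - {(x, x) |x. x \<in> points G}"
    proof -
      have "h (?\<phi> (a, a)) = 0" if "a \<in> chart m" "a \<in> chart m'" for a
        using iff[OF that] h(1) by blast
      then show ?thesis unfolding pU using chart_subset by auto
    qed
    ultimately show "\<exists>T. openin (zariski_top ?P) T \<and> p \<in> T \<and> T \<subseteq> points ?P - {(x, x) |x. x \<in> points G}"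
      by blast
  qed
  then show ?thesis unfolding closedin_def by auto
qed

lemma is_variety_G: "is_variety G"
proof (rule is_varietyI[OF fun_space_G, of "chart ` {..<N}"])
  show "\<Union>(chart ` {..<N}) = points G"
  proof
    show "points G \<subseteq> \<Union>(chart ` {..<N})"
    proof
      fix x assume "x \<in> points G"
      then obtain t where t: "t \<in> frames smul k E" "frame_span t = x" using frame_exists by auto
      obtain m where "m < N" "\<mu> m t \<noteq> 0" using cover[OF t(1)] by blast
      then show "x \<in> \<Union>(chart ` {..<N})" using chart_iff t by auto
    qed
  qed (use chart_subset in auto)
  fix U assume "U \<in> chart ` {..<N}"
  then obtain m where m: "m < N" "U = chart m" by blast
  then show "openin (zariski_top G) U" using openin_chart by simp
  have e: "{x \<in> C m. frame_span (\<rho> x) \<in> chart m} = C m" using span_\<rho>_chart[OF m(1)] by auto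
  have "is_affine (induced Y (C m))" by (rule is_affine_closed[OF fun_space_Y Y(2) C[OF m(1)]])
  then show "is_affine (induced G U)"
    using is_affine_isomorphic[OF isomorphic_sym[OF isomorphic_chart[OF m(1) order_refl]]]
    unfolding m(2) e by blast
qed (simp_all add: diagonal_closed[simplified])

text \<open>The charts are removed one by one. What is left of \<open>A\<close> is closed, its part
  in the next chart is open in it, so each removal is a scissor relation, and the removed part is
  computed in normal forms. The equations \<open>Z\<close> on frames are what makes \<open>A\<close>
  closed.\<close>

lemma closed_class:
  assumes A: "A \<subseteq> subspaces smul k E" and Z: "Z \<subseteq> gfun F"
    and AZ: "\<And>t. t \<in> frames smul k E \<Longrightarrow> frame_span t \<in> A \<longleftrightarrow> (\<forall>f\<in>Z. f t = 0)"
  shows "K0_class (induced G A) =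
    (\<Sum>m<N. sclass Y {x \<in> C m. frame_span (\<rho> x) \<in> A \<and> (\<forall>m'<m. \<mu> m' (\<rho> x) = 0)})"
proof -
  have closed: "closedin (zariski_top G) A"
  proof -
    have "{t \<in> frames smul k E. frame_span t \<in> points G - A} = points F - {t \<in> points F. \<forall>f\<in>Z. f t = 0}"
      using AZ frame_span_subspaces by auto
    moreover have "openin (zariski_top F) (points F - {t \<in> points F. \<forall>f\<in>Z. f t = 0})"
      using closedin_zeros[OF fun_space_F Z] unfolding closedin_def by (rule conjunct2)
    ultimately show ?thesis
      unfolding closedin_def openin_G points_G using A by auto
  qed
  define A' where "A' m = {x \<in> A. \<forall>m'<m. x \<notin> chart m'}" for m
  have cA': "closedin (zariski_top G) (A' m)" if "m \<le> N" for m
    using that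
  proof (induction m)
    case 0
    then show ?case using closed by (simp add: A'_def)
  next
    case (Suc m)
    have "A' (Suc m) = A' m - chart m" unfolding A'_def by (auto simp: less_Suc_eq)
    then show ?case using Suc openin_chart[of m] by (simp add: closedin_diff)
  qed
  let ?B = "\<lambda>m. {x \<in> C m. frame_span (\<rho> x) \<in> A \<and> (\<forall>m'<m. \<mu> m' (\<rho> x) = 0)}"
  have B: "subvariety Y (?B m)" if m: "m < N" for m
  proof -
    have Cm: "subvariety Y (C m)"
      unfolding subvariety_def
      using is_variety_closed[OF Y(1) C[OF m]] fun_space_Y C_points[OF m] by simp
    let ?F = "(\<lambda>f x. f (\<rho> x)) ` (Z \<union> \<mu> ` {..<m})"
    have "?F \<subseteq> gfun (induced Y (C m))"
      using gfun_pullback[OF \<rho>[OF m]] Z \<mu> m by auto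
    from subvariety_zeros[OF Cm this] have "subvariety Y {x \<in> C m. \<forall>f\<in>?F. f x = 0}" .
    also have "{x \<in> C m. \<forall>f\<in>?F. f x = 0} = ?B m"
      using AZ[OF \<rho>_frames[OF m]] by auto
    finally show ?thesis .
  qed
  have step: "K0_class (induced G (A' m)) = sclass Y (?B m) + K0_class (induced G (A' (Suc m)))"
    if m: "m < N" for m
  proof -
    let ?S = "A' m \<inter> chart m"
    have e: "{x \<in> C m. frame_span (\<rho> x) \<in> ?S} = ?B m"
      unfolding A'_def using span_\<rho>_chart[OF m] chart_iff[OF _ \<rho>_frames[OF m]] m by auto
    have iso: "isomorphic (induced G ?S) (induced Y (?B m))"
      using isomorphic_chart[OF m, of ?S] unfolding e by simp
    have V: "is_variety (induced G (A' m))"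
      by (rule is_variety_closed[OF is_variety_G cA']) (use m in simp)
    have p: "points (induced G (A' m)) = A' m" unfolding A'_def using A by auto
    have o: "openin (zariski_top (induced G (A' m))) ?S"
      unfolding openin_induced using openin_chart[OF m] by blast
    have i2: "isomorphic (induced (induced G (A' m)) ?S) (induced G ?S)"
      using isomorphic_induced_induced[OF fun_space_G, of "A' m" ?S] by (simp add: Int_absorb1)
    have i3: "isomorphic (induced (induced G (A' m)) (A' m - ?S)) (induced G (A' (Suc m)))"
    proof -
      have "A' m \<inter> (A' m - ?S) = A' (Suc m)" unfolding A'_def by (auto simp: less_Suc_eq)
      then show ?thesis using isomorphic_induced_induced[OF fun_space_G, of "A' m" "A' m - ?S"] by simp
    qed
    have "is_variety (induced (induced G (A' m)) ?S)"
      by (rule is_variety_isomorphic[OF isomorphic_sym[OF isomorphic_trans[OF i2 iso]]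
            subvarietyD(3)[OF B[OF m]]]) (intro fun_space_induced fun_space_G)
    from K0_class_scissor[OF V o this] show ?thesis
      unfolding p K0_class_cong[OF isomorphic_trans[OF i2 iso]] K0_class_cong[OF i3] sclass_def .
  qed
  have "K0_class (induced G (A' 0)) = (\<Sum>m<n. sclass Y (?B m)) + K0_class (induced G (A' n))"
    if "n \<le> N" for n
    using that
  proof (induction n)
    case (Suc n)
    then show ?case using step[of n] by (simp add: add.assoc)
  qed simp
  from this[OF order_refl] have "K0_class (induced G (A' 0)) =
      (\<Sum>m<N. sclass Y (?B m)) + K0_class (induced G (A' N))" .
  moreover have "A' N = {}"
  proof -
    have "\<exists>m<N. x \<in> chart m" if "x \<in> A" for x
      using frame_exists[of x] A that cover chart_iff by (metis subsetD)
    then show ?thesis unfolding A'_def by blast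
  qed
  moreover have "A' 0 = A" unfolding A'_def by simp
  ultimately show ?thesis
    using sclass_empty[OF fun_space_G, of "{}"] by (simp add: sclass_def)
qed

end

section \<open>Charts of projective spaces and of Grassmannians of planes\<close>

lemma is_affine_affine_space: "is_affine (affine_space n)"
  unfolding is_affine_def using isomorphic_refl by blast

text \<open>The functionals \<open>c j\<close> are defined on the ambient space although they give
  coordinates only on \<open>E\<close>: the algebra of a frame space is generated by linear
  functionals on the whole type.\<close>

locale coordinatized = vector_space smul
  for smul :: "complex \<Rightarrow> 'v::ab_group_add \<Rightarrow> 'v" +
  fixes E :: "'v set" and d :: nat and e :: "nat \<Rightarrow> 'v" and c :: "nat \<Rightarrow> 'v \<Rightarrow> complex"
  assumes E_subspace: "subspace E"
    and e_E: "j < d \<Longrightarrow> e j \<in> E"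
    and c_linear: "Vector_Spaces.linear smul (*) (c j)"
    and c_e: "j < d \<Longrightarrow> l < d \<Longrightarrow> c j (e l) = (if j = l then 1 else 0)"
    and expand: "v \<in> E \<Longrightarrow> v = (\<Sum>j<d. smul (c j v) (e j))"
begin

definition comb :: "(nat \<Rightarrow> complex) \<Rightarrow> 'v"
  where "comb x = (\<Sum>j<d. smul (x j) (e j))"

lemma linear_add: "Vector_Spaces.linear smul (*) \<xi> \<Longrightarrow> \<xi> (u + v) = \<xi> u + \<xi> v"
proof -
  assume "Vector_Spaces.linear smul (*) \<xi>"
  then interpret l: Vector_Spaces.linear smul "(*)" \<xi> .
  show ?thesis by (rule l.add)
qed

lemma linear_scale: "Vector_Spaces.linear smul (*) \<xi> \<Longrightarrow> \<xi> (smul a v) = a * \<xi> v"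
proof -
  assume "Vector_Spaces.linear smul (*) \<xi>"
  then interpret l: Vector_Spaces.linear smul "(*)" \<xi> .
  show ?thesis by (rule l.scale)
qed

lemma linear_comb: "Vector_Spaces.linear smul (*) \<xi> \<Longrightarrow> \<xi> (comb x) = (\<Sum>j<d. x j * \<xi> (e j))"
proof -
  assume "Vector_Spaces.linear smul (*) \<xi>"
  then interpret l: Vector_Spaces.linear smul "(*)" \<xi> .
  show ?thesis unfolding comb_def by (simp add: l.sum l.scale)
qed

lemma c_comb:
  assumes "j < d"
  shows "c j (comb x) = x j"
proof -
  have "c j (comb x) = (\<Sum>l<d. if l = j then x l else 0)"
    unfolding linear_comb[OF c_linear] by (intro sum.cong refl) (auto simp: c_e[OF assms])
  then show ?thesis using assms by simp
qed

lemma comb_E: "comb x \<in> E"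
  unfolding comb_def by (intro subspace_sum[OF E_subspace] subspace_scale[OF E_subspace] e_E) simp

lemma comb_linear: "comb (\<lambda>j. a * x j + b * y j) = smul a (comb x) + smul b (comb y)"
  unfolding comb_def by (simp add: scale_left_distrib sum.distrib scale_sum_right)

lemma comb_cong: "(\<And>j. j < d \<Longrightarrow> x j = y j) \<Longrightarrow> comb x = comb y"
  unfolding comb_def by (intro sum.cong) auto

lemma comb_coordinates: "v \<in> E \<Longrightarrow> (\<And>j. j < d \<Longrightarrow> x j = c j v) \<Longrightarrow> comb x = v"
  using expand[of v] unfolding comb_def by simp

lemma coordinates_eq_zero: "v \<in> E \<Longrightarrow> (\<And>j. j < d \<Longrightarrow> c j v = 0) \<Longrightarrow> v = 0"
  using expand[of v] by simp

lemma c_combination: "c j (smul a u + smul b v) = a * c j u + b * c j v"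
  by (simp add: linear_add[OF c_linear] linear_scale[OF c_linear])

lemma coordinates_eq: "u \<in> E \<Longrightarrow> v \<in> E \<Longrightarrow> (\<And>j. j < d \<Longrightarrow> c j u = c j v) \<Longrightarrow> u = v"
  using expand[of u] expand[of v] by simp

lemma span_pair_iff: "x \<in> span {r, s} \<longleftrightarrow> (\<exists>a b. x = smul a r + smul b s)"
proof
  assume "x \<in> span {r, s}"
  then obtain a where "x - smul a r \<in> span {s}" unfolding span_insert by blast
  then obtain b where "x - smul a r = smul b s" unfolding span_singleton by blast
  then have "x = smul a r + smul b s" by (simp add: algebra_simps)
  then show "\<exists>a b. x = smul a r + smul b s" by blast
next
  assume "\<exists>a b. x = smul a r + smul b s"
  then show "x \<in> span {r, s}" by (auto intro: span_add span_scale span_base)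
qed

text \<open>The adjugate matrix recovers \<open>r\<close> and \<open>s\<close> up to the nonzero
  determinant.\<close>

lemma span_pair_eqI:
  assumes "p = smul a r + smul b s" "q = smul a' r + smul b' s" "a * b' - b * a' \<noteq> 0"
  shows "span {p, q} = span {r, s}"
proof -
  let ?D = "a * b' - b * a'"
  have "p \<in> span {r, s}" "q \<in> span {r, s}" unfolding span_pair_iff using assms by blast+
  then have 1: "span {p, q} \<subseteq> span {r, s}" by (intro span_minimal) auto
  have "smul b' p + smul (- b) q = smul ?D r"
    unfolding assms(1,2) by (simp add: scale_right_distrib scale_left_diff_distrib mult.commute)
  then have "smul ?D r \<in> span {p, q}" unfolding span_pair_iff by metis
  from span_scale[OF this, of "inverse ?D"] have r: "r \<in> span {p, q}" using assms(3) by simp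
  have "smul (- a') p + smul a q = smul ?D s"
    unfolding assms(1,2) by (simp add: scale_right_distrib scale_left_diff_distrib mult.commute)
  then have "smul ?D s \<in> span {p, q}" unfolding span_pair_iff by metis
  from span_scale[OF this, of "inverse ?D"] have "s \<in> span {p, q}" using assms(3) by simp
  with r have "span {r, s} \<subseteq> span {p, q}" by (intro span_minimal) auto
  with 1 show ?thesis by blast
qed

lemma frames1_iff: "t \<in> frames smul 1 E \<longleftrightarrow> t 0 \<in> E \<and> t 0 \<noteq> 0 \<and> (\<forall>i\<ge>1. t i = 0)"
  unfolding frames_def by (auto simp: lessThan_Suc)

lemma frames2_iff: "t \<in> frames smul 2 E \<longleftrightarrow> t 0 \<in> E \<and> t 1 \<in> E \<and> (\<forall>i\<ge>2. t i = 0) \<and>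
  t 1 \<noteq> 0 \<and> t 0 \<notin> span {t 1}"
proof -
  have r: "{..<2} = {0, 1::nat}" by auto
  have s: "(\<forall>i<2. t i \<in> E) \<longleftrightarrow> t 0 \<in> E \<and> t 1 \<in> E" by (auto simp: less_2_cases_iff)
  have "inj_on t {0, 1} \<and> independent (t ` {0, 1}) \<longleftrightarrow> t 1 \<noteq> 0 \<and> t 0 \<notin> span {t 1}"
    using span_base[of "t 0" "{t 1}"] independent_insert[of "t 0" "{t 1}"] by (auto simp: dependent_single)
  then show ?thesis unfolding frames_def r mem_Collect_eq s by blast
qed

lemma finite_frames1: "finite_frames smul 1 E"
  by unfold_locales (use E_subspace in auto)

lemma finite_frames2: "finite_frames smul 2 E"
  by unfold_locales (use E_subspace in auto)

definition section1 :: "nat \<Rightarrow> (nat \<Rightarrow> 'v) \<Rightarrow> nat \<Rightarrow> complex"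
  where "section1 m t = (\<lambda>j. if j < d then c j (t 0) / c m (t 0) else 0)"

definition frame1 :: "(nat \<Rightarrow> complex) \<Rightarrow> nat \<Rightarrow> 'v"
  where "frame1 x = (\<lambda>i. if i = 0 then comb x else 0)"

text \<open>The second vector is normalised to \<open>1\<close> at place \<open>m\<close>, so if the
  two vectors are proportional, the factor can only be the entry of the first one there.\<close>

definition transition1 :: "nat \<Rightarrow> ((nat \<Rightarrow> complex) \<times> (nat \<Rightarrow> complex) \<Rightarrow> complex) set"
  where "transition1 m = (\<lambda>l p. fst p l - snd p l * fst p m) ` {..<d}"

lemma comb_section1:
  assumes "t 0 \<in> E" "c m (t 0) \<noteq> 0"
  shows "comb (section1 m t) = smul (inverse (c m (t 0))) (t 0)"
  by (rule comb_coordinates[OF subspace_scale[OF E_subspace assms(1)]])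
    (simp add: section1_def linear_scale[OF c_linear] field_simps)

lemma atlas1:
  "grassmann_atlas smul 1 E (affine_space d) d (\<lambda>m t. c m (t 0)) section1 frame1
    (\<lambda>m. {x \<in> affine_points d. x m = 1})
    (\<lambda>m m'. transition1 m')"
proof -
  interpret FF: finite_frames smul 1 E by (rule finite_frames1)
  have im: "t ` {..<1::nat} = {t 0}" for t :: "nat \<Rightarrow> 'v" by auto
  have f: "fun_space (affine_space d)" by (rule fun_space_affine)
  have fr: "frame1 x \<in> frames smul 1 E" if "m < d" "x m = 1" for x m
  proof -
    have "c m (comb x) \<noteq> 0" using c_comb[OF that(1)] that(2) by simp
    moreover have "c m 0 = 0" using linear_scale[OF c_linear, of m 0 0] by simp
    ultimately have "comb x \<noteq> 0" by metis
    then show ?thesis unfolding frames1_iff using comb_E by (simp add: frame1_def)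
  qed
  have c0: "c m (frame1 x 0) = x m" if "m < d" for m x using c_comb[OF that] by (simp add: frame1_def)
  show ?thesis
  proof
    show "is_variety (affine_space d)" by (rule is_variety_affine)
    show "is_affine (affine_space d)" by (rule is_affine_affine_space)
    fix m assume m: "m < d"
    have "closedin (zariski_top (affine_space d)) {x \<in> points (affine_space d). x m - 1 = 0}"
      by (intro closedin_zero f gfun_diff gfun_coord gfun_const)
    then show "closedin (zariski_top (affine_space d)) {x \<in> affine_points d. x m = 1}" by simp
    have cg: "(\<lambda>t. c j (t 0)) \<in> gfun FF.F" for j
      by (rule FF.frame_coordinate_gfun[OF c_linear]) simp
    show "(\<lambda>t. c m (t 0)) \<in> gfun FF.F" by (rule cg)
    show "morphism (induced FF.F {t \<in> frames smul 1 E. c m (t 0) \<noteq> 0}) (affine_space d) (section1 m)"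
      unfolding section1_def[abs_def]
      by (intro morphism_affine_space fun_space_induced FF.fun_space_F gfun_if gfun_divide gfun_const
          gfun_induced cg) (auto simp: affine_points_def)
    show "morphism (induced (affine_space d) {x \<in> affine_points d. x m = 1}) FF.F frame1"
      unfolding frame_space_def
    proof (rule morphism_zariski[OF fun_space_induced[OF f]])
      fix s assume "s \<in> {\<lambda>t::nat \<Rightarrow> 'v. \<xi> (t i) |\<xi> i. Vector_Spaces.linear smul (*) \<xi> \<and> i < 1}"
      then obtain \<xi> i where s: "s = (\<lambda>t. \<xi> (t i))" "Vector_Spaces.linear smul (*) \<xi>" "i < (1::nat)" by (elim CollectE exE conjE) (rule that)
      have "s (frame1 x) = (\<Sum>j<d. x j * \<xi> (e j))" for x
        using s linear_comb[OF s(2)] by (simp add: frame1_def)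
      then show "(\<lambda>x. s (frame1 x)) \<in> gfun (induced (affine_space d) {x \<in> affine_points d. x m = 1})"
        by (simp only:) (intro gfun_sum gfun_mult gfun_const gfun_coord_induced fun_space_induced f)
    qed (use fr[OF m] in auto)
    fix t assume t: "t \<in> frames smul 1 E"
    then have tE: "t 0 \<in> E" "t 0 \<noteq> 0" unfolding frames1_iff by auto
    {
      fix t' assume t': "t' \<in> frames smul 1 E" "FF.frame_span t = FF.frame_span t'" "c m (t 0) \<noteq> 0"
      have "t 0 \<in> span {t' 0}" using t'(2) span_base[of "t 0" "{t 0}"] unfolding im by simp
      then obtain a where a: "t 0 = smul a (t' 0)" unfolding span_singleton by blast
      have ca: "c j (t 0) = a * c j (t' 0)" for j unfolding a linear_scale[OF c_linear] ..
      have "a \<noteq> 0" using t'(3) ca by auto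
      then show "c m (t' 0) \<noteq> 0 \<and> section1 m t = section1 m t'"
        using t'(3) unfolding section1_def ca by (auto simp: fun_eq_iff)
    }
    assume ne: "c m (t 0) \<noteq> 0"
    show "section1 m t \<in> {x \<in> affine_points d. x m = 1}"
      using ne m by (simp add: section1_def affine_points_def)
    show "FF.frame_span (frame1 (section1 m t)) = FF.frame_span t"
    proof -
      let ?a = "inverse (c m (t 0))"
      have e: "frame1 (section1 m t) 0 = smul ?a (t 0)"
        using comb_section1[of t m] tE ne by (simp add: frame1_def)
      have "span {smul ?a (t 0)} = span {t 0}"
        using span_image_scale[of "{t 0}" "\<lambda>_. ?a"] ne by simp
      then show ?thesis unfolding im e .
    qed
  next
    fix m x assume m: "m < d" and x: "x \<in> {x \<in> affine_points d. x m = 1}"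
    then show "c m (frame1 x 0) \<noteq> 0" using c0 by simp
    show "section1 m (frame1 x) = x"
      using x m unfolding section1_def by (auto simp: c0 affine_points_def fun_eq_iff)
  next
    fix t assume "t \<in> frames smul 1 E"
    then show "\<exists>m<d. c m (t 0) \<noteq> 0"
      unfolding frames1_iff using coordinates_eq_zero by blast
  next
    fix m m' h assume "m < d" "m' < d" "h \<in> transition1 m'"
    then show "h \<in> gfun (induced (fproduct (affine_space d) (affine_space d))
        ({x \<in> affine_points d. x m = 1} \<times> {x \<in> affine_points d. x m' = 1}))"
      unfolding transition1_def
      by (auto intro!: gfun_diff gfun_mult gfun_fst_coord gfun_snd_coord fun_space_induced fun_space_A2)
  next
    fix m m' x y assume m: "m < d" "m' < d" and x: "x \<in> {x \<in> affine_points d. x m = 1}"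
      and y: "y \<in> {x \<in> affine_points d. x m' = 1}"
    have "FF.frame_span (frame1 x) = FF.frame_span (frame1 y) \<longleftrightarrow> (\<forall>l<d. x l - y l * x m' = 0)"
      unfolding im
    proof
      assume "span {frame1 x 0} = span {frame1 y 0}"
      then have "comb x \<in> span {comb y}" using span_base[of "comb x" "{comb x}"] by (simp add: frame1_def)
      then obtain a where a: "comb x = smul a (comb y)" unfolding span_singleton by blast
      have "x l = a * y l" if "l < d" for l
        using c_comb[OF that, of x] c_comb[OF that, of y] a linear_scale[OF c_linear] by metis
      then show "\<forall>l<d. x l - y l * x m' = 0" using m y by simp
    next
      assume *: "\<forall>l<d. x l - y l * x m' = 0"
      have "comb x = comb (\<lambda>l. x m' * y l + 0 * y l)"
        by (rule comb_cong) (use * in \<open>auto simp: mult.commute\<close>)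
      then have cx: "comb x = smul (x m') (comb y)" unfolding comb_linear by simp
      \<comment> \<open>Otherwise the equations would make all coordinates of \<open>x\<close> zero,
        against \<open>x m = 1\<close>.\<close>
      have "x m' \<noteq> 0" using * m x by force
      then have "span {comb x} = span {comb y}"
        using span_image_scale[of "{comb y}" "\<lambda>_. x m'"] cx by simp
      then show "span {frame1 x 0} = span {frame1 y 0}" by (simp add: frame1_def)
    qed
    then show "FF.frame_span (frame1 x) = FF.frame_span (frame1 y) \<longleftrightarrow>
        (\<forall>h\<in>transition1 m'. h (x, y) = 0)" unfolding transition1_def by auto
  qed
qed

definition minor2 :: "nat \<Rightarrow> nat \<Rightarrow> (nat \<Rightarrow> 'v) \<Rightarrow> complex"
  where "minor2 i j t = c i (t 0) * c j (t 1) - c j (t 0) * c i (t 1)"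

text \<open>The inverse of the block in columns \<open>i\<close>, \<open>j\<close> times the frame
  has quotients of minors as entries. In this form the independence of the frame is visible, since a
  change of frame multiplies all minors by one factor.\<close>

definition section2 :: "nat \<times> nat \<Rightarrow> (nat \<Rightarrow> 'v) \<Rightarrow> (nat \<Rightarrow> complex) \<times> (nat \<Rightarrow> complex)"
  where "section2 = (\<lambda>(i, j) t. (\<lambda>l. if l < d then minor2 l j t / minor2 i j t else 0,
    \<lambda>l. if l < d then minor2 i l t / minor2 i j t else 0))"

definition frame2 :: "(nat \<Rightarrow> complex) \<times> (nat \<Rightarrow> complex) \<Rightarrow> nat \<Rightarrow> 'v"
  where "frame2 p = (\<lambda>i. if i = 0 then comb (fst p) else if i = 1 then comb (snd p) else 0)"

definition normalized2 :: "nat \<times> nat \<Rightarrow> ((nat \<Rightarrow> complex) \<times> (nat \<Rightarrow> complex)) set"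
  where "normalized2 = (\<lambda>(i, j). {p \<in> affine_points d \<times> affine_points d.
    fst p i = 1 \<and> fst p j = 0 \<and> snd p i = 0 \<and> snd p j = 1})"

text \<open>The second frame is the identity in columns \<open>i\<close>, \<open>j\<close>. If the
  spans agree, the transition matrix must be the block of the first frame in these columns; the
  functions compare the first frame with that block times the second.\<close>

definition transition2 :: "nat \<times> nat \<Rightarrow>
    ((((nat \<Rightarrow> complex) \<times> (nat \<Rightarrow> complex)) \<times> ((nat \<Rightarrow> complex) \<times> (nat \<Rightarrow> complex))) \<Rightarrow> complex) set"
  where "transition2 = (\<lambda>(i, j).
    (\<lambda>l p. fst (fst p) l - (fst (fst p) i * fst (snd p) l + fst (fst p) j * snd (snd p) l)) ` {..<d} \<union>
    (\<lambda>l p. snd (fst p) l - (snd (fst p) i * fst (snd p) l + snd (fst p) j * snd (snd p) l)) ` {..<d})"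

lemma minor2_transform:
  assumes "t 0 = smul a (t' 0) + smul b (t' 1)" "t 1 = smul a' (t' 0) + smul b' (t' 1)"
  shows "minor2 i j t = (a * b' - b * a') * minor2 i j t'"
  unfolding minor2_def assms c_combination by (simp add: algebra_simps)

lemma minor2_frame2: "i < d \<Longrightarrow> j < d \<Longrightarrow> minor2 i j (frame2 p) = fst p i * snd p j - fst p j * snd p i"
  unfolding minor2_def frame2_def by (simp add: c_comb)

text \<open>Expanding the minors in \<open>section2\<close> exhibits the normal form as the inverse
  block applied to the two vectors of the frame.\<close>

lemma comb_section2:
  assumes t: "t 0 \<in> E" "t 1 \<in> E" and ne: "minor2 i j t \<noteq> 0"
  shows "comb (fst (section2 (i, j) t)) =
      smul (c j (t 1) / minor2 i j t) (t 0) + smul (- c j (t 0) / minor2 i j t) (t 1)"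
    "comb (snd (section2 (i, j) t)) =
      smul (- c i (t 1) / minor2 i j t) (t 0) + smul (c i (t 0) / minor2 i j t) (t 1)"
proof -
  have E: "smul a (t 0) + smul b (t 1) \<in> E" for a b
    using t by (intro subspace_add[OF E_subspace] subspace_scale[OF E_subspace])
  show "comb (fst (section2 (i, j) t)) =
      smul (c j (t 1) / minor2 i j t) (t 0) + smul (- c j (t 0) / minor2 i j t) (t 1)"
    by (rule comb_coordinates[OF E], simp only: c_combination)
      (simp add: section2_def minor2_def[of l j t for l] diff_divide_distrib)
  show "comb (snd (section2 (i, j) t)) =
      smul (- c i (t 1) / minor2 i j t) (t 0) + smul (c i (t 0) / minor2 i j t) (t 1)"
    by (rule comb_coordinates[OF E], simp only: c_combination)
      (simp add: section2_def minor2_def[of i l t for l] diff_divide_distrib)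
qed

lemma atlas2:
  assumes ms: "set ms = {(i, j). i < j \<and> j < d}"
  shows "grassmann_atlas smul 2 E (fproduct (affine_space d) (affine_space d)) (length ms)
    (\<lambda>m t. minor2 (fst (ms ! m)) (snd (ms ! m)) t) (\<lambda>m. section2 (ms ! m)) frame2
    (\<lambda>m. normalized2 (ms ! m)) (\<lambda>m m'. transition2 (ms ! m'))"
proof -
  interpret FF: finite_frames smul 2 E by (rule finite_frames2)
  have im: "t ` {..<2::nat} = {t 0, t 1}" for t :: "nat \<Rightarrow> 'v" by (auto simp: less_2_cases_iff)
  let ?A = "affine_space d"
  let ?Y = "fproduct ?A ?A"
  have f: "fun_space ?Y" by (rule fun_space_A2)
  have ms_nth: "\<exists>i j. ms ! m = (i, j) \<and> i < d \<and> j < d \<and> i \<noteq> j" if "m < length ms" for m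
  proof -
    have "ms ! m \<in> {(i, j). i < j \<and> j < d}" using nth_mem[OF that] unfolding ms .
    then show ?thesis by (cases "ms ! m") auto
  qed
  have mg: "minor2 i j \<in> gfun FF.F" for i j
  proof -
    have cg: "(\<lambda>t. c j (t 0)) \<in> gfun FF.F" "(\<lambda>t. c j (t 1)) \<in> gfun FF.F" for j
      by (rule FF.frame_coordinate_gfun[OF c_linear]; simp)+
    have "(\<lambda>t. c i (t 0) * c j (t 1) - c j (t 0) * c i (t 1)) \<in> gfun FF.F"
      by (intro gfun_diff gfun_mult FF.fun_space_F cg)
    then show ?thesis by (simp add: minor2_def[abs_def])
  qed
  have fr: "frame2 p \<in> frames smul 2 E" if m: "m < length ms" and p: "p \<in> normalized2 (ms ! m)" for m p
  proof -
    obtain i j where ij: "ms ! m = (i, j)" "i < d" "j < d" using ms_nth[OF m] by blast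
    have n: "fst p i = 1" "fst p j = 0" "snd p i = 0" "snd p j = 1"
      using p unfolding normalized2_def ij by auto
    have z: "c l 0 = 0" for l using linear_scale[OF c_linear, of l 0 0] by simp
    have "comb (snd p) \<noteq> 0" using c_comb[OF ij(3), of "snd p"] n z by (metis zero_neq_one)
    moreover have "comb (fst p) \<notin> span {comb (snd p)}"
    proof
      assume "comb (fst p) \<in> span {comb (snd p)}"
      then obtain a where "comb (fst p) = smul a (comb (snd p))" unfolding span_singleton by blast
      then have "c i (comb (fst p)) = a * c i (comb (snd p))" using linear_scale[OF c_linear] by simp
      then show False using n c_comb[OF ij(2)] by simp
    qed
    ultimately show ?thesis unfolding frames2_iff frame2_def using comb_E by simp
  qed
  show ?thesis
  proof
    show "is_variety ?Y" by (intro is_variety_fproduct is_variety_affine)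
    show "is_affine ?Y" by (intro is_affine_fproduct fun_space_affine is_affine_affine_space)
    fix m assume m: "m < length ms"
    obtain i j where ij: "ms ! m = (i, j)" "i < d" "j < d" "i \<noteq> j" using ms_nth[OF m] by blast
    let ?Z = "{\<lambda>p. fst p i - 1, \<lambda>p. fst p j, \<lambda>p. snd p i, \<lambda>p. snd p j - 1}"
    have "?Z \<subseteq> gfun ?Y"
      by (auto intro!: gfun_diff gfun_const f gfun_coord_pullback[OF morphism_fst] gfun_coord_pullback[OF morphism_snd])
    from closedin_zeros[OF f this]
    show "closedin (zariski_top ?Y) (normalized2 (ms ! m))"
      by (rule back_subst[of "closedin (zariski_top ?Y)"]) (auto simp: normalized2_def ij)
    show "minor2 (fst (ms ! m)) (snd (ms ! m)) \<in> gfun FF.F" by (rule mg)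
    show "morphism (induced FF.F {t \<in> frames smul 2 E. minor2 (fst (ms ! m)) (snd (ms ! m)) t \<noteq> 0}) ?Y (section2 (ms ! m))"
      unfolding section2_def ij prod.case fst_conv snd_conv
      by (intro morphism_pair fun_space_affine morphism_affine_space fun_space_induced FF.fun_space_F
          gfun_if gfun_divide gfun_const gfun_induced mg) (auto simp: affine_points_def)
    show "morphism (induced ?Y (normalized2 (ms ! m))) FF.F frame2"
      unfolding frame_space_def
    proof (rule morphism_zariski[OF fun_space_induced[OF f]])
      fix s assume "s \<in> {\<lambda>t::nat \<Rightarrow> 'v. \<xi> (t i) |\<xi> i. Vector_Spaces.linear smul (*) \<xi> \<and> i < 2}"
      then obtain \<xi> i where s: "s = (\<lambda>t. \<xi> (t i))" "Vector_Spaces.linear smul (*) \<xi>" "i < (2::nat)" by (elim CollectE exE conjE) (rule that)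
      have "s (frame2 p) = (if i = 0 then (\<Sum>j<d. fst p j * \<xi> (e j)) else (\<Sum>j<d. snd p j * \<xi> (e j)))" for p
        using s linear_comb[OF s(2)] by (auto simp: frame2_def less_2_cases_iff)
      then show "(\<lambda>p. s (frame2 p)) \<in> gfun (induced ?Y (normalized2 (ms ! m)))"
        by (simp only:) (intro gfun_if gfun_sum gfun_mult gfun_const gfun_fst_coord gfun_snd_coord fun_space_induced f)
    qed (use fr[OF m] in auto)
    fix t assume t: "t \<in> frames smul 2 E"
    then have tE: "t 0 \<in> E" "t 1 \<in> E" unfolding frames2_iff by auto
    {
      fix t' assume t': "t' \<in> frames smul 2 E" "FF.frame_span t = FF.frame_span t'"
        "minor2 (fst (ms ! m)) (snd (ms ! m)) t \<noteq> 0"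
      have "t 0 \<in> span {t' 0, t' 1}" "t 1 \<in> span {t' 0, t' 1}"
        using t'(2) span_base[of "t 0" "{t 0, t 1}"] span_base[of "t 1" "{t 0, t 1}"] unfolding im by simp_all
      then obtain a b a' b' where ab: "t 0 = smul a (t' 0) + smul b (t' 1)" "t 1 = smul a' (t' 0) + smul b' (t' 1)"
        unfolding span_pair_iff by (elim exE) (rule that)
      note tr = minor2_transform[OF ab]
      have D: "a * b' - b * a' \<noteq> 0" "minor2 i j t' \<noteq> 0" using t'(3) tr[of i j] unfolding ij by auto
      have q: "minor2 k l t / minor2 i j t = minor2 k l t' / minor2 i j t'" for k l
        unfolding tr using D(1) by simp
      show "minor2 (fst (ms ! m)) (snd (ms ! m)) t' \<noteq> 0 \<and> section2 (ms ! m) t = section2 (ms ! m) t'"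
        unfolding ij fst_conv snd_conv section2_def prod.case q using D(2) by simp
    }
    assume ne: "minor2 (fst (ms ! m)) (snd (ms ! m)) t \<noteq> 0"
    then have ne': "minor2 i j t \<noteq> 0" unfolding ij by simp
    show "section2 (ms ! m) t \<in> normalized2 (ms ! m)"
      using ne' ij unfolding ij(1) section2_def normalized2_def by (auto simp: affine_points_def minor2_def)
    show "FF.frame_span (frame2 (section2 (ms ! m) t)) = FF.frame_span t"
    proof -
      note cs = comb_section2[OF tE ne']
      let ?D = "minor2 i j t"
      \<comment> \<open>The determinant of the inverse block, that is,
        \<open>1 / ?D\<close>.\<close>
      have "(c j (t 1) / ?D) * (c i (t 0) / ?D) - (- c j (t 0) / ?D) * (- c i (t 1) / ?D) = ?D / (?D * ?D)"
        by (simp add: minor2_def[of i j t] diff_divide_distrib mult.commute)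
      also have "\<dots> \<noteq> 0" using ne' by simp
      finally have "span {comb (fst (section2 (i, j) t)), comb (snd (section2 (i, j) t))} = span {t 0, t 1}"
        by (rule span_pair_eqI[OF cs])
      then show ?thesis unfolding im ij(1) frame2_def by simp
    qed
  next
    fix m p assume m: "m < length ms" and p: "p \<in> normalized2 (ms ! m)"
    obtain i j where ij: "ms ! m = (i, j)" "i < d" "j < d" "i \<noteq> j" using ms_nth[OF m] by blast
    have n: "fst p i = 1" "fst p j = 0" "snd p i = 0" "snd p j = 1" "p \<in> affine_points d \<times> affine_points d"
      using p unfolding normalized2_def ij by auto
    have 1: "minor2 i j (frame2 p) = 1" using minor2_frame2[OF ij(2,3)] n by simp
    then show "minor2 (fst (ms ! m)) (snd (ms ! m)) (frame2 p) \<noteq> 0" unfolding ij by simp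
    have "minor2 l j (frame2 p) = fst p l" "minor2 i l (frame2 p) = snd p l" if "l < d" for l
      using minor2_frame2[OF that ij(3)] minor2_frame2[OF ij(2) that] n by simp_all
    then show "section2 (ms ! m) (frame2 p) = p"
      using n(5) unfolding ij section2_def prod.case 1
      by (auto simp: affine_points_def prod_eq_iff fun_eq_iff)
  next
    fix t assume t: "t \<in> frames smul 2 E"
    show "\<exists>m<length ms. minor2 (fst (ms ! m)) (snd (ms ! m)) t \<noteq> 0"
    proof (rule ccontr)
      assume "\<not> ?thesis"
      then have "\<forall>x\<in>set ms. minor2 (fst x) (snd x) t = 0" by (auto simp: all_set_conv_all_nth)
      then have z: "minor2 i j t = 0" if "i < j" "j < d" for i j using that unfolding ms by auto
      \<comment> \<open>If all minors vanish, the coordinate vectors are proportional and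
        \<open>t 0\<close> is a multiple of \<open>t 1\<close>, contrary to independence.\<close>
      have zz: "c i (t 0) * c j (t 1) = c j (t 0) * c i (t 1)" if "i < d" "j < d" for i j
        using z[of i j] z[of j i] that unfolding minor2_def by (cases i j rule: linorder_cases) auto
      have tE: "t 0 \<in> E" "t 1 \<in> E" "t 1 \<noteq> 0" "t 0 \<notin> span {t 1}" using t unfolding frames2_iff by auto
      then obtain j where j: "j < d" "c j (t 1) \<noteq> 0" using coordinates_eq_zero by blast
      have "t 0 = smul (c j (t 0) / c j (t 1)) (t 1)"
        by (rule coordinates_eq[OF tE(1) subspace_scale[OF E_subspace tE(2)]])
          (use zz j in \<open>simp add: linear_scale[OF c_linear] field_simps\<close>)
      then show False using tE(4) unfolding span_singleton by blast
    qed
  next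
    fix m m' h assume m: "m < length ms" "m' < length ms" and h: "h \<in> transition2 (ms ! m')"
    obtain i j where ij: "ms ! m' = (i, j)" using ms_nth[OF m(2)] by blast
    have "(\<lambda>p. fst (fst p) l) \<in> gfun (induced (fproduct ?Y ?Y) T)" "(\<lambda>p. snd (fst p) l) \<in> gfun (induced (fproduct ?Y ?Y) T)"
      "(\<lambda>p. fst (snd p) l) \<in> gfun (induced (fproduct ?Y ?Y) T)" "(\<lambda>p. snd (snd p) l) \<in> gfun (induced (fproduct ?Y ?Y) T)" for l T
      by (intro gfun_induced gfun_coord_pullback[OF morphism_comp[OF morphism_fst morphism_fst]]
        gfun_coord_pullback[OF morphism_comp[OF morphism_fst morphism_snd]]
        gfun_coord_pullback[OF morphism_comp[OF morphism_snd morphism_fst]]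
        gfun_coord_pullback[OF morphism_comp[OF morphism_snd morphism_snd]])+
    then show "h \<in> gfun (induced (fproduct ?Y ?Y) (normalized2 (ms ! m) \<times> normalized2 (ms ! m')))"
      using h unfolding transition2_def ij
      by (auto intro!: gfun_diff gfun_add gfun_mult fun_space_induced fun_space_fproduct f)
  next
    fix m m' x y assume m: "m < length ms" "m' < length ms"
      and x: "x \<in> normalized2 (ms ! m)" and y: "y \<in> normalized2 (ms ! m')"
    obtain i j where ij: "ms ! m = (i, j)" "i < d" "j < d" using ms_nth[OF m(1)] by blast
    obtain k l where kl: "ms ! m' = (k, l)" "k < d" "l < d" using ms_nth[OF m(2)] by blast
    have nx: "fst x i = 1" "fst x j = 0" "snd x i = 0" "snd x j = 1" using x unfolding normalized2_def ij by auto
    have ny: "fst y k = 1" "fst y l = 0" "snd y k = 0" "snd y l = 1" using y unfolding normalized2_def kl by auto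
    let ?T = "\<forall>r<d. fst x r = fst x k * fst y r + fst x l * snd y r \<and> snd x r = snd x k * fst y r + snd x l * snd y r"
    have fx: "frame2 p 0 = comb (fst p)" "frame2 p 1 = comb (snd p)" for p by (simp_all add: frame2_def)
    have "FF.frame_span (frame2 x) = FF.frame_span (frame2 y) \<longleftrightarrow> ?T"
      unfolding im fx
    proof
      assume *: "span {comb (fst x), comb (snd x)} = span {comb (fst y), comb (snd y)}"
      have co: "z r = z k * fst y r + z l * snd y r" if z: "comb z \<in> span {comb (fst y), comb (snd y)}" "r < d" for z r
      proof -
        obtain a b where ab: "comb z = smul a (comb (fst y)) + smul b (comb (snd y))"
          using z(1) unfolding span_pair_iff by blast
        have zr: "z r = a * fst y r + b * snd y r" if "r < d" for r
          using c_comb[OF that, of z] c_comb[OF that, of "fst y"] c_comb[OF that, of "snd y"]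
          unfolding ab c_combination by simp
        show ?thesis using zr[OF z(2)] zr[OF kl(2)] zr[OF kl(3)] ny by simp
      qed
      have "comb (fst x) \<in> span {comb (fst y), comb (snd y)}" "comb (snd x) \<in> span {comb (fst y), comb (snd y)}"
        using *[symmetric] span_base[of _ "{comb (fst x), comb (snd x)}"] by auto
      then show ?T using co by blast
    next
      assume T: ?T
      have cx: "comb (fst x) = smul (fst x k) (comb (fst y)) + smul (fst x l) (comb (snd y))"
        "comb (snd x) = smul (snd x k) (comb (fst y)) + smul (snd x l) (comb (snd y))"
        unfolding comb_linear[symmetric] by (rule comb_cong, use T in blast)+
      \<comment> \<open>The minor of \<open>x\<close> in its own columns is \<open>1\<close>, so the
        transition matrix cannot be singular.\<close>
      have "minor2 i j (frame2 x) = (fst x k * snd x l - fst x l * snd x k) * minor2 i j (frame2 y)"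
        by (rule minor2_transform; simp only: fx; rule cx)
      then have "fst x k * snd x l - fst x l * snd x k \<noteq> 0"
        using minor2_frame2[OF ij(2,3), of x] nx by auto
      then show "span {comb (fst x), comb (snd x)} = span {comb (fst y), comb (snd y)}"
        by (rule span_pair_eqI[OF cx])
    qed
    also have "?T \<longleftrightarrow> (\<forall>h\<in>transition2 (ms ! m'). h (x, y) = 0)"
      unfolding transition2_def kl prod.case ball_Un by (simp only: ball_simps fst_conv snd_conv) auto
    finally show "FF.frame_span (frame2 x) = FF.frame_span (frame2 y) \<longleftrightarrow> (\<forall>h\<in>transition2 (ms ! m'). h (x, y) = 0)" .
  qed
qed

end

section \<open>Skew forms in coordinates\<close>

lemma vector_space_complex: "vector_space ((*) :: complex \<Rightarrow> complex \<Rightarrow> complex)"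
  by unfold_locales (simp_all add: algebra_simps)

section \<open>Independent families and dual bases\<close>

context vector_space
begin

lemma independent_familyI:
  assumes K: "finite K" and ind: "\<And>a. (\<Sum>k\<in>K. scale (a k) (g k)) = 0 \<Longrightarrow> \<forall>k\<in>K. a k = 0"
  shows "inj_on g K" "independent (g ` K)"
proof -
  show inj: "inj_on g K"
  proof (rule inj_onI, rule ccontr)
    fix x y assume xy: "x \<in> K" "y \<in> K" "g x = g y" "x \<noteq> y"
    \<comment> \<open>A repeated value would give the nontrivial relation
      \<open>g x - g y = 0\<close>.\<close>
    let ?a = "\<lambda>k. if k = x then (1::'a) else if k = y then - 1 else 0"
    have "(\<Sum>k\<in>K. scale (?a k) (g k)) = (\<Sum>k\<in>{x, y}. scale (?a k) (g k))"
      by (rule sum.mono_neutral_right) (use K xy in auto)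
    also have "\<dots> = 0" using xy by simp
    finally have "?a x = 0" using ind[of ?a] xy(1) by blast
    then show False by simp
  qed
  show "independent (g ` K)"
  proof
    assume "dependent (g ` K)"
    then obtain u where u: "\<exists>v\<in>g ` K. u v \<noteq> 0" "(\<Sum>v\<in>g ` K. scale (u v) v) = 0"
      using dependent_finite[of "g ` K"] K by auto
    have "(\<Sum>k\<in>K. scale (u (g k)) (g k)) = 0" using u(2) by (simp add: sum.reindex[OF inj])
    from ind[OF this] show False using u(1) by auto
  qed
qed

text \<open>The finite spanning set makes the basis counted by \<open>dim\<close> finite, so that
  the exchange bound applies to it.\<close>

lemma independent_card_le:
  assumes "finite T" "V \<subseteq> span T" "independent S" "S \<subseteq> V"
  shows "card S \<le> dim V"
proof -
  obtain B where B: "B \<subseteq> V" "independent B" "V \<subseteq> span B" "card B = dim V"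
    using basis_exists[of V] by metis
  have "finite B" using independent_span_bound[OF assms(1) B(2)] B(1) assms(2) by blast
  then show ?thesis using independent_span_bound[of B S] assms(3,4) B(3,4) by auto
qed

end

text \<open>The dual basis of an independent family extends to functionals on the whole
  space.\<close>

lemma coordinatized_exists:
  fixes smul :: "complex \<Rightarrow> 'v::ab_group_add \<Rightarrow> 'v" and f :: "nat \<Rightarrow> 'v"
  assumes vs: "vector_space smul" and f: "inj_on f {..<d}" "\<not> module.dependent smul (f ` {..<d})"
  shows "\<exists>c. coordinatized smul (module.span smul (f ` {..<d})) d f c"
proof -
  interpret vector_space smul by (rule vs)
  interpret p: vector_space_pair smul "(*) :: complex \<Rightarrow> complex \<Rightarrow> complex"
    using vs vector_space_complex by (simp add: vector_space_pair_def)
  have "\<exists>g. Vector_Spaces.linear smul (*) g \<and> (\<forall>x\<in>f ` {..<d}. g x = (if x = f j then 1 else 0))" for j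
    by (rule p.linear_independent_extend[OF f(2)])
  then obtain c where c: "\<And>j. Vector_Spaces.linear smul (*) (c j)"
    "\<And>j. \<forall>x\<in>f ` {..<d}. c j x = (if x = f j then 1 else 0)" by metis
  have cf: "c j (f l) = (if j = l then 1 else 0)" if "j < d" "l < d" for j l
    using c(2)[of j] that inj_on_eq_iff[OF f(1), of l j] by auto
  have "v = (\<Sum>j<d. smul (c j v) (f j))" if v: "v \<in> span (f ` {..<d})" for v
  proof -
    obtain u where "v = (\<Sum>x\<in>f ` {..<d}. smul (u x) x)"
      using v span_finite[of "f ` {..<d}"] by auto
    then have u: "v = (\<Sum>j<d. smul (u (f j)) (f j))" by (simp add: sum.reindex[OF f(1)])
    have "c j v = u (f j)" if "j < d" for j
    proof -
      interpret l: Vector_Spaces.linear smul "(*)" "c j" by (rule c(1))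
      have "c j v = (\<Sum>l<d. u (f l) * c j (f l))" unfolding u by (simp add: l.sum l.scale)
      also have "\<dots> = (\<Sum>l<d. if l = j then u (f l) else 0)"
        by (intro sum.cong refl) (auto simp: cf[OF that])
      finally show ?thesis using that by simp
    qed
    then show ?thesis using u by simp
  qed
  then have "coordinatized smul (span (f ` {..<d})) d f c"
    by (intro coordinatized.intro coordinatized_axioms.intro vs subspace_span c(1) cf)
      (auto intro: span_base)
  then show ?thesis by blast
qed

definition rank6 :: "(nat \<Rightarrow> nat \<Rightarrow> complex) \<Rightarrow> nat \<times> nat \<times> nat \<times> nat \<times> nat \<times> nat \<Rightarrow> complex"
  where "rank6 M = (\<lambda>(p, q, r, s, t, u). M p q * schur M p q r s * schur (schur M p q) r s t u)"

lemma skew_formsD: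
  assumes "w \<in> skew_forms smul"
  shows "Vector_Spaces.linear smul (*) (w x)" "Vector_Spaces.linear smul (*) (\<lambda>x. w x y)" "w x x = 0"
  using assms unfolding skew_forms_def by auto

text \<open>Polarisation of \<open>w z z = 0\<close> at \<open>z = x + y\<close>.\<close>

lemma skew_forms_swap:
  assumes "w \<in> skew_forms smul"
  shows "w x y = - w y x"
proof -
  interpret l: Vector_Spaces.linear smul "(*)" "w (x + y)" by (rule skew_formsD(1)[OF assms])
  interpret r: Vector_Spaces.linear smul "(*)" "\<lambda>z. w z x" by (rule skew_formsD(2)[OF assms])
  interpret s: Vector_Spaces.linear smul "(*)" "\<lambda>z. w z y" by (rule skew_formsD(2)[OF assms])
  have "w (x + y) (x + y) = w x x + w y x + (w x y + w y y)"
    by (simp add: l.add r.add s.add)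
  then have "w y x + w x y = 0" using skew_formsD(3)[OF assms] by simp
  then show ?thesis by (simp add: add_eq_0_iff)
qed

section \<open>The matrix of a form and its rank\<close>

locale coordinates7 = coordinatized smul UNIV 7 e c
  for smul :: "complex \<Rightarrow> 'v::ab_group_add \<Rightarrow> 'v" and e c
begin

text \<open>Set to zero outside the 7 x 7 range, so that \<open>alternating\<close> holds for all
  natural indices.\<close>

definition form_matrix :: "('v \<Rightarrow> 'v \<Rightarrow> complex) \<Rightarrow> nat \<Rightarrow> nat \<Rightarrow> complex"
  where "form_matrix w i j = (if i < 7 \<and> j < 7 then w (e i) (e j) else 0)"

lemma form_matrix_alternating:
  assumes "w \<in> skew_forms smul"
  shows "alternating (form_matrix w)"
  unfolding alternating_def
proof (intro conjI allI)
  fix i j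
  show "form_matrix w i i = 0" using skew_formsD(3)[OF assms, of "e i"] by (simp add: form_matrix_def)
  have "w (e i) (e j) = - w (e j) (e i)" by (rule skew_forms_swap[OF assms])
  then show "form_matrix w i j = - form_matrix w j i" by (auto simp only: form_matrix_def minus_zero split: if_splits)
qed

lemma form_right: "w \<in> skew_forms smul \<Longrightarrow> w x y = (\<Sum>j<7. c j y * w x (e j))"
  using linear_comb[OF skew_formsD(1)[of w smul x], of "\<lambda>j. c j y"] expand[of y] unfolding comb_def by simp

lemma form_left: "w \<in> skew_forms smul \<Longrightarrow> w x y = (\<Sum>i<7. c i x * w (e i) y)"
  using linear_comb[OF skew_formsD(2)[of w smul y], of "\<lambda>j. c j x"] expand[of x] unfolding comb_def by simp

lemma form_comb:
  assumes "w \<in> skew_forms smul"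
  shows "w (comb u) (comb v) = (\<Sum>i<7. \<Sum>j<7. form_matrix w i j * u i * v j)"
proof -
  have r: "w (e i) (comb v) = (\<Sum>j<7. v j * w (e i) (e j))" for i
    unfolding form_right[OF assms, of "e i" "comb v"] by (simp add: c_comb)
  have "w (comb u) (comb v) = (\<Sum>i<7. u i * w (e i) (comb v))"
    unfolding form_left[OF assms, of "comb u" "comb v"] by (simp add: c_comb)
  then show ?thesis
    unfolding r by (simp add: form_matrix_def sum_distrib_left algebra_simps)
qed

lemma form_zero:
  assumes "w \<in> skew_forms smul" "\<forall>i<7. \<forall>j<7. form_matrix w i j = 0"
  shows "w = 0"
proof (intro ext)
  fix x y
  have "w (comb (\<lambda>i. c i x)) (comb (\<lambda>i. c i y)) = 0"
    unfolding form_comb[OF assms(1)] using assms(2) by simp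
  then show "w x y = 0 x y" using expand[of x] expand[of y] unfolding comb_def by simp
qed

end

lemma sum_fun_apply: "(\<Sum>i\<in>I. f i) x = (\<Sum>i\<in>I. f i x)"
  by (induction I rule: infinite_finite_induct) simp_all

lemma vector_space_functions: "vector_space (\<lambda>a (\<xi> :: 'b \<Rightarrow> complex) y. a * \<xi> y)"
  by unfold_locales (simp_all add: fun_eq_iff algebra_simps)

context coordinates7
begin

lemma range_form_span:
  assumes w: "w \<in> skew_forms smul" and R: "\<And>i. i < 7 \<Longrightarrow> w (e i) \<in> module.span (\<lambda>a \<xi> y. a * \<xi> y) R"
  shows "range w \<subseteq> module.span (\<lambda>a \<xi> y. a * \<xi> y) R"
proof -
  interpret d: vector_space "\<lambda>a (\<xi> :: 'v \<Rightarrow> complex) y. a * \<xi> y" by (rule vector_space_functions)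
  show ?thesis
  proof
    fix \<xi> assume "\<xi> \<in> range w"
    then obtain x where x: "\<xi> = w x" by blast
    have "w x = (\<Sum>i<7. (\<lambda>y. c i x * w (e i) y))"
      using form_left[OF w, of x] by (simp add: fun_eq_iff sum_fun_apply)
    then show "\<xi> \<in> d.span R" unfolding x
      using d.span_sum[of "{..<7}" "\<lambda>i y. c i x * w (e i) y" R] d.span_scale[OF R] by simp
  qed
qed

text \<open>When elimination stops after at most two steps, vanishing of the last complement
  expresses every covector \<open>w (e i)\<close> through the pivot covectors. At most four of these
  span the range.\<close>

lemma rank6_zero:
  assumes w: "w \<in> skew_forms smul"
    and z: "\<forall>m \<in> {..<7} \<times> {..<7} \<times> {..<7} \<times> {..<7} \<times> {..<7} \<times> {..<7}. rank6 (form_matrix w) m = 0"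
  shows "form_rank w < 6"
proof -
  interpret d: vector_space "\<lambda>a (\<xi> :: 'v \<Rightarrow> complex) y. a * \<xi> y" by (rule vector_space_functions)
  let ?M = "form_matrix w"
  have sp: "\<xi> \<in> d.span {w x, w y, w z, w u}" if "\<And>v. \<xi> v = a * w x v + b * w y v + a' * w z v + b' * w u v"
    for \<xi> x y z u a b a' b'
  proof -
    have "\<xi> = (\<lambda>v. a * w x v) + (\<lambda>v. b * w y v) + (\<lambda>v. a' * w z v) + (\<lambda>v. b' * w u v)"
      using that by (simp add: fun_eq_iff)
    then show ?thesis
      by (simp only:) (intro d.span_add d.span_scale d.span_base; simp)
  qed
  have "\<exists>p q r s. \<forall>i<7. w (e i) \<in> d.span {w (e p), w (e q), w (e r), w (e s)}"
  proof (cases "\<exists>p<7. \<exists>q<7. ?M p q \<noteq> 0")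
    case False
    then have "w = 0" using form_zero[OF w] by blast
    \<comment> \<open>All covectors vanish, so the indices are arbitrary.\<close>
    then show ?thesis using d.span_zero by (intro exI[of _ 0]) (simp add: zero_fun_def)
  next
    case True
    then obtain p q where pq: "p < 7" "q < 7" "?M p q \<noteq> 0" by blast
    let ?S = "schur ?M p q"
    \<comment> \<open>The covector whose coordinates form row \<open>i\<close> of the complement:
      elimination performed on forms instead of matrix entries.\<close>
    define f where "f i y = ?M p q * w (e i) y - ?M p i * w (e q) y + w (e p) y * ?M q i" for i y
    have fe: "f i (e j) = ?S i j" if "i < 7" "j < 7" for i j
      using that pq unfolding f_def schur_def by (simp add: form_matrix_def)
    have fy: "f i y = (\<Sum>j<7. c j y * ?S i j)" if "i < 7" for i y
    proof -
      have "f i y = (\<Sum>j<7. c j y * f i (e j))"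
        unfolding f_def form_right[OF w, of _ y]
        by (simp add: sum_distrib_left sum_distrib_right sum_subtractf sum.distrib algebra_simps)
      then show ?thesis using fe[OF that] by simp
    qed
    show ?thesis
    proof (cases "\<exists>r<7. \<exists>s<7. ?S r s \<noteq> 0")
      case False
      \<comment> \<open>After one elimination there are only two pivot covectors; they are repeated
        to fill four places.\<close>
      have "w (e i) \<in> d.span {w (e p), w (e q), w (e p), w (e q)}" if "i < 7" for i
      proof (rule sp[of _ "- (?M q i / ?M p q)" _ "?M p i / ?M p q" _ 0 _ 0])
        fix y
        have "f i y = 0" using fy[OF that] False that by simp
        then show "w (e i) y = - (?M q i / ?M p q) * w (e p) y + ?M p i / ?M p q * w (e q) y +
            0 * w (e p) y + 0 * w (e q) y"
          using pq(3) unfolding f_def by (simp add: field_simps add_eq_0_iff)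
      qed
      then show ?thesis by blast
    next
      case True
      then obtain r s where rs: "r < 7" "s < 7" "?S r s \<noteq> 0" by blast
      have S2: "schur ?S r s i j = 0" if "i < 7" "j < 7" for i j
      proof -
        have "(p, q, r, s, i, j) \<in> {..<7} \<times> {..<7} \<times> {..<7} \<times> {..<7} \<times> {..<7} \<times> {..<7}"
          using pq rs that by simp
        then have "rank6 ?M (p, q, r, s, i, j) = 0" using z by blast
        then show ?thesis using pq rs unfolding rank6_def by simp
      qed
      have f2: "?S r s * f i y = ?S r i * f s y - ?S s i * f r y" if "i < 7" for i y
      proof -
        have "?S r s * f i y - ?S r i * f s y + f r y * ?S s i = (\<Sum>j<7. c j y * schur ?S r s i j)"
          unfolding fy[OF that] fy[OF rs(1)] fy[OF rs(2)] schur_def[of ?S]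
          by (simp add: sum_distrib_left sum_distrib_right sum_subtractf sum.distrib algebra_simps)
        also have "\<dots> = 0" using S2 that by simp
        finally show ?thesis by (simp add: algebra_simps)
      qed
      have "w (e i) \<in> d.span {w (e p), w (e q), w (e r), w (e s)}" if i: "i < 7" for i
      \<comment> \<open>The coefficients come from solving \<open>f2\<close> for \<open>f i\<close>
        and then the definition of \<open>f\<close> for \<open>w (e i)\<close>; the denominators are
        the two pivots.\<close>
      proof (rule sp[of _ "(?S r i * ?M q s - ?S s i * ?M q r - ?S r s * ?M q i) / (?M p q * ?S r s)" _
            "(- ?S r i * ?M p s + ?S s i * ?M p r + ?S r s * ?M p i) / (?M p q * ?S r s)" _
            "- ?S s i / ?S r s" _ "?S r i / ?S r s"])
        fix y
        let ?D = "?M p q * ?S r s"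
        have "?D * w (e i) y = (?S r i * ?M q s - ?S s i * ?M q r - ?S r s * ?M q i) * w (e p) y +
          (- ?S r i * ?M p s + ?S s i * ?M p r + ?S r s * ?M p i) * w (e q) y +
          (- ?S s i * ?M p q) * w (e r) y + ?S r i * ?M p q * w (e s) y"
          using f2[OF i, of y] unfolding f_def by (simp add: algebra_simps)
        then have "w (e i) y = ((?S r i * ?M q s - ?S s i * ?M q r - ?S r s * ?M q i) * w (e p) y +
          (- ?S r i * ?M p s + ?S s i * ?M p r + ?S r s * ?M p i) * w (e q) y +
          (- ?S s i * ?M p q) * w (e r) y + ?S r i * ?M p q * w (e s) y) / ?D"
          using pq rs by (simp add: nonzero_eq_divide_eq mult.commute)
        then show "w (e i) y = (?S r i * ?M q s - ?S s i * ?M q r - ?S r s * ?M q i) / ?D * w (e p) y +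
            (- ?S r i * ?M p s + ?S s i * ?M p r + ?S r s * ?M p i) / ?D * w (e q) y +
            - ?S s i / ?S r s * w (e r) y + ?S r i / ?S r s * w (e s) y"
        proof -
          have "(a * x + b * y' + (- s' * m) * z' + r' * m * v) / (m * n) =
              a / (m * n) * x + b / (m * n) * y' + - s' / n * z' + r' / n * v"
            if "m \<noteq> 0" "n \<noteq> 0" for a b x y' z' v m n r' s' :: complex
            using that by (simp add: field_simps)
          from this[OF pq(3) rs(3)] \<open>w (e i) y = _\<close> show ?thesis by (simp only:)
        qed
      qed
      then show ?thesis by blast
    qed
  qed
  then obtain p q r s where "\<forall>i<7. w (e i) \<in> d.span {w (e p), w (e q), w (e r), w (e s)}" by blast
  then have "range w \<subseteq> d.span {w (e p), w (e q), w (e r), w (e s)}"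
    by (intro range_form_span[OF w]) blast
  then have "d.dim (range w) \<le> card {w (e p), w (e q), w (e r), w (e s)}"
    by (rule d.dim_le_card) simp
  also have "\<dots> \<le> 4"
    using card_insert_le_m1 by (auto simp: card_insert_if)
  finally show ?thesis unfolding form_rank_def by simp
qed

text \<open>A relation among the six pivot covectors is a kernel vector of the matrix that vanishes
  at the seventh index. Back substitution through the three eliminations makes its other entries
  zero, so the rank is at least 6.\<close>

lemma rank6_nonzero:
  assumes w: "w \<in> skew_forms smul" and m: "p < 7" "q < 7" "r < 7" "s < 7" "t < 7" "u < 7"
    and ne: "rank6 (form_matrix w) (p, q, r, s, t, u) \<noteq> 0"
  shows "\<not> form_rank w < 6"
proof -
  interpret d: vector_space "\<lambda>a (\<xi> :: 'v \<Rightarrow> complex) y. a * \<xi> y" by (rule vector_space_functions)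
  let ?M = "form_matrix w"
  let ?S1 = "schur ?M p q"
  let ?S2 = "schur ?S1 r s"
  let ?S3 = "schur ?S2 t u"
  have ne': "?M p q \<noteq> 0" "?S1 r s \<noteq> 0" "?S2 t u \<noteq> 0" using ne unfolding rank6_def by auto
  have alt: "alternating ?M" "alternating ?S1" "alternating ?S2"
    using form_matrix_alternating[OF w] alternating_schur by blast+
  have ap: "?S1 p j = 0" "?S1 q j = 0" "?S1 j p = 0" "?S1 j q = 0" for j
    by (rule schur_zero[OF alt(1)])+
  have ar: "?S2 p j = 0" "?S2 q j = 0" "?S2 j p = 0" "?S2 j q = 0" for j
    unfolding schur_def[of ?S1] by (simp_all add: ap)
  have ar': "?S2 r j = 0" "?S2 s j = 0" "?S2 j r = 0" "?S2 j s = 0" for j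
    by (rule schur_zero[OF alt(2)])+
  let ?J1 = "{..<7} - {p, q}"
  let ?J2 = "?J1 - {r, s}"
  let ?J3 = "?J2 - {t, u}"
  have rs: "r \<in> ?J1" "s \<in> ?J1" using ne'(2) ap m by auto
  have tu: "t \<in> ?J2" "u \<in> ?J2" using ne'(3) ar ar' m by auto
  have neq: "p \<noteq> q" "r \<noteq> s" "t \<noteq> u" using ne' alt unfolding alternating_def by metis+
  let ?K = "{p, q, r, s, t, u}"
  have cardK: "card ?K = 6" using neq rs tu by auto
  have ind: "\<forall>k\<in>?K. a k = 0" if a: "(\<Sum>k\<in>?K. (\<lambda>y. a k * w (e k) y)) = 0" for a
  proof -
    let ?a = "\<lambda>k. if k \<in> ?K then a k else 0"
    have "(\<Sum>j<7. ?M i j * ?a j) = 0" if i: "i < 7" for i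
    proof -
      have "(\<Sum>j<7. ?M i j * ?a j) = (\<Sum>k\<in>?K. ?M i k * a k)"
        by (rule sum.mono_neutral_cong_right) (use m in auto)
      also have "\<dots> = - (\<Sum>k\<in>?K. a k * w (e k) (e i))"
        unfolding sum_negf[symmetric]
      proof (intro sum.cong refl)
        fix k assume "k \<in> ?K"
        then have "k < 7" using m by auto
        then show "?M i k * a k = - (a k * w (e k) (e i))"
          using i skew_forms_swap[OF w, of "e i" "e k"] by (simp add: form_matrix_def)
      qed
      also have "(\<Sum>k\<in>?K. a k * w (e k) (e i)) = (\<Sum>k\<in>?K. (\<lambda>y. a k * w (e k) y)) (e i)"
        by (simp only: sum_fun_apply)
      also have "\<dots> = 0" unfolding a by simp
      finally show ?thesis by simp
    qed
    then have 1: "\<forall>i\<in>{..<7}. (\<Sum>j\<in>{..<7}. ?M i j * ?a j) = 0" by simp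
    note k1 = kernel_schur[OF alt(1) finite_lessThan, of p 7 q ?a, THEN iffD1, OF _ _ ne'(1) 1]
    have 2: "?a p = (\<Sum>j\<in>?J1. ?M q j * ?a j) / ?M p q" "?a q = - (\<Sum>j\<in>?J1. ?M p j * ?a j) / ?M p q"
      "\<forall>i\<in>?J1. (\<Sum>j\<in>?J1. ?S1 i j * ?a j) = 0"
      using k1 m by blast+
    note k2 = kernel_schur[OF alt(2) _ rs ne'(2), of ?a, THEN iffD1, OF _ 2(3)]
    have 3: "?a r = (\<Sum>j\<in>?J2. ?S1 s j * ?a j) / ?S1 r s" "?a s = - (\<Sum>j\<in>?J2. ?S1 r j * ?a j) / ?S1 r s"
      "\<forall>i\<in>?J2. (\<Sum>j\<in>?J2. ?S2 i j * ?a j) = 0"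
      using k2 by blast+
    note k3 = kernel_schur[OF alt(3) _ tu ne'(3), of ?a, THEN iffD1, OF _ 3(3)]
    have 4: "?a t = (\<Sum>j\<in>?J3. ?S2 u j * ?a j) / ?S2 t u" "?a u = - (\<Sum>j\<in>?J3. ?S2 t j * ?a j) / ?S2 t u"
      using k3 by blast+
    \<comment> \<open>Back substitution starts from the index that is not a pivot, where the vector
      is zero by construction.\<close>
    have z3: "?a j = 0" if "j \<in> ?J3" for j using that by auto
    have "(\<Sum>j\<in>?J3. h j * ?a j) = 0" for h by (rule sum.neutral) (use z3 in auto)
    then have tu0: "?a t = 0" "?a u = 0" using 4 by simp_all
    have "(\<Sum>j\<in>?J2. h j * ?a j) = 0" for h
    proof (rule sum.neutral, rule ballI)
      fix j assume "j \<in> ?J2"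
      then have "j \<in> ?J3 \<or> j = t \<or> j = u" by blast
      then have "?a j = 0" using z3[of j] tu0 by blast
      then show "h j * ?a j = 0" by simp
    qed
    then have rs0: "?a r = 0" "?a s = 0" using 3 by simp_all
    have "(\<Sum>j\<in>?J1. h j * ?a j) = 0" for h
    proof (rule sum.neutral, rule ballI)
      fix j assume "j \<in> ?J1"
      then have "j \<in> ?J3 \<or> j = t \<or> j = u \<or> j = r \<or> j = s" by blast
      then have "?a j = 0" using z3[of j] tu0 rs0 by blast
      then show "h j * ?a j = 0" by simp
    qed
    then have "?a p = 0" "?a q = 0" using 2 by simp_all
    then show ?thesis using tu0 rs0 by auto
  qed
  have finK: "finite ?K" by simp
  note i = d.independent_familyI[OF finK, of "\<lambda>k. w (e k)", OF ind]
  have "range w \<subseteq> d.span ((\<lambda>i. w (e i)) ` {..<7})"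
    by (rule range_form_span[OF w]) (rule d.span_base, simp)
  from d.independent_card_le[OF _ this i(2)] have "card ((\<lambda>k. w (e k)) ` ?K) \<le> d.dim (range w)"
    by auto
  moreover have "card ((\<lambda>k. w (e k)) ` ?K) = 6" using card_image[OF i(1)] cardK by simp
  ultimately show ?thesis unfolding form_rank_def by simp
qed

lemma form_rank_less_iff:
  assumes w: "w \<in> skew_forms smul"
  shows "form_rank w < 6 \<longleftrightarrow>
    (\<forall>m \<in> {..<7} \<times> {..<7} \<times> {..<7} \<times> {..<7} \<times> {..<7} \<times> {..<7}. rank6 (form_matrix w) m = 0)"
proof
  assume r: "form_rank w < 6"
  show "\<forall>m \<in> {..<7} \<times> {..<7} \<times> {..<7} \<times> {..<7} \<times> {..<7} \<times> {..<7}. rank6 (form_matrix w) m = 0"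
  proof (rule ballI, rule ccontr)
    fix m :: "nat \<times> nat \<times> nat \<times> nat \<times> nat \<times> nat"
    assume m: "m \<in> {..<7} \<times> {..<7} \<times> {..<7} \<times> {..<7} \<times> {..<7} \<times> {..<7}" and ne: "rank6 (form_matrix w) m \<noteq> 0"
    obtain p q r s t u where m': "m = (p, q, r, s, t, u)" by (cases m)
    show False
      using rank6_nonzero[OF w _ _ _ _ _ _ ne[unfolded m']] m r unfolding m' by auto
  qed
qed (rule rank6_zero[OF w])

end

section \<open>Generic nets\<close>

text \<open>For \<open>w' = w\<close> this is the Pfaffian of a 4 x 4 submatrix, a coefficient of
  the square of \<open>w\<close> up to a factor 2. It is bilinear but not symmetric, hence the two
  summands of \<open>quad_col\<close> for distinct members.\<close>

definition pf :: "(nat \<Rightarrow> nat \<Rightarrow> 'a::comm_ring) \<Rightarrow> (nat \<Rightarrow> nat \<Rightarrow> 'a) \<Rightarrow> nat \<Rightarrow> nat \<Rightarrow> nat \<Rightarrow> nat \<Rightarrow> 'a"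
  where "pf w w' p q r s = w p q * w' r s - w p r * w' q s + w p s * w' q r"

text \<open>
  The \<open>28\<close> products of two members of a net \<open>t\<close> are numbered by \<open>(m, s)\<close> with \<open>m < 7\<close>, \<open>s < 4\<close>: the
  square of \<open>t m\<close> for \<open>s = 0\<close>, and otherwise the product of \<open>t (m + s)\<close> and \<open>t (m - s)\<close>, with
  indices modulo \<open>7\<close>. The linear functionals \<open>quad_row m r\<close> on \<open>4\<close>-forms are chosen to be the dual
  basis for the products of members of the net \<open>cyclic_form\<close>.
\<close>

definition quad_row :: "nat \<Rightarrow> nat \<Rightarrow> (nat \<Rightarrow> nat \<Rightarrow> nat \<Rightarrow> nat \<Rightarrow> 'a::comm_ring) \<Rightarrow> 'a"
  where "quad_row m r X = (let Y = (\<lambda>a b c d. X ((a + m) mod 7) ((b + m) mod 7) ((c + m) mod 7) ((d + m) mod 7)) in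
    if r = 0 then Y 1 2 5 6 - Y 2 3 4 5 else if r = 1 then Y 0 1 2 4
    else if r = 2 then Y 1 3 4 6 + Y 0 1 2 4 else - Y 2 3 4 5)"

definition quad_col :: "(nat \<Rightarrow> nat \<Rightarrow> nat \<Rightarrow> 'a::comm_ring) \<Rightarrow> nat \<Rightarrow> nat \<Rightarrow> nat \<Rightarrow> nat \<Rightarrow> nat \<Rightarrow> nat \<Rightarrow> 'a"
  where "quad_col t m s = (if s = 0 then pf (t m) (t m) else (\<lambda>p q u v.
    pf (t ((m + s) mod 7)) (t ((m + 7 - s) mod 7)) p q u v +
    pf (t ((m + 7 - s) mod 7)) (t ((m + s) mod 7)) p q u v))"

text \<open>Since 2 is invertible modulo 7, every unordered pair of indices is
  \<open>{m + s, m - s}\<close> for exactly one \<open>m\<close> and one \<open>s < 4\<close>. This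
  numbers the 28 monomials of degree two.\<close>

definition quad_monomial :: "(nat \<Rightarrow> 'a::comm_ring) \<Rightarrow> nat \<Rightarrow> nat \<Rightarrow> 'a"
  where "quad_monomial a m s = (if s = 0 then a m * a m else a ((m + s) mod 7) * a ((m + 7 - s) mod 7))"

text \<open>Integer values make the check of all products a computation. Both terms of member
  \<open>i\<close> have index sum \<open>2 * i\<close> modulo 7; the four products numbered by
  \<open>m\<close> therefore involve only 4-forms of index sum \<open>4 * m\<close>, and shifting
  all indices turns one block into the next.\<close>

definition cyclic_form :: "nat \<Rightarrow> nat \<Rightarrow> nat \<Rightarrow> int"
  where "cyclic_form i p q = (let p' = (p + 7 - i) mod 7; q' = (q + 7 - i) mod 7 in
    if p' = 1 \<and> q' = 6 \<or> p' = 2 \<and> q' = 5 then 1 else if p' = 6 \<and> q' = 1 \<or> p' = 5 \<and> q' = 2 then - 1 else 0)"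

text \<open>All \<open>28 * 28\<close> values evaluated over the integers; lists make the bounded
  quantifiers executable.\<close>

lemma cyclic_form_dual_list: "list_all (\<lambda>m. list_all (\<lambda>r. list_all (\<lambda>k. list_all (\<lambda>s.
    quad_row m r (quad_col cyclic_form k s) = (if m = k \<and> r = s then 1 else 0))
    [0,1,2,3]) [0,1,2,3,4,5,6]) [0,1,2,3]) [0,1,2,3,4,5,6]"
  by code_simp

lemma set_7: "set [0,1,2,3,4,5,6::nat] = {..<7}" and set_4: "set [0,1,2,3::nat] = {..<4}"
  by auto

lemma cyclic_form_dual:
  assumes "m < 7" "r < 4" "k < 7" "s < 4"
  shows "quad_row m r (quad_col cyclic_form k s) = (if m = k \<and> r = s then 1 else 0)"
proof -
  have "\<forall>m\<in>{..<7}. \<forall>r\<in>{..<4}. \<forall>k\<in>{..<7}. \<forall>s\<in>{..<4}.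
      quad_row m r (quad_col cyclic_form k s) = (if m = k \<and> r = s then 1 else 0)"
    using cyclic_form_dual_list unfolding list_all_iff set_7 set_4 .
  then have "\<forall>r\<in>{..<4}. \<forall>k\<in>{..<7}. \<forall>s\<in>{..<4}.
      quad_row m r (quad_col cyclic_form k s) = (if m = k \<and> r = s then 1 else 0)"
    by (rule bspec) (use assms in simp)
  then have "\<forall>k\<in>{..<7}. \<forall>s\<in>{..<4}. quad_row m r (quad_col cyclic_form k s) = (if m = k \<and> r = s then 1 else 0)"
    by (rule bspec) (use assms in simp)
  then have "\<forall>s\<in>{..<4}. quad_row m r (quad_col cyclic_form k s) = (if m = k \<and> r = s then 1 else 0)"
    by (rule bspec) (use assms in simp)
  then show ?thesis by (rule bspec) (use assms in simp)
qed

lemma cyclic_form_alternating_list: "list_all (\<lambda>i. list_all (\<lambda>p. list_all (\<lambda>q.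
    cyclic_form i p q = - cyclic_form i q p) [0,1,2,3,4,5,6]) [0,1,2,3,4,5,6]) [0,1,2,3,4,5,6]"
  by code_simp

lemma sum_7: "(\<Sum>i<7. f i) = f 0 + f 1 + f 2 + f 3 + f 4 + f 5 + f (6::nat)"
  and sum_4: "(\<Sum>i<4. g i) = g 0 + g 1 + g 2 + g (3::nat)"
  by (simp_all add: eval_nat_numeral add.assoc)

text \<open>Collects 49 ordered pairs of indices into 28 unordered ones; off the diagonal two
  summands share a monomial.\<close>

lemma sum_quad_monomials:
  fixes a :: "nat \<Rightarrow> 'a::comm_ring"
  shows "(\<Sum>i<7. \<Sum>j<7. a i * a j * P i j) = (\<Sum>m<7. \<Sum>s<4. quad_monomial a m s *
    (if s = 0 then P m m else P ((m + s) mod 7) ((m + 7 - s) mod 7) + P ((m + 7 - s) mod 7) ((m + s) mod 7)))"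
  unfolding sum_7 sum_4 quad_monomial_def by (simp add: algebra_simps flip: numeral_2_eq_2)

lemma pf_expansion:
  fixes a :: "nat \<Rightarrow> 'a::comm_ring"
  shows "pf (\<lambda>p q. \<Sum>i<7. a i * t i p q) (\<lambda>p q. \<Sum>i<7. a i * t i p q) p q r s =
    (\<Sum>m<7. \<Sum>l<4. quad_monomial a m l * quad_col t m l p q r s)"
proof -
  have "pf (\<lambda>p q. \<Sum>i<7. a i * t i p q) (\<lambda>p q. \<Sum>i<7. a i * t i p q) p q r s =
      (\<Sum>i<7. \<Sum>j<7. a i * a j * pf (t i) (t j) p q r s)"
    unfolding pf_def sum_product
    by (simp add: sum_subtractf[symmetric] sum.distrib[symmetric]) (simp add: algebra_simps)
  also have "\<dots> = (\<Sum>m<7. \<Sum>l<4. quad_monomial a m l * quad_col t m l p q r s)"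
    unfolding sum_quad_monomials quad_col_def by (intro sum.cong refl) simp
  finally show ?thesis .
qed

text \<open>Matrices and determinants are indexed by finite types, so the 28 labels are made into
  one.\<close>

typedef quad_index = "{..<7::nat} \<times> {..<4::nat}"
  by (rule exI[of _ "(0, 0)"]) simp

instance quad_index :: finite
proof
  have "(UNIV :: quad_index set) = Abs_quad_index ` ({..<7::nat} \<times> {..<4::nat})"
    by (metis type_definition.univ type_definition_quad_index)
  then show "finite (UNIV :: quad_index set)"
    using finite_imageI[of "{..<7::nat} \<times> {..<4::nat}" Abs_quad_index] by simp
qed

lemma quad_index_bounds: "fst (Rep_quad_index k) < 7" "snd (Rep_quad_index k) < 4"
  using Rep_quad_index[of k] by auto

lemma sum_quad_index:
  "(\<Sum>k\<in>UNIV. f (fst (Rep_quad_index k)) (snd (Rep_quad_index k))) = (\<Sum>m<7. \<Sum>s<4. f m s)"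
proof -
  have "bij_betw Rep_quad_index UNIV ({..<7::nat} \<times> {..<4::nat})"
    unfolding bij_betw_def
    by (auto simp: inj_on_def Rep_quad_index_inject type_definition.Rep_range[OF type_definition_quad_index])
  from sum.reindex_bij_betw[OF this, of "\<lambda>(m, s). f m s"] show ?thesis
    by (simp add: sum.cartesian_product case_prod_beta)
qed

text \<open>The multiplication map from the symmetric square of the net to the 4-forms, followed by
  the 28 functionals \<open>quad_row\<close>. Its determinant is a polynomial in the entries of the
  forms.\<close>

definition quad_matrix :: "(nat \<Rightarrow> nat \<Rightarrow> nat \<Rightarrow> complex) \<Rightarrow> complex^quad_index^quad_index"
  where "quad_matrix t = (\<chi> r k. quad_row (fst (Rep_quad_index r)) (snd (Rep_quad_index r))
    (quad_col t (fst (Rep_quad_index k)) (snd (Rep_quad_index k))))"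

lemma quad_row_sum: "quad_row m r (\<lambda>p q u v. \<Sum>k\<in>K. x k * X k p q u v) = (\<Sum>k\<in>K. x k * quad_row m r (X k))"
  unfolding quad_row_def Let_def
  by (simp add: sum_subtractf[symmetric] sum.distrib[symmetric] sum_negf[symmetric] algebra_simps)

lemma quad_row_zero:
  assumes "\<And>p q u v. p < 7 \<Longrightarrow> q < 7 \<Longrightarrow> u < 7 \<Longrightarrow> v < 7 \<Longrightarrow> X p q u v = 0"
  shows "quad_row m r X = 0"
  unfolding quad_row_def Let_def using assms by simp

text \<open>If the square of a combination vanishes, the vector of its monomials
  \<open>a i * a j\<close> is in the kernel of an invertible matrix. Its entries at
  \<open>(i, 0)\<close> are the squares \<open>a i * a i\<close>.\<close>

lemma quad_matrix_kernel:
  assumes D: "det (quad_matrix t) \<noteq> 0"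
    and z: "\<And>p q r s. p < 7 \<Longrightarrow> q < 7 \<Longrightarrow> r < 7 \<Longrightarrow> s < 7 \<Longrightarrow>
      pf (\<lambda>p q. \<Sum>i<7. a i * t i p q) (\<lambda>p q. \<Sum>i<7. a i * t i p q) p q r s = 0"
    and i: "i < 7"
  shows "a i = 0"
proof -
  let ?x = "\<chi> k. quad_monomial a (fst (Rep_quad_index k)) (snd (Rep_quad_index k))"
  let ?X = "\<lambda>k. quad_col t (fst (Rep_quad_index k)) (snd (Rep_quad_index k))"
  have "(\<Sum>k\<in>UNIV. ?x $ k * quad_row m r (?X k)) = 0" for m r
  proof -
    have "(\<Sum>k\<in>UNIV. ?x $ k * quad_row m r (?X k)) =
        quad_row m r (\<lambda>p q u v. \<Sum>k\<in>UNIV. ?x $ k * ?X k p q u v)"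
      by (rule quad_row_sum[symmetric])
    also have "\<dots> = 0"
    proof (rule quad_row_zero)
      fix p q u v :: nat assume b: "p < 7" "q < 7" "u < 7" "v < 7"
      have "(\<Sum>k\<in>UNIV. ?x $ k * ?X k p q u v) = (\<Sum>m<7. \<Sum>l<4. quad_monomial a m l * quad_col t m l p q u v)"
        by (simp add: sum_quad_index[of "\<lambda>m l. quad_monomial a m l * quad_col t m l p q u v"])
      then show "(\<Sum>k\<in>UNIV. ?x $ k * ?X k p q u v) = 0"
        unfolding pf_expansion[symmetric] using z[OF b] by simp
    qed
    finally show ?thesis .
  qed
  then have "quad_matrix t *v ?x = 0"
    unfolding quad_matrix_def by (simp add: vec_eq_iff matrix_vector_mult_def mult.commute)
  moreover obtain B where "B ** quad_matrix t = mat 1"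
    using D invertible_det_nz[of "quad_matrix t"] unfolding invertible_def by auto
  ultimately have "?x = 0" using matrix_left_invertible_ker[of "quad_matrix t"] by blast
  then have "?x $ Abs_quad_index (i, 0) = 0" by simp
  then show ?thesis using i by (simp add: Abs_quad_index_inverse quad_monomial_def)
qed

lemma quad_matrix_cyclic: "quad_matrix (\<lambda>i p q. of_int (cyclic_form i p q)) = mat 1"
proof -
  have 1: "quad_col (\<lambda>i p q. of_int (cyclic_form i p q)) k s = (\<lambda>p q u v. of_int (quad_col cyclic_form k s p q u v))"
    for k s :: nat unfolding quad_col_def pf_def by (auto simp: fun_eq_iff)
  have 2: "quad_row m r (\<lambda>p q u v. of_int (X p q u v)) = of_int (quad_row m r X)" for m r and X :: "nat \<Rightarrow> nat \<Rightarrow> nat \<Rightarrow> nat \<Rightarrow> int"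
    unfolding quad_row_def Let_def by simp
  have 3: "Rep_quad_index r = Rep_quad_index k \<longleftrightarrow> r = k" for r k by (rule Rep_quad_index_inject)
  show ?thesis
    unfolding quad_matrix_def 1 2 mat_def
    by (simp add: vec_eq_iff cyclic_form_dual quad_index_bounds prod_eq_iff[symmetric] 3)
qed

text \<open>\<open>pf M M p q r s\<close> and \<open>schur M p q r s\<close> are the same
  expression, and permuting the indices changes it by a sign at most. As it is nonzero, one of
  \<open>M p q\<close>, \<open>M p r\<close>, \<open>M p s\<close> is nonzero and can serve as
  pivot.\<close>

lemma rank4_of_pf:
  assumes M: "alternating M" and ne: "pf M M p q r s \<noteq> 0" and b: "p < 7" "q < 7" "r < 7" "s < (7::nat)"
  shows "\<exists>p<7. \<exists>q<7. \<exists>r<7. \<exists>s<7. M p q * schur M p q r s \<noteq> (0::complex)"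
proof -
  have sw: "M i j = - M j i" for i j using M unfolding alternating_def by blast
  have "schur M p q r s \<noteq> 0" using ne unfolding pf_def schur_def by (simp add: mult.commute)
  moreover have "schur M p r q s = - schur M p q r s" "schur M p s q r = schur M p q r s"
    unfolding schur_def sw[of r q] sw[of s q] sw[of s r] by (simp_all add: algebra_simps)
  moreover have "M p q \<noteq> 0 \<or> M p r \<noteq> 0 \<or> M p s \<noteq> 0" using ne unfolding pf_def by auto
  ultimately have "M p q * schur M p q r s \<noteq> 0 \<or> M p r * schur M p r q s \<noteq> 0 \<or> M p s * schur M p s q r \<noteq> 0"
    by auto
  then show ?thesis using b by blast
qed

section \<open>The open set of nondegenerate nets\<close>

lemma vector_space_form_scale: "vector_space form_scale"
  by unfold_locales (simp_all add: form_scale_def fun_eq_iff algebra_simps)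

lemma (in vector_space) independent_span_eq:
  assumes S: "independent S" "S \<subseteq> T" and T: "subspace T" "T \<subseteq> span B" and B: "finite B" "card B \<le> card S"
  shows "span S = T"
proof
  show "span S \<subseteq> T" by (rule span_minimal[OF S(2) T(1)])
  show "T \<subseteq> span S"
  proof (rule subsetI, rule ccontr)
    fix x assume x: "x \<in> T" "x \<notin> span S"
    have "x \<notin> S" using x(2) span_base by blast
    have "independent (insert x S)" using S(1) x(2) by (simp add: independent_insert \<open>x \<notin> S\<close>)
    moreover have "insert x S \<subseteq> span B" using x(1) S(2) T(2) by blast
    ultimately have "finite (insert x S) \<and> card (insert x S) \<le> card B"
      by (rule independent_span_bound[OF B(1)])
    then show False using B(2) \<open>x \<notin> S\<close> by (auto simp: card_insert_disjoint)
  qed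
qed

context coordinates7
begin

lemma subspace_skew_forms: "module.subspace form_scale (skew_forms smul)"
proof -
  interpret s: vector_space form_scale by (rule vector_space_form_scale)
  interpret p: vector_space_pair smul "(*) :: complex \<Rightarrow> complex \<Rightarrow> complex"
    using vector_space_complex vector_space_axioms by (simp add: vector_space_pair_def)
  show ?thesis
    unfolding s.subspace_def
  proof (intro conjI ballI allI)
    show "0 \<in> skew_forms smul"
      unfolding skew_forms_def using p.linear_zero by (simp add: zero_fun_def)
    fix w assume w: "w \<in> skew_forms smul"
    note w1 = skew_formsD[OF w]
    fix a
    show "form_scale a w \<in> skew_forms smul"
      unfolding skew_forms_def form_scale_def
      using p.linear_compose_scale_right[OF w1(1), of a] p.linear_compose_scale_right[OF w1(2), of a] w1(3)
      by simp
    fix w' assume w': "w' \<in> skew_forms smul"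
    note w2 = skew_formsD[OF w']
    show "w + w' \<in> skew_forms smul"
      unfolding skew_forms_def
    proof (intro CollectI conjI allI)
      fix x
      have e: "(w + w') x = (\<lambda>y. w x y + w' x y)" "(\<lambda>y. (w + w') y x) = (\<lambda>y. w y x + w' y x)" by auto
      show "Vector_Spaces.linear smul (*) ((w + w') x)"
        unfolding e by (rule p.linear_compose_add[OF w1(1) w2(1)])
      show "Vector_Spaces.linear smul (*) (\<lambda>y. (w + w') y x)"
        unfolding e by (rule p.linear_compose_add[OF w1(2) w2(2)])
      show "(w + w') x x = 0" using w1(3) w2(3) by simp
    qed
  qed
qed

lemma linear_form_matrix: "Vector_Spaces.linear form_scale (*) (\<lambda>w. form_matrix w p q)"
proof -
  interpret s: vector_space form_scale by (rule vector_space_form_scale)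
  interpret t: vector_space "(*) :: complex \<Rightarrow> complex \<Rightarrow> complex" by (rule vector_space_complex)
  show ?thesis
    by unfold_locales (simp_all add: form_matrix_def form_scale_def algebra_simps)
qed

lemma form_matrix_sum: "form_matrix (\<Sum>i<n. form_scale (a i) (t i)) p q = (\<Sum>i<n. a i * form_matrix (t i) p q)"
  by (cases "p < 7 \<and> q < 7") (auto simp: form_matrix_def form_scale_def sum_fun_apply)

definition nondegenerate_net :: "(nat \<Rightarrow> 'v \<Rightarrow> 'v \<Rightarrow> complex) \<Rightarrow> bool"
  where "nondegenerate_net t \<longleftrightarrow> det (quad_matrix (\<lambda>i. form_matrix (t i))) \<noteq> 0"

lemma nondegenerate_net_pf:
  assumes D: "nondegenerate_net t" and i: "i < 7" "a i \<noteq> 0"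
  shows "\<exists>p<7. \<exists>q<7. \<exists>r<7. \<exists>s<7. pf (form_matrix (\<Sum>i<7. form_scale (a i) (t i)))
    (form_matrix (\<Sum>i<7. form_scale (a i) (t i))) p q r s \<noteq> 0"
proof (rule ccontr)
  have e: "form_matrix (\<Sum>i<7. form_scale (a i) (t i)) = (\<lambda>p q. \<Sum>i<7. a i * form_matrix (t i) p q)"
    by (intro ext) (rule form_matrix_sum)
  assume "\<not> ?thesis"
  then have "pf (\<lambda>p q. \<Sum>i<7. a i * form_matrix (t i) p q) (\<lambda>p q. \<Sum>i<7. a i * form_matrix (t i) p q) p q r s = 0"
    if "p < 7" "q < 7" "r < 7" "s < 7" for p q r s
    unfolding e using that by blast
  from quad_matrix_kernel[OF D[unfolded nondegenerate_net_def] this i(1)] i(2) show False by simp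
qed

text \<open>A nontrivial relation would be a combination equal to the zero form, whose square
  vanishes.\<close>

lemma nondegenerate_net_independent:
  assumes D: "nondegenerate_net t"
  shows "inj_on t {..<7}" "\<not> module.dependent form_scale (t ` {..<7})"
proof -
  interpret s: vector_space form_scale by (rule vector_space_form_scale)
  have fz: "form_matrix 0 = (\<lambda>p q. 0)" by (auto simp: fun_eq_iff form_matrix_def)
  have "\<forall>i\<in>{..<7}. a i = 0" if z: "(\<Sum>i\<in>{..<7}. form_scale (a i) (t i)) = 0" for a
  proof (rule ballI, rule ccontr)
    fix i :: nat assume "i \<in> {..<7}" "a i \<noteq> 0"
    then show False
      using nondegenerate_net_pf[of t i a, OF D]
      unfolding z fz pf_def by simp
  qed
  from s.independent_familyI[OF finite_lessThan this]
  show "inj_on t {..<7}" "\<not> module.dependent form_scale (t ` {..<7})" by auto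
qed

text \<open>The witness is any family in \<open>W\<close>, which keeps the condition free of a
  choice of basis and turns it into a union of determinant conditions. Its first seven members form
  a basis of \<open>W\<close>, as \<open>generic_nets_basis\<close> shows.\<close>

definition generic_nets :: "('v \<Rightarrow> 'v \<Rightarrow> complex) set set"
  where "generic_nets = {W \<in> subspaces form_scale 7 (skew_forms smul). \<exists>t. (\<forall>i. t i \<in> W) \<and> nondegenerate_net t}"

lemma finite_frames_forms: "finite_frames form_scale 7 (skew_forms smul)"
  by (intro finite_frames.intro finite_frames_axioms.intro vector_space_form_scale subspace_skew_forms) simp

text \<open>Over a frame of \<open>W\<close>, the families in \<open>W\<close> are the coefficient
  arrays \<open>g\<close> applied to the frame. For fixed \<open>g\<close> the determinant is a
  regular function of the frame, and the preimage of \<open>generic_nets\<close> is the union of the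
  nonvanishing loci over all \<open>g\<close>.\<close>

lemma generic_nets_open:
  "openin (zariski_top (grassmannian form_scale 7 (skew_forms smul))) generic_nets"
proof -
  interpret FF: finite_frames form_scale 7 "skew_forms smul" by (rule finite_frames_forms)
  let ?D = "\<lambda>g t. det (quad_matrix (\<lambda>i. form_matrix (\<Sum>j<7. form_scale (g i j) (t j))))"
  have g: "?D g \<in> gfun FF.F" for g
  proof -
    have "(\<lambda>t. form_matrix (t j) p q) \<in> gfun FF.F" if "j < 7" for j p q
      by (rule FF.frame_coordinate_gfun[OF linear_form_matrix that])
    then have 1: "(\<lambda>t. form_matrix (\<Sum>j<7. form_scale (g i j) (t j)) p q) \<in> gfun FF.F" for i p q
      unfolding form_matrix_sum
      by (intro gfun_sum gfun_mult gfun_const FF.fun_space_F) auto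
    have 2: "(\<lambda>t. quad_col (\<lambda>i. form_matrix (\<Sum>j<7. form_scale (g i j) (t j))) m s p q u v) \<in> gfun FF.F" for m s p q u v
      unfolding quad_col_def pf_def
      by (cases "s = 0"; simp only: if_True if_False simp_thms; intro gfun_add gfun_diff gfun_mult 1 FF.fun_space_F)
    have 3: "(\<lambda>t. quad_row m r (quad_col (\<lambda>i. form_matrix (\<Sum>j<7. form_scale (g i j) (t j))) k s)) \<in> gfun FF.F" for m r k s
      unfolding quad_row_def Let_def
      by (cases "r = 0"; cases "r = 1"; cases "r = 2"; simp only: if_True if_False simp_thms; intro gfun_add gfun_diff gfun_uminus 2 FF.fun_space_F)
    show ?thesis
      unfolding det_def quad_matrix_def vec_lambda_beta
      by (intro gfun_sum gfun_prod gfun_mult gfun_const FF.fun_space_F 3)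
  qed
  have "{t \<in> points FF.F. FF.frame_span t \<in> generic_nets} = (\<Union>g. {t \<in> points FF.F. ?D g t \<noteq> 0})"
  proof (intro set_eqI iffI)
    fix t assume t: "t \<in> {t \<in> points FF.F. FF.frame_span t \<in> generic_nets}"
    then obtain t' where t': "\<forall>i. t' i \<in> FF.frame_span t" "nondegenerate_net t'"
      unfolding generic_nets_def by blast
    have inj: "inj_on t {..<7}" using t unfolding FF.points_F frames_def by blast
    have "\<exists>g. t' i = (\<Sum>j<7. form_scale (g j) (t j))" for i
    proof -
      obtain u where "t' i = (\<Sum>x\<in>t ` {..<7}. form_scale (u x) x)"
        using t'(1) FF.span_finite[of "t ` {..<7}"] by auto
      then show ?thesis by (intro exI[of _ "\<lambda>j. u (t j)"]) (simp add: sum.reindex[OF inj])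
    qed
    then obtain g where "\<And>i. t' i = (\<Sum>j<7. form_scale (g i j) (t j))" by metis
    then have "t' = (\<lambda>i. \<Sum>j<7. form_scale (g i j) (t j))" by auto
    then show "t \<in> (\<Union>g. {t \<in> points FF.F. ?D g t \<noteq> 0})"
      using t t'(2) unfolding nondegenerate_net_def by blast
  next
    fix t assume "t \<in> (\<Union>g. {t \<in> points FF.F. ?D g t \<noteq> 0})"
    then obtain g where t: "t \<in> points FF.F" "?D g t \<noteq> 0" by blast
    have "(\<Sum>j<7. form_scale (g i j) (t j)) \<in> FF.frame_span t" for i
      by (intro FF.span_sum FF.span_scale FF.span_base) simp
    then have "\<exists>t'. (\<forall>i. t' i \<in> FF.frame_span t) \<and> nondegenerate_net t'"
      using t(2) unfolding nondegenerate_net_def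
      by (intro exI[of _ "\<lambda>i. \<Sum>j<7. form_scale (g i j) (t j)"]) simp
    then show "t \<in> {t \<in> points FF.F. FF.frame_span t \<in> generic_nets}"
      using t(1) FF.frame_span_subspaces[of t] unfolding generic_nets_def by simp
  qed
  moreover have "openin (zariski_top FF.F) (\<Union>g. {t \<in> points FF.F. ?D g t \<noteq> 0})"
    by (intro openin_Union) (use fun_space_nonzero_open[OF FF.fun_space_F openin_topspace g[unfolded gfun_def]] in blast)
  ultimately show ?thesis
    unfolding FF.openin_G generic_nets_def by auto
qed

lemma generic_nets_nonempty: "generic_nets \<noteq> {}"
proof -
  interpret s: vector_space form_scale by (rule vector_space_form_scale)
  interpret p: vector_space_pair smul "(*) :: complex \<Rightarrow> complex \<Rightarrow> complex"
    using vector_space_complex vector_space_axioms by (simp add: vector_space_pair_def)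
  \<comment> \<open>A family in \<open>generic_nets\<close> must lie in \<open>W\<close> at every
    natural index, hence the periodic extension by \<open>i mod 7\<close>.\<close>
  define f where "f i x y = (\<Sum>p<7. \<Sum>q<7. of_int (cyclic_form (i mod 7) p q) * c p x * c q y)" for i x y
  have sw: "cyclic_form (i mod 7) p q = - cyclic_form (i mod 7) q p" if "p < 7" "q < 7" for i p q
  proof -
    have "\<forall>i\<in>{..<7}. \<forall>p\<in>{..<7}. \<forall>q\<in>{..<7}. cyclic_form i p q = - cyclic_form i q p"
      using cyclic_form_alternating_list unfolding list_all_iff set_7 .
    moreover have "i mod 7 < 7" by simp
    ultimately show ?thesis using that by blast
  qed
  have f: "f i \<in> skew_forms smul" for i
    unfolding skew_forms_def
  proof (intro CollectI conjI allI)
    fix x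
    interpret c: Vector_Spaces.linear smul "(*)" "c p" for p by (rule c_linear)
    show "Vector_Spaces.linear smul (*) (f i x)"
      by unfold_locales (simp_all add: f_def c.add c.scale algebra_simps sum.distrib sum_distrib_left)
    show "Vector_Spaces.linear smul (*) (\<lambda>y. f i y x)"
      by unfold_locales (simp_all add: f_def c.add c.scale algebra_simps sum.distrib sum_distrib_left)
    have "f i x x = (\<Sum>q<7. \<Sum>p<7. of_int (cyclic_form (i mod 7) p q) * c p x * c q x)"
      unfolding f_def by (rule sum.swap)
    also have "\<dots> = - f i x x"
      unfolding f_def sum_negf[symmetric]
    proof (intro sum.cong refl)
      fix p q :: nat assume "p \<in> {..<7}" "q \<in> {..<7}"
      then have "cyclic_form (i mod 7) q p = - cyclic_form (i mod 7) p q" by (intro sw) auto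
      then show "of_int (cyclic_form (i mod 7) q p) * c q x * c p x =
          - (of_int (cyclic_form (i mod 7) p q) * c p x * c q x)"
        by (simp only: of_int_minus) (simp add: mult.assoc mult.left_commute)
    qed
    finally show "f i x x = 0" by simp
  qed
  have m: "form_matrix (f i) p q = of_int (cyclic_form (i mod 7) p q)" if "p < 7" "q < 7" for i p q
  proof -
    have "f i (e p) (e q) = (\<Sum>p'<7. \<Sum>q'<7. if p' = p then (if q' = q then of_int (cyclic_form (i mod 7) p' q') else 0) else 0)"
      unfolding f_def by (intro sum.cong refl) (use that in \<open>auto simp: c_e\<close>)
    also have "\<dots> = (\<Sum>p'<7. if p' = p then (\<Sum>q'<7. if q' = q then of_int (cyclic_form (i mod 7) p' q') else 0) else 0)"
      by (intro sum.cong refl) auto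
    also have "\<dots> = of_int (cyclic_form (i mod 7) p q)" using that by simp
    finally show ?thesis using that by (simp add: form_matrix_def)
  qed
  have "quad_row m r (quad_col (\<lambda>i. form_matrix (f i)) k s) =
      quad_row m r (quad_col (\<lambda>i p q. of_int (cyclic_form i p q)) k s)" if "k < 7" for m r k s
    unfolding quad_row_def quad_col_def pf_def Let_def using that by (simp add: m)
  then have "quad_matrix (\<lambda>i. form_matrix (f i)) = mat 1"
    unfolding quad_matrix_cyclic[symmetric] quad_matrix_def by (simp add: quad_index_bounds)
  then have D: "nondegenerate_net f" unfolding nondegenerate_net_def by simp
  note i = nondegenerate_net_independent[OF D]
  let ?W = "s.span (f ` {..<7})"
  have "f n \<in> ?W" for n
  proof -
    have "f n = f (n mod 7)" unfolding f_def by simp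
    then show ?thesis by (simp add: s.span_base)
  qed
  moreover have "?W \<subseteq> skew_forms smul" by (rule s.span_minimal[OF _ subspace_skew_forms]) (use f in blast)
  moreover have "s.dim ?W = 7" using s.dim_span_eq_card_independent[OF i(2)] card_image[OF i(1)] by simp
  ultimately have "?W \<in> generic_nets"
    unfolding generic_nets_def subspaces_def using D by auto
  then show ?thesis by blast
qed

text \<open>Seven independent members must span a space that is itself spanned by a frame of length
  seven.\<close>

lemma generic_nets_basis:
  assumes W: "W \<in> generic_nets"
  shows "\<exists>t. nondegenerate_net t \<and> (\<forall>i. t i \<in> skew_forms smul) \<and> module.span form_scale (t ` {..<7}) = W"
proof -
  interpret FF: finite_frames form_scale 7 "skew_forms smul" by (rule finite_frames_forms)
  have W': "W \<in> subspaces form_scale 7 (skew_forms smul)" using W unfolding generic_nets_def by blast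
  obtain t where t: "\<forall>i. t i \<in> W" "nondegenerate_net t" using W unfolding generic_nets_def by blast
  note i = nondegenerate_net_independent[OF t(2)]
  obtain b where b: "FF.frame_span b = W" using FF.frame_exists[OF W'] by blast
  have "FF.span (t ` {..<7}) = W"
  proof (rule FF.independent_span_eq[OF i(2)])
    show "t ` {..<7} \<subseteq> W" using t(1) by blast
    show "FF.subspace W" using W' unfolding subspaces_def by blast
    show "W \<subseteq> FF.span (b ` {..<7})" using b by simp
    show "card (b ` {..<7}) \<le> card (t ` {..<7})"
      using card_image[OF i(1)] card_image_le[of "{..<7}" b] by simp
  qed simp
  then show ?thesis using t W' unfolding subspaces_def by blast
qed

end

section \<open>The loci of a generic net\<close>

text \<open>Each Schur complement doubles the degree: the three pivots have degrees 1, 2 and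
  4.\<close>

lemma rank6_scale: "rank6 (\<lambda>i j. a * M i j) m = a ^ 7 * rank6 M m"
proof -
  have s: "schur (\<lambda>i j. b * N i j) p q = (\<lambda>i j. b * b * schur N p q i j)" for b N p q
    by (intro ext) (simp add: schur_def right_diff_distrib distrib_left mult.assoc mult.left_commute)
  obtain p q r s t u where m: "m = (p, q, r, s, t, u)" by (cases m)
  show ?thesis unfolding m rank6_def by (simp add: s eval_nat_numeral)
qed

context coordinates7
begin

section \<open>Matching the two loci with the strata of the count\<close>

lemma span_forms_zero_iff:
  "(\<forall>w \<in> module.span form_scale (t ` {..<7}). w x y = 0) \<longleftrightarrow> (\<forall>k<7::nat. t k x y = (0::complex))"
proof -
  interpret s: vector_space form_scale by (rule vector_space_form_scale)
  have sub: "s.subspace {w. w x y = 0}" unfolding s.subspace_def by (simp add: form_scale_def)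
  show ?thesis
  proof
    assume *: "\<forall>w \<in> s.span (t ` {..<7}). w x y = 0"
    show "\<forall>k<7. t k x y = 0"
    proof (intro allI impI)
      fix k :: nat assume "k < 7"
      then have "t k \<in> s.span (t ` {..<7})" by (intro s.span_base) simp
      with * show "t k x y = 0" by blast
    qed
  next
    assume "\<forall>k<7. t k x y = 0"
    then have "s.span (t ` {..<7}) \<subseteq> {w. w x y = 0}" by (intro s.span_minimal[OF _ sub]) auto
    then show "\<forall>w \<in> s.span (t ` {..<7}). w x y = 0" by blast
  qed
qed

lemma form_expand:
  assumes "w \<in> skew_forms smul"
  shows "w x y = (\<Sum>i<7. \<Sum>j<7. form_matrix w i j * c i x * c j y)"
  using form_comb[OF assms, of "\<lambda>i. c i x" "\<lambda>j. c j y"] comb_coordinates[of x "\<lambda>i. c i x"]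
    comb_coordinates[of y "\<lambda>i. c i y"] by simp

lemma form_pair:
  assumes w: "w \<in> skew_forms smul"
  shows "w (smul a u + smul b v) (smul a' u + smul b' v) = (a * b' - b * a') * w u v"
proof -
  note l = linear_add[OF skew_formsD(1)[OF w]] linear_scale[OF skew_formsD(1)[OF w]]
    linear_add[OF skew_formsD(2)[OF w]] linear_scale[OF skew_formsD(2)[OF w]]
  have "w v u = - w u v" by (rule skew_forms_swap[OF w])
  then show ?thesis using skew_formsD(3)[OF w, of u] skew_formsD(3)[OF w, of v]
    unfolding l by (simp add: algebra_simps)
qed

text \<open>In the charts of the atlas the pieces of the locus are literally the
  \<open>normal_frames\<close> of the count. Isotropy of a plane is one equation on a frame for each
  form, and linearity reduces the forms in \<open>W\<close> to the basis \<open>t\<close>.\<close>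

lemma isotropic_locus_class:
  assumes ms: "set ms = {(i, j). i < j \<and> j < 7}"
    and t: "\<forall>i. t i \<in> skew_forms smul" and W: "module.span form_scale (t ` {..<7}) = W"
  shows "K0_class (isotropic_locus smul W) =
    (\<Sum>k<length ms. sclass (fproduct (affine_space 7) (affine_space 7)) (skew_net.normal_frames (\<lambda>k. form_matrix (t k)) ms k))"
proof -
  interpret N: skew_net "\<lambda>k. form_matrix (t k)"
    by unfold_locales (rule form_matrix_alternating[OF t[rule_format]])
  interpret s: vector_space form_scale by (rule vector_space_form_scale)
  interpret GA: grassmann_atlas smul 2 UNIV "fproduct (affine_space 7) (affine_space 7)" "length ms"
    "\<lambda>m t. minor2 (fst (ms ! m)) (snd (ms ! m)) t" "\<lambda>m. section2 (ms ! m)" frame2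
    "\<lambda>m. normalized2 (ms ! m)" "\<lambda>m m'. transition2 (ms ! m')"
    by (rule atlas2[OF ms])
  have Wsk: "W \<subseteq> skew_forms smul"
    unfolding W[symmetric] by (rule s.span_minimal[OF _ subspace_skew_forms]) (use t in blast)
  let ?A = "{T \<in> subspaces smul 2 UNIV. \<forall>w\<in>W. \<forall>x\<in>T. \<forall>y\<in>T. w x y = 0}"
  let ?Z = "(\<lambda>w t. w (t 0) (t 1)) ` W"
  have Z: "?Z \<subseteq> gfun GA.F"
  proof (rule image_subsetI)
    fix w assume "w \<in> W"
    then have w: "w \<in> skew_forms smul" using Wsk by blast
    have g0: "(\<lambda>t. c i (t 0)) \<in> gfun GA.F" for i
      by (rule GA.frame_coordinate_gfun[OF c_linear]) simp
    have g1: "(\<lambda>t. c i (t 1)) \<in> gfun GA.F" for i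
      by (rule GA.frame_coordinate_gfun[OF c_linear]) simp
    \<comment> \<open>The value of a form on a frame is not a generator of the frame algebra, but it
      is polynomial in the coordinates of the two vectors.\<close>
    have "(\<lambda>t. \<Sum>i<7. \<Sum>j<7. form_matrix w i j * c i (t 0) * c j (t 1)) \<in> gfun GA.F"
      by (intro gfun_sum gfun_mult gfun_const GA.fun_space_F g0 g1)
    also have "(\<lambda>t. \<Sum>i<7. \<Sum>j<7. form_matrix w i j * c i (t 0) * c j (t 1)) = (\<lambda>t. w (t 0) (t 1))"
      by (rule ext) (rule form_expand[OF w, symmetric])
    finally show "(\<lambda>t. w (t 0) (t 1)) \<in> gfun GA.F" .
  qed
  have AZ: "GA.frame_span t \<in> ?A \<longleftrightarrow> (\<forall>f\<in>?Z. f t = 0)" if tf: "t \<in> frames smul 2 UNIV" for t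
  proof -
    have sp: "GA.frame_span t = span {t 0, t 1}"
      by (rule arg_cong[of _ _ span]) (auto simp: less_2_cases_iff)
    have b: "t 0 \<in> span {t 0, t 1}" "t 1 \<in> span {t 0, t 1}" by (auto intro: span_base)
    have "(\<forall>x\<in>span {t 0, t 1}. \<forall>y\<in>span {t 0, t 1}. w x y = 0) \<longleftrightarrow> w (t 0) (t 1) = 0" if "w \<in> W" for w
    proof
      assume "\<forall>x\<in>span {t 0, t 1}. \<forall>y\<in>span {t 0, t 1}. w x y = 0"
      with b show "w (t 0) (t 1) = 0" by blast
    next
      assume z: "w (t 0) (t 1) = 0"
      have w: "w \<in> skew_forms smul" using that Wsk by blast
      show "\<forall>x\<in>span {t 0, t 1}. \<forall>y\<in>span {t 0, t 1}. w x y = 0"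
      proof (intro ballI)
        fix x y assume "x \<in> span {t 0, t 1}" "y \<in> span {t 0, t 1}"
        then obtain a b a' b' where "x = smul a (t 0) + smul b (t 1)" "y = smul a' (t 0) + smul b' (t 1)"
          unfolding span_pair_iff by blast
        then show "w x y = 0" using form_pair[OF w, of a "t 0" b "t 1" a' b'] z by simp
      qed
    qed
    then have "(\<forall>w\<in>W. \<forall>x\<in>span {t 0, t 1}. \<forall>y\<in>span {t 0, t 1}. w x y = 0) \<longleftrightarrow> (\<forall>w\<in>W. w (t 0) (t 1) = 0)"
      by (rule ball_cong[OF refl])
    then show ?thesis using GA.frame_span_subspaces[OF tf] unfolding sp by simp
  qed
  have "K0_class (isotropic_locus smul W) = K0_class (induced GA.G ?A)"
    unfolding isotropic_locus_def Let_def GA.points_G ..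
  also have "\<dots> = (\<Sum>k<length ms. sclass (fproduct (affine_space 7) (affine_space 7)) {x \<in> normalized2 (ms ! k). GA.frame_span (frame2 x) \<in> ?A \<and>
      (\<forall>m'<k. minor2 (fst (ms ! m')) (snd (ms ! m')) (frame2 x) = 0)})"
    by (rule GA.closed_class[OF _ Z AZ]) auto
  also have "\<dots> = (\<Sum>k<length ms. sclass (fproduct (affine_space 7) (affine_space 7)) (N.normal_frames ms k))"
  proof (intro sum.cong refl arg_cong[of _ _ "sclass (fproduct (affine_space 7) (affine_space 7))"] set_eqI)
    fix k p assume "k \<in> {..<length ms}"
    then have k: "k < length ms" by simp
    have lt: "fst (ms ! m) < 7" "snd (ms ! m) < 7" if "m < length ms" for m
      using nth_mem[OF that] unfolding ms by auto
    have 1: "GA.frame_span (frame2 p) \<in> ?A \<longleftrightarrow> (\<forall>l<7. N.pairing l (fst p) (snd p) = 0)"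
      if p: "p \<in> normalized2 (ms ! k)"
    proof -
      have "GA.frame_span (frame2 p) \<in> ?A \<longleftrightarrow> (\<forall>w\<in>W. w (comb (fst p)) (comb (snd p)) = 0)"
        unfolding AZ[OF GA.\<rho>_frames[OF k p]] by (simp add: frame2_def)
      also have "\<dots> \<longleftrightarrow> (\<forall>l<7. t l (comb (fst p)) (comb (snd p)) = 0)"
        unfolding W[symmetric] by (rule span_forms_zero_iff)
      also have "\<dots> \<longleftrightarrow> (\<forall>l<7. N.pairing l (fst p) (snd p) = 0)"
        unfolding N.pairing_def form_comb[OF t[rule_format]] ..
      finally show ?thesis .
    qed
    have 2: "minor2 (fst (ms ! m')) (snd (ms ! m')) (frame2 p) = N.minor (ms ! m') p" if "m' < k" for m'
      using that k lt[of m'] by (simp add: minor2_frame2 N.minor_def)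
    have 3: "p \<in> normalized2 (ms ! k) \<longleftrightarrow> p \<in> coord {..<7} \<times> coord {..<7} \<and> fst p (fst (ms ! k)) = 1 \<and>
        fst p (snd (ms ! k)) = 0 \<and> snd p (fst (ms ! k)) = 0 \<and> snd p (snd (ms ! k)) = 1"
      unfolding normalized2_def coord_lessThan by (simp add: case_prod_beta)
    have 4: "(\<forall>m'<k. minor2 (fst (ms ! m')) (snd (ms ! m')) (frame2 p) = 0) \<longleftrightarrow> (\<forall>i<k. N.minor (ms ! i) p = 0)"
      using 2 by simp
    have "p \<in> {x \<in> normalized2 (ms ! k). GA.frame_span (frame2 x) \<in> ?A \<and>
          (\<forall>m'<k. minor2 (fst (ms ! m')) (snd (ms ! m')) (frame2 x) = 0)} \<longleftrightarrow>
        p \<in> normalized2 (ms ! k) \<and> (\<forall>l<7. N.pairing l (fst p) (snd p) = 0) \<and> (\<forall>i<k. N.minor (ms ! i) p = 0)"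
      unfolding mem_Collect_eq[of p] using 1 4 by blast
    also have "\<dots> \<longleftrightarrow> p \<in> N.normal_frames ms k"
      unfolding 3 N.normal_frames_def N.isotropic_iff mem_Collect_eq by blast
    finally show "p \<in> {x \<in> normalized2 (ms ! k). GA.frame_span (frame2 x) \<in> ?A \<and>
          (\<forall>m'<k. minor2 (fst (ms ! m')) (snd (ms ! m')) (frame2 x) = 0)} \<longleftrightarrow> p \<in> N.normal_frames ms k" .
  qed
  finally show ?thesis .
qed

text \<open>The locus asks for some generator of a line. Scaling multiplies \<open>rank6\<close> by
  a power of the scalar, so the equations persist for every member of the line.\<close>

lemma form_rank_span:
  assumes w: "w \<in> skew_forms smul" and v: "v \<in> module.span form_scale {w}" and r: "form_rank w < 6"
  shows "form_rank v < 6"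
proof -
  interpret s: vector_space form_scale by (rule vector_space_form_scale)
  obtain a where a: "v = form_scale a w" using v unfolding s.span_singleton by blast
  have "v \<in> skew_forms smul" unfolding a by (rule s.subspace_scale[OF subspace_skew_forms w])
  moreover have "form_matrix v = (\<lambda>i j. a * form_matrix w i j)"
    unfolding a form_scale_def by (auto simp: form_matrix_def fun_eq_iff)
  ultimately show ?thesis
    using r unfolding form_rank_less_iff[OF w] by (simp add: form_rank_less_iff rank6_scale)
qed

text \<open>The update \<open>a(i := 1)\<close> restores the homogeneous coordinate that a point of
  the cell leaves implicit.\<close>

lemma net_entry:
  assumes t: "\<forall>i. t i \<in> skew_forms smul" and i: "i < 7" and a: "a \<in> coord {i<..<7}"
  shows "skew_net.W (\<lambda>k. form_matrix (t k)) i j l a =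
    form_matrix (\<Sum>k<7. form_scale ((a(i := 1)) k) (t k)) j l"
proof -
  interpret N: skew_net "\<lambda>k. form_matrix (t k)"
    by unfold_locales (rule form_matrix_alternating[OF t[rule_format]])
  let ?x = "a(i := 1)"
  have z: "a k = 0" if "k \<notin> {i<..<7}" for k using a that unfolding coord_def by blast
  have "form_matrix (\<Sum>k<7. form_scale (?x k) (t k)) j l = (\<Sum>k<7. ?x k * form_matrix (t k) j l)"
    by (rule form_matrix_sum)
  also have "\<dots> = (\<Sum>k\<in>insert i {i<..<7}. ?x k * form_matrix (t k) j l)"
    by (rule sum.mono_neutral_right) (use i z in auto)
  also have "\<dots> = form_matrix (t i) j l + (\<Sum>k\<in>{i<..<7}. a k * form_matrix (t k) j l)"
    by simp
  finally show ?thesis unfolding N.W_def by simp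
qed

text \<open>Stratum \<open>m\<close> of the atlas consists of coordinate vectors
  \<open>(0, ..., 0, 1, ...)\<close> with the \<open>1\<close> at place \<open>m\<close>, while the
  cells of the count carry \<open>0\<close> there. Writing \<open>1\<close> or \<open>0\<close> at
  this place gives inverse morphisms between the two descriptions.\<close>

lemma pfaffian_locus_class:
  assumes D: "nondegenerate_net t" and t: "\<forall>i. t i \<in> skew_forms smul"
    and W: "module.span form_scale (t ` {..<7}) = W"
  shows "K0_class (pfaffian_locus W) = (\<Sum>m<7. sclass (affine_space 7) (skew_net.degenerate (\<lambda>k. form_matrix (t k)) m))"
proof -
  interpret N: skew_net "\<lambda>k. form_matrix (t k)"
    by unfold_locales (rule form_matrix_alternating[OF t[rule_format]])
  interpret s: vector_space form_scale by (rule vector_space_form_scale)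
  obtain c' where c': "coordinatized form_scale W 7 t c'"
    using coordinatized_exists[OF vector_space_form_scale nondegenerate_net_independent[OF D]] unfolding W by blast
  interpret C: coordinatized form_scale W 7 t c' by (rule c')
  interpret GA: grassmann_atlas form_scale 1 W "affine_space 7" 7 "\<lambda>m t. c' m (t 0)" C.section1 C.frame1
    "\<lambda>m. {x \<in> affine_points 7. x m = 1}" "\<lambda>m m'. C.transition1 m'"
    by (rule C.atlas1)
  have Wsk: "W \<subseteq> skew_forms smul"
    unfolding W[symmetric] by (rule s.span_minimal[OF _ subspace_skew_forms]) (use t in blast)
  let ?I = "{..<7} \<times> {..<7} \<times> {..<7} \<times> {..<7} \<times> {..<7} \<times> {..<7::nat}"
  let ?A = "{l \<in> subspaces form_scale 1 W. \<exists>w. w \<noteq> 0 \<and> l = s.span {w} \<and> form_rank w < 6}"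
  let ?Z = "(\<lambda>m t. rank6 (form_matrix (t 0)) m) ` ?I"
  have Z: "?Z \<subseteq> gfun GA.F"
  proof (rule image_subsetI)
    fix m :: "nat \<times> nat \<times> nat \<times> nat \<times> nat \<times> nat"
    obtain p q r s t u where m: "m = (p, q, r, s, t, u)" by (cases m)
    have 1: "(\<lambda>t. form_matrix (t 0) i j) \<in> gfun GA.F" for i j
      by (rule GA.frame_coordinate_gfun[OF linear_form_matrix]) simp
    show "(\<lambda>t. rank6 (form_matrix (t 0)) m) \<in> gfun GA.F"
      unfolding m rank6_def schur_def prod.case
      by (intro gfun_mult gfun_add gfun_diff 1 GA.fun_space_F)
  qed
  have AZ': "GA.frame_span u \<in> ?A \<longleftrightarrow> form_rank (u 0) < 6" if u: "u \<in> frames form_scale 1 W" for u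
  proof -
    have u0: "u 0 \<in> W" "u 0 \<noteq> 0" using u unfolding C.frames1_iff by blast+
    have sp: "GA.frame_span u = s.span {u 0}"
      by (rule arg_cong[of _ _ s.span]) auto
    have "form_rank (u 0) < 6" if "w \<noteq> 0" "s.span {u 0} = s.span {w}" "form_rank w < 6" for w
    proof (rule form_rank_span[OF _ _ that(3)])
      have "s.span {u 0} \<subseteq> skew_forms smul"
        by (rule s.span_minimal[OF _ subspace_skew_forms]) (use u0(1) Wsk in blast)
      then show "w \<in> skew_forms smul" using s.span_base[of w "{w}"] that(2) by blast
      show "u 0 \<in> s.span {w}" unfolding that(2)[symmetric] by (rule s.span_base) simp
    qed
    then show ?thesis using GA.frame_span_subspaces[OF u] u0(2) unfolding sp by blast
  qed
  have AZ: "GA.frame_span u \<in> ?A \<longleftrightarrow> (\<forall>f\<in>?Z. f u = 0)" if u: "u \<in> frames form_scale 1 W" for u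
  proof -
    have u0: "u 0 \<in> skew_forms smul" using u Wsk unfolding C.frames1_iff by blast
    show ?thesis unfolding AZ'[OF u] form_rank_less_iff[OF u0] by (simp only: ball_simps)
  qed
  have "K0_class (pfaffian_locus W) = K0_class (induced GA.G ?A)"
    unfolding pfaffian_locus_def Let_def GA.points_G ..
  also have "\<dots> = (\<Sum>m<7. sclass (affine_space 7) {x \<in> {x \<in> affine_points 7. x m = 1}. GA.frame_span (C.frame1 x) \<in> ?A \<and>
      (\<forall>m'<m. c' m' (C.frame1 x 0) = 0)})"
    by (rule GA.closed_class[OF _ Z AZ]) auto
  also have "\<dots> = (\<Sum>m<7. sclass (affine_space 7) (N.degenerate m))"
  proof (rule sum.cong[OF refl])
    fix m :: nat assume "m \<in> {..<7}"
    then have m: "m < 7" by simp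
    let ?S = "{x \<in> {x \<in> affine_points 7. x m = 1}. GA.frame_span (C.frame1 x) \<in> ?A \<and>
      (\<forall>m'<m. c' m' (C.frame1 x 0) = 0)}"
    have S: "x \<in> ?S \<longleftrightarrow> x \<in> affine_points 7 \<and> x m = 1 \<and> (\<forall>m'<m. x m' = 0) \<and>
        (\<forall>i\<in>?I. rank6 (form_matrix (C.comb x)) i = 0)" for x
    proof -
      have x0: "C.frame1 x 0 = C.comb x" by (simp add: C.frame1_def)
      have sk: "C.comb x \<in> skew_forms smul" using C.comb_E Wsk by blast
      have "GA.frame_span (C.frame1 x) \<in> ?A \<longleftrightarrow> (\<forall>i\<in>?I. rank6 (form_matrix (C.comb x)) i = 0)"
        if "x \<in> {x \<in> affine_points 7. x m = 1}"
        unfolding AZ'[OF GA.\<rho>_frames[OF m that]] x0 by (rule form_rank_less_iff[OF sk])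
      moreover have "(\<forall>m'<m. c' m' (C.frame1 x 0) = 0) \<longleftrightarrow> (\<forall>m'<m. x m' = 0)"
        unfolding x0 using m by (simp add: C.c_comb)
      ultimately show ?thesis unfolding mem_Collect_eq[of x] by blast
    qed
    have NW: "(\<lambda>j l. N.W m j l a) = form_matrix (C.comb (a(m := 1)))" if a: "a \<in> coord {m<..<7}" for a
      unfolding C.comb_def by (intro ext) (rule net_entry[OF t m a])
    have deg: "a \<in> N.degenerate m \<longleftrightarrow> a \<in> coord {m<..<7} \<and> (\<forall>i\<in>?I. rank6 (form_matrix (C.comb (a(m := 1)))) i = 0)" for a
    proof -
      have "N.rank6_minor m i a = rank6 (\<lambda>j l. N.W m j l a) i" for i
        unfolding N.rank6_minor_def rank6_def by (simp add: case_prod_beta)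
      then show ?thesis unfolding N.degenerate_def mem_Collect_eq using NW[of a] by auto
    qed
    have upd: "(\<lambda>x. (x(m := b)) i) \<in> gfun (induced (affine_space 7) T)" for b i T
      by (cases "i = m") (simp_all add: gfun_const gfun_coord_induced fun_space_induced fun_space_affine)
    have mor: "morphism (induced (affine_space 7) T) (affine_space 7) (\<lambda>x. x(m := b))" for b T
      by (rule morphism_affine_space[OF fun_space_induced[OF fun_space_affine] _ upd])
        (use m in \<open>auto simp: affine_points_def\<close>)
    show "sclass (affine_space 7) ?S = sclass (affine_space 7) (N.degenerate m)"
    proof (rule subvariety_isoI(2)[OF N.degenerate_subvariety[OF m] fun_space_affine _ mor[of _ 1] mor[of _ 0]])
      show "?S \<subseteq> points (affine_space 7)" by auto
    next
      fix a assume a: "a \<in> N.degenerate m"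
      then have ac: "a \<in> coord {m<..<7}" and r: "\<forall>i\<in>?I. rank6 (form_matrix (C.comb (a(m := 1)))) i = 0"
        unfolding deg by blast+
      have z: "a i = 0" if "i \<notin> {m<..<7}" for i using ac that unfolding coord_def by blast
      have "a(m := 1) \<in> ?S"
        unfolding S using r m z by (auto simp: affine_points_def)
      moreover have "(a(m := 1))(m := 0) = a" using z[of m] by auto
      ultimately show "a(m := 1) \<in> ?S \<and> (a(m := 1))(m := 0) = a" ..
    next
      fix x assume "x \<in> ?S"
      then have x: "x \<in> affine_points 7" "x m = 1" "\<forall>m'<m. x m' = 0"
        "\<forall>i\<in>?I. rank6 (form_matrix (C.comb x)) i = 0"
        unfolding S by blast+
      have e: "(x(m := 0))(m := 1) = x" using x(2) by auto
      have "x(m := 0) \<in> coord {m<..<7}"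
        unfolding coord_def
      proof (intro CollectI allI impI)
        fix i assume "i \<notin> {m<..<7}"
        then have "i < m \<or> i = m \<or> 7 \<le> i" by auto
        then show "(x(m := 0)) i = 0" using x(1,3) unfolding affine_points_def by auto
      qed
      then have "x(m := 0) \<in> N.degenerate m" unfolding deg e using x(4) by blast
      with e show "x(m := 0) \<in> N.degenerate m \<and> (x(m := 0))(m := 1) = x" by blast
    qed
  qed
  finally show ?thesis .
qed

text \<open>The combination belonging to a point of the cell has coefficient \<open>1\<close> at
  place \<open>i\<close>. Nondegeneracy thus gives a nonzero Pfaffian of size 4, and from it two
  successive pivots.\<close>

lemma net_rank4:
  assumes D: "nondegenerate_net t" and t: "\<forall>i. t i \<in> skew_forms smul" and i: "i < 7" and a: "a \<in> coord {i<..<7}"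
  shows "\<exists>m \<in> {..<7} \<times> {..<7} \<times> {..<7} \<times> {..<7}. skew_net.rank4_minor (\<lambda>k. form_matrix (t k)) i m a \<noteq> 0"
proof -
  interpret N: skew_net "\<lambda>k. form_matrix (t k)"
    by unfold_locales (rule form_matrix_alternating[OF t[rule_format]])
  interpret s: vector_space form_scale by (rule vector_space_form_scale)
  let ?x = "a(i := 1)"
  let ?w = "\<Sum>k<7. form_scale (?x k) (t k)"
  let ?M = "form_matrix ?w"
  have M: "N.W i j l a = ?M j l" for j l by (rule net_entry[OF t i a])
  have "?w \<in> skew_forms smul"
    by (intro s.subspace_sum[OF subspace_skew_forms] s.subspace_scale[OF subspace_skew_forms] t[rule_format])
  then have alt: "alternating ?M" by (rule form_matrix_alternating)
  have "?x i \<noteq> 0" by simp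
  from nondegenerate_net_pf[of t i ?x, OF D i this]
  obtain p q r s where b: "p < 7" "q < 7" "r < 7" "s < 7" "pf ?M ?M p q r s \<noteq> 0" by blast
  from rank4_of_pf[OF alt b(5) b(1-4)]
  obtain p q r s where b: "p < 7" "q < 7" "r < 7" "s < 7" "?M p q * schur ?M p q r s \<noteq> 0" by blast
  have "N.rank4_minor i (p, q, r, s) a = ?M p q * schur ?M p q r s"
    unfolding N.rank4_minor_def prod.case M ..
  then show ?thesis using b by (intro bexI[of _ "(p, q, r, s)"]) auto
qed

lemma generic_nets_class:
  assumes W: "W \<in> generic_nets"
  shows "(K0_class (isotropic_locus smul W) - K0_class (pfaffian_locus W)) * (L ^ 2 - 1) * (L - 1) * L ^ 7 = 0"
proof -
  obtain t where t: "nondegenerate_net t" "\<forall>i. t i \<in> skew_forms smul" "module.span form_scale (t ` {..<7}) = W"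
    using generic_nets_basis[OF W] by blast
  have "finite {(i, j). i < j \<and> j < (7::nat)}"
    by (rule finite_subset[of _ "{..<7} \<times> {..<7}"]) auto
  then obtain ms where ms: "set ms = {(i, j). i < j \<and> j < (7::nat)}" using finite_list by blast
  interpret N: skew_net "\<lambda>k. form_matrix (t k)"
    by unfold_locales (rule form_matrix_alternating[OF t(2)[rule_format]])
  show ?thesis
    unfolding isotropic_locus_class[OF ms t(2,3)] pfaffian_locus_class[OF t]
    by (rule N.main_class_identity[OF ms net_rank4[OF t(1,2)]])
qed

end

theorem proposition2p11:
  fixes smul :: "complex \<Rightarrow> 'v::ab_group_add \<Rightarrow> 'v"
  assumes "vector_space smul"
    and "vector_space.dim smul (UNIV :: 'v set) = 7"
  shows "\<exists>\<Omega>. openin (zariski_top (grassmannian form_scale 7 (skew_forms smul))) \<Omega> \<and> \<Omega> \<noteq> {} \<and>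
    (\<forall>W\<in>\<Omega>. (K0_class (isotropic_locus smul W) - K0_class (pfaffian_locus W))
      * (L ^ 2 - 1) * (L - 1) * L ^ 7 = 0)"
proof -
  interpret v: vector_space smul by (rule assms(1))
  obtain B where B: "v.independent B" "UNIV \<subseteq> v.span B" "card B = 7"
    using v.basis_exists[of UNIV] assms(2) by metis
  have "finite B" using B(3) card_ge_0_finite[of B] by simp
  then obtain e :: "nat \<Rightarrow> 'v" where e: "bij_betw e {..<7} B"
    using ex_bij_betw_nat_finite[of B] B(3) by (auto simp: atLeast0LessThan)
  then have e': "inj_on e {..<7}" "e ` {..<7} = B" unfolding bij_betw_def by blast+
  obtain c where "coordinatized smul (v.span (e ` {..<7})) 7 e c"
    using coordinatized_exists[OF assms(1) e'(1)] B(1) unfolding e'(2) by blast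
  moreover have "v.span (e ` {..<7}) = UNIV" using B(2) unfolding e'(2) by blast
  ultimately interpret coordinates7 smul e c
    unfolding coordinates7_def by simp
  show ?thesis
    using generic_nets_open generic_nets_nonempty generic_nets_class by blast
qed

end
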